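(* Let $q$ be a discrete complex-valued measure on $\mathbb{R}_+$ with $\operatorname{supp}q\subset\mathbb{Z}_+$, and let $\mathcal D_q$ be the corresponding Dirac operator with main spectral measure $\mu_q$. If $\sum_{k\ge0}k|q(\{k\})|^2<\infty$, then $\sigma_p(\mathcal D_q)=\sigma_{sc}(\mathcal D_q)=\emptyset$, and $\mu_q$ has the form $\mu_q=w_q\,dx$, where $\log w_q=\sum_{k\in\mathbb{Z}}c_ke^{2ikx}$ is such that $\sum_{k\in\mathbb{Z}}|k||c_k|^2<\infty$. The converse is also true: if $\mu_q=w_q\,dx$ with $w_q$ of this form, then $\sum_{k\ge0}k|q(\{k\})|^2<\infty$.
   Context: $\mathbb{R}_+=[0,\infty)$, $\mathbb{Z}_+=\{0,1,2,\dots\}$, $\mathbb{C}_+=\{\operatorname{Im}z>0\}$. The measure is $q=\sum_{k\ge0}q(\{k\})\delta_k$ with arbitrary complex masses. $\sigma_p$, $\sigma_{sc}$ denote the pure point and singular continuous parts of the spectrum. The expansion of $\log w_q$ is the Fourier series of the $\pi$-periodic function $\log w_q$, integrable over a period, with $c_k=\frac1\pi\int_{-\pi/2}^{\pi/2}e^{-2ikx}\log w_q(x)\,dx$. Put $J=\begin{pmatrix}0&-1\\ 1&0\end{pmatrix}$, $Q=\begin{pmatrix}\operatorname{Im}q&\operatorname{Re}q\\ \operatorname{Re}q&-\operatorname{Im}q\end{pmatrix}$ (a matrix-valued measure), and $\mathbf g(T)=I+\sum_{n\ge2}T^{n-1}/n!$ for $2\times2$ matrices $T$. For $z\in\mathbb{C}$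 the Dirac system $JN'+QN=zN$ with $N=I$ on $(-\infty,0)$ is understood in the sense of Persson: $N(\cdot,z)=\begin{pmatrix}n_{11}&n_{12}\\ n_{21}&n_{22}\end{pmatrix}$ is the unique right-continuous (in $x$) matrix function, of locally bounded variation, with $$JN(x,z)+\int_{(-\infty,x]}\mathbf g\bigl(Q(\{x_1\})J^*\bigr)\bigl(dQ(x_1)-z\,\chi_{\mathbb{R}_+}(x_1)\,dx_1\bigr)N(x_1,z)=J,\qquad x\in\mathbb{R}.$$ The Weyl function of $\mathcal D_q$ is $m_q(z)=\lim_{x\to+\infty}n_{22}(x,z)/n_{21}(x,z)$, $z\in\mathbb{C}_+$; the Schur function $f_q$ is defined by $m_q=i\frac{1+f_q}{1-f_q}$. The main spectral measure $\mu_q$ of $\mathcal D_q$ is the nonnegative Borel measure on $\mathbb{R}$ with $$\frac{1-|f_q(z)|^2}{|1-f_q(z)|^2}=\frac1\pi\int_{\mathbb{R}}\frac{\operatorname{Im}z}{|x-z|^2}\,d\mu_q(x),\qquad z\in\mathbb{C}_+.$$ The self-adjoint Dirac operator $\mathcal D_q$ on $L^2(\mathbb{R}_+,\mathbb{C}^2)$ (given by $X\mapsto JX'+QX$ in the sense of Persson, with the boundary condition that the second component of $X(0-)$ vanishes) is unitarily equivalent to multiplication by the independent variable in $L^2(\mu_q)$, so the spectral parts of $\mathcal D_q$ are those of $\mu_q$. *)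

theory Defs
  imports "HOL-Analysis.Analysis"
begin

text \<open>
  A discrete complex measure \<open>q = (\<Sum>k. q({k}) \<delta>\<^sub>k)\<close> on the half-line carried by the nonnegative
  integers is represented by the sequence of its masses, so \<open>q k\<close> stands for \<open>q({k})\<close>. The masses
  are arbitrary; since only finitely many atoms lie in \<open>(-\<infinity>,x]\<close>, integrals against \<open>q\<close> over such
  a half-line are finite sums. The half-plane \<open>Im z > 0\<close> is written out wherever it occurs.
\<close>

definition J :: "complex^2^2" where
  "J = vector [vector [0, -1], vector [1, 0]]"

definition Qmat :: "complex \<Rightarrow> complex^2^2" where
  "Qmat c = vector [vector [of_real (Im c), of_real (Re c)],
                    vector [of_real (Re c), - of_real (Im c)]]"

definition mass_at :: "(nat \<Rightarrow> complex) \<Rightarrow> real \<Rightarrow> complex" where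
  "mass_at q x = (if x \<in> \<nat> then q (nat \<lfloor>x\<rfloor>) else 0)"

primrec mat_pow :: "complex^2^2 \<Rightarrow> nat \<Rightarrow> complex^2^2" where
  "mat_pow T 0 = mat 1"
| "mat_pow T (Suc n) = T ** mat_pow T n"

text \<open>The summation index is shifted by two: the sum is that of \<open>T\<^bsup>n-1\<^esup>/n!\<close> over \<open>n \<ge> 2\<close>.\<close>

definition gfun :: "complex^2^2 \<Rightarrow> complex^2^2" where
  "gfun T = mat 1 + (\<Sum>n. (1 / fact (n + 2)) *\<^sub>R mat_pow T (n + 1))"

text \<open>The factor \<open>g(Q({x}) J\<^sup>*)\<close>; \<open>J\<close> is real, so its adjoint is its transpose.\<close>

definition persson_factor :: "(nat \<Rightarrow> complex) \<Rightarrow> real \<Rightarrow> complex^2^2" where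
  "persson_factor q x = gfun (Qmat (mass_at q x) ** transpose J)"

definition locally_bounded_variation :: "(real \<Rightarrow> 'a::real_normed_vector) \<Rightarrow> bool" where
  "locally_bounded_variation N \<longleftrightarrow>
     (\<forall>a b. \<exists>C. \<forall>n. \<forall>t :: nat \<Rightarrow> real.
        (\<forall>i<n. t i \<le> t (Suc i)) \<and> a \<le> t 0 \<and> t n \<le> b \<longrightarrow>
        (\<Sum>i<n. norm (N (t (Suc i)) - N (t i))) \<le> C)"

text \<open>
  The integral over \<open>(-\<infinity>,x]\<close> of the Persson equation is split into its part with respect to \<open>dQ\<close>
  (a sum over the atoms in \<open>(-\<infinity>,x]\<close>) and its part with respect to \<open>z \<chi> dx\<close>; \<open>mat z\<close> is \<open>z\<close> times
  the identity matrix.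
\<close>

definition persson_solution ::
    "(nat \<Rightarrow> complex) \<Rightarrow> complex \<Rightarrow> (real \<Rightarrow> complex^2^2) \<Rightarrow> bool" where
  "persson_solution q z N \<longleftrightarrow>
     (\<forall>x. continuous (at_right x) N) \<and> locally_bounded_variation N \<and>
     (\<forall>x. J ** N x
          + ((\<Sum>k | real k \<le> x. persson_factor q (real k) ** Qmat (q k) ** N (real k))
             - (LINT t:{..x}|lborel.
                  persson_factor q t ** (indicator {0..} t *\<^sub>R (mat z ** N t))))
          = J)"

definition dirac_solution :: "(nat \<Rightarrow> complex) \<Rightarrow> complex \<Rightarrow> real \<Rightarrow> complex^2^2" where
  "dirac_solution q z = (THE N. persson_solution q z N)"

definition weyl_function :: "(nat \<Rightarrow> complex) \<Rightarrow> complex \<Rightarrow> complex" where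
  "weyl_function q z =
     Lim at_top (\<lambda>x. dirac_solution q z x $ 2 $ 2 / dirac_solution q z x $ 2 $ 1)"

definition schur_function :: "(nat \<Rightarrow> complex) \<Rightarrow> complex \<Rightarrow> complex" where
  "schur_function q z = (THE f. f \<noteq> 1 \<and> weyl_function q z = \<i> * ((1 + f) / (1 - f)))"

definition main_spectral_measure :: "(nat \<Rightarrow> complex) \<Rightarrow> real measure" where
  "main_spectral_measure q = (THE \<mu>. sets \<mu> = sets borel \<and>
     (\<forall>z. Im z > 0 \<longrightarrow>
        integrable \<mu> (\<lambda>x. Im z / (cmod (of_real x - z))\<^sup>2) \<and>
        (1 - (cmod (schur_function q z))\<^sup>2) / (cmod (1 - schur_function q z))\<^sup>2
          = 1 / pi * (LINT x|\<mu>. Im z / (cmod (of_real x - z))\<^sup>2)))"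

text \<open>
  Lebesgue decomposition of a Borel measure on the line into an absolutely continuous, a pure point
  and a singular continuous part.
\<close>

definition lebesgue_parts ::
    "real measure \<Rightarrow> real measure \<Rightarrow> real measure \<Rightarrow> real measure \<Rightarrow> bool" where
  "lebesgue_parts \<mu> ac pp sc \<longleftrightarrow>
     sets ac = sets borel \<and> sets pp = sets borel \<and> sets sc = sets borel \<and>
     (\<forall>A\<in>sets borel. emeasure \<mu> A = emeasure ac A + emeasure pp A + emeasure sc A) \<and>
     absolutely_continuous lborel ac \<and>
     (\<exists>C. countable C \<and> emeasure pp (- C) = 0) \<and>
     (\<forall>x. emeasure sc {x} = 0) \<and> (\<exists>S\<in>null_sets lborel. emeasure sc (- S) = 0)"

definition pp_part :: "real measure \<Rightarrow> real measure" where
  "pp_part \<mu> = (THE pp. \<exists>ac sc. lebesgue_parts \<mu> ac pp sc)"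

definition sc_part :: "real measure \<Rightarrow> real measure" where
  "sc_part \<mu> = (THE sc. \<exists>ac pp. lebesgue_parts \<mu> ac pp sc)"

definition closed_support :: "real measure \<Rightarrow> real set" where
  "closed_support \<nu> = {x. \<forall>e>0. emeasure \<nu> (ball x e) > 0}"

text \<open>
  The Dirac operator of \<open>q\<close> is unitarily equivalent to multiplication by the independent variable
  in \<open>L\<^sup>2\<close> of its main spectral measure, so its spectral parts are those of this measure:
  multiplication by the variable in \<open>L\<^sup>2(\<nu>)\<close> has spectrum \<open>closed_support \<nu>\<close>.
\<close>

definition sigma_p :: "(nat \<Rightarrow> complex) \<Rightarrow> real set" where
  "sigma_p q = closed_support (pp_part (main_spectral_measure q))"

definition sigma_sc :: "(nat \<Rightarrow> complex) \<Rightarrow> real set" where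
  "sigma_sc q = closed_support (sc_part (main_spectral_measure q))"

definition log_fourier_coeff :: "(real \<Rightarrow> real) \<Rightarrow> int \<Rightarrow> complex" where
  "log_fourier_coeff w k =
     of_real (1 / pi) *
     (LINT x:{- pi / 2..pi / 2}|lborel.
        exp (- 2 * \<i> * of_int k * of_real x) * of_real (ln (w x)))"

text \<open>
  Densities whose logarithm is a \<open>\<pi>\<close>-periodic function, integrable over a period, with Fourier
  coefficients \<open>c\<^sub>k\<close> satisfying \<open>\<Sum> |k| |c\<^sub>k|\<^sup>2 < \<infinity>\<close>. As \<open>ln 0 = 0\<close> in the library, integrability of
  \<open>ln \<circ> w\<close> does not prevent \<open>w\<close> from vanishing on a set of positive measure; positivity almost
  everywhere is therefore required separately.
\<close>

definition log_sobolev_density :: "(real \<Rightarrow> real) \<Rightarrow> bool" where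
  "log_sobolev_density w \<longleftrightarrow>
     w \<in> borel_measurable borel \<and> (\<forall>x. w x \<ge> 0) \<and> (AE x in lborel. w x > 0) \<and>
     (\<forall>x. w (x + pi) = w x) \<and>
     set_integrable lborel {- pi / 2..pi / 2} (\<lambda>x. ln (w x)) \<and>
     (\<lambda>k::int. \<bar>real_of_int k\<bar> * (cmod (log_fourier_coeff w k))\<^sup>2) summable_on UNIV"

end

theory Submission
  imports Defs "HOL-Complex_Analysis.Complex_Analysis" "HOL-Probability.Probability" "HOL-Computational_Algebra.Fundamental_Theorem_Algebra"
begin

text \<open>
  This is the strong Szego theorem, in the form of Golinskii and Ibragimov, in the language of the Dirac
  operator. Between two atoms the Dirac system rotates, and at an atom it is multiplied by the exponential
  of a symmetric matrix (\<open>gfun_Qmat\<close>, \<open>fundamental_persson\<close>, \<open>persson_unique\<close>). In coordinates that diagonalise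
  the rotation, and with \<open>\<zeta> = e\<^bsup>2iz\<^esup>\<close>, the transfer matrices obey the Szego recursion with parameters \<open>\<gamma> k\<close> of
  modulus \<open>tanh \<bar>q k\<bar>\<close>. So the Weyl function is \<open>\<i>\<close> times the Caratheodory function of these parameters
  (\<open>weyl_function_eq\<close>), the main spectral measure is the periodisation of its Herglotz measure
  (\<open>main_spectral_measure_eq\<close>, through the partial fractions of the cotangent and the uniqueness of Poisson
  integrals), and the condition on the masses is \<open>\<Sum> k \<bar>\<gamma> k\<bar>\<^sup>2 < \<infinity>\<close>.

  The exact identity behind the theorem is \<open>dirichlet_identity\<close>: for a logarithm \<open>g\<close> of the polynomial
  \<open>phi_star \<gamma> n\<close>, with Taylor coefficients \<open>g\<^sub>k\<close>,
  \<open>\<Sum> k \<bar>g\<^sub>k\<bar>\<^sup>2 = - (\<Sum> k \<le> n. k ln (1 - \<bar>\<gamma> k\<bar>\<^sup>2))\<close>.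
  One step of the recursion multiplies the polynomial by \<open>1 - \<gamma> b\<close> with a Blaschke product \<open>b\<close> of degree \<open>n + 1\<close>.
  The logarithm of this factor is orthogonal to \<open>g\<close> in the Dirichlet form, and its own norm is
  \<open>- (n + 1) ln (1 - \<bar>\<gamma>\<bar>\<^sup>2)\<close> because \<open>n + 1\<close> is the winding number of \<open>b\<close>.

  Limits are taken with \<open>dirichlet_bounded_subsequence\<close>: a bound on the Dirichlet norms gives a subsequence
  whose real parts converge in the mean on the circle, and so do the weights \<open>exp (- 2 Re g)\<close>, since the
  Lebedev--Milin inequality bounds their square integrals.

  If the sum of the parameters is finite, the Dirichlet norms of the logarithms of all \<open>phi_star \<gamma> n\<close> are
  bounded. The Bernstein--Szego weights, which represent the approximants of the Caratheodory function,
  converge in the mean along a subsequence to a density \<open>w\<close>. It represents the Caratheodory function itself, and the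
  Fourier coefficients of its logarithm inherit the bound (\<open>summable_parameters_sobolev_density\<close>). A measure
  with a density has neither a pure point nor a singular continuous part.

  Conversely, let \<open>w\<close> be a density with square-summable weighted logarithmic coefficients. The partial sums of
  its logarithm are approximated by logarithms of zero-free polynomials, and every zero-free polynomial belongs to a
  finite sequence of parameters (\<open>inverse_szego\<close>). The identity bounds their weighted sums uniformly. The
  weights converge to \<open>w\<close> in the mean, so the Schur functions converge, and by the Schur algorithm every
  single parameter converges to that of the operator (\<open>schur_parameters_continuous\<close>). The bound passes to
  the limit (\<open>sobolev_density_summable_parameters\<close>).
\<close>

section \<open>Fourier analysis on the circle\<close>

text \<open>
  The boundary variable of the disc is \<open>e\<^bsup>2ix\<^esup>\<close> for real \<open>x\<close>, because \<open>e\<^bsup>2iz\<^esup>\<close> is the quotient of the two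
  multipliers of the free motion over a unit interval. Functions on the circle thus are the \<open>\<pi>\<close>-periodic
  functions on the line, and one period carries the normalised measure of the circle.
\<close>

definition circ :: "real \<Rightarrow> complex" where
  "circ x = cis (2 * x)"

definition circle_measure :: "real measure" where
  "circle_measure = uniform_measure lborel {- pi / 2..pi / 2}"

definition taylor_coeff :: "(complex \<Rightarrow> complex) \<Rightarrow> nat \<Rightarrow> complex" where
  "taylor_coeff f k = (deriv ^^ k) f 0 / fact k"

lemma norm_circ [simp]: "norm (circ x) = 1"
  by (simp add: circ_def)

lemma circ_nonzero [simp]: "circ x \<noteq> 0"
  by (simp add: circ_def)

lemma cnj_circ: "cnj (circ x) = inverse (circ x)"
  by (simp add: circ_def cis_cnj)

lemma circ_mult_cnj [simp]: "circ x * cnj (circ x) = 1" "cnj (circ x) * circ x = 1"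
  by (simp_all add: cnj_circ)

lemma continuous_circ [continuous_intros]: "continuous_on A circ"
  unfolding circ_def by (intro continuous_intros)

lemma measurable_circ [measurable]: "circ \<in> borel_measurable borel"
  by (intro borel_measurable_continuous_onI continuous_circ)

lemma measurable_cnj [measurable]: "cnj \<in> borel_measurable borel"
  by (intro borel_measurable_continuous_onI continuous_intros)

lemma integrable_scaleR_iff:
  fixes f :: "'b \<Rightarrow> 'a::{banach, second_countable_topology}"
  assumes "c \<noteq> 0"
  shows "integrable M (\<lambda>x. c *\<^sub>R f x) \<longleftrightarrow> integrable M f"
  using integrable_scaleR_right[of "inverse c" M "\<lambda>x. c *\<^sub>R f x"] integrable_scaleR_right[of c M f] assms
  by auto

lemma circ_power: "circ x ^ k = cis (2 * real k * x)"
  unfolding circ_def Complex.DeMoivre by (rule arg_cong[of _ _ cis]) simp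

lemma circ_periodic: "circ (x + pi) = circ x"
  by (simp add: circ_def distrib_left cis_mult [symmetric] cis_multiple_2pi flip: cis_mult)

lemma sets_circle_measure [measurable_cong, simp]: "sets circle_measure = sets borel"
  by (simp add: circle_measure_def)

lemma space_circle_measure [simp]: "space circle_measure = UNIV"
  by (simp add: circle_measure_def)

interpretation circle: prob_space circle_measure
  unfolding circle_measure_def by (rule prob_space_uniform_measure) auto

lemma circle_integral:
  fixes f :: "real \<Rightarrow> 'a::{banach, second_countable_topology}"
  assumes [measurable]: "f \<in> borel_measurable borel"
  shows "(LINT x|circle_measure. f x) = (1 / pi) *\<^sub>R (LINT x:{- pi / 2..pi / 2}|lborel. f x)"
    and "integrable circle_measure f \<longleftrightarrow> set_integrable lborel {- pi / 2..pi / 2} f"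
proof -
  have eq: "circle_measure = density lborel (\<lambda>x. ennreal (indicator {- pi / 2..pi / 2} x / pi))"
    unfolding circle_measure_def uniform_measure_def
    by (intro density_cong) (auto simp: indicator_def divide_ennreal[of 1, simplified]  )
  show "(LINT x|circle_measure. f x) = (1 / pi) *\<^sub>R (LINT x:{- pi / 2..pi / 2}|lborel. f x)"
    unfolding eq set_lebesgue_integral_def
    by (subst integral_density) (auto simp: integral_scaleR_right[symmetric] mult.commute
         simp del: integral_scaleR_right intro!: Bochner_Integration.integral_cong)
  have "integrable circle_measure f \<longleftrightarrow> integrable lborel (\<lambda>x. (indicator {- pi / 2..pi / 2} x / pi) *\<^sub>R f x)"
    unfolding eq by (subst integrable_density) auto
  also have "(\<lambda>x. (indicator {- pi / 2..pi / 2} x / pi) *\<^sub>R f x)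
      = (\<lambda>x. (1 / pi) *\<^sub>R (indicator {- pi / 2..pi / 2} x *\<^sub>R f x))" by auto
  finally show "integrable circle_measure f \<longleftrightarrow> set_integrable lborel {- pi / 2..pi / 2} f"
    unfolding set_integrable_def by (simp add: integrable_scaleR_iff del: scaleR_scaleR)
qed

lemma circle_integrable_bounded:
  fixes f :: "real \<Rightarrow> 'a::{banach, second_countable_topology}"
  assumes "f \<in> borel_measurable borel" "\<And>x. norm (f x) \<le> B"
  shows "integrable circle_measure f"
  by (rule circle.integrable_const_bound[where B = B]) (use assms in auto)

lemma circ_power_mult_cnj [simp]:
  "circ x ^ k * cnj (circ x) ^ k = 1" "cnj (circ x) ^ k * circ x ^ k = 1"
  by (simp_all flip: power_mult_distrib)

lemma circ_character_integral:
  "(LINT x|circle_measure. circ x ^ j * cnj (circ x ^ k)) = (if j = k then 1 else 0)"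
proof (cases "j = k")
  case True
  then show ?thesis using circle.prob_space by simp
next
  case False
  define m where "m = 2 * (real j - real k)"
  have m0: "m \<noteq> 0" using False by (simp add: m_def)
  have eq: "circ x ^ j * cnj (circ x ^ k) = cis (m * x)" for x
    by (simp only: circ_power cis_cnj cis_mult m_def) (simp add: algebra_simps)
  have d: "((\<lambda>x. cis (m * x) / (\<i> * of_real m)) has_vector_derivative cis (m * x)) (at x within A)" for x A
  proof -
    have "((\<lambda>z. exp (\<i> * of_real m * z) / (\<i> * of_real m)) has_field_derivative
            exp (\<i> * of_real m * of_real x)) (at (of_real x))"
      using m0 by (auto intro!: derivative_eq_intros)
    from has_vector_derivative_real_field[OF this, of A] show ?thesis
      by (simp add: cis_conv_exp mult_ac)
  qed
  have "(LINT x|circle_measure. circ x ^ j * cnj (circ x ^ k))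
      = (1 / pi) *\<^sub>R (LINT x:{- pi / 2..pi / 2}|lborel. cis (m * x))"
    by (subst circle_integral(1)) (auto simp: eq[symmetric])
  also have "(LINT x:{- pi / 2..pi / 2}|lborel. cis (m * x))
      = cis (m * (pi / 2)) / (\<i> * of_real m) - cis (m * (- pi / 2)) / (\<i> * of_real m)"
    unfolding set_lebesgue_integral_def
    by (rule integral_FTC_Icc) (auto intro!: d continuous_intros)
  also have "cis (m * (pi / 2)) = cis (m * (- pi / 2)) * cis (2 * pi * (real_of_int (int j - int k)))"
    unfolding cis_mult by (rule arg_cong[of _ _ cis]) (simp add: m_def field_simps)
  also have "cis (2 * pi * (real_of_int (int j - int k))) = 1"
    by (rule cis_multiple_2pi) auto
  finally show ?thesis using False by simp
qed

lemma taylor_coeff_eq: "f has_fps_expansion F \<Longrightarrow> taylor_coeff f k = fps_nth F k"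
  by (simp add: taylor_coeff_def fps_nth_fps_expansion)

lemma holomorphic_fps_expansion:
  "f holomorphic_on ball 0 R \<Longrightarrow> 0 < R \<Longrightarrow> f has_fps_expansion fps_expansion f 0"
  by (rule has_fps_expansion_fps_expansion[of "ball 0 R"]) auto

lemma taylor_coeff_0 [simp]: "taylor_coeff f 0 = f 0"
  by (simp add: taylor_coeff_def)

lemma taylor_coeff_sums:
  assumes "f holomorphic_on ball 0 R" "norm z < R"
  shows "(\<lambda>k. taylor_coeff f k * z ^ k) sums f z"
  using holomorphic_power_series[OF assms(1), of z] assms(2) by (simp add: taylor_coeff_def)

lemma taylor_coeff_norm_summable:
  assumes "f holomorphic_on ball 0 R" "1 < R"
  shows "summable (\<lambda>k. norm (taylor_coeff f k))"
proof -
  define r where "r = (1 + R) / 2"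
  have r: "1 < r" "r < R" using assms(2) by (auto simp: r_def)
  have "summable (\<lambda>k. taylor_coeff f k * of_real r ^ k)"
    using taylor_coeff_sums[OF assms(1), of "of_real r"] r by (auto simp: sums_iff)
  from powser_insidea[OF this, of 1] r show ?thesis by simp
qed

lemma taylor_coeff_add:
  assumes "f holomorphic_on ball 0 R" "g holomorphic_on ball 0 R" "0 < R"
  shows "taylor_coeff (\<lambda>z. f z + g z) k = taylor_coeff f k + taylor_coeff g k"
  using taylor_coeff_eq[OF has_fps_expansion_add[OF holomorphic_fps_expansion[OF assms(1,3)]
      holomorphic_fps_expansion[OF assms(2,3)]]]
    taylor_coeff_eq[OF holomorphic_fps_expansion[OF assms(1,3)]]
    taylor_coeff_eq[OF holomorphic_fps_expansion[OF assms(2,3)]] by simp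

lemma taylor_coeff_diff:
  assumes "f holomorphic_on ball 0 R" "g holomorphic_on ball 0 R" "0 < R"
  shows "taylor_coeff (\<lambda>z. f z - g z) k = taylor_coeff f k - taylor_coeff g k"
  using taylor_coeff_eq[OF has_fps_expansion_diff[OF holomorphic_fps_expansion[OF assms(1,3)]
      holomorphic_fps_expansion[OF assms(2,3)]]]
    taylor_coeff_eq[OF holomorphic_fps_expansion[OF assms(1,3)]]
    taylor_coeff_eq[OF holomorphic_fps_expansion[OF assms(2,3)]] by simp

lemma taylor_coeff_mult:
  assumes "f holomorphic_on ball 0 R" "g holomorphic_on ball 0 R" "0 < R"
  shows "taylor_coeff (\<lambda>z. f z * g z) k = (\<Sum>i=0..k. taylor_coeff f i * taylor_coeff g (k - i))"
  using taylor_coeff_eq[OF has_fps_expansion_mult[OF holomorphic_fps_expansion[OF assms(1,3)]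
      holomorphic_fps_expansion[OF assms(2,3)]]]
    taylor_coeff_eq[OF holomorphic_fps_expansion[OF assms(1,3)]]
    taylor_coeff_eq[OF holomorphic_fps_expansion[OF assms(2,3)]] by (simp add: fps_mult_nth)

lemma taylor_coeff_euler_derivative:
  assumes "f holomorphic_on ball 0 R" "0 < R"
  shows "taylor_coeff (\<lambda>z. z * deriv f z) k = of_nat k * taylor_coeff f k"
  using taylor_coeff_eq[OF has_fps_expansion_mult[OF has_fps_expansion_fps_X
        has_fps_expansion_deriv[OF holomorphic_fps_expansion[OF assms]]], of k]
    taylor_coeff_eq[OF holomorphic_fps_expansion[OF assms], of k]
  by (cases k) simp_all

lemma taylor_coeff_cong:
  assumes "\<And>z. norm z < R \<Longrightarrow> f z = g z" "0 < R"
  shows "taylor_coeff f k = taylor_coeff g k"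
proof -
  have "eventually (\<lambda>z. f z = g z) (nhds 0)"
    using eventually_nhds_in_open[of "ball 0 R" "0::complex"] assms
    by (auto elim!: eventually_mono)
  then show ?thesis unfolding taylor_coeff_def by (simp cong: higher_deriv_cong_ev)
qed

lemma continuous_on_circ_holomorphic:
  assumes "f holomorphic_on ball 0 R" "1 < R"
  shows "continuous_on A (\<lambda>x. f (circ x))"
  by (rule continuous_on_compose2[OF holomorphic_on_imp_continuous_on[OF assms(1)] continuous_circ])
     (use assms(2) in auto)

lemma measurable_circ_holomorphic:
  assumes "f holomorphic_on ball 0 R" "1 < R"
  shows "(\<lambda>x. f (circ x)) \<in> borel_measurable borel"
  by (intro borel_measurable_continuous_onI continuous_on_circ_holomorphic[OF assms])

lemma bounded_circ_holomorphic:
  assumes "f holomorphic_on ball 0 R" "1 < R"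
  obtains B where "B > 0" "\<And>x. norm (f (circ x)) \<le> B"
proof -
  have "compact (f ` sphere 0 1)"
    by (intro compact_continuous_image holomorphic_on_imp_continuous_on
         holomorphic_on_subset[OF assms(1)]) (use assms(2) in auto)
  then obtain B where "B > 0" "\<And>y. y \<in> f ` sphere 0 1 \<Longrightarrow> norm y \<le> B"
    using compact_imp_bounded bounded_pos by metis
  then show ?thesis by (intro that[of B]) auto
qed

text \<open>Expansion of one factor on the circle in its Taylor series, with the other factor fixed.\<close>

lemma circle_integral_taylor:
  fixes v :: "real \<Rightarrow> complex"
  assumes f: "f holomorphic_on ball 0 R" "1 < R"
    and v: "integrable circle_measure v"
  shows "(\<lambda>k. taylor_coeff f k * (LINT x|circle_measure. circ x ^ k * v x)) sums
           (LINT x|circle_measure. f (circ x) * v x)"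
proof -
  have [measurable]: "v \<in> borel_measurable borel" using borel_measurable_integrable[OF v] by simp
  let ?F = "\<lambda>k x. taylor_coeff f k * (circ x ^ k * v x)"
  have int: "integrable circle_measure (\<lambda>x. circ x ^ k * v x)" for k
    by (rule Bochner_Integration.integrable_bound[OF v]) (auto simp: norm_mult norm_power)
  have sm: "summable (\<lambda>k. norm (taylor_coeff f k))"
    using taylor_coeff_norm_summable[OF f] .
  have "(\<lambda>k. LINT x|circle_measure. ?F k x) sums (LINT x|circle_measure. (\<Sum>k. ?F k x))"
  proof (rule sums_integral)
    show "AE x in circle_measure. summable (\<lambda>k. norm (?F k x))"
      by (rule AE_I2) (use summable_mult2[OF sm] in \<open>auto simp: norm_mult norm_power\<close>)
    show "summable (\<lambda>k. LINT x|circle_measure. norm (?F k x))"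
      using summable_mult2[OF sm] by (auto simp: norm_mult norm_power)
  qed (use int in auto)
  moreover have "(\<Sum>k. ?F k x) = f (circ x) * v x" for x
    using sums_mult2[OF taylor_coeff_sums[OF f(1), of "circ x"], of "v x"] f(2)
    by (simp add: sums_iff mult_ac)
  ultimately show ?thesis using int by simp
qed

lemma integrable_circ_holomorphic:
  assumes f: "f holomorphic_on ball 0 R" "1 < R"
  shows "integrable circle_measure (\<lambda>x. f (circ x))"
  by (rule bounded_circ_holomorphic[OF f])
     (auto intro!: circle_integrable_bounded measurable_circ_holomorphic[OF f])

lemma circle_mean_character:
  assumes f: "f holomorphic_on ball 0 R" "1 < R"
  shows "(LINT x|circle_measure. f (circ x) * cnj (circ x ^ k)) = taylor_coeff f k"
proof -
  have "(\<lambda>j. taylor_coeff f j * (LINT x|circle_measure. circ x ^ j * cnj (circ x ^ k))) sums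
      (LINT x|circle_measure. f (circ x) * cnj (circ x ^ k))"
    by (rule circle_integral_taylor[OF f])
       (rule circle_integrable_bounded[where B=1], auto simp: norm_power intro!: borel_measurable_continuous_onI continuous_intros)
  moreover have "(\<lambda>j. taylor_coeff f j * (LINT x|circle_measure. circ x ^ j * cnj (circ x ^ k))) =
      (\<lambda>j. if j = k then taylor_coeff f j else 0)"
    by (simp only: circ_character_integral) auto
  ultimately show ?thesis
    using sums_unique2[OF _ sums_single[of k "taylor_coeff f"]] by simp
qed

lemma circle_mean:
  assumes f: "f holomorphic_on ball 0 R" "1 < R"
  shows "(LINT x|circle_measure. f (circ x)) = f 0"
  using circle_mean_character[OF f, of 0] by simp

lemma circle_parseval:
  assumes f: "f holomorphic_on ball 0 R" and g: "g holomorphic_on ball 0 R" and R: "1 < R"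
  shows "(\<lambda>k. taylor_coeff f k * cnj (taylor_coeff g k)) sums
           (LINT x|circle_measure. f (circ x) * cnj (g (circ x)))"
proof -
  have "(LINT x|circle_measure. circ x ^ k * cnj (g (circ x))) = cnj (taylor_coeff g k)" for k
  proof -
    have "(LINT x|circle_measure. circ x ^ k * cnj (g (circ x))) =
        (LINT x|circle_measure. cnj (g (circ x) * cnj (circ x ^ k)))" by (simp add: mult.commute)
    also have "\<dots> = cnj (taylor_coeff g k)"
      unfolding circle_mean_character[OF g R, symmetric] by (rule Bochner_Integration.integral_cnj)
    finally show ?thesis .
  qed
  moreover have "integrable circle_measure (\<lambda>x. cnj (g (circ x)))"
    using integrable_circ_holomorphic[OF g R] by simp
  note circle_integral_taylor[OF f R this]
  ultimately show ?thesis by simp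
qed

lemma circle_parseval_norm:
  assumes f: "f holomorphic_on ball 0 R" and R: "1 < R"
  shows "(\<lambda>k. (cmod (taylor_coeff f k))\<^sup>2) sums (LINT x|circle_measure. (cmod (f (circ x)))\<^sup>2)"
proof -
  have "(\<lambda>k. Re (taylor_coeff f k * cnj (taylor_coeff f k))) sums
     Re (LINT x|circle_measure. f (circ x) * cnj (f (circ x)))"
    using circle_parseval[OF f f R] by (rule sums_Re)
  moreover have "(LINT x|circle_measure. f (circ x) * cnj (f (circ x))) =
      of_real (LINT x|circle_measure. (cmod (f (circ x)))\<^sup>2)"
    by (subst integral_complex_of_real[symmetric]) (simp only: complex_norm_square[symmetric])
  ultimately show ?thesis by (simp add: complex_norm_square[symmetric] flip: of_real_power)
qed

text \<open>
  The Schwarz kernel of the disc; its real part is the Poisson kernel.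
\<close>

definition herglotz_kernel :: "complex \<Rightarrow> real \<Rightarrow> complex" where
  "herglotz_kernel \<zeta> x = (circ x + \<zeta>) / (circ x - \<zeta>)"

lemma herglotz_kernel_denominator:
  assumes "norm \<zeta> < 1"
  shows "circ x - \<zeta> \<noteq> 0" "norm (circ x - \<zeta>) \<ge> 1 - norm \<zeta>"
proof -
  show *: "norm (circ x - \<zeta>) \<ge> 1 - norm \<zeta>"
    using norm_triangle_ineq2[of "circ x" \<zeta>] by simp
  show "circ x - \<zeta> \<noteq> 0" using * assms by auto
qed

lemma continuous_herglotz_kernel: "norm \<zeta> < 1 \<Longrightarrow> continuous_on A (herglotz_kernel \<zeta>)"
  unfolding herglotz_kernel_def
  by (intro continuous_intros) (use herglotz_kernel_denominator in auto)

lemma measurable_herglotz_kernel [measurable]: "herglotz_kernel \<zeta> \<in> borel_measurable borel"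
  unfolding herglotz_kernel_def by measurable

lemma norm_herglotz_kernel_le:
  assumes "norm \<zeta> < 1"
  shows "norm (herglotz_kernel \<zeta> x) \<le> 2 / (1 - norm \<zeta>)"
  unfolding herglotz_kernel_def norm_divide
  by (rule frac_le) (use assms herglotz_kernel_denominator(2)[OF assms, of x]
      norm_triangle_ineq[of "circ x" \<zeta>] in auto)

lemma herglotz_kernel_eq:
  assumes "norm \<zeta> < 1"
  shows "herglotz_kernel \<zeta> x = 2 * cnj (1 / (1 - cnj \<zeta> * circ x)) - 1"
proof -
  have 1: "cnj (1 / (1 - cnj \<zeta> * circ x)) = circ x / (circ x - \<zeta>)"
    using herglotz_kernel_denominator(1)[OF assms, of x]
    by (simp add: cnj_circ field_simps)
  show ?thesis unfolding 1 herglotz_kernel_def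
    using herglotz_kernel_denominator(1)[OF assms, of x] by (simp add: field_simps)
qed

lemma geometric_holomorphic:
  assumes "norm \<zeta> < 1"
  obtains R where "R > 1" "(\<lambda>z. 1 / (1 - \<zeta> * z)) holomorphic_on ball 0 R"
    "\<And>k. taylor_coeff (\<lambda>z. 1 / (1 - \<zeta> * z)) k = \<zeta> ^ k"
proof -
  obtain R where R: "R > 1" "R * norm \<zeta> < 1"
  proof (cases "\<zeta> = 0")
    case True then show ?thesis using that[of 2] by simp
  next
    case False
    then obtain R where "1 < R" "R < 1 / norm \<zeta>" using dense[of 1 "1 / norm \<zeta>"] assms by auto
    then show ?thesis using False by (intro that[of R]) (auto simp: field_simps)
  qed
  have nz: "norm (\<zeta> * z) < 1" if "norm z < R" for z
    using R that mult_left_mono[of "norm z" R "norm \<zeta>"] by (auto simp: norm_mult mult_ac)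
  have nz': "1 - \<zeta> * z \<noteq> 0" if "norm z < R" for z
    using nz[OF that] by auto
  have hol: "(\<lambda>z. 1 / (1 - \<zeta> * z)) holomorphic_on ball 0 R"
    by (intro holomorphic_intros) (use nz' in auto)
  have "taylor_coeff (\<lambda>z. 1 / (1 - \<zeta> * z)) k = \<zeta> ^ k" for k
  proof -
    have "(\<lambda>z. 1 / (1 - \<zeta> * z)) has_fps_expansion Abs_fps (\<lambda>k. \<zeta> ^ k)"
    proof (rule has_fps_expansionI)
      show "\<forall>\<^sub>F u in nhds 0. (\<lambda>n. fps_nth (Abs_fps (\<lambda>k. \<zeta> ^ k)) n * u ^ n) sums (1 / (1 - \<zeta> * u))"
        using eventually_nhds_in_open[of "ball 0 R" "0::complex"] R
        by (auto elim!: eventually_mono simp: power_mult_distrib[symmetric] intro!: geometric_sums nz)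
    qed
    from taylor_coeff_eq[OF this] show ?thesis by simp
  qed
  with R hol that show ?thesis by blast
qed

text \<open>
  The Herglotz formula for a function that is holomorphic across the circle: writing the kernel as
  \<open>2 cnj (1 / (1 - cnj \<zeta> e)) - 1\<close> makes all integrals instances of Parseval's formula.
\<close>

lemma herglotz_formula:
  assumes C: "C holomorphic_on ball 0 R" "1 < R" and z: "norm \<zeta> < 1"
  shows "(LINT x|circle_measure. herglotz_kernel \<zeta> x * of_real (Re (C (circ x)))) = C \<zeta> - \<i> * of_real (Im (C 0))"
proof -
  define G where "G = (\<lambda>z. 1 / (1 - cnj \<zeta> * z))"
  obtain R' where R': "R' > 1" "G holomorphic_on ball 0 R'" "\<And>k. taylor_coeff G k = cnj \<zeta> ^ k"
    using geometric_holomorphic[of "cnj \<zeta>"] z unfolding G_def by auto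
  define r where "r = min R R'"
  have r: "1 < r" "C holomorphic_on ball 0 r" "G holomorphic_on ball 0 r"
    using C R' by (auto simp: r_def intro: holomorphic_on_subset[OF C(1)] holomorphic_on_subset[OF R'(2)])
  have I1: "(LINT x|circle_measure. C (circ x) * cnj (G (circ x))) = C \<zeta>"
  proof (rule sums_unique2[OF circle_parseval[OF r(2,3,1)]])
    show "(\<lambda>k. taylor_coeff C k * cnj (taylor_coeff G k)) sums C \<zeta>"
      using taylor_coeff_sums[OF C(1), of \<zeta>] z C(2) by (simp add: R'(3))
  qed
  have I2: "(LINT x|circle_measure. cnj (C (circ x)) * cnj (G (circ x))) = cnj (C 0)"
  proof -
    have "(LINT x|circle_measure. C (circ x) * G (circ x)) = C 0 * G 0"
      by (rule circle_mean[of "\<lambda>z. C z * G z" r]) (use r in \<open>auto intro!: holomorphic_intros\<close>)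
    then show ?thesis
      using Bochner_Integration.integral_cnj[of circle_measure "\<lambda>x. C (circ x) * G (circ x)"] by (simp add: G_def)
  qed
  have I3: "(LINT x|circle_measure. C (circ x)) = C 0" "(LINT x|circle_measure. cnj (C (circ x))) = cnj (C 0)"
    using circle_mean[OF C] by auto
  have int: "integrable circle_measure (\<lambda>x. C (circ x))" "integrable circle_measure (\<lambda>x. C (circ x) * cnj (G (circ x)))"
     "integrable circle_measure (\<lambda>x. cnj (C (circ x)) * cnj (G (circ x)))"
  proof -
    show "integrable circle_measure (\<lambda>x. C (circ x))" by (rule integrable_circ_holomorphic[OF C])
    obtain B1 where "B1 > 0" "\<And>x. norm (C (circ x)) \<le> B1" using bounded_circ_holomorphic[OF C] by blast
    moreover obtain B2 where "B2 > 0" "\<And>x. norm (G (circ x)) \<le> B2"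
      using bounded_circ_holomorphic[OF R'(2,1)] by blast
    moreover note [measurable] = measurable_circ_holomorphic[OF C] measurable_circ_holomorphic[OF R'(2,1)]
    ultimately show "integrable circle_measure (\<lambda>x. C (circ x) * cnj (G (circ x)))"
     "integrable circle_measure (\<lambda>x. cnj (C (circ x)) * cnj (G (circ x)))"
      by (auto intro!: circle_integrable_bounded[where B="B1 * B2"] mult_mono simp: norm_mult less_imp_le)
  qed
  have "(LINT x|circle_measure. herglotz_kernel \<zeta> x * of_real (Re (C (circ x)))) =
     (LINT x|circle_measure. C (circ x) * cnj (G (circ x)) + cnj (C (circ x)) * cnj (G (circ x))
        - (C (circ x) + cnj (C (circ x))) / 2)"
  proof (intro Bochner_Integration.integral_cong refl)
    fix x
    have alg: "(2 * g - 1) * ((c + c') / 2) = c * g + c' * g - (c + c') / 2" for g c c' :: complex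
      by (simp add: field_simps)
    have "complex_of_real (Re (C (circ x))) = (C (circ x) + cnj (C (circ x))) / 2"
      by (simp add: complex_add_cnj)
    then show "herglotz_kernel \<zeta> x * of_real (Re (C (circ x))) =
       C (circ x) * cnj (G (circ x)) + cnj (C (circ x)) * cnj (G (circ x)) - (C (circ x) + cnj (C (circ x))) / 2"
      unfolding herglotz_kernel_eq[OF z] G_def by (simp only: alg)
  qed
  also have "\<dots> = C \<zeta> + cnj (C 0) - (C 0 + cnj (C 0)) / 2"
    using int I1 I2 I3 by simp
  also have "\<dots> = C \<zeta> - \<i> * of_real (Im (C 0))"
    by (simp add: complex_eq_iff)
  finally show ?thesis .
qed

section \<open>The Lebedev--Milin inequality\<close>

text \<open>Comparing coefficients in \<open>z (exp g)' = z g' exp g\<close>.\<close>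

lemma taylor_coeff_exp_recursion:
  assumes g: "g holomorphic_on ball 0 R" "0 < R"
  shows "of_nat k * taylor_coeff (\<lambda>z. exp (g z)) k =
     (\<Sum>i\<le>k. of_nat i * taylor_coeff g i * taylor_coeff (\<lambda>z. exp (g z)) (k - i))"
proof -
  let ?h = "\<lambda>z. exp (g z)"
  have h: "?h holomorphic_on ball 0 R" by (intro holomorphic_intros g)
  have "of_nat k * taylor_coeff ?h k = taylor_coeff (\<lambda>z. z * deriv ?h z) k"
    by (rule taylor_coeff_euler_derivative[OF h g(2), symmetric])
  also have "\<dots> = taylor_coeff (\<lambda>z. (z * deriv g z) * ?h z) k"
  proof (rule taylor_coeff_cong[OF _ g(2)])
    fix z :: complex assume "norm z < R"
    then have "(g has_field_derivative deriv g z) (at z)"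
      using g by (intro holomorphic_derivI[of g "ball 0 R"]) auto
    then have "(?h has_field_derivative exp (g z) * deriv g z) (at z)"
      by (auto intro!: derivative_eq_intros)
    then show "z * deriv ?h z = z * deriv g z * exp (g z)" by (simp add: DERIV_imp_deriv)
  qed
  also have "\<dots> = (\<Sum>i\<le>k. of_nat i * taylor_coeff g i * taylor_coeff ?h (k - i))"
    by (subst taylor_coeff_mult[where R=R])
       (auto intro!: holomorphic_intros g h simp: taylor_coeff_euler_derivative[OF g] atLeast0AtMost)
  finally show ?thesis .
qed

text \<open>
  The Lebedev--Milin inequality. With \<open>b\<close> the coefficients of \<open>exp g\<close> and \<open>p\<close> those of
  \<open>exp (\<Sum>j. j \<bar>c\<^sub>j\<bar>\<^sup>2 z\<^sup>j)\<close>, the two recursions and the Cauchy--Schwarz inequality give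
  \<open>\<bar>b\<^sub>k\<bar>\<^sup>2 \<le> p\<^sub>k\<close> by induction; summing the \<open>p\<^sub>k\<close> means evaluating at \<open>1\<close>.
\<close>

lemma lebedev_milin_partial:
  assumes g: "g holomorphic_on ball 0 R" "0 < R"
  shows "(\<Sum>k\<le>n. (cmod (taylor_coeff (\<lambda>z. exp (g z)) k))\<^sup>2) \<le>
     (cmod (exp (g 0)))\<^sup>2 * exp (\<Sum>k\<le>n. real k * (cmod (taylor_coeff g k))\<^sup>2)"
proof -
  define b where "b = taylor_coeff (\<lambda>z. exp (g z))"
  define c where "c = taylor_coeff g"
  define a where "a j = real j * (cmod (c j))\<^sup>2" for j
  have a0: "a j \<ge> 0" "a 0 = 0" for j by (auto simp: a_def)
  define G where "G z = (\<Sum>j\<le>n. complex_of_real (a j) * z ^ j)" for z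
  have G: "G holomorphic_on ball 0 2" unfolding G_def by (intro holomorphic_intros)
  have Gc: "taylor_coeff G k = (if k \<le> n then complex_of_real (a k) else 0)" for k
  proof -
    have "G has_fps_expansion (\<Sum>j\<le>n. fps_const (complex_of_real (a j)) * fps_X ^ j)"
      unfolding G_def by (intro fps_expansion_intros)
    from taylor_coeff_eq[OF this, of k] show ?thesis
      by (simp add: fps_sum_nth fps_X_power_nth if_distrib sum.delta cong: if_cong)
  qed
  define p where "p = taylor_coeff (\<lambda>z. exp (G z))"
  have prec: "of_nat k * p k = (\<Sum>i\<le>k. of_nat i * taylor_coeff G i * p (k - i))" for k
    unfolding p_def by (rule taylor_coeff_exp_recursion[OF G]) simp
  have G0: "G 0 = 0" using a0 by (simp add: G_def power_0_left if_distrib cong: if_cong)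
  have p0: "p 0 = 1" by (simp add: p_def G0)
  have preal: "Im (p k) = 0 \<and> Re (p k) \<ge> 0" for k
  proof (induction k rule: less_induct)
    case (less k)
    show ?case
    proof (cases "k = 0")
      case True then show ?thesis by (simp add: p0)
    next
      case False
      have *: "Im (of_nat i * taylor_coeff G i * p (k - i)) = 0 \<and> Re (of_nat i * taylor_coeff G i * p (k - i)) \<ge> 0"
        if "i \<le> k" for i
        using less.IH[of "k - i"] False that a0 by (cases "i = 0") (auto simp: Gc)
      have "Im (of_nat k * p k) = 0 \<and> Re (of_nat k * p k) \<ge> 0"
        unfolding prec using * by (auto intro!: sum_nonneg simp: Re_sum Im_sum simp del: mult_eq_0_iff)
      with False show ?thesis by (auto simp: zero_le_mult_iff)
    qed
  qed
  have brec: "of_nat k * b k = (\<Sum>i\<le>k. of_nat i * c i * b (k - i))" for k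
    unfolding b_def c_def by (rule taylor_coeff_exp_recursion[OF g])
  define B where "B = (cmod (exp (g 0)))\<^sup>2"
  have key: "k \<le> n \<Longrightarrow> (cmod (b k))\<^sup>2 \<le> B * Re (p k)" for k
  proof (induction k rule: less_induct)
    case (less k)
    show ?case
    proof (cases "k = 0")
      case True then show ?thesis by (simp add: p0 b_def B_def)
    next
      case False
      have "(real k)\<^sup>2 * (cmod (b k))\<^sup>2 = (cmod (of_nat k * b k))\<^sup>2" by (simp add: norm_mult power_mult_distrib)
      also have "\<dots> \<le> (\<Sum>i\<le>k. cmod (of_nat i * c i * b (k - i)))\<^sup>2"
        unfolding brec by (intro power_mono norm_sum) auto
      also have "\<dots> = (\<Sum>i\<in>{1..k}. 1 * (real i * cmod (c i) * cmod (b (k - i))))\<^sup>2"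
        by (rule arg_cong[of _ _ "\<lambda>x. x\<^sup>2"], rule sum.mono_neutral_cong_right) (auto simp: norm_mult)
      also have "\<dots> \<le> (\<Sum>i\<in>{1..k}. 1\<^sup>2) * (\<Sum>i\<in>{1..k}. (real i * cmod (c i) * cmod (b (k - i)))\<^sup>2)"
        by (rule Cauchy_Schwarz_ineq_sum)
      also have "\<dots> = real k * (\<Sum>i\<in>{1..k}. real i * a i * (cmod (b (k - i)))\<^sup>2)"
        by (simp add: a_def power_mult_distrib power2_eq_square mult_ac)
      also have "\<dots> \<le> real k * (\<Sum>i\<in>{1..k}. real i * a i * (B * Re (p (k - i))))"
        by (intro mult_left_mono sum_mono less.IH) (use less.prems False a0 in auto)
      also have "(\<Sum>i\<in>{1..k}. real i * a i * (B * Re (p (k - i)))) = B * Re (\<Sum>i\<le>k. of_nat i * taylor_coeff G i * p (k - i))"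
        unfolding Re_sum sum_distrib_left
        by (rule sum.mono_neutral_cong_left) (use less.prems in \<open>auto simp: Gc\<close>)
      also have "\<dots> = B * (real k * Re (p k))" unfolding prec[symmetric] by simp
      finally have "(real k)\<^sup>2 * (cmod (b k))\<^sup>2 \<le> (real k)\<^sup>2 * (B * Re (p k))"
        by (simp add: power2_eq_square mult_ac)
      then show ?thesis using False by simp
    qed
  qed
  have "(\<lambda>k. p k * 1 ^ k) sums exp (G 1)" unfolding p_def
    by (rule taylor_coeff_sums[where R=2]) (auto intro!: holomorphic_intros G)
  then have ps: "(\<lambda>k. Re (p k)) sums Re (exp (G 1))" by (auto dest: sums_Re)
  have "G 1 = complex_of_real (\<Sum>j\<le>n. a j)" by (simp add: G_def)
  then have Re_G: "Re (exp (G 1)) = exp (\<Sum>j\<le>n. a j)" by (simp only: exp_of_real Re_complex_of_real)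
  have "(\<Sum>k\<le>n. (cmod (b k))\<^sup>2) \<le> (\<Sum>k\<le>n. B * Re (p k))" by (intro sum_mono key) auto
  also have "\<dots> = B * (\<Sum>k\<le>n. Re (p k))" by (simp add: sum_distrib_left)
  also have "\<dots> \<le> B * exp (\<Sum>j\<le>n. a j)"
  proof (rule mult_left_mono)
    show "(\<Sum>k\<le>n. Re (p k)) \<le> exp (\<Sum>j\<le>n. a j)"
      using sum_le_suminf[of "\<lambda>k. Re (p k)" "{..n}"] preal ps Re_G by (auto simp: sums_iff)
  qed (simp add: B_def)
  finally show ?thesis by (simp add: B_def b_def a_def c_def)
qed

lemma lebedev_milin:
  assumes g: "g holomorphic_on ball 0 R" "1 < R"
    and D: "\<And>n. (\<Sum>k\<le>n. real k * (cmod (taylor_coeff g k))\<^sup>2) \<le> D"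
  shows "(LINT x|circle_measure. (cmod (exp (g (circ x))))\<^sup>2) \<le> (cmod (exp (g 0)))\<^sup>2 * exp D"
proof -
  have "(\<lambda>z. exp (g z)) holomorphic_on ball 0 R" by (intro holomorphic_intros g)
  from circle_parseval_norm[OF this g(2)]
  have *: "(\<lambda>k. (cmod (taylor_coeff (\<lambda>z. exp (g z)) k))\<^sup>2) sums (LINT x|circle_measure. (cmod (exp (g (circ x))))\<^sup>2)" .
  show ?thesis
  proof (rule LIMSEQ_le_const2)
    show "(\<lambda>n. \<Sum>k\<le>n. (cmod (taylor_coeff (\<lambda>z. exp (g z)) k))\<^sup>2) \<longlonglongrightarrow>
        (LINT x|circle_measure. (cmod (exp (g (circ x))))\<^sup>2)"
      using * by (simp add: sums_def_le)
    have "(\<Sum>k\<le>n. (cmod (taylor_coeff (\<lambda>z. exp (g z)) k))\<^sup>2) \<le> (cmod (exp (g 0)))\<^sup>2 * exp D" for n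
    proof -
      have "(\<Sum>k\<le>n. (cmod (taylor_coeff (\<lambda>z. exp (g z)) k))\<^sup>2) \<le>
           (cmod (exp (g 0)))\<^sup>2 * exp (\<Sum>k\<le>n. real k * (cmod (taylor_coeff g k))\<^sup>2)"
        using lebedev_milin_partial[OF g(1)] g(2) by simp
      also have "\<dots> \<le> (cmod (exp (g 0)))\<^sup>2 * exp D"
        by (intro mult_left_mono) (use D in auto)
      finally show ?thesis .
    qed
    then show "\<exists>N. \<forall>n\<ge>N. (\<Sum>k\<le>n. (cmod (taylor_coeff (\<lambda>z. exp (g z)) k))\<^sup>2) \<le> (cmod (exp (g 0)))\<^sup>2 * exp D"
      by blast
  qed
qed

section \<open>The Szego recursion and its Caratheodory function\<close>

text \<open>
  One step of the recursion is the effect of one unit of free motion followed by one atom on a column of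
  the transfer matrix. The atom at the origin comes before any motion, so the first step has no factor
  \<open>z\<close>. The initial pairs \<open>(-1, 1)\<close> and \<open>(1, 1)\<close> are the two columns of the identity matrix, up to factors,
  in the coordinates in which the motion is diagonal; they lead to the orthogonal polynomials of the
  first and of the second kind together with their reversals.
\<close>

primrec szego :: "(nat \<Rightarrow> complex) \<Rightarrow> complex poly \<times> complex poly \<Rightarrow> nat \<Rightarrow> complex poly \<times> complex poly" where
  "szego \<gamma> r 0 = (fst r + smult (cnj (\<gamma> 0)) (snd r), snd r + smult (\<gamma> 0) (fst r))"
| "szego \<gamma> r (Suc n) = (let s = szego \<gamma> r n in
     (pCons 0 (fst s) + smult (cnj (\<gamma> (Suc n))) (snd s), snd s + smult (\<gamma> (Suc n)) (pCons 0 (fst s))))"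

definition phi :: "(nat \<Rightarrow> complex) \<Rightarrow> nat \<Rightarrow> complex poly" where
  "phi \<gamma> n = fst (szego \<gamma> (- 1, 1) n)"

definition phi_star :: "(nat \<Rightarrow> complex) \<Rightarrow> nat \<Rightarrow> complex poly" where
  "phi_star \<gamma> n = snd (szego \<gamma> (- 1, 1) n)"

definition psi :: "(nat \<Rightarrow> complex) \<Rightarrow> nat \<Rightarrow> complex poly" where
  "psi \<gamma> n = fst (szego \<gamma> (1, 1) n)"

definition psi_star :: "(nat \<Rightarrow> complex) \<Rightarrow> nat \<Rightarrow> complex poly" where
  "psi_star \<gamma> n = snd (szego \<gamma> (1, 1) n)"

definition defect :: "(nat \<Rightarrow> complex) \<Rightarrow> nat \<Rightarrow> real" where
  "defect \<gamma> n = (\<Prod>k\<le>n. 1 - (cmod (\<gamma> k))\<^sup>2)"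

lemma phi_0: "phi \<gamma> 0 = [:- 1 + cnj (\<gamma> 0):]" "phi_star \<gamma> 0 = [:1 - \<gamma> 0:]"
  by (simp_all add: phi_def phi_star_def one_pCons)

lemma psi_0: "psi \<gamma> 0 = [:1 + cnj (\<gamma> 0):]" "psi_star \<gamma> 0 = [:1 + \<gamma> 0:]"
  by (simp_all add: psi_def psi_star_def one_pCons)

lemma phi_Suc:
  "phi \<gamma> (Suc n) = pCons 0 (phi \<gamma> n) + smult (cnj (\<gamma> (Suc n))) (phi_star \<gamma> n)"
  "phi_star \<gamma> (Suc n) = phi_star \<gamma> n + smult (\<gamma> (Suc n)) (pCons 0 (phi \<gamma> n))"
  by (simp_all add: phi_def phi_star_def Let_def)

lemma psi_Suc:
  "psi \<gamma> (Suc n) = pCons 0 (psi \<gamma> n) + smult (cnj (\<gamma> (Suc n))) (psi_star \<gamma> n)"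
  "psi_star \<gamma> (Suc n) = psi_star \<gamma> n + smult (\<gamma> (Suc n)) (pCons 0 (psi \<gamma> n))"
  by (simp_all add: psi_def psi_star_def Let_def)

lemma phi_star_at_0: "poly (phi_star \<gamma> n) 0 = 1 - \<gamma> 0"
  by (induction n) (simp_all add: phi_0 phi_Suc)

lemma psi_star_at_0: "poly (psi_star \<gamma> n) 0 = 1 + \<gamma> 0"
  by (induction n) (simp_all add: psi_0 psi_Suc)

text \<open>
  The matrix of one parameter preserves the form \<open>\<bar>y\<bar>\<^sup>2 - \<bar>x\<bar>\<^sup>2\<close> up to its determinant.
\<close>

lemma norm_reflection:
  fixes x y g :: complex
  shows "(cmod (y + g * x))\<^sup>2 - (cmod (x + cnj g * y))\<^sup>2 = (1 - (cmod g)\<^sup>2) * ((cmod y)\<^sup>2 - (cmod x)\<^sup>2)"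
proof -
  have "complex_of_real ((cmod (y + g * x))\<^sup>2 - (cmod (x + cnj g * y))\<^sup>2) =
      complex_of_real ((1 - (cmod g)\<^sup>2) * ((cmod y)\<^sup>2 - (cmod x)\<^sup>2))"
    by (simp add: complex_norm_square algebra_simps del: of_real_power)
  then show ?thesis by (simp only: of_real_eq_iff)
qed

lemma phi_norm_identity:
  "(cmod (poly (phi_star \<gamma> (Suc n)) z))\<^sup>2 - (cmod (poly (phi \<gamma> (Suc n)) z))\<^sup>2 =
   (1 - (cmod (\<gamma> (Suc n)))\<^sup>2) * ((cmod (poly (phi_star \<gamma> n) z))\<^sup>2 - (cmod z)\<^sup>2 * (cmod (poly (phi \<gamma> n) z))\<^sup>2)"
  using norm_reflection[of "poly (phi_star \<gamma> n) z" "\<gamma> (Suc n)" "z * poly (phi \<gamma> n) z"]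
  by (simp add: phi_Suc norm_mult power_mult_distrib mult_ac)

lemma phi_0_norm: "cmod (poly (phi \<gamma> 0) z) = cmod (1 - \<gamma> 0)" "cmod (poly (phi_star \<gamma> 0) z) = cmod (1 - \<gamma> 0)"
proof -
  have "cmod (- 1 + cnj (\<gamma> 0)) = cmod (cnj (- (1 - \<gamma> 0)))" by simp
  also have "\<dots> = cmod (1 - \<gamma> 0)" by (simp only: complex_mod_cnj norm_minus_cancel)
  finally show "cmod (poly (phi \<gamma> 0) z) = cmod (1 - \<gamma> 0)" by (simp add: phi_0)
qed (simp add: phi_0)

locale schur_parameters =
  fixes \<gamma> :: "nat \<Rightarrow> complex"
  assumes \<gamma>: "cmod (\<gamma> k) < 1"
begin

lemma \<gamma>_sq: "(cmod (\<gamma> k))\<^sup>2 < 1" "1 - (cmod (\<gamma> k))\<^sup>2 > 0"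
proof -
  show "(cmod (\<gamma> k))\<^sup>2 < 1" using \<gamma>[of k] by (simp add: power_less_one_iff abs_square_less_1)
  then show "1 - (cmod (\<gamma> k))\<^sup>2 > 0" by simp
qed

lemma \<gamma>_neq_1: "\<gamma> k \<noteq> 1" "1 - \<gamma> k \<noteq> 0"
  using \<gamma>[of k] by auto

lemma defect_pos: "defect \<gamma> n > 0"
  unfolding defect_def by (intro prod_pos ballI \<gamma>_sq)

lemma defect_Suc: "defect \<gamma> (Suc n) = defect \<gamma> n * (1 - (cmod (\<gamma> (Suc n)))\<^sup>2)"
  by (simp add: defect_def)

text \<open>
  The form \<open>\<bar>phi_star\<bar>\<^sup>2 - \<bar>phi\<bar>\<^sup>2\<close> stays nonnegative on the closed disc because the factor \<open>z\<close> decreases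
  the second term.
\<close>

lemma phi_le_phi_star:
  assumes "cmod z \<le> 1"
  shows "cmod (poly (phi \<gamma> n) z) \<le> cmod (poly (phi_star \<gamma> n) z) \<and> poly (phi_star \<gamma> n) z \<noteq> 0"
proof (induction n)
  case 0
  show ?case unfolding phi_0_norm using \<gamma>_neq_1 by (auto simp: phi_0)
next
  case (Suc n)
  let ?X = "poly (phi \<gamma> n) z" and ?Y = "poly (phi_star \<gamma> n) z"
  have "(cmod z)\<^sup>2 * (cmod ?X)\<^sup>2 \<le> 1 * (cmod ?Y)\<^sup>2"
    by (intro mult_mono power_mono) (use assms Suc in \<open>auto simp: power_le_one\<close>)
  then have "(cmod (poly (phi \<gamma> (Suc n)) z))\<^sup>2 \<le> (cmod (poly (phi_star \<gamma> (Suc n)) z))\<^sup>2"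
    using phi_norm_identity[of \<gamma> n z] mult_nonneg_nonneg[OF less_imp_le[OF \<gamma>_sq(2)[of "Suc n"]],
        of "(cmod ?Y)\<^sup>2 - (cmod z)\<^sup>2 * (cmod ?X)\<^sup>2"] by linarith
  then have 1: "cmod (poly (phi \<gamma> (Suc n)) z) \<le> cmod (poly (phi_star \<gamma> (Suc n)) z)"
    by (rule power2_le_imp_le) simp
  have "cmod (z * ?X) \<le> cmod ?Y" using assms Suc mult_mono[of "cmod z" 1 "cmod ?X" "cmod ?Y"] by (simp add: norm_mult)
  then have "cmod (\<gamma> (Suc n) * (z * ?X)) < cmod ?Y"
  proof (cases "z * ?X = 0")
    case False
    then have "cmod (\<gamma> (Suc n)) * cmod (z * ?X) < 1 * cmod (z * ?X)" using \<gamma> by (intro mult_strict_right_mono) auto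
    then show ?thesis using \<open>cmod (z * ?X) \<le> cmod ?Y\<close> by (simp add: norm_mult)
  qed (use Suc in auto)
  then have "poly (phi_star \<gamma> (Suc n)) z \<noteq> 0"
    by (auto simp: phi_Suc mult.left_commute add_eq_0_iff)
  with 1 show ?case by blast
qed

lemma phi_star_nonzero: "cmod z \<le> 1 \<Longrightarrow> poly (phi_star \<gamma> n) z \<noteq> 0"
  using phi_le_phi_star by blast

end

text \<open>
  On the circle the two components of a column are reversals of each other, with opposite signs for the
  two kinds.
\<close>

lemma phi_circle:
  assumes "cmod z = 1"
  shows "poly (phi \<gamma> n) z = - (z ^ n) * cnj (poly (phi_star \<gamma> n) z)"
proof (induction n)
  case 0 show ?case by (simp add: phi_0)
next
  case (Suc n)
  have z: "z * cnj z = 1" using assms by (simp flip: complex_norm_square)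
  have "cnj (poly (phi \<gamma> n) z) = - cnj (z ^ n) * poly (phi_star \<gamma> n) z" by (simp add: Suc)
  then have "z ^ n * cnj (poly (phi \<gamma> n) z) = - (z ^ n * cnj z ^ n) * poly (phi_star \<gamma> n) z" by simp
  also have "z ^ n * cnj z ^ n = 1" by (simp add: z flip: power_mult_distrib)
  finally have *: "z ^ n * cnj (poly (phi \<gamma> n) z) = - poly (phi_star \<gamma> n) z" by simp
  have "z ^ Suc n * cnj (poly (phi_star \<gamma> (Suc n)) z) = z * (z ^ n * cnj (poly (phi_star \<gamma> n) z))
     + cnj (\<gamma> (Suc n)) * (z * cnj z) * (z ^ n * cnj (poly (phi \<gamma> n) z))"
    by (simp add: phi_Suc algebra_simps)
  also have "\<dots> = - poly (phi \<gamma> (Suc n)) z" unfolding * z by (simp add: phi_Suc Suc)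
  finally show ?case by simp
qed

lemma psi_circle:
  assumes "cmod z = 1"
  shows "poly (psi \<gamma> n) z = z ^ n * cnj (poly (psi_star \<gamma> n) z)"
proof (induction n)
  case 0 show ?case by (simp add: psi_0)
next
  case (Suc n)
  have z: "z * cnj z = 1" using assms by (simp flip: complex_norm_square)
  have "cnj (poly (psi \<gamma> n) z) = cnj (z ^ n) * poly (psi_star \<gamma> n) z" by (simp add: Suc)
  then have "z ^ n * cnj (poly (psi \<gamma> n) z) = (z ^ n * cnj z ^ n) * poly (psi_star \<gamma> n) z" by simp
  also have "z ^ n * cnj z ^ n = 1" by (simp add: z flip: power_mult_distrib)
  finally have *: "z ^ n * cnj (poly (psi \<gamma> n) z) = poly (psi_star \<gamma> n) z" by simp
  have "z ^ Suc n * cnj (poly (psi_star \<gamma> (Suc n)) z) = z * (z ^ n * cnj (poly (psi_star \<gamma> n) z))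
     + cnj (\<gamma> (Suc n)) * (z * cnj z) * (z ^ n * cnj (poly (psi \<gamma> n) z))"
    by (simp add: psi_Suc algebra_simps)
  also have "\<dots> = poly (psi \<gamma> (Suc n)) z" unfolding * z by (simp add: psi_Suc Suc)
  finally show ?case by simp
qed

lemma szego_determinant:
  "poly (psi \<gamma> n) z * poly (phi_star \<gamma> n) z - poly (psi_star \<gamma> n) z * poly (phi \<gamma> n) z =
     2 * z ^ n * of_real (defect \<gamma> n)"
proof (induction n)
  case 0
  show ?case unfolding defect_def by (simp add: phi_0 psi_0 complex_norm_square algebra_simps del: of_real_power)
next
  case (Suc n)
  let ?g = "\<gamma> (Suc n)"
  have "poly (psi \<gamma> (Suc n)) z * poly (phi_star \<gamma> (Suc n)) z - poly (psi_star \<gamma> (Suc n)) z * poly (phi \<gamma> (Suc n)) z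
     = z * (1 - ?g * cnj ?g) * (poly (psi \<gamma> n) z * poly (phi_star \<gamma> n) z - poly (psi_star \<gamma> n) z * poly (phi \<gamma> n) z)"
    by (simp add: phi_Suc psi_Suc algebra_simps)
  also have "\<dots> = 2 * z ^ Suc n * of_real (defect \<gamma> (Suc n))"
    unfolding Suc by (simp add: defect_def complex_norm_square algebra_simps del: of_real_power)
  finally show ?case .
qed

definition bernstein_szego_weight :: "(nat \<Rightarrow> complex) \<Rightarrow> nat \<Rightarrow> real \<Rightarrow> real" where
  "bernstein_szego_weight \<gamma> n x = defect \<gamma> n / (cmod (poly (phi_star \<gamma> n) (circ x)))\<^sup>2"

definition carath_approx :: "(nat \<Rightarrow> complex) \<Rightarrow> nat \<Rightarrow> complex \<Rightarrow> complex" where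
  "carath_approx \<gamma> n z = poly (psi_star \<gamma> n) z / poly (phi_star \<gamma> n) z"

text \<open>
  The Weyl function, divided by \<open>\<i>\<close> and expressed in the variable of the disc. Convergence on the open
  disc is proved below.
\<close>

definition carath :: "(nat \<Rightarrow> complex) \<Rightarrow> complex \<Rightarrow> complex" where
  "carath \<gamma> z = lim (\<lambda>n. carath_approx \<gamma> n z)"

lemma poly_nonzero_ball:
  fixes p :: "complex poly"
  assumes "\<And>z. cmod z \<le> 1 \<Longrightarrow> poly p z \<noteq> 0"
  obtains R where "R > 1" "\<And>z. cmod z < R \<Longrightarrow> poly p z \<noteq> 0"
proof -
  have p0: "p \<noteq> 0" using assms[of 0] by auto
  define Z where "Z = cmod ` {z. poly p z = 0}"
  have fin: "finite Z" using poly_roots_finite[OF p0] by (simp add: Z_def)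
  define R where "R = Min (insert 2 Z)"
  have "R > 1" unfolding R_def using fin assms by (subst Min_gr_iff) (force simp: Z_def)+
  moreover have "poly p z \<noteq> 0" if "cmod z < R" for z
  proof
    assume "poly p z = 0"
    then have "R \<le> cmod z" unfolding R_def using fin by (intro Min_le) (auto simp: Z_def)
    with that show False by simp
  qed
  ultimately show ?thesis using that by blast
qed

context schur_parameters
begin

text \<open>
  On the circle the reversal symmetry turns the determinant into
  \<open>2 z\<^sup>n Re (psi_star cnj phi_star)\<close>.
\<close>

lemma bernstein_szego_density:
  assumes "cmod z = 1"
  shows "Re (carath_approx \<gamma> n z) = defect \<gamma> n / (cmod (poly (phi_star \<gamma> n) z))\<^sup>2"
proof -
  let ?Y = "poly (phi_star \<gamma> n) z" and ?W = "poly (psi_star \<gamma> n) z"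
  have Y: "?Y \<noteq> 0" using phi_star_nonzero[of z n] assms by simp
  have z: "z ^ n \<noteq> 0" using assms by auto
  have "z ^ n * (cnj ?W * ?Y + ?W * cnj ?Y) = z ^ n * (2 * of_real (defect \<gamma> n))"
    using szego_determinant[of \<gamma> n z] unfolding phi_circle[OF assms] psi_circle[OF assms]
    by (simp add: algebra_simps)
  with z have "cnj ?W * ?Y + ?W * cnj ?Y = 2 * of_real (defect \<gamma> n)" by (metis mult_left_cancel)
  then have "Re (cnj ?W * ?Y + ?W * cnj ?Y) = 2 * defect \<gamma> n" by simp
  then have "Re (?W * cnj ?Y) = defect \<gamma> n" by (simp add: mult.commute)
  then show ?thesis unfolding carath_approx_def
    by (simp add: complex_div_cnj[of ?W ?Y] Re_divide_of_real flip: of_real_power)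
qed

lemma carath_approx_holomorphic:
  obtains R where "R > 1" "carath_approx \<gamma> n holomorphic_on ball 0 R"
    "\<And>z. cmod z < R \<Longrightarrow> poly (phi_star \<gamma> n) z \<noteq> 0"
proof -
  obtain R where R: "R > 1" "\<And>z. cmod z < R \<Longrightarrow> poly (phi_star \<gamma> n) z \<noteq> 0"
    using poly_nonzero_ball[of "phi_star \<gamma> n"] phi_star_nonzero by blast
  moreover have "carath_approx \<gamma> n holomorphic_on ball 0 R"
    unfolding carath_approx_def by (intro holomorphic_intros) (use R in auto)
  ultimately show ?thesis using that by blast
qed

lemma carath_approx_at_0: "carath_approx \<gamma> n 0 = (1 + \<gamma> 0) / (1 - \<gamma> 0)"
  by (simp add: carath_approx_def phi_star_at_0 psi_star_at_0)

lemma carath_approx_herglotz: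
  assumes "cmod \<zeta> < 1"
  shows "carath_approx \<gamma> n \<zeta> = \<i> * of_real (Im ((1 + \<gamma> 0) / (1 - \<gamma> 0))) +
    (LINT x|circle_measure. herglotz_kernel \<zeta> x * of_real (bernstein_szego_weight \<gamma> n x))"
proof -
  obtain R where R: "R > 1" "carath_approx \<gamma> n holomorphic_on ball 0 R"
    using carath_approx_holomorphic by blast
  show ?thesis using herglotz_formula[OF R(2,1) assms]
    by (simp add: bernstein_szego_density carath_approx_at_0 bernstein_szego_weight_def)
qed

end

lemma Re_herglotz_kernel:
  "Re (herglotz_kernel \<zeta> x) = (1 - (cmod \<zeta>)\<^sup>2) / (cmod (circ x - \<zeta>))\<^sup>2"
proof -
  have "Re ((circ x + \<zeta>) * cnj (circ x - \<zeta>)) = Re (circ x * cnj (circ x)) - Re (\<zeta> * cnj \<zeta>)"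
    by (simp add: algebra_simps)
  also have "\<dots> = 1 - (cmod \<zeta>)\<^sup>2" by (simp flip: complex_norm_square)
  finally show ?thesis unfolding herglotz_kernel_def
    by (simp add: complex_div_cnj[of "circ x + \<zeta>"] Re_divide_of_real flip: of_real_power)
qed

lemma Re_herglotz_kernel_pos: "cmod \<zeta> < 1 \<Longrightarrow> Re (herglotz_kernel \<zeta> x) > 0"
  unfolding Re_herglotz_kernel using herglotz_kernel_denominator(1)[of \<zeta> x]
  by (intro divide_pos_pos) (auto simp: abs_square_less_1)

context schur_parameters
begin

lemma weight_pos: "bernstein_szego_weight \<gamma> n x > 0"
  unfolding bernstein_szego_weight_def using defect_pos[of n] phi_star_nonzero[of "circ x" n] by simp

lemma weight_bounded:
  obtains B where "B > 0" "\<And>x. bernstein_szego_weight \<gamma> n x \<le> B"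
proof -
  obtain R where R: "R > 1" "carath_approx \<gamma> n holomorphic_on ball 0 R"
    using carath_approx_holomorphic by blast
  obtain B where "B > 0" "\<And>x. norm (carath_approx \<gamma> n (circ x)) \<le> B"
    using bounded_circ_holomorphic[OF R(2,1)] by blast
  moreover have "bernstein_szego_weight \<gamma> n x \<le> norm (carath_approx \<gamma> n (circ x))" for x
    using complex_Re_le_cmod[of "carath_approx \<gamma> n (circ x)"]
    by (simp add: bernstein_szego_weight_def bernstein_szego_density)
  ultimately show ?thesis by (intro that[of B]) (auto intro: order_trans)
qed

lemma weight_measurable [measurable]: "bernstein_szego_weight \<gamma> n \<in> borel_measurable borel"
  unfolding bernstein_szego_weight_def
  by (intro borel_measurable_continuous_onI continuous_intros continuous_on_poly)
     (auto simp: phi_star_nonzero)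

lemma weight_integrable: "integrable circle_measure (bernstein_szego_weight \<gamma> n)"
proof -
  obtain B where "B > 0" "\<And>x. bernstein_szego_weight \<gamma> n x \<le> B" using weight_bounded by blast
  then show ?thesis using weight_pos[of n] by (intro circle_integrable_bounded[where B = B]) (auto simp: less_imp_le)
qed

lemma herglotz_weight_integrable:
  assumes "cmod \<zeta> < 1"
  shows "integrable circle_measure (\<lambda>x. herglotz_kernel \<zeta> x * of_real (bernstein_szego_weight \<gamma> n x))"
proof -
  obtain B where B: "B > 0" "\<And>x. bernstein_szego_weight \<gamma> n x \<le> B" using weight_bounded by blast
  show ?thesis
  proof (rule circle_integrable_bounded)
    show "norm (herglotz_kernel \<zeta> x * of_real (bernstein_szego_weight \<gamma> n x)) \<le> 2 / (1 - norm \<zeta>) * B" for x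
      unfolding norm_mult by (intro mult_mono norm_herglotz_kernel_le assms) (use B weight_pos[of n x] assms in auto)
  qed measurable
qed

lemma carath_approx_Re_nonneg:
  assumes "cmod \<zeta> < 1"
  shows "Re (carath_approx \<gamma> n \<zeta>) \<ge> 0"
proof -
  have "Re (carath_approx \<gamma> n \<zeta>) =
    (LINT x|circle_measure. Re (herglotz_kernel \<zeta> x * of_real (bernstein_szego_weight \<gamma> n x)))"
    unfolding carath_approx_herglotz[OF assms]
    using integral_Re[OF herglotz_weight_integrable[OF assms, of n]] by simp
  also have "\<dots> \<ge> 0"
    using Re_herglotz_kernel_pos[OF assms] weight_pos[of n]
    by (intro integral_nonneg_AE AE_I2) (auto intro!: mult_nonneg_nonneg simp: less_imp_le)
  finally show ?thesis .
qed

text \<open>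
  After division by the defect the difference of squares does not decrease in \<open>n\<close>. This is the lower
  bound of the denominators in the estimate of the Weyl discs.
\<close>

lemma phi_gap:
  assumes "cmod z \<le> 1"
  shows "(1 - (cmod z)\<^sup>2) * (cmod (1 - \<gamma> 0))\<^sup>2 / defect \<gamma> 0 * defect \<gamma> (Suc n) \<le>
     (cmod (poly (phi_star \<gamma> (Suc n)) z))\<^sup>2 - (cmod (poly (phi \<gamma> (Suc n)) z))\<^sup>2"
proof (induction n)
  case 0
  have "defect \<gamma> 0 \<noteq> 0" using defect_pos[of 0] by simp
  then have "(1 - s) * c / defect \<gamma> 0 * (defect \<gamma> 0 * g) = g * (c - s * c)" for s c g :: real
    by (subst times_divide_eq_left [symmetric]) (simp add: field_simps)
  then show ?case unfolding phi_norm_identity phi_0_norm defect_Suc by simp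
next
  case (Suc n)
  let ?X = "poly (phi \<gamma> (Suc n)) z" and ?Y = "poly (phi_star \<gamma> (Suc n)) z"
  let ?g = "1 - (cmod (\<gamma> (Suc (Suc n))))\<^sup>2"
  have "(1 - (cmod z)\<^sup>2) * (cmod (1 - \<gamma> 0))\<^sup>2 / defect \<gamma> 0 * defect \<gamma> (Suc (Suc n)) =
     ((1 - (cmod z)\<^sup>2) * (cmod (1 - \<gamma> 0))\<^sup>2 / defect \<gamma> 0 * defect \<gamma> (Suc n)) * ?g"
    unfolding defect_Suc[of "Suc n"] by simp
  also have "\<dots> \<le> ((cmod ?Y)\<^sup>2 - (cmod ?X)\<^sup>2) * ?g"
    by (intro mult_right_mono Suc less_imp_le \<gamma>_sq)
  also have "\<dots> \<le> ((cmod ?Y)\<^sup>2 - (cmod z)\<^sup>2 * (cmod ?X)\<^sup>2) * ?g"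
    using mult_right_mono[of "(cmod z)\<^sup>2" 1 "(cmod ?X)\<^sup>2"] assms
    by (intro mult_right_mono less_imp_le[OF \<gamma>_sq(2)]) (auto simp: power_le_one)
  finally show ?case unfolding phi_norm_identity[of \<gamma> "Suc n"] by (simp add: mult.commute)
qed

definition gap_constant :: "complex \<Rightarrow> real" where
  "gap_constant z = (1 - (cmod z)\<^sup>2) * (cmod (1 - \<gamma> 0))\<^sup>2 / defect \<gamma> 0"

lemma gap_constant_pos: "cmod z < 1 \<Longrightarrow> gap_constant z > 0"
  unfolding gap_constant_def using \<gamma>_neq_1 defect_pos
  by (intro divide_pos_pos mult_pos_pos) (auto simp: abs_square_less_1)

text \<open>
  The nested Weyl discs: for \<open>\<bar>u\<bar> \<le> 1\<close> the quotient differs from its value at \<open>u = 0\<close> by \<open>u\<close> times the determinant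
  \<open>2 z\<^sup>n defect\<close> over a product of two denominators, and this product is at least a fixed multiple of the
  same defect. So the radii decrease geometrically, whatever the parameters are.
\<close>

lemma weyl_disc:
  assumes z: "cmod z < 1" and u: "cmod u \<le> 1" and n: "n \<ge> 1"
  shows "poly (phi_star \<gamma> n) z + u * poly (phi \<gamma> n) z \<noteq> 0"
    and "cmod ((poly (psi_star \<gamma> n) z + u * poly (psi \<gamma> n) z) / (poly (phi_star \<gamma> n) z + u * poly (phi \<gamma> n) z)
      - carath_approx \<gamma> n z) \<le> 4 * cmod z ^ n / gap_constant z"
proof -
  let ?X = "poly (phi \<gamma> n) z" and ?Y = "poly (phi_star \<gamma> n) z"
  let ?V = "poly (psi \<gamma> n) z" and ?W = "poly (psi_star \<gamma> n) z"
  let ?d = "gap_constant z * defect \<gamma> n"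
  have d: "?d > 0" using gap_constant_pos[OF z] defect_pos by simp
  obtain m where m: "n = Suc m" using n by (cases n) auto
  have gap: "?d \<le> (cmod ?Y)\<^sup>2 - (cmod ?X)\<^sup>2"
    using phi_gap[of z m] z unfolding m gap_constant_def by simp
  have XY: "cmod ?X \<le> cmod ?Y" using phi_le_phi_star[of z n] z by simp
  have "(cmod ?Y)\<^sup>2 - (cmod ?X)\<^sup>2 = (cmod ?Y + cmod ?X) * (cmod ?Y - cmod ?X)"
    by (simp add: power2_eq_square algebra_simps)
  also have "\<dots> \<le> (2 * cmod ?Y) * (cmod ?Y - cmod ?X)"
    using XY by (intro mult_right_mono) auto
  finally have gap2: "?d / 2 \<le> cmod ?Y * (cmod ?Y - cmod ?X)" using gap by simp
  have "cmod (u * ?X) \<le> 1 * cmod ?X" unfolding norm_mult by (rule mult_right_mono) (use u in auto)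
  then have low: "cmod ?Y - cmod ?X \<le> cmod (?Y + u * ?X)"
    using norm_diff_ineq[of ?Y "u * ?X"] by linarith
  have gap3: "?d / 2 \<le> cmod ?Y * cmod (?Y + u * ?X)"
    using gap2 mult_left_mono[OF low, of "cmod ?Y"] by simp
  have Y0: "?Y \<noteq> 0" using phi_star_nonzero z by simp
  show nz: "?Y + u * ?X \<noteq> 0" using gap3 d by auto
  have "(?W + u * ?V) / (?Y + u * ?X) - carath_approx \<gamma> n z = u * (?V * ?Y - ?W * ?X) / (?Y * (?Y + u * ?X))"
    unfolding carath_approx_def using Y0 nz by (simp add: diff_frac_eq algebra_simps)
  also have "cmod \<dots> = (cmod u * (2 * cmod z ^ n * defect \<gamma> n)) / (cmod ?Y * cmod (?Y + u * ?X))"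
    unfolding szego_determinant using defect_pos[of n] by (simp add: norm_mult norm_divide norm_power)
  also have "\<dots> \<le> (1 * (2 * cmod z ^ n * defect \<gamma> n)) / (?d / 2)"
    by (intro frac_le mult_right_mono gap3 u) (use d defect_pos[of n] in auto)
  also have "\<dots> = 4 * cmod z ^ n / gap_constant z" using defect_pos[of n] by simp
  finally show "cmod ((?W + u * ?V) / (?Y + u * ?X) - carath_approx \<gamma> n z) \<le> 4 * cmod z ^ n / gap_constant z" .
qed

lemma carath_approx_tendsto:
  assumes z: "cmod z < 1"
  shows "(\<lambda>n. carath_approx \<gamma> n z) \<longlonglongrightarrow> carath \<gamma> z"
proof -
  have step: "cmod (carath_approx \<gamma> (Suc n) z - carath_approx \<gamma> n z) \<le> 4 * cmod z ^ n / gap_constant z" if "n \<ge> 1" for n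
  proof -
    \<comment> \<open>the next approximant is the point of the disc of index n given by the next parameter\<close>
    have "carath_approx \<gamma> (Suc n) z = (poly (psi_star \<gamma> n) z + (\<gamma> (Suc n) * z) * poly (psi \<gamma> n) z) /
       (poly (phi_star \<gamma> n) z + (\<gamma> (Suc n) * z) * poly (phi \<gamma> n) z)"
      by (simp add: carath_approx_def phi_Suc psi_Suc mult_ac)
    moreover have "cmod (\<gamma> (Suc n) * z) \<le> 1"
      using \<gamma>[of "Suc n"] z by (simp add: norm_mult mult_le_one less_imp_le)
    ultimately show ?thesis using weyl_disc(2)[OF z _ that] by simp
  qed
  have "summable (\<lambda>n. 4 / gap_constant z * cmod z ^ n)"
    using z by (intro summable_mult summable_geometric) simp
  then have "summable (\<lambda>n. carath_approx \<gamma> (Suc n) z - carath_approx \<gamma> n z)"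
    by (rule summable_comparison_test[rotated]) (use step in \<open>auto intro!: exI[of _ 1]\<close>)
  then have "convergent (\<lambda>n. \<Sum>i<n. carath_approx \<gamma> (Suc i) z - carath_approx \<gamma> i z)"
    by (simp add: summable_iff_convergent)
  moreover have "convergent (\<lambda>n. carath_approx \<gamma> n z - carath_approx \<gamma> 0 z)"
    if "convergent (\<lambda>n. \<Sum>i<n. carath_approx \<gamma> (Suc i) z - carath_approx \<gamma> i z)"
  proof -
    have "(\<Sum>i<n. carath_approx \<gamma> (Suc i) z - carath_approx \<gamma> i z) = carath_approx \<gamma> n z - carath_approx \<gamma> 0 z" for n
      by (induction n) simp_all
    with that show ?thesis by simp
  qed
  ultimately have "convergent (\<lambda>n. carath_approx \<gamma> n z)"
    using convergent_add[OF _ convergent_const[of "carath_approx \<gamma> 0 z"]] by fastforce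
  then show ?thesis unfolding carath_def by (rule convergent_LIMSEQ_iff[THEN iffD1])
qed

lemma carath_Re_nonneg: "cmod z < 1 \<Longrightarrow> Re (carath \<gamma> z) \<ge> 0"
  by (rule LIMSEQ_le_const[OF tendsto_Re[OF carath_approx_tendsto]]) (auto intro: carath_approx_Re_nonneg)

lemma carath_plus_1_nonzero: "cmod z < 1 \<Longrightarrow> carath \<gamma> z + 1 \<noteq> 0" "cmod z < 1 \<Longrightarrow> carath_approx \<gamma> n z + 1 \<noteq> 0"
  using carath_Re_nonneg[of z] carath_approx_Re_nonneg[of z n] by (auto simp: complex_eq_iff)

text \<open>
  A bounded multiplier \<open>u\<close> that varies with the index does not change the limit; in the application it is
  the free motion since the last atom.
\<close>

lemma weyl_disc_tendsto:
  assumes z: "cmod z < 1" and u: "\<And>x. cmod (u x) \<le> 1" and n: "filterlim n at_top F"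
  shows "((\<lambda>x. (poly (psi_star \<gamma> (n x)) z + u x * poly (psi \<gamma> (n x)) z) /
      (poly (phi_star \<gamma> (n x)) z + u x * poly (phi \<gamma> (n x)) z)) \<longlongrightarrow> carath \<gamma> z) F"
proof -
  have c: "((\<lambda>x. carath_approx \<gamma> (n x) z) \<longlongrightarrow> carath \<gamma> z) F"
    by (rule filterlim_compose[OF carath_approx_tendsto[OF z] n])
  have "((\<lambda>n. 4 * cmod z ^ n / gap_constant z) \<longlonglongrightarrow> 4 * 0 / gap_constant z)"
    using gap_constant_pos[OF z] z by (intro tendsto_intros LIMSEQ_power_zero) auto
  then have "((\<lambda>x. 4 * cmod z ^ (n x) / gap_constant z) \<longlongrightarrow> 0) F"
    using filterlim_compose[OF _ n] by auto
  then have "((\<lambda>x. (poly (psi_star \<gamma> (n x)) z + u x * poly (psi \<gamma> (n x)) z) /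
      (poly (phi_star \<gamma> (n x)) z + u x * poly (phi \<gamma> (n x)) z) - carath_approx \<gamma> (n x) z) \<longlongrightarrow> 0) F"
    by (rule Lim_null_comparison[rotated])
       (use filterlim_at_top[of n F] n weyl_disc(2)[OF z u] in \<open>auto elim!: eventually_mono allE[of _ 1]\<close>)
  from tendsto_add[OF this c] show ?thesis by simp
qed

end

section \<open>The Dirichlet norm of the logarithms\<close>

lemma open_contains_larger_ball:
  fixes S :: "complex set"
  assumes "open S" "cball 0 1 \<subseteq> S"
  obtains R where "R > 1" "ball 0 R \<subseteq> S"
proof -
  obtain e where e: "e > 0" "(\<Union>x\<in>cball (0::complex) 1. ball x e) \<subseteq> S"
    using compact_subset_open_imp_ball_epsilon_subset[OF compact_cball assms(1,2)] by blast
  have "ball 0 (1 + e) \<subseteq> S"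
  proof
    fix w :: complex assume w: "w \<in> ball 0 (1 + e)"
    show "w \<in> S"
    proof (cases "cmod w \<le> 1")
      case True then show ?thesis using assms(2) by auto
    next
      case False
      have "w - sgn w = complex_of_real (1 - 1 / cmod w) * w"
        by (simp add: sgn_eq algebra_simps)
      then have "cmod (w - sgn w) = \<bar>1 - 1 / cmod w\<bar> * cmod w" by (simp only: norm_mult norm_of_real)
      also have "\<bar>1 - 1 / cmod w\<bar> * cmod w = cmod w - 1"
      proof -
        have "\<bar>1 - 1 / n\<bar> * n = n - 1" if "1 < n" for n :: real
        proof -
          have "1 - 1 / n \<ge> 0" using that by simp
          then have "\<bar>1 - 1 / n\<bar> * n = (1 - 1 / n) * n" by simp
          also have "\<dots> = n - 1" using that by (simp add: field_simps)
          finally show ?thesis .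
        qed
        from this[of "cmod w"] False show ?thesis by linarith
      qed
      finally have "w \<in> ball (sgn w) e" using w by (simp add: dist_norm norm_minus_commute)
      moreover have "sgn w \<in> cball 0 1" using False by (metis mem_cball_0 norm_sgn norm_zero order_refl zero_le_one)
      ultimately show ?thesis using e(2) by blast
    qed
  qed
  then show ?thesis using e(1) that[of "1 + e"] by simp
qed

text \<open>
  The derivative of the reversal symmetry along the circle. The symmetry holds on the circle only, so its
  derivative is obtained from the recursion.
\<close>

lemma phi_tangential_derivative:
  assumes "cmod z = 1"
  shows "z * poly (pderiv (phi \<gamma> n)) z = of_nat n * poly (phi \<gamma> n) z + z ^ n * cnj (z * poly (pderiv (phi_star \<gamma> n)) z)"
proof (induction n)
  case 0 show ?case by (simp add: phi_0 pderiv_pCons)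
next
  case (Suc n)
  let ?X = "poly (phi \<gamma> n) z" and ?Y = "poly (phi_star \<gamma> n) z" and ?g = "\<gamma> (Suc n)"
  let ?X' = "poly (pderiv (phi \<gamma> n)) z" and ?Y' = "poly (pderiv (phi_star \<gamma> n)) z"
  have z: "z * cnj z = 1" using assms by (simp flip: complex_norm_square)
  have zn: "z ^ n * cnj z ^ n = 1" by (simp add: z flip: power_mult_distrib)
  have 1: "z ^ n * cnj ?X = - ?Y"
  proof -
    have "z ^ n * cnj ?X = - (z ^ n * cnj z ^ n) * ?Y" by (simp add: phi_circle[OF assms])
    then show ?thesis by (simp add: zn)
  qed
  have 2: "z ^ n * cnj (z * ?X') = - of_nat n * ?Y + z * ?Y'"
  proof -
    have "z ^ n * cnj (z * ?X') = of_nat n * (z ^ n * cnj ?X) + (z ^ n * cnj z ^ n) * (z * ?Y')"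
      unfolding Suc by (simp add: algebra_simps)
    then show ?thesis by (simp add: 1 zn)
  qed
  have 3: "z ^ n * cnj (z * ?Y') = z * ?X' - of_nat n * ?X" using Suc by simp
  have "z ^ Suc n * cnj (z * poly (pderiv (phi_star \<gamma> (Suc n))) z) =
     z * (z ^ n * cnj (z * ?Y')) + cnj ?g * (z * cnj z) * (z ^ n * cnj ?X + z ^ n * cnj (z * ?X'))"
    by (simp add: phi_Suc pderiv_add pderiv_smult pderiv_pCons algebra_simps)
  also have "\<dots> = z * (z * ?X' - of_nat n * ?X) + cnj ?g * (- ?Y - of_nat n * ?Y + z * ?Y')"
    unfolding 1 2 3 z by (simp add: algebra_simps)
  finally show ?case
    by (simp add: phi_Suc pderiv_add pderiv_smult pderiv_pCons algebra_simps)
qed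

text \<open>
  Termwise integration of the logarithmic series, dominated by a geometric series.
\<close>

lemma circle_log_series:
  fixes b v :: "real \<Rightarrow> complex"
  assumes [measurable]: "b \<in> borel_measurable borel" and v: "integrable circle_measure v"
    and b: "\<And>x. cmod (b x) \<le> 1" and \<alpha>: "cmod \<alpha> < 1"
  shows "(\<lambda>k. - (\<alpha> ^ k / of_nat k) * (LINT x|circle_measure. b x ^ k * v x)) sums
           (LINT x|circle_measure. Ln (1 - \<alpha> * b x) * v x)"
proof -
  have [measurable]: "v \<in> borel_measurable borel" using borel_measurable_integrable[OF v] by simp
  let ?F = "\<lambda>k x. - (\<alpha> ^ k / of_nat k) * (b x ^ k * v x)"
  have bk: "cmod (b x) ^ k \<le> 1" for x k using b[of x] by (simp add: power_le_one)
  have int: "integrable circle_measure (\<lambda>x. b x ^ k * v x)" for k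
    by (rule Bochner_Integration.integrable_bound[OF v])
       (use bk in \<open>auto simp: norm_mult norm_power mult_left_le_one_le\<close>)
  have le: "norm (?F k x) \<le> cmod \<alpha> ^ k * cmod (v x)" for k x
  proof -
    have "norm (?F k x) = cmod \<alpha> ^ k / real k * (cmod (b x) ^ k * cmod (v x))"
      by (simp add: norm_mult norm_power norm_divide)
    also have "\<dots> \<le> cmod \<alpha> ^ k * (1 * cmod (v x))"
      by (intro mult_mono mult_right_mono bk) (cases k, auto simp: field_simps)
    finally show ?thesis by simp
  qed
  have sm: "summable (\<lambda>k. cmod \<alpha> ^ k)" using \<alpha> by (simp add: summable_geometric)
  have "(\<lambda>k. LINT x|circle_measure. ?F k x) sums (LINT x|circle_measure. (\<Sum>k. ?F k x))"
  proof (rule sums_integral)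
    show "AE x in circle_measure. summable (\<lambda>k. norm (?F k x))"
      by (rule AE_I2, rule summable_comparison_test[OF _ summable_mult2[OF sm]])
         (use le in auto)
    show "summable (\<lambda>k. LINT x|circle_measure. norm (?F k x))"
    proof (rule summable_comparison_test[OF _ summable_mult2[OF sm]])
      have "(LINT x|circle_measure. norm (?F k x)) \<le> (LINT x|circle_measure. cmod \<alpha> ^ k * cmod (v x))" for k
        by (intro integral_mono le integrable_norm integrable_mult_right int v)
      then show "\<exists>N. \<forall>n\<ge>N. norm (LINT x|circle_measure. norm (?F n x)) \<le> cmod \<alpha> ^ n * (LINT x|circle_measure. cmod (v x))"
        by (auto simp: abs_of_nonneg[OF integral_nonneg_AE[OF AE_I2]])
    qed
  qed (use int in auto)
  moreover have "(\<Sum>k. ?F k x) = Ln (1 - \<alpha> * b x) * v x" for x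
  proof -
    have "cmod (\<alpha> * b x) < 1" using \<alpha> b[of x] mult_left_le[of "cmod (b x)" "cmod \<alpha>"]
      by (simp add: norm_mult)
    then have "(\<lambda>k. (-1) ^ Suc k / of_nat k * (- (\<alpha> * b x)) ^ k) sums Ln (1 + - (\<alpha> * b x))"
      by (intro Ln_series) simp
    also have "(\<lambda>k. (-1) ^ Suc k / of_nat k * (- (\<alpha> * b x)) ^ k) = (\<lambda>k. - (\<alpha> ^ k / of_nat k) * b x ^ k)"
      by (rule ext) (simp add: power_minus[of "\<alpha> * b x"] power_mult_distrib field_simps flip: power_add mult_2)
    finally have "(\<lambda>k. - (\<alpha> ^ k / of_nat k) * b x ^ k * v x) sums (Ln (1 - \<alpha> * b x) * v x)"
      using sums_mult2 by fastforce
    then show ?thesis by (simp add: sums_iff mult.assoc)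
  qed
  ultimately show ?thesis using int by simp
qed

context schur_parameters
begin

text \<open>
  The quotient by which the recursion is a multiplication:
  \<open>phi_star (n + 1) = phi_star n (1 - \<gamma> (n + 1) blaschke n)\<close>. It is unimodular on the circle, hence a finite
  Blaschke product, of degree \<open>n + 1\<close>.
\<close>

definition blaschke :: "nat \<Rightarrow> complex \<Rightarrow> complex" where
  "blaschke n z = - z * poly (phi \<gamma> n) z / poly (phi_star \<gamma> n) z"

text \<open>
  This is \<open>z g'\<close> for every logarithm \<open>g\<close> of \<open>phi_star n\<close>, defined without choosing one.
\<close>

definition log_deriv :: "nat \<Rightarrow> complex \<Rightarrow> complex" where
  "log_deriv n z = z * poly (pderiv (phi_star \<gamma> n)) z / poly (phi_star \<gamma> n) z"

lemma blaschke_le_1: "cmod z \<le> 1 \<Longrightarrow> cmod (blaschke n z) \<le> 1"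
  using phi_le_phi_star[of z n] mult_mono[of "cmod z" 1 "cmod (poly (phi \<gamma> n) z)" "cmod (poly (phi_star \<gamma> n) z)"]
  by (simp add: blaschke_def norm_mult norm_divide divide_le_eq_1)

lemma phi_norm_circle: "cmod z = 1 \<Longrightarrow> cmod (poly (phi \<gamma> n) z) = cmod (poly (phi_star \<gamma> n) z)"
  by (simp add: phi_circle norm_mult norm_power)

lemma phi_circ_nonzero: "poly (phi \<gamma> n) (circ x) \<noteq> 0" "poly (phi_star \<gamma> n) (circ x) \<noteq> 0"
  using phi_norm_circle[of "circ x" n] phi_star_nonzero[of "circ x" n] by auto

lemma blaschke_circ: "cmod (blaschke n (circ x)) = 1"
  using phi_circ_nonzero[of n x] by (simp add: blaschke_def norm_mult norm_divide phi_norm_circle)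

lemma blaschke_cnj: "blaschke n (circ x) * cnj (blaschke n (circ x)) = 1"
  by (simp add: blaschke_circ flip: complex_norm_square)

lemma log_deriv_cnj:
  "poly (phi \<gamma> n) (circ x) * cnj (log_deriv n (circ x)) =
     of_nat n * poly (phi \<gamma> n) (circ x) - circ x * poly (pderiv (phi \<gamma> n)) (circ x)"
proof -
  let ?z = "circ x"
  have nz: "cnj (poly (phi_star \<gamma> n) ?z) \<noteq> 0" using phi_circ_nonzero by simp
  have "poly (phi \<gamma> n) ?z * cnj (log_deriv n ?z) = - (?z ^ n * cnj (?z * poly (pderiv (phi_star \<gamma> n)) ?z))"
    unfolding log_deriv_def using nz by (simp add: phi_circle[of ?z])
  then show ?thesis using phi_tangential_derivative[of ?z \<gamma> n] by simp
qed

lemma blaschke_holomorphic: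
  assumes "\<And>z. cmod z < R \<Longrightarrow> poly (phi_star \<gamma> n) z \<noteq> 0"
  shows "blaschke n holomorphic_on ball 0 R" "log_deriv n holomorphic_on ball 0 R"
  unfolding blaschke_def log_deriv_def by (intro holomorphic_intros; use assms in auto)+

text \<open>
  The logarithmic derivative of \<open>phi_star\<close> is orthogonal on the circle to all positive powers of the
  Blaschke product: the reversal symmetry turns the product into the trace of a holomorphic
  function vanishing at the origin.
\<close>

lemma blaschke_log_deriv_orthogonal:
  "(LINT x|circle_measure. blaschke n (circ x) ^ Suc k * cnj (log_deriv n (circ x))) = 0"
proof -
  obtain R where R: "R > 1" "\<And>z. cmod z < R \<Longrightarrow> poly (phi_star \<gamma> n) z \<noteq> 0"
    using carath_approx_holomorphic by metis
  define F where "F z = blaschke n z ^ k * (- z / poly (phi_star \<gamma> n) z) *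
      (of_nat n * poly (phi \<gamma> n) z - z * poly (pderiv (phi \<gamma> n)) z)" for z
  have "F holomorphic_on ball 0 R" unfolding F_def
    by (intro holomorphic_intros blaschke_holomorphic) (use R in auto)
  from circle_mean[OF this R(1)] have "(LINT x|circle_measure. F (circ x)) = 0" by (simp add: F_def)
  moreover have "blaschke n (circ x) ^ Suc k * cnj (log_deriv n (circ x)) = F (circ x)" for x
  proof -
    have "blaschke n (circ x) ^ Suc k * cnj (log_deriv n (circ x)) =
       blaschke n (circ x) ^ k * (- circ x / poly (phi_star \<gamma> n) (circ x)) *
       (poly (phi \<gamma> n) (circ x) * cnj (log_deriv n (circ x)))"
      by (simp add: blaschke_def[of n "circ x"])
    then show ?thesis unfolding F_def log_deriv_cnj .
  qed
  ultimately show ?thesis by simp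
qed

text \<open>
  The left-hand side is the derivative of the argument of the Blaschke product along the circle; being
  equal to the right-hand side, it is real.
\<close>

lemma blaschke_argument_derivative:
  "circ x * deriv (blaschke n) (circ x) * cnj (blaschke n (circ x)) =
     of_nat (Suc n) - log_deriv n (circ x) - cnj (log_deriv n (circ x))"
proof -
  let ?z = "circ x" and ?X = "poly (phi \<gamma> n) (circ x)" and ?Y = "poly (phi_star \<gamma> n) (circ x)"
  let ?X' = "poly (pderiv (phi \<gamma> n)) ?z" and ?Y' = "poly (pderiv (phi_star \<gamma> n)) ?z"
  note nz = phi_circ_nonzero[of n x] circ_nonzero[of x]
  have "(blaschke n has_field_derivative - (((?X + ?X' * ?z) * ?Y - ?z * ?X * ?Y') / (?Y * ?Y))) (at ?z)"
    unfolding blaschke_def using nz by (auto intro!: derivative_eq_intros simp: poly_DERIV)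
  then have d: "deriv (blaschke n) ?z = - (((?X + ?X' * ?z) * ?Y - ?z * ?X * ?Y') / (?Y * ?Y))"
    by (rule DERIV_imp_deriv)
  have "cnj (blaschke n ?z) = 1 / blaschke n ?z"
    using blaschke_cnj[of n x] by (metis mult_zero_left nonzero_eq_divide_eq mult.commute zero_neq_one)
  also have "\<dots> = - ?Y / (?z * ?X)" by (simp add: blaschke_def)
  finally have c: "cnj (blaschke n ?z) = - ?Y / (?z * ?X)" .
  have q: "cnj (log_deriv n ?z) = of_nat n - ?z * ?X' / ?X"
    using log_deriv_cnj[of n x] nz by (simp add: field_simps)
  show ?thesis unfolding d c q unfolding log_deriv_def using nz by (simp add: divide_simps) (simp add: algebra_simps)
qed

text \<open>
  The mean of the argument derivative is the winding number \<open>n + 1\<close>. For the other powers the reality of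
  this derivative turns the integrand into the conjugate of a holomorphic function vanishing at the
  origin.
\<close>

lemma blaschke_winding:
  "(LINT x|circle_measure. circ x * deriv (blaschke n) (circ x) * cnj (blaschke n (circ x)) ^ Suc k) =
     (if k = 0 then of_nat (Suc n) else 0)"
proof -
  obtain R where R: "R > 1" "\<And>z. cmod z < R \<Longrightarrow> poly (phi_star \<gamma> n) z \<noteq> 0"
    using carath_approx_holomorphic by metis
  note hol = blaschke_holomorphic[OF R(2)]
  show ?thesis
  proof (cases k)
    case 0
    have "(LINT x|circle_measure. log_deriv n (circ x)) = 0"
      using circle_mean[OF hol(2) R(1)] by (simp add: log_deriv_def)
    then show ?thesis using integrable_circ_holomorphic[OF hol(2) R(1)] circle.prob_space
      by (simp add: 0 blaschke_argument_derivative del: of_nat_Suc)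
  next
    case (Suc j)
    let ?F = "\<lambda>z. z * deriv (blaschke n) z * blaschke n z ^ j"
    have F: "?F holomorphic_on ball 0 R" by (intro holomorphic_intros hol) auto
    have "circ x * deriv (blaschke n) (circ x) * cnj (blaschke n (circ x)) ^ Suc k = cnj (?F (circ x))" for x
    proof -
      let ?w = "circ x * deriv (blaschke n) (circ x) * cnj (blaschke n (circ x))"
      have real: "cnj ?w = ?w" unfolding blaschke_argument_derivative by simp
      have "circ x * deriv (blaschke n) (circ x) * cnj (blaschke n (circ x)) ^ Suc k = ?w * cnj (blaschke n (circ x)) ^ k"
        by (simp add: mult.assoc)
      also have "\<dots> = cnj (?w * blaschke n (circ x) ^ k)"
        by (simp only: complex_cnj_mult[of ?w] real complex_cnj_power)
      also have "?w * blaschke n (circ x) ^ k = ?F (circ x) * (blaschke n (circ x) * cnj (blaschke n (circ x)))"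
        by (simp add: Suc)
      finally show ?thesis by (simp only: blaschke_cnj mult_1_right)
    qed
    then have "(LINT x|circle_measure. circ x * deriv (blaschke n) (circ x) * cnj (blaschke n (circ x)) ^ Suc k) =
        cnj (LINT x|circle_measure. ?F (circ x))" by (simp only: Bochner_Integration.integral_cnj)
    also have "(LINT x|circle_measure. ?F (circ x)) = 0" using circle_mean[OF F R(1)] by simp
    finally show ?thesis by (simp add: Suc)
  qed
qed

text \<open>
  The Dirichlet norm of the factor added in one step. In the pairing of \<open>l = Ln (1 - \<alpha> b)\<close> with \<open>z l'\<close>, both
  expanded in powers of \<open>b\<close>, only the terms of equal powers survive, each contributing the winding number
  of \<open>b\<close>.
\<close>

lemma log_factor_pairing:
  assumes \<alpha>: "cmod \<alpha> < 1" and R: "R > 1" "\<And>z. cmod z < R \<Longrightarrow> poly (phi_star \<gamma> n) z \<noteq> 0"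
    and less: "\<And>z. cmod z < R \<Longrightarrow> cmod (\<alpha> * blaschke n z) < 1"
  defines "l \<equiv> \<lambda>z. Ln (1 - \<alpha> * blaschke n z)"
  shows "(\<lambda>k. real k * (cmod (taylor_coeff l k))\<^sup>2) sums - (real (Suc n) * ln (1 - (cmod \<alpha>)\<^sup>2))"
    and "(\<lambda>k. taylor_coeff l k * cnj (taylor_coeff (log_deriv n) k)) sums 0"
    and "l holomorphic_on ball 0 R"
proof -
  note hol = blaschke_holomorphic[OF R(2)]
  have pos: "Re (1 - \<alpha> * blaschke n z) > 0" if "cmod z < R" for z
    using less[OF that] complex_Re_le_cmod[of "\<alpha> * blaschke n z"] by simp
  have nonpos: "1 - \<alpha> * blaschke n z \<notin> \<real>\<^sub>\<le>\<^sub>0" if "cmod z < R" for z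
    using pos[OF that] by (auto simp: complex_nonpos_Reals_iff)
  show l: "l holomorphic_on ball 0 R" unfolding l_def
    by (intro holomorphic_intros hol(1)) (use nonpos in auto)
  have nz: "1 - \<alpha> * blaschke n z \<noteq> 0" if "cmod z < R" for z using nonpos[OF that] by auto
  have dl: "deriv l z = - \<alpha> * deriv (blaschke n) z / (1 - \<alpha> * blaschke n z)" if "cmod z < R" for z
  proof (rule DERIV_imp_deriv)
    have "(blaschke n has_field_derivative deriv (blaschke n) z) (at z)"
      using that by (intro holomorphic_derivI[OF hol(1)]) auto
    then show "(l has_field_derivative - \<alpha> * deriv (blaschke n) z / (1 - \<alpha> * blaschke n z)) (at z)"
      unfolding l_def using nonpos[OF that] nz[OF that]
      by (auto intro!: derivative_eq_intros simp: field_simps)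
  qed
  have lc: "l (circ x) = Ln (1 - \<alpha> * blaschke n (circ x))" for x by (simp add: l_def)
  have bmeas: "(\<lambda>x. blaschke n (circ x)) \<in> borel_measurable borel"
    by (rule measurable_circ_holomorphic[OF hol(1) R(1)])

  have ld: "integrable circle_measure (\<lambda>x. cnj (log_deriv n (circ x)))"
    using integrable_circ_holomorphic[OF hol(2) R(1)] by simp
  have "(\<lambda>k. - (\<alpha> ^ k / of_nat k) * (LINT x|circle_measure. blaschke n (circ x) ^ k * cnj (log_deriv n (circ x)))) sums
      (LINT x|circle_measure. l (circ x) * cnj (log_deriv n (circ x)))"
    unfolding lc by (rule circle_log_series[OF bmeas ld _ \<alpha>]) (simp add: blaschke_circ)
  moreover have "- (\<alpha> ^ k / of_nat k) * (LINT x|circle_measure. blaschke n (circ x) ^ k * cnj (log_deriv n (circ x))) = 0" for k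
    by (cases k) (use blaschke_log_deriv_orthogonal in auto)
  ultimately have "(LINT x|circle_measure. l (circ x) * cnj (log_deriv n (circ x))) = 0"
    using sums_unique2[OF _ sums_zero] by (simp only:)
  with circle_parseval[OF l hol(2) R(1)]
  show "(\<lambda>k. taylor_coeff l k * cnj (taylor_coeff (log_deriv n) k)) sums 0" by simp

  \<comment> \<open>multiplication by cnj b, the inverse of b on the circle, relates the integrals J recursively\<close>
  define J where "J k = (LINT x|circle_measure. circ x * deriv (blaschke n) (circ x) * cnj (blaschke n (circ x)) ^ k
      / (1 - \<alpha> * blaschke n (circ x)))" for k
  have mult_hol: "(\<lambda>z. z * deriv (blaschke n) z) holomorphic_on ball 0 R"
    and quot_hol: "(\<lambda>z. z * deriv (blaschke n) z / (1 - \<alpha> * blaschke n z)) holomorphic_on ball 0 R"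
    by (intro holomorphic_intros hol; use nz in auto)+
  have int1: "integrable circle_measure (\<lambda>x. circ x * deriv (blaschke n) (circ x) * cnj (blaschke n (circ x)) ^ k)" for k
    by (rule Bochner_Integration.integrable_bound[OF integrable_circ_holomorphic[OF mult_hol R(1)]])
       (use bmeas measurable_circ_holomorphic[OF mult_hol R(1)] in \<open>auto simp: norm_mult norm_power blaschke_circ\<close>)
  have int2: "integrable circle_measure (\<lambda>x. circ x * deriv (blaschke n) (circ x) * cnj (blaschke n (circ x)) ^ k
      / (1 - \<alpha> * blaschke n (circ x)))" for k
  proof -
    define Q where "Q x = circ x * deriv (blaschke n) (circ x) / (1 - \<alpha> * blaschke n (circ x))" for x
    have Q: "integrable circle_measure Q" "Q \<in> borel_measurable borel"
      unfolding Q_def using integrable_circ_holomorphic[OF quot_hol R(1)] measurable_circ_holomorphic[OF quot_hol R(1)] .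
    have "integrable circle_measure (\<lambda>x. Q x * cnj (blaschke n (circ x)) ^ k)"
      by (rule Bochner_Integration.integrable_bound[OF Q(1)])
         (use bmeas Q(2) in \<open>auto simp: norm_mult norm_power blaschke_circ\<close>)
    then show ?thesis by (simp add: Q_def)
  qed
  have J0: "J 0 = 0" unfolding J_def using circle_mean[OF quot_hol R(1)] by simp
  have JSuc: "J (Suc k) = (if k = 0 then of_nat (Suc n) else 0) + \<alpha> * J k" for k
  proof -
    have "circ x * deriv (blaschke n) (circ x) * cnj (blaschke n (circ x)) ^ Suc k / (1 - \<alpha> * blaschke n (circ x)) =
      circ x * deriv (blaschke n) (circ x) * cnj (blaschke n (circ x)) ^ Suc k +
      \<alpha> * (circ x * deriv (blaschke n) (circ x) * cnj (blaschke n (circ x)) ^ k / (1 - \<alpha> * blaschke n (circ x)))" for x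
    proof -
      let ?b = "blaschke n (circ x)"
      have alg: "w * c ^ Suc k / (1 - \<alpha> * b) = w * c ^ Suc k + \<alpha> * (w * c ^ k / (1 - \<alpha> * b))"
        if "b * c = 1" "1 - \<alpha> * b \<noteq> 0" for w b c :: complex
      proof -
        have "w * c ^ Suc k = w * c ^ Suc k * (1 - \<alpha> * b) + \<alpha> * (w * c ^ k) * (b * c)" by (simp add: algebra_simps)
        with that show ?thesis by (simp add: field_simps)
      qed
      show ?thesis by (rule alg) (use blaschke_cnj nz[of "circ x"] R(1) in auto)
    qed
    then have "J (Suc k) = (LINT x|circle_measure. circ x * deriv (blaschke n) (circ x) * cnj (blaschke n (circ x)) ^ Suc k +
      \<alpha> * (circ x * deriv (blaschke n) (circ x) * cnj (blaschke n (circ x)) ^ k / (1 - \<alpha> * blaschke n (circ x))))"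
      unfolding J_def by (simp only:)
    also have "\<dots> = (LINT x|circle_measure. circ x * deriv (blaschke n) (circ x) * cnj (blaschke n (circ x)) ^ Suc k) + \<alpha> * J k"
      unfolding J_def by (subst Bochner_Integration.integral_add[OF int1 integrable_mult_right[OF int2]]) (simp only: integral_mult_right_zero)
    finally show ?thesis unfolding blaschke_winding .
  qed
  have J: "J (Suc k) = of_nat (Suc n) * \<alpha> ^ k" for k
    by (induction k) (simp_all add: JSuc J0 del: of_nat_Suc)
  have zl: "(\<lambda>z. z * deriv l z) holomorphic_on ball 0 R" by (intro holomorphic_intros l) auto
  have pair: "(LINT x|circle_measure. blaschke n (circ x) ^ k * cnj (circ x * deriv l (circ x))) = cnj (- \<alpha> * J k)" for k
  proof -
    have "blaschke n (circ x) ^ k * cnj (circ x * deriv l (circ x)) = cnj (- \<alpha> * (circ x * deriv (blaschke n) (circ x) * cnj (blaschke n (circ x)) ^ k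
      / (1 - \<alpha> * blaschke n (circ x))))" for x
      using dl[of "circ x"] R(1) by simp
    then have "(LINT x|circle_measure. blaschke n (circ x) ^ k * cnj (circ x * deriv l (circ x))) =
      cnj (LINT x|circle_measure. - \<alpha> * (circ x * deriv (blaschke n) (circ x) * cnj (blaschke n (circ x)) ^ k
      / (1 - \<alpha> * blaschke n (circ x))))"
      by (simp only: Bochner_Integration.integral_cnj)
    also have "\<dots> = cnj (- \<alpha> * J k)"
      unfolding J_def by (subst integral_mult_right_zero) simp
    finally show ?thesis .
  qed
  have "(\<lambda>k. - (\<alpha> ^ k / of_nat k) * cnj (- \<alpha> * J k)) sums (LINT x|circle_measure. l (circ x) * cnj (circ x * deriv l (circ x)))"
    unfolding lc pair[symmetric]
    by (rule circle_log_series[OF bmeas integrable_cnj[OF integrable_circ_holomorphic[OF zl R(1)]] _ \<alpha>])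
       (simp add: blaschke_circ)
  moreover have "- (\<alpha> ^ k / of_nat k) * cnj (- \<alpha> * J k) = of_real (real (Suc n) * (((cmod \<alpha>)\<^sup>2) ^ k / real k))" for k
  proof (cases k)
    case (Suc j)
    have "(complex_of_real ((cmod \<alpha>)\<^sup>2)) ^ k = \<alpha> ^ k * cnj \<alpha> ^ k"
      by (simp add: complex_norm_square power_mult_distrib del: of_real_power)
    then show ?thesis using J[of j] by (simp add: Suc del: of_nat_Suc)
  qed simp
  ultimately have 1: "(\<lambda>k. complex_of_real (real (Suc n) * (((cmod \<alpha>)\<^sup>2) ^ k / real k))) sums
      (LINT x|circle_measure. l (circ x) * cnj (circ x * deriv l (circ x)))" by (simp only:)
  have "(\<lambda>k. - ((- (- (cmod \<alpha>)\<^sup>2)) ^ k) / real k) sums ln (1 + - (cmod \<alpha>)\<^sup>2)"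
    by (rule ln_series') (use \<alpha> in \<open>simp add: abs_square_less_1\<close>)
  from sums_mult[OF sums_minus[OF this], of "real (Suc n)"]
  have "(\<lambda>k. real (Suc n) * (((cmod \<alpha>)\<^sup>2) ^ k / real k)) sums - (real (Suc n) * ln (1 - (cmod \<alpha>)\<^sup>2))" by simp
  then have 2: "(\<lambda>k. complex_of_real (real (Suc n) * (((cmod \<alpha>)\<^sup>2) ^ k / real k))) sums
     of_real (- (real (Suc n) * ln (1 - (cmod \<alpha>)\<^sup>2)))" by (rule sums_of_real)
  have 3: "(\<lambda>k. taylor_coeff l k * cnj (taylor_coeff (\<lambda>z. z * deriv l z) k)) sums
     of_real (- (real (Suc n) * ln (1 - (cmod \<alpha>)\<^sup>2)))"
    using circle_parseval[OF l zl R(1)] sums_unique2[OF 1 2] by simp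
  have "taylor_coeff l k * cnj (taylor_coeff (\<lambda>z. z * deriv l z) k) = of_real (real k * (cmod (taylor_coeff l k))\<^sup>2)" for k
    using R(1) by (simp add: taylor_coeff_euler_derivative[OF l] complex_norm_square del: of_real_power)
  with sums_Re[OF 3] show "(\<lambda>k. real k * (cmod (taylor_coeff l k))\<^sup>2) sums - (real (Suc n) * ln (1 - (cmod \<alpha>)\<^sup>2))"
    by simp
qed

lemma log_deriv_eq:
  assumes g: "g holomorphic_on ball 0 R" "0 < R" and c: "c \<noteq> 0"
    and eq: "\<And>z. cmod z < R \<Longrightarrow> exp (g z) = c * poly (phi_star \<gamma> n) z"
  shows "cmod z < R \<Longrightarrow> z * deriv g z = log_deriv n z"
    and "of_nat k * taylor_coeff g k = taylor_coeff (log_deriv n) k"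
proof -
  show *: "z * deriv g z = log_deriv n z" if z: "cmod z < R" for z
  proof -
    have Y: "poly (phi_star \<gamma> n) z \<noteq> 0" using eq[OF z] by auto
    have "(g has_field_derivative deriv g z) (at z)"
      using z by (intro holomorphic_derivI[OF g(1)]) auto
    then have "((\<lambda>z. exp (g z)) has_field_derivative exp (g z) * deriv g z) (at z)"
      by (auto intro!: derivative_eq_intros)
    moreover have "((\<lambda>z. exp (g z)) has_field_derivative c * poly (pderiv (phi_star \<gamma> n)) z) (at z)"
    proof (rule has_field_derivative_transform_within_open)
      show "((\<lambda>z. c * poly (phi_star \<gamma> n) z) has_field_derivative c * poly (pderiv (phi_star \<gamma> n)) z) (at z)"
        by (auto intro!: derivative_eq_intros simp: poly_DERIV)
    qed (use z eq in \<open>auto intro: open_ball[of 0 R]\<close>)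
    ultimately have "exp (g z) * deriv g z = c * poly (pderiv (phi_star \<gamma> n)) z" by (rule DERIV_unique)
    then show ?thesis unfolding eq[OF z] log_deriv_def using c Y by (simp add: field_simps)
  qed
  show "of_nat k * taylor_coeff g k = taylor_coeff (log_deriv n) k"
    unfolding taylor_coeff_euler_derivative[OF g, symmetric] by (rule taylor_coeff_cong[OF * g(2)])
qed

text \<open>
  Induction on \<open>n\<close>. Passing from \<open>n\<close> to \<open>n + 1\<close> adds to the logarithm the term \<open>Ln (1 - \<gamma> (n + 1) blaschke n)\<close>.
  The cross term of the Dirichlet form is its pairing with \<open>log_deriv n\<close>, which vanishes, so the squares of
  the norms add up.
\<close>

lemma dirichlet_identity_ex:
  "\<exists>R g. R > 1 \<and> g holomorphic_on ball 0 R \<and> (\<forall>z. cmod z < R \<longrightarrow> exp (g z) = poly (phi_star \<gamma> n) z) \<and>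
     (\<lambda>k. real k * (cmod (taylor_coeff g k))\<^sup>2) sums - (\<Sum>k=1..n. real k * ln (1 - (cmod (\<gamma> k))\<^sup>2))"
proof (induction n)
  case 0
  have "taylor_coeff (\<lambda>_. Ln (1 - \<gamma> 0)) k = (if k = 0 then Ln (1 - \<gamma> 0) else 0)" for k
    using taylor_coeff_eq[OF has_fps_expansion_const[of "Ln (1 - \<gamma> 0)"], of k] by simp
  then have "(\<lambda>k. real k * (cmod (taylor_coeff (\<lambda>_. Ln (1 - \<gamma> 0)) k))\<^sup>2) = (\<lambda>k. 0)" by auto
  then show ?case using \<gamma>_neq_1[of 0]
    by (intro exI[of _ 2] exI[of _ "\<lambda>_. Ln (1 - \<gamma> 0)"]) (simp add: phi_0)
next
  case (Suc n)
  then obtain R g where R: "R > 1" and g: "g holomorphic_on ball 0 R" and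
    eg: "\<And>z. cmod z < R \<Longrightarrow> exp (g z) = poly (phi_star \<gamma> n) z" and
    gs: "(\<lambda>k. real k * (cmod (taylor_coeff g k))\<^sup>2) sums - (\<Sum>k=1..n. real k * ln (1 - (cmod (\<gamma> k))\<^sup>2))"
    by blast
  define \<alpha> where "\<alpha> = \<gamma> (Suc n)"
  have Y: "poly (phi_star \<gamma> n) z \<noteq> 0" if "cmod z < R" for z using eg[OF that] by auto
  have bhol: "blaschke n holomorphic_on ball 0 R" by (rule blaschke_holomorphic[OF Y])
  define S where "S = {z \<in> ball 0 R. cmod (\<alpha> * blaschke n z) < 1}"
  have "open (ball 0 R \<inter> (\<lambda>z. cmod (\<alpha> * blaschke n z)) -` {..<1})"
    by (intro continuous_open_preimage continuous_intros holomorphic_on_imp_continuous_on bhol) auto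
  also have "ball 0 R \<inter> (\<lambda>z. cmod (\<alpha> * blaschke n z)) -` {..<1} = S" by (auto simp: S_def)
  finally have "open S" .
  moreover have "cball 0 1 \<subseteq> S"
  proof
    fix z :: complex assume z: "z \<in> cball 0 1"
    have "cmod (\<alpha> * blaschke n z) \<le> cmod \<alpha> * 1" unfolding norm_mult
      by (rule mult_left_mono) (use z blaschke_le_1[of z n] in auto)
    then show "z \<in> S" using z R \<gamma>[of "Suc n"] by (auto simp: S_def \<alpha>_def)
  qed
  ultimately obtain r where r: "r > 1" "ball 0 r \<subseteq> S" using open_contains_larger_ball by blast
  have rR: "ball (0::complex) r \<subseteq> ball 0 R"
  proof
    fix z :: complex assume "z \<in> ball 0 r"
    then have "z \<in> S" by (rule subsetD[OF r(2)])
    then show "z \<in> ball 0 R" by (simp add: S_def)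
  qed
  have rY: "poly (phi_star \<gamma> n) z \<noteq> 0" if "cmod z < r" for z using Y[of z] rR that by auto
  have less: "cmod (\<alpha> * blaschke n z) < 1" if "cmod z < r" for z using r(2) that by (auto simp: S_def)
  have \<alpha>: "cmod \<alpha> < 1" using \<gamma> by (simp add: \<alpha>_def)
  define l where "l = (\<lambda>z. Ln (1 - \<alpha> * blaschke n z))"
  note l = log_factor_pairing[OF \<alpha> r(1) rY less, folded l_def]
  have gr: "g holomorphic_on ball 0 r" using g rR by (rule holomorphic_on_subset)
  have r0: "0 < r" using r(1) by simp
  have eg': "exp (g z) = 1 * poly (phi_star \<gamma> n) z" if "cmod z < r" for z using eg[of z] rR that by auto
  have cross: "(\<lambda>k. real k * Re (taylor_coeff l k * cnj (taylor_coeff g k))) sums 0"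
  proof -
    have "taylor_coeff l k * cnj (taylor_coeff (log_deriv n) k) = of_nat k * (taylor_coeff l k * cnj (taylor_coeff g k))" for k
      using log_deriv_eq(2)[OF gr r0 _ eg', of k] by (metis complex_cnj_mult complex_cnj_of_nat mult.left_commute zero_neq_one)
    with sums_Re[OF l(2)] show ?thesis by simp
  qed
  have "(\<lambda>k. real k * (cmod (taylor_coeff g k))\<^sup>2 + real k * (cmod (taylor_coeff l k))\<^sup>2 +
      2 * (real k * Re (taylor_coeff l k * cnj (taylor_coeff g k)))) sums
    (- (\<Sum>k=1..n. real k * ln (1 - (cmod (\<gamma> k))\<^sup>2)) + - (real (Suc n) * ln (1 - (cmod \<alpha>)\<^sup>2)) + 2 * 0)"
    by (intro sums_add sums_mult gs l(1) cross)
  moreover have "real k * (cmod (taylor_coeff g k))\<^sup>2 + real k * (cmod (taylor_coeff l k))\<^sup>2 +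
      2 * (real k * Re (taylor_coeff l k * cnj (taylor_coeff g k))) =
      real k * (cmod (taylor_coeff (\<lambda>z. g z + l z) k))\<^sup>2" for k
  proof -
    have tadd: "taylor_coeff (\<lambda>z. g z + l z) k = taylor_coeff g k + taylor_coeff l k"
      by (rule taylor_coeff_add[OF gr l(3) r0])
    have "(cmod (a + b))\<^sup>2 = (cmod a)\<^sup>2 + (cmod b)\<^sup>2 + 2 * Re (b * cnj a)" for a b :: complex
      unfolding cmod_power2 by (simp add: power2_eq_square algebra_simps)
    then show ?thesis unfolding tadd by (simp add: algebra_simps)
  qed
  ultimately have "(\<lambda>k. real k * (cmod (taylor_coeff (\<lambda>z. g z + l z) k))\<^sup>2) sums
      - (\<Sum>k=1..Suc n. real k * ln (1 - (cmod (\<gamma> k))\<^sup>2))" by (simp add: \<alpha>_def)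
  moreover have "exp (g z + l z) = poly (phi_star \<gamma> (Suc n)) z" if z: "cmod z < r" for z
  proof -
    have "1 - \<alpha> * blaschke n z \<noteq> 0" using less[OF z] by auto
    then have "exp (l z) = 1 - \<alpha> * blaschke n z" by (simp add: l_def)
    then show ?thesis unfolding exp_add eg'[OF z] using rY[OF z]
      by (simp add: blaschke_def phi_Suc \<alpha>_def field_simps)
  qed
  moreover have "(\<lambda>z. g z + l z) holomorphic_on ball 0 r" by (intro holomorphic_intros gr l(3))
  ultimately show ?case using r(1) by blast
qed

text \<open>
  The identity behind the strong Szego theorem, for Bernstein--Szego weights. Two logarithms of multiples
  of \<open>phi_star\<close> have the same derivative, so the Dirichlet norm does not depend on the choice.
\<close>

lemma dirichlet_identity:
  assumes g: "g holomorphic_on ball 0 R" "0 < R" and c: "c \<noteq> 0"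
    and eq: "\<And>z. cmod z < R \<Longrightarrow> exp (g z) = c * poly (phi_star \<gamma> n) z"
  shows "(\<lambda>k. real k * (cmod (taylor_coeff g k))\<^sup>2) sums - (\<Sum>k=1..n. real k * ln (1 - (cmod (\<gamma> k))\<^sup>2))"
proof -
  obtain r h where r: "r > 1" and h: "h holomorphic_on ball 0 r" and
    eh: "\<And>z. cmod z < r \<Longrightarrow> exp (h z) = 1 * poly (phi_star \<gamma> n) z" and
    hs: "(\<lambda>k. real k * (cmod (taylor_coeff h k))\<^sup>2) sums - (\<Sum>k=1..n. real k * ln (1 - (cmod (\<gamma> k))\<^sup>2))"
    using dirichlet_identity_ex[of n] by auto
  have "real k * (cmod (taylor_coeff h k))\<^sup>2 = real k * (cmod (taylor_coeff g k))\<^sup>2" for k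
  proof (cases "k = 0")
    case False
    have "of_nat k * taylor_coeff g k = of_nat k * taylor_coeff h k"
      using log_deriv_eq(2)[OF g c eq, of k] log_deriv_eq(2)[OF h _ _ eh, of k] r by simp
    then show ?thesis using False by simp
  qed simp
  with hs show ?thesis by simp
qed

end

section \<open>Compactness in the Dirichlet norm\<close>

text \<open>
  Fatou's lemma, applied to the differences from a fixed term, identifies the limit in the mean with the
  pointwise limit.
\<close>

lemma L1_limit:
  fixes s :: "nat \<Rightarrow> 'a \<Rightarrow> real"
  assumes s: "\<And>i. integrable M (s i)" and [measurable]: "f \<in> borel_measurable M"
    and ae: "AE x in M. (\<lambda>i. s i x) \<longlonglongrightarrow> f x"
    and cauchy: "\<And>e. e > 0 \<Longrightarrow> \<exists>N. \<forall>i\<ge>N. \<forall>j\<ge>N. (LINT x|M. \<bar>s i x - s j x\<bar>) \<le> e"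
  shows "integrable M f" and "(\<lambda>i. LINT x|M. \<bar>s i x - f x\<bar>) \<longlonglongrightarrow> 0"
proof -
  have sm [measurable]: "s i \<in> borel_measurable M" for i using s by auto
  have bound: "integrable M (\<lambda>x. s i x - f x) \<and> (LINT x|M. \<bar>s i x - f x\<bar>) \<le> e"
    if N: "\<forall>i\<ge>N. \<forall>j\<ge>N. (LINT x|M. \<bar>s i x - s j x\<bar>) \<le> e" and i: "i \<ge> N" and e: "e \<ge> 0" for N i e
  proof -
    have "(\<integral>\<^sup>+x. ennreal \<bar>s i x - f x\<bar> \<partial>M) = (\<integral>\<^sup>+x. liminf (\<lambda>j. ennreal \<bar>s i x - s j x\<bar>) \<partial>M)"
    proof (rule nn_integral_cong_AE)
      show "AE x in M. ennreal \<bar>s i x - f x\<bar> = liminf (\<lambda>j. ennreal \<bar>s i x - s j x\<bar>)"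
        using ae
      proof eventually_elim
        case (elim x)
        then have "(\<lambda>j. ennreal \<bar>s i x - s j x\<bar>) \<longlonglongrightarrow> ennreal \<bar>s i x - f x\<bar>"
          by (intro tendsto_intros)
        then show ?case by (intro lim_imp_Liminf[symmetric]) auto
      qed
    qed
    also have "\<dots> \<le> liminf (\<lambda>j. \<integral>\<^sup>+x. ennreal \<bar>s i x - s j x\<bar> \<partial>M)"
      by (rule nn_integral_liminf) measurable
    also have "\<dots> \<le> ennreal e"
    proof -
      have "(\<integral>\<^sup>+x. ennreal \<bar>s i x - s j x\<bar> \<partial>M) \<le> ennreal e" if "j \<ge> N" for j
        using N i that s by (subst nn_integral_eq_integral) (auto intro!: ennreal_leI)
      then have "limsup (\<lambda>j. \<integral>\<^sup>+x. ennreal \<bar>s i x - s j x\<bar> \<partial>M) \<le> ennreal e"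
        by (intro Limsup_bounded) (auto simp: eventually_sequentially)
      then show ?thesis by (rule order.trans[OF Liminf_le_Limsup, rotated]) simp
    qed
    finally have le: "(\<integral>\<^sup>+x. ennreal \<bar>s i x - f x\<bar> \<partial>M) \<le> ennreal e" .
    have int: "integrable M (\<lambda>x. s i x - f x)"
      by (rule integrableI_bounded) (use le in \<open>auto intro: le_less_trans\<close>)
    have "ennreal (LINT x|M. \<bar>s i x - f x\<bar>) \<le> ennreal e"
      using le int by (subst (asm) nn_integral_eq_integral) auto
    then show ?thesis using int e by (simp add: ennreal_le_iff)
  qed
  obtain N where "\<forall>i\<ge>N. \<forall>j\<ge>N. (LINT x|M. \<bar>s i x - s j x\<bar>) \<le> 1" using cauchy[of 1] by auto
  from bound[OF this, of N] have "integrable M (\<lambda>x. s N x - f x)" by simp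
  from Bochner_Integration.integrable_diff[OF s[of N] this] show "integrable M f" by simp
  show "(\<lambda>i. LINT x|M. \<bar>s i x - f x\<bar>) \<longlonglongrightarrow> 0"
  proof (rule LIMSEQ_I)
    fix e :: real assume e: "e > 0"
    obtain N where "\<forall>i\<ge>N. \<forall>j\<ge>N. (LINT x|M. \<bar>s i x - s j x\<bar>) \<le> e / 2" using cauchy[of "e/2"] e by auto
    from bound[OF this] e have "(LINT x|M. \<bar>s i x - f x\<bar>) \<le> e / 2" if "i \<ge> N" for i using that by auto
    then have "norm ((LINT x|M. \<bar>s i x - f x\<bar>) - 0) < e" if "i \<ge> N" for i
      using that e integral_nonneg_AE[of "\<lambda>x. \<bar>s i x - f x\<bar>" M] by (fastforce simp: abs_less_iff)
    then show "\<exists>N. \<forall>i\<ge>N. norm ((LINT x|M. \<bar>s i x - f x\<bar>) - 0) < e" by blast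
  qed
qed

lemma exp_diff_le: "\<bar>exp a - exp b\<bar> \<le> \<bar>a - b\<bar> * (exp a + exp (b::real))"
proof (induction a b rule: linorder_wlog)
  case (le a b)
  have "exp b * (1 + (a - b)) \<le> exp b * exp (a - b)" by (intro mult_left_mono exp_ge_add_one_self) auto
  also have "\<dots> = exp a" by (simp flip: exp_add)
  finally have "exp b - exp a \<le> (b - a) * exp b" by (simp add: algebra_simps)
  moreover have "0 \<le> (b - a) * exp a" using le by simp
  moreover have "\<bar>exp a - exp b\<bar> = exp b - exp a" "\<bar>a - b\<bar> = b - a" using le by auto
  ultimately have "\<bar>exp a - exp b\<bar> \<le> (b - a) * exp a + (b - a) * exp b" by linarith
  then show ?case using le by (simp add: distrib_left)
next
  case (sym a b) then show ?case by (simp add: abs_minus_commute add.commute)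
qed

text \<open>
  Strong convergence in \<open>L\<^sup>2\<close> comes from the weight \<open>k\<close> in the Dirichlet norm, which makes the tails of the
  Taylor series uniformly small; uniform integrability of the exponentials comes from the Lebedev--Milin
  inequality.
\<close>

lemma dirichlet_bounded_subsequence:
  fixes g :: "nat \<Rightarrow> complex \<Rightarrow> complex" and R :: "nat \<Rightarrow> real"
  assumes hol: "\<And>i. g i holomorphic_on ball 0 (R i)" and R: "\<And>i. R i > 1"
    and c0: "\<And>i. g i 0 = c0"
    and D: "\<And>i n. (\<Sum>k\<le>n. real k * (cmod (taylor_coeff (g i) k))\<^sup>2) \<le> D"
  obtains r u where "strict_mono (r :: nat \<Rightarrow> nat)" "u \<in> borel_measurable borel" "\<And>x. u (x + pi) = u x"
    "integrable circle_measure u"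
    "(\<lambda>i. LINT x|circle_measure. \<bar>Re (g (r i) (circ x)) - u x\<bar>) \<longlonglongrightarrow> 0"
    "integrable circle_measure (\<lambda>x. exp (- 2 * u x))"
    "(\<lambda>i. LINT x|circle_measure. \<bar>exp (- 2 * Re (g (r i) (circ x))) - exp (- 2 * u x)\<bar>) \<longlonglongrightarrow> 0"
proof -
  define c where "c i k = taylor_coeff (g i) k" for i k
  have D0: "D \<ge> 0" using D[of 0 0] by simp
  have cb: "real k * (cmod (c i k))\<^sup>2 \<le> D" for i k
    using D[of i k] member_le_sum[of k "{..k}" "\<lambda>k. real k * (cmod (c i k))\<^sup>2"] by (auto simp: c_def)
  have cb': "cmod (c i k) \<le> cmod c0 + sqrt D" for i k
  proof (cases k)
    case 0 then show ?thesis using c0 D0 by (simp add: c_def)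
  next
    case (Suc j)
    have "1 * (cmod (c i k))\<^sup>2 \<le> real k * (cmod (c i k))\<^sup>2" by (rule mult_right_mono) (auto simp: Suc)
    also have "\<dots> \<le> D" by (rule cb)
    finally have "cmod (c i k) \<le> sqrt D" by (simp add: real_le_rsqrt)
    then show ?thesis by (simp add: add_increasing)
  qed
  \<comment> \<open>a diagonal sequence along which every Taylor coefficient converges\<close>
  obtain r1 :: "nat \<Rightarrow> nat" where r1: "strict_mono r1" and conv: "\<And>k. \<exists>l. (\<lambda>i. c (r1 i) k) \<longlonglongrightarrow> l"
    using function_convergent_subsequence[of "UNIV :: nat set" c "cmod c0 + sqrt D"] cb' by auto
  define h where "h i = g (r1 i)" for i
  define G where "G i x = h i (circ x)" for i x
  have Gm [measurable]: "G i \<in> borel_measurable borel" for i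
    unfolding G_def h_def by (rule measurable_circ_holomorphic[OF hol R])
  have Gb: "\<exists>B>0. \<forall>x. cmod (G i x) \<le> B" for i
    using bounded_circ_holomorphic[OF hol R, of "r1 i"] unfolding G_def h_def by blast
  have bint: "integrable circle_measure (\<lambda>x. F (G i x) (G j x))"
    if "continuous_on UNIV (\<lambda>p. F (fst p) (snd p) :: real)" for i j and F :: "complex \<Rightarrow> complex \<Rightarrow> real"
  proof -
    obtain B1 where B1: "\<And>x. cmod (G i x) \<le> B1" using Gb by blast
    obtain B2 where B2: "\<And>x. cmod (G j x) \<le> B2" using Gb by blast
    have "compact ((\<lambda>p. F (fst p) (snd p)) ` (cball 0 B1 \<times> cball 0 B2))"
      by (intro compact_continuous_image compact_Times continuous_on_subset[OF that]) auto
    then have "bounded ((\<lambda>p. F (fst p) (snd p)) ` (cball 0 B1 \<times> cball 0 B2))"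
      by (rule compact_imp_bounded)
    then obtain B where B: "\<forall>y\<in>(\<lambda>p. F (fst p) (snd p)) ` (cball 0 B1 \<times> cball 0 B2). norm y \<le> B"
      unfolding bounded_iff ..
    have mem: "F (G i x) (G j x) \<in> (\<lambda>p. F (fst p) (snd p)) ` (cball 0 B1 \<times> cball 0 B2)" for x
      using B1[of x] B2[of x] by (intro image_eqI[of _ _ "(G i x, G j x)"]) auto
    have "(\<lambda>x. F (G i x) (G j x)) \<in> borel_measurable borel"
      using measurable_compose[OF borel_measurable_Pair[OF Gm[of i] Gm[of j]] borel_measurable_continuous_onI[OF that]]
      by (simp only: fst_conv snd_conv)
    then show ?thesis by (rule circle_integrable_bounded) (use B mem in blast)
  qed
  \<comment> \<open>the coefficients beyond index M contribute at most a multiple of D / M\<close>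
  have L2: "(LINT x|circle_measure. (cmod (G i x - G j x))\<^sup>2) \<le>
     (\<Sum>k\<le>M. (cmod (c (r1 i) k - c (r1 j) k))\<^sup>2) + 4 * D / real (Suc M)" for i j M
  proof -
    define \<rho> where "\<rho> = min (R (r1 i)) (R (r1 j))"
    have \<rho>: "\<rho> > 1" using R by (simp add: \<rho>_def)
    have hi: "h i holomorphic_on ball 0 \<rho>" "h j holomorphic_on ball 0 \<rho>"
      unfolding h_def by (rule holomorphic_on_subset[OF hol]; force simp: \<rho>_def)+
    have tc: "taylor_coeff (\<lambda>z. h i z - h j z) k = c (r1 i) k - c (r1 j) k" for k
      using taylor_coeff_diff[OF hi] \<rho> by (simp add: c_def h_def)
    let ?a = "\<lambda>k. (cmod (c (r1 i) k - c (r1 j) k))\<^sup>2"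
    have "(\<lambda>z. h i z - h j z) holomorphic_on ball 0 \<rho>" by (intro holomorphic_intros hi)
    from circle_parseval_norm[OF this \<rho>] have sums: "?a sums (LINT x|circle_measure. (cmod (G i x - G j x))\<^sup>2)"
      by (simp add: tc G_def)
    show ?thesis
    proof (rule LIMSEQ_le_const2)
      show "(\<lambda>n. \<Sum>k\<le>n. ?a k) \<longlonglongrightarrow> (LINT x|circle_measure. (cmod (G i x - G j x))\<^sup>2)"
        using sums by (simp add: sums_def_le)
      have "(\<Sum>k\<le>n. ?a k) \<le> (\<Sum>k\<le>M. ?a k) + 4 * D / real (Suc M)" if n: "n \<ge> M" for n
      proof -
        have "(\<Sum>k\<le>n. ?a k) = (\<Sum>k\<le>M. ?a k) + (\<Sum>k\<in>{Suc M..n}. ?a k)"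
        proof -
          have "{..n} = {..M} \<union> {Suc M..n}" using n by auto
          then show ?thesis by (simp add: sum.union_disjoint)
        qed
        also have "(\<Sum>k\<in>{Suc M..n}. ?a k) \<le> (\<Sum>k\<in>{Suc M..n}. 2 / real (Suc M) * (real k * (cmod (c (r1 i) k))\<^sup>2 + real k * (cmod (c (r1 j) k))\<^sup>2))"
        proof (rule sum_mono)
          fix k assume k: "k \<in> {Suc M..n}"
          have "?a k \<le> (cmod (c (r1 i) k) + cmod (c (r1 j) k))\<^sup>2" by (intro power_mono norm_triangle_ineq4) auto
          also have "\<dots> \<le> 2 * ((cmod (c (r1 i) k))\<^sup>2 + (cmod (c (r1 j) k))\<^sup>2)"
            using sum_squares_bound[of "cmod (c (r1 i) k)" "cmod (c (r1 j) k)"] by (simp add: power2_sum)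
          also have "\<dots> \<le> real k / real (Suc M) * (2 * ((cmod (c (r1 i) k))\<^sup>2 + (cmod (c (r1 j) k))\<^sup>2))"
            using k mult_right_mono[of 1 "real k / real (Suc M)" "2 * ((cmod (c (r1 i) k))\<^sup>2 + (cmod (c (r1 j) k))\<^sup>2)"]
            by (simp del: of_nat_Suc)
          finally show "?a k \<le> 2 / real (Suc M) * (real k * (cmod (c (r1 i) k))\<^sup>2 + real k * (cmod (c (r1 j) k))\<^sup>2)"
            by (simp add: algebra_simps add_divide_distrib)
        qed
        also have "\<dots> = 2 / real (Suc M) * ((\<Sum>k\<in>{Suc M..n}. real k * (cmod (c (r1 i) k))\<^sup>2) + (\<Sum>k\<in>{Suc M..n}. real k * (cmod (c (r1 j) k))\<^sup>2))"
          by (simp only: sum_distrib_left[symmetric] sum.distrib)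
        also have "\<dots> \<le> 2 / real (Suc M) * (D + D)"
        proof (intro mult_left_mono add_mono)
          have "(\<Sum>k\<in>{Suc M..n}. real k * (cmod (c i k))\<^sup>2) \<le> (\<Sum>k\<le>n. real k * (cmod (c i k))\<^sup>2)" for i
            by (rule sum_mono2) auto
          then show "(\<Sum>k\<in>{Suc M..n}. real k * (cmod (c (r1 i) k))\<^sup>2) \<le> D" "(\<Sum>k\<in>{Suc M..n}. real k * (cmod (c (r1 j) k))\<^sup>2) \<le> D"
            using D[of "r1 i" n] D[of "r1 j" n] unfolding c_def by (auto intro: order_trans)
        qed auto
        finally show ?thesis by simp
      qed
      then show "\<exists>N. \<forall>n\<ge>N. (\<Sum>k\<le>n. ?a k) \<le> (\<Sum>k\<le>M. ?a k) + 4 * D / real (Suc M)" by blast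
    qed
  qed
  have L2_cauchy: "\<exists>N. \<forall>i\<ge>N. \<forall>j\<ge>N. (LINT x|circle_measure. (cmod (G i x - G j x))\<^sup>2) \<le> e" if e: "e > 0" for e
  proof -
    obtain M where M: "4 * D / real (Suc M) \<le> e / 2"
    proof -
      obtain M :: nat where "real M > 8 * D / e" using reals_Archimedean2 by blast
      then have "4 * D / real (Suc M) \<le> e / 2" using e by (simp add: field_simps)
      then show ?thesis using that by blast
    qed
    define d where "d = sqrt (e / (2 * real (Suc M)))"
    have d: "d > 0" using e by (simp add: d_def)
    have "\<exists>N. \<forall>i\<ge>N. \<forall>j\<ge>N. cmod (c (r1 i) k - c (r1 j) k) < d" for k
    proof -
      have "Cauchy (\<lambda>i. c (r1 i) k)" using conv[of k] by (auto intro: LIMSEQ_imp_Cauchy)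
      then show ?thesis using d unfolding Cauchy_def dist_norm by blast
    qed
    then obtain N where N: "\<And>k i j. i \<ge> N k \<Longrightarrow> j \<ge> N k \<Longrightarrow> cmod (c (r1 i) k - c (r1 j) k) < d" by metis
    have "(LINT x|circle_measure. (cmod (G i x - G j x))\<^sup>2) \<le> e" if ij: "i \<ge> (\<Sum>k\<le>M. N k)" "j \<ge> (\<Sum>k\<le>M. N k)" for i j
    proof -
      have "(\<Sum>k\<le>M. (cmod (c (r1 i) k - c (r1 j) k))\<^sup>2) \<le> (\<Sum>k\<le>M. d\<^sup>2)"
      proof (intro sum_mono power_mono)
        fix k assume "k \<in> {..M}"
        then have "N k \<le> (\<Sum>k\<le>M. N k)" by (intro member_le_sum) auto
        with ij have "N k \<le> i" "N k \<le> j" by auto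
        then show "cmod (c (r1 i) k - c (r1 j) k) \<le> d" using N[of k i j] by simp
      qed auto
      also have "\<dots> = e / 2" using e by (simp add: d_def field_simps)
      finally show ?thesis using L2[of i j M] M by linarith
    qed
    then show ?thesis by blast
  qed
  define v where "v i x = Re (G i x)" for i x
  have [measurable]: "v i \<in> borel_measurable borel" for i unfolding v_def by measurable
  have vint: "integrable circle_measure (v i)" for i
    unfolding v_def by (rule bint[of "\<lambda>a b. Re a" i i]) (intro continuous_intros)
  \<comment> \<open>trades the square norm for the mean, with a free parameter\<close>
  have amgm: "a * b \<le> (a\<^sup>2 / e + e * b\<^sup>2) / 2" if "e > 0" for a b e :: real
  proof -
    have "0 \<le> (a / sqrt e - sqrt e * b)\<^sup>2" by simp
    also have "\<dots> = a\<^sup>2 / e + e * b\<^sup>2 - 2 * (a * b)" using that by (simp add: power2_diff power_divide power_mult_distrib)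
    finally show ?thesis by simp
  qed
  have sq_int: "integrable circle_measure (\<lambda>x. (cmod (G i x - G j x))\<^sup>2)" for i j
    by (rule bint[of "\<lambda>a b. (cmod (a - b))\<^sup>2"]) (intro continuous_intros)
  have v_cauchy: "\<exists>N. \<forall>i\<ge>N. \<forall>j\<ge>N. (LINT x|circle_measure. \<bar>v i x - v j x\<bar>) \<le> e" if e: "e > 0" for e
  proof -
    obtain N where N: "\<And>i j. i \<ge> N \<Longrightarrow> j \<ge> N \<Longrightarrow> (LINT x|circle_measure. (cmod (G i x - G j x))\<^sup>2) \<le> e * e"
      using L2_cauchy[of "e * e"] e by auto
    have "(LINT x|circle_measure. \<bar>v i x - v j x\<bar>) \<le> e" if ij: "i \<ge> N" "j \<ge> N" for i j
    proof -
      have "(LINT x|circle_measure. \<bar>v i x - v j x\<bar>) \<le> (LINT x|circle_measure. ((cmod (G i x - G j x))\<^sup>2 / e + e) / 2)"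
      proof (rule integral_mono)
        show "integrable circle_measure (\<lambda>x. \<bar>v i x - v j x\<bar>)" using vint by auto
        show "integrable circle_measure (\<lambda>x. ((cmod (G i x - G j x))\<^sup>2 / e + e) / 2)" using sq_int by auto
        fix x
        have "\<bar>v i x - v j x\<bar> \<le> cmod (G i x - G j x)" unfolding v_def using abs_Re_le_cmod[of "G i x - G j x"] by simp
        also have "\<dots> \<le> ((cmod (G i x - G j x))\<^sup>2 / e + e) / 2" using amgm[OF e, of "cmod (G i x - G j x)" 1] by simp
        finally show "\<bar>v i x - v j x\<bar> \<le> ((cmod (G i x - G j x))\<^sup>2 / e + e) / 2" .
      qed
      also have "\<dots> = ((LINT x|circle_measure. (cmod (G i x - G j x))\<^sup>2) / e + e) / 2"
        using sq_int circle.prob_space by simp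
      also have "\<dots> \<le> (e * e / e + e) / 2" using N[OF ij] e by (intro divide_right_mono add_right_mono) auto
      finally show ?thesis using e by simp
    qed
    then show ?thesis by blast
  qed
  \<comment> \<open>the square integral of the weight is the one of exp (- 2 h), controlled by the Dirichlet norm\<close>
  have lm: "(LINT x|circle_measure. (exp (- 2 * v i x))\<^sup>2) \<le> (cmod (exp (- 2 * c0)))\<^sup>2 * exp (4 * D)" for i
  proof -
    have hg: "(\<lambda>z. - 2 * h i z) holomorphic_on ball 0 (R (r1 i))" unfolding h_def by (intro holomorphic_intros hol)
    have t: "taylor_coeff (\<lambda>z. - 2 * h i z) k = - 2 * c (r1 i) k" for k
    proof -
      have "h i has_fps_expansion fps_expansion (h i) 0" unfolding h_def
        by (rule holomorphic_fps_expansion[OF hol]) (use R[of "r1 i"] in simp)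
      from taylor_coeff_eq[OF has_fps_expansion_cmult_left[OF this, of "- 2"], of k] taylor_coeff_eq[OF this, of k]
      show ?thesis by (simp add: c_def h_def)
    qed
    have "(LINT x|circle_measure. (cmod (exp (- 2 * h i (circ x))))\<^sup>2) \<le> (cmod (exp (- 2 * h i 0)))\<^sup>2 * exp (4 * D)"
    proof (rule lebedev_milin[OF hg R])
      have "(\<Sum>k\<le>n. real k * (cmod (taylor_coeff (\<lambda>z. - 2 * h i z) k))\<^sup>2) = 4 * (\<Sum>k\<le>n. real k * (cmod (c (r1 i) k))\<^sup>2)" for n
      proof -
        have "real k * (cmod (- 2 * c (r1 i) k))\<^sup>2 = 4 * (real k * (cmod (c (r1 i) k))\<^sup>2)" for k
          by (simp add: norm_mult power_mult_distrib)
        then show ?thesis by (simp only: t sum_distrib_left)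
      qed
      then show "(\<Sum>k\<le>n. real k * (cmod (taylor_coeff (\<lambda>z. - 2 * h i z) k))\<^sup>2) \<le> 4 * D" for n
        using D[of "r1 i" n] by (simp add: c_def)
    qed
    then show ?thesis by (simp add: v_def G_def h_def c0)
  qed
  define B where "B = (cmod (exp (- 2 * c0)))\<^sup>2 * exp (4 * D)"
  have B: "B > 0" by (simp add: B_def)
  define w where "w i x = exp (- 2 * v i x)" for i x
  have wm [measurable]: "w i \<in> borel_measurable borel" for i unfolding w_def by measurable
  have wint: "integrable circle_measure (w i)" for i
    unfolding w_def v_def by (rule bint[of "\<lambda>a b. exp (- 2 * Re a)" i i]) (intro continuous_intros)
  have wint2: "integrable circle_measure (\<lambda>x. (w i x)\<^sup>2)" for i
    unfolding w_def v_def by (rule bint[of "\<lambda>a b. (exp (- 2 * Re a))\<^sup>2" i i]) (intro continuous_intros)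
  have w_cauchy: "\<exists>N. \<forall>i\<ge>N. \<forall>j\<ge>N. (LINT x|circle_measure. \<bar>w i x - w j x\<bar>) \<le> e" if e: "e > 0" for e
  proof -
    \<comment> \<open>half of e goes to the exponentials, whose square integrals are at most B\<close>
    define \<delta> where "\<delta> = e / (4 * B)"
    have \<delta>: "\<delta> > 0" using e B by (simp add: \<delta>_def)
    obtain N where N: "\<And>i j. i \<ge> N \<Longrightarrow> j \<ge> N \<Longrightarrow> (LINT x|circle_measure. (cmod (G i x - G j x))\<^sup>2) \<le> \<delta> * e / 4"
      using L2_cauchy[of "\<delta> * e / 4"] e \<delta> by auto
    have "(LINT x|circle_measure. \<bar>w i x - w j x\<bar>) \<le> e" if ij: "i \<ge> N" "j \<ge> N" for i j
    proof -
      have "(LINT x|circle_measure. \<bar>w i x - w j x\<bar>) \<le>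
        (LINT x|circle_measure. 2 * (cmod (G i x - G j x))\<^sup>2 / \<delta> + \<delta> * ((w i x)\<^sup>2 + (w j x)\<^sup>2))"
      proof (rule integral_mono)
        show "integrable circle_measure (\<lambda>x. \<bar>w i x - w j x\<bar>)" using wint by auto
        show "integrable circle_measure (\<lambda>x. 2 * (cmod (G i x - G j x))\<^sup>2 / \<delta> + \<delta> * ((w i x)\<^sup>2 + (w j x)\<^sup>2))" using sq_int wint2 by auto
        fix x
        have vG: "\<bar>v i x - v j x\<bar> \<le> cmod (G i x - G j x)" unfolding v_def using abs_Re_le_cmod[of "G i x - G j x"] by simp
        have "\<bar>w i x - w j x\<bar> \<le> \<bar>(- 2 * v i x) - (- 2 * v j x)\<bar> * (w i x + w j x)"
          unfolding w_def by (rule exp_diff_le)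
        also have "\<dots> \<le> (2 * cmod (G i x - G j x)) * (w i x + w j x)"
          by (rule mult_right_mono) (use vG in \<open>auto simp: w_def add_nonneg_nonneg\<close>)
        also have "\<dots> \<le> ((2 * cmod (G i x - G j x))\<^sup>2 / \<delta> + \<delta> * (w i x + w j x)\<^sup>2) / 2"
          by (rule amgm[OF \<delta>])
        also have "\<dots> \<le> ((2 * cmod (G i x - G j x))\<^sup>2 / \<delta> + \<delta> * (2 * ((w i x)\<^sup>2 + (w j x)\<^sup>2))) / 2"
          using \<delta> sum_squares_bound[of "w i x" "w j x"] by (intro divide_right_mono add_left_mono mult_left_mono) (auto simp: power2_sum)
        finally show "\<bar>w i x - w j x\<bar> \<le> 2 * (cmod (G i x - G j x))\<^sup>2 / \<delta> + \<delta> * ((w i x)\<^sup>2 + (w j x)\<^sup>2)"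
          by (simp add: power_mult_distrib add_divide_distrib distrib_left)
      qed
      also have "\<dots> = 2 * (LINT x|circle_measure. (cmod (G i x - G j x))\<^sup>2) / \<delta>
          + \<delta> * ((LINT x|circle_measure. (w i x)\<^sup>2) + (LINT x|circle_measure. (w j x)\<^sup>2))"
        using sq_int wint2 by simp
      also have "\<dots> \<le> 2 * (\<delta> * e / 4) / \<delta> + \<delta> * (B + B)"
        using N[OF ij] lm[of i] lm[of j] \<delta>
        by (intro add_mono mult_left_mono divide_right_mono) (auto simp: w_def B_def)
      also have "\<dots> = e" using \<delta> B by (simp add: \<delta>_def)
      finally show ?thesis .
    qed
    then show ?thesis by blast
  qed
  obtain r2 where r2: "strict_mono r2" "AE x in circle_measure. Cauchy (\<lambda>i. v (r2 i) x)"
  proof (rule cauchy_L1_AE_cauchy_subseq[of circle_measure v])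
    fix e :: real assume e: "e > 0"
    then obtain N where "\<forall>i\<ge>N. \<forall>j\<ge>N. (LINT x|circle_measure. \<bar>v i x - v j x\<bar>) \<le> e / 2" using v_cauchy[of "e/2"] by auto
    then have "\<forall>i\<ge>N. \<forall>j\<ge>N. (LINT x|circle_measure. norm (v i x - v j x)) < e" using e by fastforce
    then show "\<exists>N. \<forall>i\<ge>N. \<forall>j\<ge>N. (LINT x|circle_measure. norm (v i x - v j x)) < e" by blast
  qed (use vint that in auto)
  define u where "u x = lim (\<lambda>i. v (r2 i) x)" for x
  have um [measurable]: "u \<in> borel_measurable borel" unfolding u_def by measurable
  have ae: "AE x in circle_measure. (\<lambda>i. v (r2 i) x) \<longlonglongrightarrow> u x"
    using r2(2) by eventually_elim (simp add: u_def convergent_LIMSEQ_iff[symmetric] Cauchy_convergent_iff)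
  have sub: "\<exists>N. \<forall>i\<ge>N. \<forall>j\<ge>N. P (r2 i) (r2 j)" if "\<exists>N. \<forall>i\<ge>N. \<forall>j\<ge>N. P i j" for P :: "nat \<Rightarrow> nat \<Rightarrow> bool"
  proof -
    from that obtain N where "\<And>i j. i \<ge> N \<Longrightarrow> j \<ge> N \<Longrightarrow> P i j" by blast
    then show ?thesis using seq_suble[OF r2(1)] by (intro exI[of _ N]) (meson order_trans)
  qed
  note lim_v = L1_limit[of circle_measure "\<lambda>i. v (r2 i)" u, OF vint _ ae sub[OF v_cauchy]]
  have aew: "AE x in circle_measure. (\<lambda>i. w (r2 i) x) \<longlonglongrightarrow> exp (- 2 * u x)"
    using ae by eventually_elim (auto simp: w_def intro!: tendsto_intros)
  note lim_w = L1_limit[of circle_measure "\<lambda>i. w (r2 i)" "\<lambda>x. exp (- 2 * u x)", OF wint _ aew sub[OF w_cauchy]]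
  show ?thesis
  proof (rule that[of "r1 \<circ> r2" u])
    show "strict_mono (r1 \<circ> r2)" using r1 r2(1) by (rule strict_mono_o)
    show "u (x + pi) = u x" for x by (simp add: u_def v_def G_def circ_periodic)
    show "integrable circle_measure u" by (rule lim_v(1)) auto
    show "integrable circle_measure (\<lambda>x. exp (- 2 * u x))" by (rule lim_w(1)) auto
    show "(\<lambda>i. LINT x|circle_measure. \<bar>Re (g ((r1 \<circ> r2) i) (circ x)) - u x\<bar>) \<longlonglongrightarrow> 0"
      using lim_v(2) by (simp add: v_def G_def h_def)
    show "(\<lambda>i. LINT x|circle_measure. \<bar>exp (- 2 * Re (g ((r1 \<circ> r2) i) (circ x))) - exp (- 2 * u x)\<bar>) \<longlonglongrightarrow> 0"
      using lim_w(2) by (simp add: w_def v_def G_def h_def)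
  qed (rule um)
qed

section \<open>Recovering the parameters\<close>

text \<open>
  The polynomial \<open>z\<^sup>n cnj (P (1 / cnj z))\<close>.
\<close>

definition conj_reverse :: "nat \<Rightarrow> complex poly \<Rightarrow> complex poly" where
  "conj_reverse n P = (\<Sum>i\<le>n. monom (cnj (coeff P (n - i))) i)"

lemma coeff_conj_reverse: "coeff (conj_reverse n P) i = (if i \<le> n then cnj (coeff P (n - i)) else 0)"
  unfolding conj_reverse_def coeff_sum coeff_monom by (simp add: sum.delta)

lemma conj_reverse_linear_factor:
  assumes "degree P \<le> n"
  shows "conj_reverse (Suc n) ([:- a, 1:] * P) = [:1, - cnj a:] * conj_reverse n P"
proof (rule poly_eqI)
  fix i
  have c: "coeff ([:- a, 1:] * P) m = - a * coeff P m + (if m = 0 then 0 else coeff P (m - 1))" for m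
    by (simp add: coeff_pCons split: nat.splits)
  have d: "coeff ([:1, - cnj a:] * Q) m = coeff Q m - cnj a * (if m = 0 then 0 else coeff Q (m - 1))" for m Q
    by (simp add: coeff_pCons split: nat.splits)
  have z: "coeff P (Suc n) = 0" using assms by (simp add: coeff_eq_0)
  consider "i = 0" | "1 \<le> i" "i \<le> n" | "i = Suc n" | "i > Suc n" by linarith
  then show "coeff (conj_reverse (Suc n) ([:- a, 1:] * P)) i = coeff ([:1, - cnj a:] * conj_reverse n P) i"
  proof cases
    case 2
    then have "Suc n - i - 1 = n - i" "n - (i - 1) = Suc n - i" by auto
    with 2 show ?thesis unfolding d coeff_conj_reverse c by simp
  qed (unfold d coeff_conj_reverse c, auto simp: z)
qed

lemma root_free_split:
  fixes P :: "complex poly"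
  assumes "degree P \<noteq> 0" "degree P \<le> Suc n" "\<And>z. cmod z \<le> 1 \<Longrightarrow> poly P z \<noteq> 0"
  obtains a Q where "P = [:- a, 1:] * Q" "cmod a > 1" "degree Q \<le> n" "\<And>z. cmod z \<le> 1 \<Longrightarrow> poly Q z \<noteq> 0"
proof -
  obtain a where a: "poly P a = 0"
    using Fundamental_Theorem_Algebra.fundamental_theorem_of_algebra[of P] assms(1) by (auto simp: constant_degree)
  then obtain Q where Q: "P = [:- a, 1:] * Q" unfolding poly_eq_0_iff_dvd by (elim dvdE)
  have a1: "cmod a > 1" using assms(3)[of a] a by force
  have "Q \<noteq> 0" using assms(1) Q by auto
  then have "degree P = Suc (degree Q)" unfolding Q by (subst degree_mult_eq) auto
  moreover have "poly Q z \<noteq> 0" if "cmod z \<le> 1" for z using assms(3)[OF that] unfolding Q by auto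
  ultimately show ?thesis using that[OF Q a1] assms(2) by auto
qed

text \<open>
  For a polynomial without zeros in the closed disc the reversal is dominated there: each linear
  factor \<open>z - a\<close> with \<open>\<bar>a\<bar> > 1\<close> dominates \<open>1 - cnj a z\<close>.
\<close>

lemma conj_reverse_le:
  assumes "degree P \<le> n" "\<And>z. cmod z \<le> 1 \<Longrightarrow> poly P z \<noteq> 0" "cmod \<zeta> \<le> 1"
  shows "cmod (poly (conj_reverse n P) \<zeta>) \<le> cmod (poly P \<zeta>)"
  using assms(1,2)
proof (induction n arbitrary: P)
  case 0
  then obtain c where "P = [:c:]" by (metis degree_0_id le_zero_eq)
  then show ?case by (simp add: conj_reverse_def poly_monom)
next
  case (Suc n)
  show ?case
  proof (cases "degree P = 0")
    case True
    then obtain c where P: "P = [:c:]" by (metis degree_0_id)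
    have "conj_reverse (Suc n) P = monom (cnj c) (Suc n)"
      by (rule poly_eqI) (auto simp: coeff_conj_reverse P coeff_pCons split: nat.splits)
    moreover have "cmod \<zeta> ^ Suc n \<le> 1" using assms(3) by (intro power_le_one) auto
    ultimately show ?thesis using mult_left_mono[of "cmod \<zeta> ^ Suc n" 1 "cmod c"]
      by (simp add: P poly_monom norm_mult norm_power)
  next
    case False
    obtain a Q where Q: "P = [:- a, 1:] * Q" "cmod a > 1" "degree Q \<le> n" "\<And>z. cmod z \<le> 1 \<Longrightarrow> poly Q z \<noteq> 0"
      using root_free_split[OF False Suc.prems] by blast
    have "0 \<le> ((cmod a)\<^sup>2 - 1) * (1 - (cmod \<zeta>)\<^sup>2)"
      using Q(2) assms(3) by (intro mult_nonneg_nonneg) (auto simp: power_le_one)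
    also have "\<dots> = (cmod (\<zeta> - a))\<^sup>2 - (cmod (1 - cnj a * \<zeta>))\<^sup>2"
    proof -
      have "complex_of_real (((cmod a)\<^sup>2 - 1) * (1 - (cmod \<zeta>)\<^sup>2)) = complex_of_real ((cmod (\<zeta> - a))\<^sup>2 - (cmod (1 - cnj a * \<zeta>))\<^sup>2)"
        by (simp add: complex_norm_square algebra_simps del: of_real_power)
      then show ?thesis by (simp only: of_real_eq_iff)
    qed
    finally have "(cmod (1 - cnj a * \<zeta>))\<^sup>2 \<le> (cmod (\<zeta> - a))\<^sup>2" by simp
    then have "cmod (1 - cnj a * \<zeta>) \<le> cmod (\<zeta> - a)" by (rule power2_le_imp_le) simp
    then have "cmod (1 - cnj a * \<zeta>) * cmod (poly (conj_reverse n Q) \<zeta>) \<le> cmod (\<zeta> - a) * cmod (poly Q \<zeta>)"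
      by (rule mult_mono[OF _ Suc.IH[OF Q(3,4)]]) auto
    moreover have "poly P \<zeta> = (\<zeta> - a) * poly Q \<zeta>" by (simp add: Q(1) algebra_simps)
    moreover have "poly (conj_reverse (Suc n) P) \<zeta> = (1 - cnj a * \<zeta>) * poly (conj_reverse n Q) \<zeta>"
      unfolding Q(1) conj_reverse_linear_factor[OF Q(3)] by (simp add: algebra_simps)
    ultimately show ?thesis by (simp add: norm_mult)
  qed
qed

text \<open>
  For full degree the quotient of the extreme coefficients is, up to sign, the inverse of the product of
  the zeros, which lie outside the closed disc.
\<close>

lemma root_free_leading_coeff:
  assumes "degree P \<le> Suc n" "\<And>z. cmod z \<le> 1 \<Longrightarrow> poly P z \<noteq> 0"
  shows "cmod (coeff P (Suc n)) < cmod (coeff P 0)"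
proof (cases "degree P = 0")
  case True
  then have "coeff P (Suc n) = 0" by (simp add: coeff_eq_0)
  then show ?thesis using assms(2)[of 0] by (simp add: poly_0_coeff_0)
next
  case False
  obtain a Q where Q: "P = [:- a, 1:] * Q" "cmod a > 1" "degree Q \<le> n" "\<And>z. cmod z \<le> 1 \<Longrightarrow> poly Q z \<noteq> 0"
    using root_free_split[OF False assms] by blast
  have Q0: "coeff Q 0 \<noteq> 0" using Q(4)[of 0] by (simp add: poly_0_coeff_0)
  have "cmod (coeff Q n) \<le> cmod (coeff Q 0)"
    using conj_reverse_le[OF Q(3,4), of 0] by (simp add: poly_0_coeff_0 coeff_conj_reverse)
  also have "\<dots> < cmod a * cmod (coeff Q 0)" using Q(2) Q0 by simp
  finally show ?thesis using Q(3) by (simp add: Q(1) coeff_eq_0 norm_mult)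
qed

lemma degree_phi: "degree (phi \<gamma> n) \<le> n \<and> degree (phi_star \<gamma> n) \<le> n"
proof (induction n)
  case 0 show ?case by (simp add: phi_0)
next
  case (Suc n)
  have X: "degree (pCons 0 (phi \<gamma> n)) \<le> Suc n" using degree_pCons_le[of 0 "phi \<gamma> n"] Suc by linarith
  have Y: "degree (phi_star \<gamma> n) \<le> Suc n" using Suc by simp
  have "degree (smult c P) \<le> Suc n" if "degree P \<le> Suc n" for c and P :: "complex poly"
    using degree_smult_le[of c P] that by linarith
  from degree_add_le[OF X this[OF Y]] degree_add_le[OF Y this[OF X]] show ?case
    unfolding phi_Suc by blast
qed

text \<open>
  The reversal symmetry as an identity of coefficients. It lets the pair be recovered from its second
  component.
\<close>

lemma phi_conj_reverse: "phi \<gamma> n = - conj_reverse n (phi_star \<gamma> n)"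
proof (induction n)
  case 0 show ?case by (simp add: phi_0 conj_reverse_def monom_0)
next
  case (Suc n)
  have d: "coeff (phi_star \<gamma> n) (Suc n) = 0" using degree_phi[of \<gamma> n] by (intro coeff_eq_0) simp
  have X: "coeff (phi \<gamma> n) i = - (if i \<le> n then cnj (coeff (phi_star \<gamma> n) (n - i)) else 0)" for i
    unfolding Suc by (simp add: coeff_conj_reverse)
  show ?case
  proof (rule poly_eqI)
    fix i
    consider "i = 0" | "1 \<le> i" "i \<le> n" | "i = Suc n" | "i > Suc n" by linarith
    then show "coeff (phi \<gamma> (Suc n)) i = coeff (- conj_reverse (Suc n) (phi_star \<gamma> (Suc n))) i"
    proof cases
      case 1 then show ?thesis by (simp add: coeff_conj_reverse phi_Suc X d)
    next
      case 2
      then obtain j where j: "i = Suc j" by (cases i) auto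
      have "n - (n - Suc j) = Suc j" using 2 j by simp
      moreover have "Suc n - Suc j = Suc (n - Suc j)" using 2 j by simp
      ultimately show ?thesis using 2 unfolding j by (simp add: coeff_conj_reverse phi_Suc X)
    next
      case 3 then show ?thesis by (simp add: coeff_conj_reverse phi_Suc X d)
    next
      case 4
      then obtain j where j: "i = Suc j" "j > n" by (cases i) auto
      have "coeff (phi_star \<gamma> n) (Suc j) = 0" using degree_phi[of \<gamma> n] j by (intro coeff_eq_0) simp
      then show ?thesis using j by (simp add: coeff_conj_reverse phi_Suc X)
    qed
  qed
qed

lemma szego_cong: "(\<And>k. k \<le> n \<Longrightarrow> \<gamma> k = \<gamma>' k) \<Longrightarrow> szego \<gamma> r n = szego \<gamma>' r n"
  by (induction n) (simp_all add: Let_def)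

text \<open>
  The recursion can be run backwards from any polynomial without zeros in the closed disc: the last
  parameter is read off from the extreme coefficients, and one step down preserves both the absence
  of zeros and the value at the origin.
\<close>

lemma inverse_szego:
  assumes "degree P \<le> n" "\<And>z. cmod z \<le> 1 \<Longrightarrow> poly P z \<noteq> 0" "poly P 0 = 1 - \<gamma>\<^sub>0" "cmod \<gamma>\<^sub>0 < 1"
  shows "\<exists>\<gamma>. schur_parameters \<gamma> \<and> \<gamma> 0 = \<gamma>\<^sub>0 \<and> phi_star \<gamma> n = P \<and> (\<forall>k>n. \<gamma> k = 0)"
  using assms(1-3)
proof (induction n arbitrary: P)
  case 0
  then obtain c where P: "P = [:c:]" by (metis degree_0_id le_zero_eq)
  show ?case
    by (rule exI[of _ "\<lambda>k. if k = 0 then \<gamma>\<^sub>0 else 0"])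
       (use 0 assms(4) in \<open>auto simp: P phi_0 schur_parameters_def\<close>)
next
  case (Suc n)
  define g where "g = - coeff P (Suc n) / cnj (coeff P 0)"
  have P0: "coeff P 0 \<noteq> 0" using Suc.prems(2)[of 0] by (simp add: poly_0_coeff_0)
  have g1: "cmod g < 1"
    using root_free_leading_coeff[OF Suc.prems(1,2)] P0 by (simp add: g_def norm_divide)
  then have gsq: "(cmod g)\<^sup>2 < 1" by (simp add: abs_square_less_1)
  define s where "s = complex_of_real (1 - (cmod g)\<^sup>2)"
  have s: "s \<noteq> 0" unfolding s_def of_real_eq_0_iff using gsq by simp
  have s': "s = 1 - g * cnj g" by (simp add: s_def complex_norm_square del: of_real_power)
  define Q where "Q = smult (1 / s) (P + smult g (conj_reverse (Suc n) P))"
  have cQ: "coeff Q j = (coeff P j + g * (if j \<le> Suc n then cnj (coeff P (Suc n - j)) else 0)) / s" for j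
    by (simp add: Q_def coeff_conj_reverse)
  have gP: "coeff P (Suc n) = - g * cnj (coeff P 0)" using P0 by (simp add: g_def)
  have top: "coeff Q j = 0" if "j > n" for j
  proof (cases "j = Suc n")
    case True then show ?thesis by (simp add: cQ gP)
  next
    case False
    then have "coeff P j = 0" using that Suc.prems(1) by (intro coeff_eq_0) auto
    then show ?thesis using that False by (simp add: cQ)
  qed
  have degQ: "degree Q \<le> n" using top by (intro degree_le) auto
  have Q0: "coeff Q 0 = coeff P 0"
  proof -
    have "coeff P 0 + g * cnj (coeff P (Suc n)) = coeff P 0 * s" by (simp add: gP s' algebra_simps)
    then show ?thesis using s by (simp add: cQ)
  qed
  have zfQ: "poly Q z \<noteq> 0" if z: "cmod z \<le> 1" for z
  proof
    assume "poly Q z = 0"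
    then have "poly P z = - (g * poly (conj_reverse (Suc n) P) z)" using s by (simp add: Q_def eq_neg_iff_add_eq_0)
    then have "cmod (poly P z) = cmod g * cmod (poly (conj_reverse (Suc n) P) z)" by (simp add: norm_mult)
    also have "\<dots> \<le> cmod g * cmod (poly P z)"
      by (intro mult_left_mono conj_reverse_le Suc.prems z) auto
    finally show False using g1 Suc.prems(2)[OF z] by (simp add: mult_le_cancel_right2 flip: not_less)
  qed
  have "poly Q 0 = 1 - \<gamma>\<^sub>0" using Suc.prems(3) Q0 by (simp add: poly_0_coeff_0)
  from Suc.IH[OF degQ zfQ this] obtain \<gamma>' where
    \<gamma>': "schur_parameters \<gamma>'" "\<gamma>' 0 = \<gamma>\<^sub>0" "phi_star \<gamma>' n = Q" "\<forall>k>n. \<gamma>' k = 0" by blast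
  define \<gamma> where "\<gamma> = \<gamma>'(Suc n := g)"
  have \<gamma>n: "phi \<gamma> n = phi \<gamma>' n" "phi_star \<gamma> n = phi_star \<gamma>' n"
    using szego_cong[of n \<gamma> \<gamma>'] by (auto simp: phi_def phi_star_def \<gamma>_def)
  have \<gamma>S: "\<gamma> (Suc n) = g" by (simp add: \<gamma>_def)
  have "phi_star \<gamma> (Suc n) = P"
  proof (rule poly_eqI)
    fix i
    have Pc: "coeff (phi_star \<gamma> (Suc n)) i = coeff Q i - g * (if i = 0 then 0 else if i \<le> Suc n then cnj (coeff Q (Suc n - i)) else 0)"
      by (auto simp: phi_Suc \<gamma>n phi_conj_reverse[of \<gamma>'] \<gamma>'(3) coeff_conj_reverse coeff_pCons \<gamma>S split: nat.splits)
    consider "i = 0" | "1 \<le> i" "i \<le> Suc n" | "i > Suc n" by linarith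
    then show "coeff (phi_star \<gamma> (Suc n)) i = coeff P i"
    proof cases
      case 1 then show ?thesis using Pc Q0 by simp
    next
      case 2
      have cs: "cnj s = s" by (simp add: s_def)
      have i: "Suc n - (Suc n - i) = i" using 2 by simp
      have "coeff Q i - g * cnj (coeff Q (Suc n - i)) =
         ((coeff P i + g * cnj (coeff P (Suc n - i))) - g * (cnj (coeff P (Suc n - i)) + cnj g * coeff P i)) / s"
        unfolding cQ using 2 by (simp add: cs i diff_divide_distrib)
      also have "\<dots> = coeff P i * s / s" unfolding s' by (simp add: algebra_simps)
      finally show ?thesis using 2 s by (simp add: Pc)
    next
      case 3
      then have "coeff P i = 0" using Suc.prems(1) by (intro coeff_eq_0) auto
      then show ?thesis using 3 top[of i] by (simp add: Pc)
    qed
  qed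
  moreover have "schur_parameters \<gamma>" using \<gamma>'(1) g1 by (auto simp: schur_parameters_def \<gamma>_def)
  moreover have "\<gamma> 0 = \<gamma>\<^sub>0" "\<forall>k>Suc n. \<gamma> k = 0" using \<gamma>'(2,4) by (simp_all add: \<gamma>_def)
  ultimately show ?case by blast
qed

lemma szego_stationary:
  assumes "\<And>k. k > n \<Longrightarrow> \<gamma> k = 0" "m \<ge> n"
  shows "snd (szego \<gamma> r m) = snd (szego \<gamma> r n)"
  using assms(2) by (induction m rule: dec_induct) (simp_all add: Let_def assms(1))

lemma carath_stationary:
  assumes "\<And>k. k > n \<Longrightarrow> \<gamma> k = 0"
  shows "carath \<gamma> z = carath_approx \<gamma> n z"
proof -
  have "(\<lambda>m. carath_approx \<gamma> m z) \<longlonglongrightarrow> carath_approx \<gamma> n z"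
  proof (rule tendsto_eventually)
    have "carath_approx \<gamma> m z = carath_approx \<gamma> n z" if "m \<ge> n" for m
    proof -
      have "snd (szego \<gamma> r m) = snd (szego \<gamma> r n)" for r
        by (rule szego_stationary[OF _ that]) (rule assms)
      then show ?thesis by (simp only: carath_approx_def psi_star_def phi_star_def)
    qed
    then show "\<forall>\<^sub>F m in sequentially. carath_approx \<gamma> m z = carath_approx \<gamma> n z"
      unfolding eventually_sequentially by blast
  qed
  then show ?thesis unfolding carath_def by (rule limI)
qed

text \<open>
  In terms of the recursion with initial pairs \<open>(1, 0)\<close> and \<open>(0, 1)\<close> this is the limit of the quotients of
  second components, which makes the removal of the first parameter a Moebius transformation.
\<close>

definition schur_fun :: "(nat \<Rightarrow> complex) \<Rightarrow> complex \<Rightarrow> complex" where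
  "schur_fun \<gamma> z = (carath \<gamma> z - 1) / (carath \<gamma> z + 1)"

lemma szego_add:
  "fst (szego \<gamma> (a + c, b + d) n) = fst (szego \<gamma> (a, b) n) + fst (szego \<gamma> (c, d) n) \<and>
   snd (szego \<gamma> (a + c, b + d) n) = snd (szego \<gamma> (a, b) n) + snd (szego \<gamma> (c, d) n)"
  by (induction n) (simp_all add: Let_def smult_add_right algebra_simps)

lemma szego_mult:
  "fst (szego \<gamma> (p * a, p * b) n) = p * fst (szego \<gamma> (a, b) n) \<and>
   snd (szego \<gamma> (p * a, p * b) n) = p * snd (szego \<gamma> (a, b) n)"
  by (induction n) (simp_all add: Let_def algebra_simps mult_pCons_right)

lemma szego_shift:
  "szego \<gamma> r (Suc n) = szego (\<lambda>k. \<gamma> (Suc k))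
     (pCons 0 (fst r + smult (cnj (\<gamma> 0)) (snd r)), snd r + smult (\<gamma> 0) (fst r)) n"
  by (induction n) (simp_all add: Let_def)

lemma szego_decompose:
  "snd (szego \<gamma> (p, q) n) = p * snd (szego \<gamma> (1, 0) n) + q * snd (szego \<gamma> (0, 1) n)"
  using szego_add[of \<gamma> "p * 1" "q * 0" "p * 0" "q * 1" n] szego_mult[of \<gamma> p 1 0 n] szego_mult[of \<gamma> q 0 1 n]
  by simp

context schur_parameters
begin

lemma schur_fun_le_1: "cmod z < 1 \<Longrightarrow> cmod (schur_fun \<gamma> z) \<le> 1"
proof -
  assume z: "cmod z < 1"
  have "(cmod (carath \<gamma> z - 1))\<^sup>2 \<le> (cmod (carath \<gamma> z + 1))\<^sup>2"
    using carath_Re_nonneg[OF z] unfolding cmod_power2 by (simp add: power2_eq_square algebra_simps)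
  then have "cmod (carath \<gamma> z - 1) \<le> cmod (carath \<gamma> z + 1)" by (rule power2_le_imp_le) simp
  then show ?thesis using carath_plus_1_nonzero(1)[OF z] by (simp add: schur_fun_def norm_divide)
qed

text \<open>
  The Schur algorithm. Numerator and denominator of an approximating quotient are \<open>z a + \<gamma> 0 b\<close> and
  \<open>cnj (\<gamma> 0) z a + b\<close> when \<open>a\<close> and \<open>b\<close> are those of the shifted parameters; the resulting identity passes to
  the limit.
\<close>

lemma schur_fun_step:
  assumes z: "cmod z < 1"
  shows "schur_fun \<gamma> z * (1 + cnj (\<gamma> 0) * z * schur_fun (\<lambda>k. \<gamma> (Suc k)) z) = \<gamma> 0 + z * schur_fun (\<lambda>k. \<gamma> (Suc k)) z"
proof -
  interpret shift: schur_parameters "\<lambda>k. \<gamma> (Suc k)" by unfold_locales (rule \<gamma>)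
  let ?\<gamma>' = "\<lambda>k. \<gamma> (Suc k)"
  define A B where "A \<gamma> n = poly (snd (szego \<gamma> (1, 0) n)) z" and "B \<gamma> n = poly (snd (szego \<gamma> (0, 1) n)) z" for \<gamma> n
  have ps: "poly (psi_star \<gamma> n) z = A \<gamma> n + B \<gamma> n" "poly (phi_star \<gamma> n) z = B \<gamma> n - A \<gamma> n" for \<gamma> n
    unfolding psi_star_def phi_star_def szego_decompose[of \<gamma> "1" 1] szego_decompose[of \<gamma> "- 1" 1] by (simp_all add: A_def B_def)
  define F where "F \<gamma> n = (carath_approx \<gamma> n z - 1) / (carath_approx \<gamma> n z + 1)" for \<gamma> n
  have FB: "B \<delta> n \<noteq> 0 \<and> F \<delta> n = A \<delta> n / B \<delta> n" if "schur_parameters \<delta>" for \<delta> n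
  proof -
    have nz: "B \<delta> n - A \<delta> n \<noteq> 0" "carath_approx \<delta> n z + 1 \<noteq> 0"
      using schur_parameters.phi_star_nonzero[OF that, of z n] schur_parameters.carath_plus_1_nonzero(2)[OF that z] z
      by (simp_all add: ps)
    then have "B \<delta> n \<noteq> 0" by (auto simp: carath_approx_def ps field_simps)
    moreover have "F \<delta> n = A \<delta> n / B \<delta> n"
    proof -
      have "carath_approx \<delta> n z - 1 = 2 * A \<delta> n / (B \<delta> n - A \<delta> n)" "carath_approx \<delta> n z + 1 = 2 * B \<delta> n / (B \<delta> n - A \<delta> n)"
        using nz(1) by (simp_all add: carath_approx_def ps field_simps)
      then show ?thesis using nz(1) by (simp add: F_def)
    qed
    ultimately show ?thesis by blast
  qed
  have rec: "A \<gamma> (Suc n) = z * A ?\<gamma>' n + \<gamma> 0 * B ?\<gamma>' n" "B \<gamma> (Suc n) = cnj (\<gamma> 0) * z * A ?\<gamma>' n + B ?\<gamma>' n" for n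
  proof -
    show "A \<gamma> (Suc n) = z * A ?\<gamma>' n + \<gamma> 0 * B ?\<gamma>' n"
      unfolding A_def szego_shift szego_decompose[of ?\<gamma>' "pCons 0 _"] by (simp add: B_def)
    show "B \<gamma> (Suc n) = cnj (\<gamma> 0) * z * A ?\<gamma>' n + B ?\<gamma>' n"
      unfolding B_def szego_shift szego_decompose[of ?\<gamma>' "pCons 0 _"] by (simp add: A_def)
  qed
  have step: "F \<gamma> (Suc n) * (1 + cnj (\<gamma> 0) * z * F ?\<gamma>' n) = \<gamma> 0 + z * F ?\<gamma>' n" for n
  proof -
    have b: "B \<gamma> (Suc n) \<noteq> 0" "B ?\<gamma>' n \<noteq> 0"
      using FB[OF schur_parameters_axioms] FB[OF shift.schur_parameters_axioms] by auto
    have "1 + cnj (\<gamma> 0) * z * (A ?\<gamma>' n / B ?\<gamma>' n) = B \<gamma> (Suc n) / B ?\<gamma>' n"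
      using b(2) by (simp add: rec field_simps)
    moreover have "\<gamma> 0 + z * (A ?\<gamma>' n / B ?\<gamma>' n) = A \<gamma> (Suc n) / B ?\<gamma>' n"
      using b(2) by (simp add: rec field_simps)
    ultimately show ?thesis using b FB[OF schur_parameters_axioms] FB[OF shift.schur_parameters_axioms] by simp
  qed
  have lim: "(\<lambda>n. F \<delta> n) \<longlonglongrightarrow> schur_fun \<delta> z" if "schur_parameters \<delta>" for \<delta>
    unfolding F_def schur_fun_def
    by (intro tendsto_intros schur_parameters.carath_approx_tendsto[OF that z] schur_parameters.carath_plus_1_nonzero(1)[OF that z])
  have "(\<lambda>n. F \<gamma> (Suc n) * (1 + cnj (\<gamma> 0) * z * F ?\<gamma>' n)) \<longlonglongrightarrow> schur_fun \<gamma> z * (1 + cnj (\<gamma> 0) * z * schur_fun ?\<gamma>' z)"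
    by (intro tendsto_intros LIMSEQ_Suc lim schur_parameters_axioms shift.schur_parameters_axioms)
  moreover have "(\<lambda>n. F \<gamma> (Suc n) * (1 + cnj (\<gamma> 0) * z * F ?\<gamma>' n)) \<longlonglongrightarrow> \<gamma> 0 + z * schur_fun ?\<gamma>' z"
    unfolding step by (intro tendsto_intros lim shift.schur_parameters_axioms)
  ultimately show ?thesis by (rule LIMSEQ_unique)
qed

lemma shift_parameters: "schur_parameters (\<lambda>k. \<gamma> (Suc k))"
  by unfold_locales (rule \<gamma>)

text \<open>
  A bound that is uniform in the parameters, so that convergence of Schur functions near the origin gives
  convergence of the first parameters.
\<close>

lemma schur_fun_dist:
  assumes z: "cmod z < 1"
  shows "cmod (schur_fun \<gamma> z - \<gamma> 0) \<le> 2 * cmod z"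
proof -
  let ?S = "schur_fun \<gamma> z" and ?S' = "schur_fun (\<lambda>k. \<gamma> (Suc k)) z"
  have "?S - \<gamma> 0 = z * (?S' * (1 - cnj (\<gamma> 0) * ?S))" using schur_fun_step[OF z] by (simp add: algebra_simps)
  then have "cmod (?S - \<gamma> 0) = cmod z * (cmod ?S' * cmod (1 - cnj (\<gamma> 0) * ?S))" by (simp add: norm_mult)
  also have "\<dots> \<le> cmod z * (1 * 2)"
  proof (intro mult_left_mono mult_mono)
    show "cmod ?S' \<le> 1" by (rule schur_parameters.schur_fun_le_1[OF shift_parameters z])
    have "cmod (1 - cnj (\<gamma> 0) * ?S) \<le> 1 + cmod (\<gamma> 0) * cmod ?S"
      using norm_triangle_ineq4[of 1 "cnj (\<gamma> 0) * ?S"] by (simp add: norm_mult)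
    also have "\<dots> \<le> 1 + 1 * 1" using \<gamma>[of 0] schur_fun_le_1[OF z] by (intro add_left_mono mult_mono) auto
    finally show "cmod (1 - cnj (\<gamma> 0) * ?S) \<le> 2" by simp
  qed auto
  finally show ?thesis by simp
qed

end

text \<open>
  The bound at the origin yields the convergence of the first parameters. Then the Schur algorithm yields that of
  the Schur functions of the shifted sequences outside the origin, and the induction proceeds.
\<close>

lemma schur_parameters_continuous:
  assumes "\<And>N. schur_parameters (G N)" "schur_parameters \<gamma>"
    and "\<And>z. z \<noteq> 0 \<Longrightarrow> cmod z < 1 \<Longrightarrow> (\<lambda>N. schur_fun (G N) z) \<longlonglongrightarrow> schur_fun \<gamma> z"
  shows "(\<lambda>N. G N k) \<longlonglongrightarrow> \<gamma> k"
  using assms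
proof (induction k arbitrary: G \<gamma>)
  have base: "(\<lambda>N. G N 0) \<longlonglongrightarrow> \<gamma> 0" if G: "\<And>N. schur_parameters (G N)" and g: "schur_parameters \<gamma>"
    and lim: "\<And>z. z \<noteq> 0 \<Longrightarrow> cmod z < 1 \<Longrightarrow> (\<lambda>N. schur_fun (G N) z) \<longlonglongrightarrow> schur_fun \<gamma> z" for G \<gamma>
  proof (rule LIMSEQ_I)
    fix e :: real assume e: "e > 0"
    define z where "z = complex_of_real (min (1/2) (e / 8))"
    have z: "z \<noteq> 0" "cmod z < 1" "cmod z \<le> e / 8" using e by (auto simp: z_def min_def)
    obtain M where M: "\<And>N. N \<ge> M \<Longrightarrow> cmod (schur_fun (G N) z - schur_fun \<gamma> z) < e / 2"
      using LIMSEQ_D[OF lim[OF z(1,2)], of "e/2"] e by auto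
    have "cmod (G N 0 - \<gamma> 0) < e" if N: "N \<ge> M" for N
    proof -
      have "G N 0 - \<gamma> 0 = (schur_fun (G N) z - schur_fun \<gamma> z) - (schur_fun (G N) z - G N 0) + (schur_fun \<gamma> z - \<gamma> 0)" by simp
      also have "cmod \<dots> \<le> cmod (schur_fun (G N) z - schur_fun \<gamma> z) + cmod (schur_fun (G N) z - G N 0) + cmod (schur_fun \<gamma> z - \<gamma> 0)"
        by (meson norm_triangle_ineq norm_triangle_ineq4 add_mono order_refl order_trans)
      also have "\<dots> < e / 2 + 2 * cmod z + 2 * cmod z"
        using M[OF N] schur_parameters.schur_fun_dist[OF G[of N] z(2)] schur_parameters.schur_fun_dist[OF g z(2)] by linarith
      also have "\<dots> \<le> e" using z(3) by simp
      finally show ?thesis .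
    qed
    then show "\<exists>no. \<forall>n\<ge>no. norm (G n 0 - \<gamma> 0) < e" by blast
  qed
  {
    case 0 then show ?case by (rule base)
  next
    case (Suc k)
    show ?case
    proof (rule Suc.IH)
      show "schur_parameters (\<lambda>k. G N (Suc k))" for N using Suc.prems(1) by (rule schur_parameters.shift_parameters)
      show "schur_parameters (\<lambda>k. \<gamma> (Suc k))" using Suc.prems(2) by (rule schur_parameters.shift_parameters)
      fix z :: complex assume z: "z \<noteq> 0" "cmod z < 1"
      have eq: "1 - cnj (\<delta> 0) * schur_fun \<delta> z \<noteq> 0 \<and>
          schur_fun (\<lambda>k. \<delta> (Suc k)) z = (schur_fun \<delta> z - \<delta> 0) / (z * (1 - cnj (\<delta> 0) * schur_fun \<delta> z))"
        if d: "schur_parameters \<delta>" for \<delta>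
      proof -
        have "cmod (cnj (\<delta> 0) * schur_fun \<delta> z) \<le> cmod (\<delta> 0) * 1"
          using mult_left_mono[OF schur_parameters.schur_fun_le_1[OF d z(2)], of "cmod (\<delta> 0)"] by (simp add: norm_mult)
        also have "\<dots> < 1" using schur_parameters.\<gamma>[OF d] by simp
        finally have nz: "1 - cnj (\<delta> 0) * schur_fun \<delta> z \<noteq> 0" by auto
        have "schur_fun \<delta> z - \<delta> 0 = schur_fun (\<lambda>k. \<delta> (Suc k)) z * (z * (1 - cnj (\<delta> 0) * schur_fun \<delta> z))"
          using schur_parameters.schur_fun_step[OF d z(2)] by (simp add: algebra_simps)
        then show ?thesis using nz z(1) by simp
      qed
      have "(\<lambda>N. (schur_fun (G N) z - G N 0) / (z * (1 - cnj (G N 0) * schur_fun (G N) z))) \<longlonglongrightarrow>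
         (schur_fun \<gamma> z - \<gamma> 0) / (z * (1 - cnj (\<gamma> 0) * schur_fun \<gamma> z))"
        using eq[OF Suc.prems(2)] z
        by (intro tendsto_intros Suc.prems(3) base[OF Suc.prems]) auto
      then show "(\<lambda>N. schur_fun (\<lambda>k. G N (Suc k)) z) \<longlonglongrightarrow> schur_fun (\<lambda>k. \<gamma> (Suc k)) z"
        using eq[OF Suc.prems(2)] eq[OF Suc.prems(1)] by simp
    qed
  }
qed

section \<open>Periodic measures and Poisson integrals\<close>

text \<open>
  The logarithmic derivative of Euler's reflection formula for the Gamma function.
\<close>

lemma Digamma_reflection:
  assumes "z \<notin> \<int>"
  shows "Digamma (1 - z) - Digamma z = of_real pi * cot (of_real pi * (z::complex))"
proof -
  have z1: "1 - z \<notin> \<int>" using Ints_diff[of 1 "1 - z"] assms by auto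
  have np: "z \<notin> \<int>\<^sub>\<le>\<^sub>0" "1 - z \<notin> \<int>\<^sub>\<le>\<^sub>0" using assms z1 nonpos_Ints_subset_Ints by blast+
  have sn: "sin (of_real pi * z) \<noteq> 0"
  proof
    assume "sin (of_real pi * z) = 0"
    then obtain n :: int where "of_real pi * z = of_real (of_int n * pi)" by (auto simp: sin_eq_0)
    then have "of_real pi * z = of_real pi * of_int n" by (simp add: mult.commute)
    then have "z = of_int n" by (simp only: mult_cancel_left) simp
    with assms show False by simp
  qed
  have "((\<lambda>z. Gamma z * Gamma (1 - z)) has_field_derivative
      Gamma z * Gamma (1 - z) * (Digamma z - Digamma (1 - z))) (at z)"
    using np by (auto intro!: derivative_eq_intros simp: algebra_simps)
  moreover have "((\<lambda>z. of_real pi / sin (of_real pi * z)) has_field_derivative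
      (of_real pi / sin (of_real pi * z)) * (- of_real pi * cot (of_real pi * z))) (at z)"
    using sn by (auto intro!: derivative_eq_intros simp: cot_def divide_simps power2_eq_square)
  ultimately have "Gamma z * Gamma (1 - z) * (Digamma z - Digamma (1 - z)) =
      (of_real pi / sin (of_real pi * z)) * (- of_real pi * cot (of_real pi * z))"
    unfolding Gamma_reflection_complex by (rule DERIV_unique)
  then have "Digamma z - Digamma (1 - z) = - of_real pi * cot (of_real pi * z)"
    unfolding Gamma_reflection_complex by (rule mult_left_cancel[THEN iffD1, rotated]) (use sn in simp)
  then show ?thesis by (simp add: algebra_simps)
qed

lemma cot_partial_fractions:
  assumes "z \<notin> \<int>"
  shows "(\<lambda>n. inverse (z + of_nat n) + inverse (z - 1 - of_nat n)) sums (of_real pi * cot (of_real pi * (z::complex)))"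
proof -
  have z1: "1 - z \<notin> \<int>" using Ints_diff[of 1 "1 - z"] assms by auto
  have z0: "z \<noteq> 0" "1 - z \<noteq> 0" using assms z1 by auto
  have *: "(\<lambda>n. inverse (of_nat (Suc n)) - inverse (w + of_nat n)) sums (Digamma w + euler_mascheroni)"
    if "w \<noteq> 0" for w :: complex
    using summable_sums[OF summable_Digamma[OF that]] unfolding Digamma_def by simp
  have "(\<lambda>n. (inverse (of_nat (Suc n)) - inverse ((1 - z) + of_nat n)) - (inverse (of_nat (Suc n)) - inverse (z + of_nat n))) sums
     ((Digamma (1 - z) + euler_mascheroni) - (Digamma z + euler_mascheroni))"
    by (intro sums_diff * z0)
  moreover have "inverse (z - 1 - of_nat n) = - inverse ((1 - z) + of_nat n)" for n
    by (subst inverse_minus_eq[symmetric]) (simp add: algebra_simps)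
  ultimately show ?thesis using Digamma_reflection[OF assms] by (simp add: algebra_simps)
qed

definition line_kernel :: "complex \<Rightarrow> real \<Rightarrow> real" where
  "line_kernel z x = Im z / (cmod (of_real x - z))\<^sup>2"

lemma line_kernel_measurable [measurable]: "line_kernel z \<in> borel_measurable borel"
  unfolding line_kernel_def by measurable

lemma line_kernel_pos: "Im z > 0 \<Longrightarrow> line_kernel z x > 0"
proof -
  assume z: "Im z > 0"
  then have "of_real x \<noteq> z" by (metis Im_complex_of_real less_irrefl)
  with z show ?thesis unfolding line_kernel_def by (intro divide_pos_pos) auto
qed

lemma nn_integral_count_int:
  fixes f :: "int \<Rightarrow> ennreal"
  shows "(\<integral>\<^sup>+k. f k \<partial>count_space UNIV) = (\<Sum>n. f (int n)) + (\<Sum>n. f (- 1 - int n))"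
proof -
  have b1: "bij_betw int UNIV {0..}" by (rule bij_betwI[of _ _ _ nat]) auto
  have b2: "bij_betw (\<lambda>n. - 1 - int n) UNIV {..<0}" by (rule bij_betwI[of _ _ _ "\<lambda>k. nat (- 1 - k)"]) auto
  have "(\<integral>\<^sup>+k. f k \<partial>count_space UNIV) = (\<integral>\<^sup>+k. f k * indicator {0..} k + f k * indicator {..<0} k \<partial>count_space UNIV)"
    by (intro nn_integral_cong) (auto simp: indicator_def)
  also have "\<dots> = (\<integral>\<^sup>+k. f k * indicator {0..} k \<partial>count_space UNIV) + (\<integral>\<^sup>+k. f k * indicator {..<0} k \<partial>count_space UNIV)"
    by (rule nn_integral_add) auto
  also have "\<dots> = (\<integral>\<^sup>+k. f k \<partial>count_space {0..}) + (\<integral>\<^sup>+k. f k \<partial>count_space {..<0})"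
    by (simp add: nn_integral_count_space_indicator)
  also have "\<dots> = (\<integral>\<^sup>+n. f (int n) \<partial>count_space UNIV) + (\<integral>\<^sup>+n. f (- 1 - int n) \<partial>count_space UNIV)"
    using nn_integral_bij_count_space[OF b1, of f] nn_integral_bij_count_space[OF b2, of f] by simp
  finally show ?thesis by (simp add: nn_integral_count_space_nat)
qed

text \<open>
  The periodised Poisson kernel of the half-plane is the Poisson kernel of the disc: it is the
  imaginary part of the partial fraction expansion of the cotangent.
\<close>

lemma line_kernel_periodization:
  assumes z: "Im z > 0"
  shows "(\<integral>\<^sup>+k. ennreal (line_kernel z (x + pi * of_int k)) \<partial>count_space UNIV) =
     ennreal (Re (herglotz_kernel (exp (2 * \<i> * z)) x))"
proof -
  define w where "w = (of_real x - z) / of_real pi"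
  have "Im w < 0" using z by (simp add: w_def divide_less_0_iff)
  then have wZ: "w \<notin> \<int>" by (auto elim!: Ints_cases)
  have pw: "of_real pi * w = of_real x - z" by (simp add: w_def)
  have zn: "exp (2 * \<i> * z) \<noteq> circ x"
  proof -
    have "cmod (exp (2 * \<i> * z)) < 1" using z by simp
    then show ?thesis by (metis norm_circ less_irrefl)
  qed
  have trm: "Im (inverse (w + of_int k)) = pi * line_kernel z (x + pi * of_int k)" for k
  proof -
    have e: "w + of_int k = (of_real (x + pi * of_int k) - z) / of_real pi" by (simp add: w_def field_simps)
    have "Im (inverse (w + of_int k)) = - Im (w + of_int k) / (cmod (w + of_int k))\<^sup>2"
      by (simp add: Im_complex_div_eq_0 cmod_power2)
    also have "\<dots> = (Im z / pi) / ((cmod (of_real (x + pi * of_int k) - z))\<^sup>2 / pi\<^sup>2)"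
      by (subst e) (simp add: w_def norm_divide power_divide)
    also have "\<dots> = pi * line_kernel z (x + pi * of_int k)"
      by (simp add: line_kernel_def power2_eq_square)
    finally show ?thesis .
  qed
  have "(\<lambda>n. Im (inverse (w + of_nat n) + inverse (w - 1 - of_nat n))) sums Im (of_real pi * cot (of_real pi * w))"
    by (rule sums_Im[OF cot_partial_fractions[OF wZ]])
  moreover have "Im (inverse (w + of_nat n) + inverse (w - 1 - of_nat n)) =
      pi * (line_kernel z (x + pi * of_int (int n)) + line_kernel z (x + pi * of_int (- 1 - int n)))" for n
    using trm[of "int n"] trm[of "- 1 - int n"] by (simp add: algebra_simps)
  ultimately have "(\<lambda>n. (1/pi) * (pi * (line_kernel z (x + pi * of_int (int n)) + line_kernel z (x + pi * of_int (- 1 - int n))))) sums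
      ((1/pi) * Im (of_real pi * cot (of_real pi * w)))" by (intro sums_mult) simp
  then have s: "(\<lambda>n. line_kernel z (x + pi * of_int (int n)) + line_kernel z (x + pi * of_int (- 1 - int n))) sums
      Im (cot (of_real x - z))" by (simp add: pw del: of_int_of_nat_eq of_int_diff of_int_minus)
  have "cot (of_real x - z) = \<i> * herglotz_kernel (exp (2 * \<i> * z)) x"
  proof -
    let ?u = "of_real x - z"
    have e2: "exp (2 * \<i> * ?u) = circ x / exp (2 * \<i> * z)"
      by (simp add: circ_def cis_conv_exp exp_diff[symmetric] algebra_simps)
    have em: "exp (- (\<i> * ?u)) * exp (\<i> * ?u) = 1" by (simp flip: exp_add)
    have e2': "exp (2 * \<i> * ?u) = exp (\<i> * ?u) * exp (\<i> * ?u)" by (simp flip: exp_add add: algebra_simps)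
    have "cot ?u = ((exp (\<i> * ?u) + exp (- (\<i> * ?u))) / 2) / ((exp (\<i> * ?u) - exp (- (\<i> * ?u))) / (2 * \<i>))"
      unfolding cot_def cos_exp_eq sin_exp_eq by simp
    also have "\<dots> = \<i> * ((exp (\<i> * ?u) + exp (- (\<i> * ?u))) / (exp (\<i> * ?u) - exp (- (\<i> * ?u))))"
    proof -
      have "((a + b) / 2) / ((a - b) / (2 * \<i>)) = \<i> * ((a + b) / (a - b))" for a b :: complex
        by (cases "a = b") (auto simp: divide_simps)
      then show ?thesis .
    qed
    also have "(exp (\<i> * ?u) + exp (- (\<i> * ?u))) / (exp (\<i> * ?u) - exp (- (\<i> * ?u))) =
       (exp (\<i> * ?u) * (exp (\<i> * ?u) + exp (- (\<i> * ?u)))) / (exp (\<i> * ?u) * (exp (\<i> * ?u) - exp (- (\<i> * ?u))))"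
      by (rule mult_divide_mult_cancel_left[symmetric]) simp
    also have "\<dots> = (exp (2 * \<i> * ?u) + 1) / (exp (2 * \<i> * ?u) - 1)"
    proof -
      have "E * (E + F) / (E * (E - F)) = (E * E + 1) / (E * E - 1)" if "F * E = 1" for E F :: complex
      proof -
        have "E * (E + F) = E * E + 1" "E * (E - F) = E * E - 1" using that by (simp_all add: algebra_simps)
        then show ?thesis by (simp only:)
      qed
      from this[OF em] show ?thesis unfolding e2' .
    qed
    also have "\<dots> = herglotz_kernel (exp (2 * \<i> * z)) x"
      unfolding e2 herglotz_kernel_def using zn by (simp add: divide_simps)
    finally show ?thesis .
  qed
  then have Imc: "Im (cot (of_real x - z)) = Re (herglotz_kernel (exp (2 * \<i> * z)) x)" by simp
  have nn: "line_kernel z y \<ge> 0" for y using line_kernel_pos[OF z] by (rule less_imp_le)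
  have "(\<integral>\<^sup>+k. ennreal (line_kernel z (x + pi * of_int k)) \<partial>count_space UNIV) =
      (\<Sum>n. ennreal (line_kernel z (x + pi * of_int (int n)))) + (\<Sum>n. ennreal (line_kernel z (x + pi * of_int (- 1 - int n))))"
    by (rule nn_integral_count_int)
  also have "\<dots> = (\<Sum>n. ennreal (line_kernel z (x + pi * of_int (int n))) + ennreal (line_kernel z (x + pi * of_int (- 1 - int n))))"
    by (rule suminf_add) auto
  also have "\<dots> = (\<Sum>n. ennreal (line_kernel z (x + pi * of_int (int n)) + line_kernel z (x + pi * of_int (- 1 - int n))))"
    by (simp only: ennreal_plus[OF nn nn])
  also have "\<dots> = ennreal (Im (cot (of_real x - z)))"
    using s by (intro suminf_ennreal_eq) (auto intro: add_nonneg_nonneg nn)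
  finally show ?thesis unfolding Imc .
qed

text \<open>
  The sum of the translates of \<open>M\<close> by the integer multiples of \<open>\<pi>\<close>.
\<close>

definition periodize :: "real measure \<Rightarrow> real measure" where
  "periodize M = distr (M \<Otimes>\<^sub>M count_space (UNIV :: int set)) borel (\<lambda>(x, k). x + pi * of_int k)"

lemma sets_periodize [simp, measurable_cong]: "sets (periodize M) = sets borel"
  by (simp add: periodize_def)

lemma nn_integral_periodize:
  assumes [simp, measurable_cong]: "sets M = sets borel"
    and [measurable]: "f \<in> borel_measurable borel"
  shows "(\<integral>\<^sup>+x. f x \<partial>periodize M) = (\<integral>\<^sup>+x. (\<integral>\<^sup>+k. f (x + pi * of_int k) \<partial>count_space UNIV) \<partial>M)"
proof -
  interpret Z: sigma_finite_measure "count_space (UNIV :: int set)" by (rule sigma_finite_measure_count_space)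
  have [measurable]: "(\<lambda>p. fst p + pi * of_int (snd p)) \<in> borel_measurable (M \<Otimes>\<^sub>M count_space (UNIV :: int set))"
    by measurable
  have m: "(\<lambda>(x, k). x + pi * of_int k) \<in> measurable (M \<Otimes>\<^sub>M count_space (UNIV :: int set)) borel"
    unfolding case_prod_beta by measurable
  show ?thesis unfolding periodize_def
    by (subst nn_integral_distr[OF m]) (auto simp: Z.nn_integral_fst[symmetric] case_prod_beta)
qed

lemma period_tiling: "(\<integral>\<^sup>+k. indicator {- pi / 2..<pi / 2} (x + pi * of_int k) \<partial>count_space (UNIV :: int set)) = (1 :: ennreal)"
proof -
  define m where "m = - \<lfloor>(x + pi / 2) / pi\<rfloor>"
  have "(x + pi * of_int k \<in> {- pi / 2..<pi / 2}) \<longleftrightarrow> k = m" for k :: int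
  proof -
    have "x + pi * of_int k \<in> {- pi / 2..<pi / 2} \<longleftrightarrow> of_int (- k) \<le> (x + pi / 2) / pi \<and> (x + pi / 2) / pi < of_int (- k) + 1"
      by (auto simp: field_simps)
    also have "\<dots> \<longleftrightarrow> \<lfloor>(x + pi / 2) / pi\<rfloor> = - k" by (simp only: floor_eq_iff)
    finally show ?thesis by (auto simp: m_def)
  qed
  then have "(\<integral>\<^sup>+k. indicator {- pi / 2..<pi / 2} (x + pi * of_int k) \<partial>count_space UNIV) = (\<integral>\<^sup>+k. indicator {m} k \<partial>count_space UNIV)"
    by (intro nn_integral_cong) (auto simp: indicator_def)
  then show ?thesis by simp
qed

lemma periodic_int:
  assumes "\<And>x. \<phi> (x + pi) = \<phi> (x :: real)"
  shows "\<phi> (x + pi * of_int k) = \<phi> x"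
proof (induction k arbitrary: x rule: int_induct[of _ 0])
  case (step1 i)
  have "\<phi> (x + pi * of_int (i + 1)) = \<phi> ((x + pi * of_int i) + pi)" by (simp add: algebra_simps)
  then show ?case using step1 assms by simp
next
  case (step2 i)
  have "\<phi> (x + pi * of_int (i - 1)) = \<phi> ((x + pi * of_int (i - 1)) + pi)" using assms by simp
  also have "(x + pi * of_int (i - 1)) + pi = x + pi * of_int i" by (simp add: algebra_simps)
  finally show ?case using step2 by simp
qed simp

text \<open>
  Every point has exactly one translate in the half-open period, so the integral of a periodic function
  can be read off from the periodised measure there.
\<close>

lemma nn_integral_periodic:
  assumes M: "sets M = sets borel"
    and [measurable]: "\<phi> \<in> borel_measurable borel" and per: "\<And>x. \<phi> (x + pi) = \<phi> x"
  shows "(\<integral>\<^sup>+x. \<phi> x \<partial>M) = (\<integral>\<^sup>+x. \<phi> x * indicator {- pi / 2..<pi / 2} x \<partial>periodize M)"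
proof -
  have "(\<integral>\<^sup>+k. \<phi> (x + pi * of_int k) * indicator {- pi / 2..<pi / 2} (x + pi * of_int k) \<partial>count_space (UNIV::int set)) = \<phi> x" for x
    unfolding periodic_int[of \<phi>, OF per] by (subst nn_integral_cmult) (simp, unfold period_tiling, simp)
  then show ?thesis by (subst nn_integral_periodize[OF M]) auto
qed

lemma density_periodize:
  assumes [measurable]: "w \<in> borel_measurable borel" and per: "\<And>x. w (x + pi) = w x"
  shows "density lborel w = periodize (density lborel (\<lambda>x. indicator {- pi / 2..<pi / 2} x * w x))"
    (is "_ = periodize ?M")
proof (rule measure_eqI)
  interpret Z: sigma_finite_measure "count_space (UNIV :: int set)" by (rule sigma_finite_measure_count_space)
  interpret P: pair_sigma_finite lborel "count_space (UNIV :: int set)" ..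
  fix A assume "A \<in> sets (density lborel w)"
  then have [measurable]: "A \<in> sets borel" by simp
  have tr: "(\<integral>\<^sup>+x. F (c + x) \<partial>lborel) = (\<integral>\<^sup>+x. F x \<partial>lborel)" if "F \<in> borel_measurable borel" for F :: "real \<Rightarrow> ennreal" and c
    using nn_integral_real_affine[OF that, of 1 c] by simp
  have mneg: "(\<integral>\<^sup>+k. indicator {- pi / 2..<pi / 2} (x - pi * of_int k) \<partial>count_space (UNIV :: int set)) = (1 :: ennreal)" for x
    using nn_integral_bij_count_space[of uminus UNIV UNIV "\<lambda>k. indicator {- pi / 2..<pi / 2} (x + pi * of_int k)"]
    unfolding period_tiling by (simp add: bij_uminus)
  have "emeasure (periodize ?M) A = (\<integral>\<^sup>+x. indicator A x \<partial>periodize ?M)" by simp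
  also have "\<dots> = (\<integral>\<^sup>+x. (\<integral>\<^sup>+k. indicator A (x + pi * of_int k) \<partial>count_space UNIV) \<partial>?M)"
    by (rule nn_integral_periodize) auto
  also have "\<dots> = (\<integral>\<^sup>+x. (indicator {- pi / 2..<pi / 2} x * w x) * (\<integral>\<^sup>+k. indicator A (x + pi * of_int k) \<partial>count_space UNIV) \<partial>lborel)"
    by (subst nn_integral_density) auto
  also have "\<dots> = (\<integral>\<^sup>+x. (\<integral>\<^sup>+k. indicator {- pi / 2..<pi / 2} x * w (x + pi * of_int k) * indicator A (x + pi * of_int k) \<partial>count_space UNIV) \<partial>lborel)"
    unfolding periodic_int[of w, OF per] by (subst nn_integral_cmult) auto
  also have "\<dots> = (\<integral>\<^sup>+k. (\<integral>\<^sup>+x. indicator {- pi / 2..<pi / 2} x * w (x + pi * of_int k) * indicator A (x + pi * of_int k) \<partial>lborel) \<partial>count_space UNIV)"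
    by (rule P.Fubini'[symmetric]) (simp add: case_prod_beta)
  also have "\<dots> = (\<integral>\<^sup>+k. (\<integral>\<^sup>+x. indicator {- pi / 2..<pi / 2} (x - pi * of_int k) * w x * indicator A x \<partial>lborel) \<partial>count_space UNIV)"
  proof (rule nn_integral_cong)
    fix k :: int
    show "(\<integral>\<^sup>+x. indicator {- pi / 2..<pi / 2} x * w (x + pi * of_int k) * indicator A (x + pi * of_int k) \<partial>lborel) =
      (\<integral>\<^sup>+x. indicator {- pi / 2..<pi / 2} (x - pi * of_int k) * w x * indicator A x \<partial>lborel)"
      using tr[of "\<lambda>x. indicator {- pi / 2..<pi / 2} (x - pi * of_int k) * w x * indicator A x" "pi * of_int k"]
      by (simp add: add.commute)
  qed
  also have "\<dots> = (\<integral>\<^sup>+x. (\<integral>\<^sup>+k. indicator {- pi / 2..<pi / 2} (x - pi * of_int k) * w x * indicator A x \<partial>count_space (UNIV::int set)) \<partial>lborel)"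
    by (rule P.Fubini') (simp add: case_prod_beta)
  also have "\<dots> = (\<integral>\<^sup>+x. w x * indicator A x \<partial>lborel)"
    by (intro nn_integral_cong) (simp only: mult.assoc, subst nn_integral_multc, simp, unfold mneg, simp)
  also have "\<dots> = emeasure (density lborel w) A" by (subst emeasure_density) auto
  finally show "emeasure (density lborel w) A = emeasure (periodize ?M) A" by simp
qed simp

lemma periodize_eq_imp_distr_circ_eq:
  assumes M: "sets M1 = sets borel" "sets M2 = sets borel" and eq: "periodize M1 = periodize M2"
  shows "distr M1 borel circ = distr M2 borel circ"
proof (rule measure_eqI)
  fix A assume "A \<in> sets (distr M1 borel circ)"
  then have [measurable]: "A \<in> sets borel" by simp
  have "emeasure (distr M borel circ) A = (\<integral>\<^sup>+x. indicator A (circ x) * indicator {- pi / 2..<pi / 2} x \<partial>periodize M)"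
    if M: "sets M = sets borel" for M
  proof -
    have [measurable_cong]: "sets M = sets borel" by (rule M)
    have "emeasure (distr M borel circ) A = (\<integral>\<^sup>+x. indicator A x \<partial>distr M borel circ)" by simp
    also have "\<dots> = (\<integral>\<^sup>+x. indicator A (circ x) \<partial>M)" by (rule nn_integral_distr) measurable
    also have "\<dots> = (\<integral>\<^sup>+x. indicator A (circ x) * indicator {- pi / 2..<pi / 2} x \<partial>periodize M)"
      by (rule nn_integral_periodic[OF M]) (measurable, simp add: circ_periodic)
    finally show ?thesis .
  qed
  from this[OF M(1)] this[OF M(2)] eq show "emeasure (distr M1 borel circ) A = emeasure (distr M2 borel circ) A" by simp
qed simp

lemma arctan_limit:
  assumes "c \<noteq> 0"
  shows "(\<lambda>n. arctan (c * real (Suc n))) \<longlonglongrightarrow> sgn c * (pi / 2)"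
proof -
  have 1: "(\<lambda>n. arctan (d * real (Suc n))) \<longlonglongrightarrow> pi / 2" if "d > 0" for d
  proof -
    have "filterlim (\<lambda>n. d * real (Suc n)) at_top sequentially"
      using that by (intro filterlim_tendsto_pos_mult_at_top[OF tendsto_const]
         filterlim_compose[OF filterlim_real_sequentially filterlim_Suc]) auto
    from filterlim_compose[OF tendsto_arctan_at_top this] show ?thesis .
  qed
  show ?thesis
  proof (cases "c > 0")
    case True then show ?thesis using 1[of c] by simp
  next
    case False
    then have "- c > 0" using assms by simp
    from tendsto_minus[OF 1[OF this]] have "(\<lambda>n. arctan (c * real (Suc n))) \<longlonglongrightarrow> - (pi / 2)"
      by (simp add: arctan_minus)
    then show ?thesis using False assms by (simp add: sgn_if)
  qed
qed

text \<open>
  The indicator of the interval with the value one half at the end points: what the integrals of the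
  Poisson kernels over the interval tend to.
\<close>

definition averaged_indicator :: "real \<Rightarrow> real \<Rightarrow> real \<Rightarrow> real" where
  "averaged_indicator a b x = (sgn (b - x) - sgn (a - x)) / 2"

text \<open>
  The integral over \<open>t\<close> in \<open>[a, b]\<close> of the Poisson kernel at the point \<open>t + \<i> / (n + 1)\<close>.
\<close>

definition interval_kernel :: "real \<Rightarrow> real \<Rightarrow> nat \<Rightarrow> real \<Rightarrow> real" where
  "interval_kernel a b n x = arctan ((b - x) * real (Suc n)) - arctan ((a - x) * real (Suc n))"

lemma interval_kernel_tendsto:
  "(\<lambda>n. interval_kernel a b n x) \<longlonglongrightarrow> pi * averaged_indicator a b x"
proof -
  have *: "(\<lambda>n. arctan (c * real (Suc n))) \<longlonglongrightarrow> sgn c * (pi / 2)" for c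
    using arctan_limit[of c] by (cases "c = 0") auto
  have "(\<lambda>n. interval_kernel a b n x) \<longlonglongrightarrow> sgn (b - x) * (pi / 2) - sgn (a - x) * (pi / 2)"
    unfolding interval_kernel_def by (intro tendsto_diff *)
  then show ?thesis by (simp add: averaged_indicator_def field_simps)
qed

lemma line_kernel_eq: "line_kernel (of_real t + \<i> * of_real y) x = y / ((x - t)\<^sup>2 + y\<^sup>2)"
  by (simp add: line_kernel_def cmod_power2)

lemma interval_kernel_has_integral:
  assumes "a \<le> b"
  shows "(\<integral>\<^sup>+t. ennreal (line_kernel (of_real t + \<i> * of_real (1 / real (Suc n))) x) * indicator {a..b} t \<partial>lborel) =
     ennreal (interval_kernel a b n x)"
proof -
  define N where "N = real (Suc n)"
  have N: "N > 0" by (simp add: N_def)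
  have eq: "line_kernel (of_real t + \<i> * of_real (1 / N)) x = N / (1 + ((t - x) * N)\<^sup>2)" for t
  proof -
    have "(1 / N) / ((x - t)\<^sup>2 + (1 / N)\<^sup>2) = N / (N\<^sup>2 * ((x - t)\<^sup>2 + (1 / N)\<^sup>2))"
      using N by (simp add: power2_eq_square)
    also have "N\<^sup>2 * ((x - t)\<^sup>2 + (1 / N)\<^sup>2) = 1 + ((t - x) * N)\<^sup>2"
      using N by (simp add: power_mult_distrib power_divide distrib_left power2_commute[of x t])
    finally show ?thesis by (simp only: line_kernel_eq)
  qed
  have "(\<integral>\<^sup>+t. ennreal (N / (1 + ((t - x) * N)\<^sup>2)) * indicator {a..b} t \<partial>lborel) =
     arctan ((b - x) * N) - arctan ((a - x) * N)"
  proof (rule nn_integral_FTC_Icc)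
    fix t
    show "DERIV (\<lambda>t. arctan ((t - x) * N)) t :> N / (1 + ((t - x) * N)\<^sup>2)"
      by (auto intro!: derivative_eq_intros simp: divide_inverse mult.commute)
    show "0 \<le> N / (1 + ((t - x) * N)\<^sup>2)" using N by (intro divide_nonneg_pos) (auto intro: add_pos_nonneg)
  qed (use assms in auto)
  then show ?thesis unfolding interval_kernel_def N_def[symmetric] eq .
qed

lemma interval_kernel_nonneg: "a \<le> b \<Longrightarrow> 0 \<le> interval_kernel a b n x"
  unfolding interval_kernel_def by (simp add: arctan_le_iff mult_right_mono)

text \<open>
  An integrable majorant that is uniform in \<open>n\<close>: near the interval the difference of arctangents is at most
  \<open>\<pi>\<close>, and far away the mean value theorem gives the decay of the kernel at \<open>\<i>\<close>.
\<close>

lemma interval_kernel_bound: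
  assumes "a \<le> b"
  obtains K where "K \<ge> 0" "\<And>n x. interval_kernel a b n x \<le> K * line_kernel \<i> x"
proof -
  define L where "L = 2 * (\<bar>a\<bar> + \<bar>b\<bar> + 1)"
  have L: "L \<ge> 2" by (simp add: L_def)
  define K where "K = pi * (1 + L\<^sup>2) + 8 * (b - a)"
  have k: "line_kernel \<i> x = 1 / (1 + x\<^sup>2)" for x
    by (simp add: line_kernel_def cmod_power2 add.commute)
  have "interval_kernel a b n x \<le> K * line_kernel \<i> x" for n x
  proof (cases "\<bar>x\<bar> \<le> L")
    case True
    have "interval_kernel a b n x \<le> pi"
      unfolding interval_kernel_def using arctan_ubound[of "(b - x) * real (Suc n)"] arctan_lbound[of "(a - x) * real (Suc n)"] by linarith
    also have "pi \<le> pi * (1 + L\<^sup>2) / (1 + x\<^sup>2)"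
      using True power_mono[of "\<bar>x\<bar>" L 2] by (simp add: pos_le_divide_eq add_pos_nonneg)
    also have "\<dots> \<le> K / (1 + x\<^sup>2)" by (rule divide_right_mono) (use assms in \<open>auto simp: K_def\<close>)
    finally show ?thesis by (simp add: k)
  next
    case False
    show ?thesis
    proof (cases "a = b")
      case True then show ?thesis using assms by (simp add: interval_kernel_def k K_def)
    next
      case False': False
      define N where "N = real (Suc n)"
      have N: "N \<ge> 1" by (simp add: N_def)
      have "\<exists>t>a. t < b \<and> arctan ((b - x) * N) - arctan ((a - x) * N) = (b - a) * (N / (1 + ((t - x) * N)\<^sup>2))"
        by (rule MVT2) (use False' assms in \<open>auto intro!: derivative_eq_intros simp: divide_inverse mult.commute\<close>)
      then obtain t where t: "a < t" "t < b" and
        e: "arctan ((b - x) * N) - arctan ((a - x) * N) = (b - a) * (N / (1 + ((t - x) * N)\<^sup>2))" by blast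
      have tx: "\<bar>t - x\<bar> \<ge> \<bar>x\<bar> / 2"
      proof -
        have "\<bar>t\<bar> \<le> \<bar>a\<bar> + \<bar>b\<bar>" using t by linarith
        moreover have "\<bar>x\<bar> - \<bar>t\<bar> \<le> \<bar>t - x\<bar>" by linarith
        moreover have "\<bar>x\<bar> > 2 * (\<bar>a\<bar> + \<bar>b\<bar> + 1)" using False by (simp add: L_def)
        ultimately show ?thesis by argo
      qed
      have x1: "\<bar>x\<bar> \<ge> 1" using False L by linarith
      have "N * (1 + x\<^sup>2) \<le> 8 * (1 + ((t - x) * N)\<^sup>2)"
      proof -
        have x2: "1 \<le> x\<^sup>2" using x1 by (simp add: one_le_power abs_le_square_iff[of 1 x, simplified])
        have "(\<bar>x\<bar> / 2)\<^sup>2 \<le> \<bar>t - x\<bar>\<^sup>2" using tx by (intro power_mono) auto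
        then have q: "x\<^sup>2 \<le> 4 * (t - x)\<^sup>2" by (simp add: power_divide)
        have "N * (1 + x\<^sup>2) \<le> N * (2 * x\<^sup>2)" using x2 N by (intro mult_left_mono) auto
        also have "\<dots> \<le> (N * N) * (2 * x\<^sup>2)" using N by (intro mult_right_mono) auto
        also have "\<dots> \<le> (N * N) * (2 * (4 * (t - x)\<^sup>2))" using q by (intro mult_left_mono) auto
        also have "\<dots> = 8 * ((t - x) * N)\<^sup>2" by (simp add: power2_eq_square)
        finally show ?thesis by simp
      qed
      then have "N / (1 + ((t - x) * N)\<^sup>2) \<le> 8 / (1 + x\<^sup>2)"
        by (simp add: divide_simps add_pos_nonneg mult.commute)
      then have "(b - a) * (N / (1 + ((t - x) * N)\<^sup>2)) \<le> (b - a) * (8 / (1 + x\<^sup>2))"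
        using assms by (intro mult_left_mono) auto
      also have "\<dots> = (8 * (b - a)) / (1 + x\<^sup>2)" by simp
      also have "\<dots> \<le> K / (1 + x\<^sup>2)" by (rule divide_right_mono) (auto simp: K_def add_nonneg_nonneg)
      finally show ?thesis unfolding interval_kernel_def N_def[symmetric] e k by simp
    qed
  qed
  moreover have "K \<ge> 0" using assms by (simp add: K_def add_nonneg_nonneg)
  ultimately show ?thesis using that by blast
qed

definition poisson_finite :: "real measure \<Rightarrow> bool" where
  "poisson_finite \<mu> \<longleftrightarrow> sets \<mu> = sets borel \<and> (\<forall>z. Im z > 0 \<longrightarrow> integrable \<mu> (line_kernel z))"

lemma poisson_finite_emeasure:
  assumes "poisson_finite \<mu>"
  shows "emeasure \<mu> {a..b} < \<infinity>"
proof -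
  have [measurable_cong]: "sets \<mu> = sets borel" and int: "integrable \<mu> (line_kernel \<i>)"
    using assms by (auto simp: poisson_finite_def)
  define L where "L = 1 + (max \<bar>a\<bar> \<bar>b\<bar>)\<^sup>2"
  have k: "line_kernel \<i> x = 1 / (1 + x\<^sup>2)" for x
    by (simp add: line_kernel_def cmod_power2 add.commute)
  have L: "L > 0" by (simp add: L_def add_pos_nonneg)
  have le: "indicator {a..b} x \<le> L * line_kernel \<i> x" for x
  proof (cases "x \<in> {a..b}")
    case True
    then have "\<bar>x\<bar> \<le> max \<bar>a\<bar> \<bar>b\<bar>" by auto
    then have "\<bar>x\<bar>\<^sup>2 \<le> (max \<bar>a\<bar> \<bar>b\<bar>)\<^sup>2" by (intro power_mono) auto
    then show ?thesis using True by (simp add: k L_def pos_le_divide_eq add_pos_nonneg)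
  qed (use L in \<open>simp add: k\<close>)
  have "emeasure \<mu> {a..b} = (\<integral>\<^sup>+x. indicator {a..b} x \<partial>\<mu>)" by simp
  also have "\<dots> \<le> (\<integral>\<^sup>+x. ennreal (L * line_kernel \<i> x) \<partial>\<mu>)"
  proof (rule nn_integral_mono)
    fix x show "indicator {a..b} x \<le> ennreal (L * line_kernel \<i> x)"
      using ennreal_leI[OF le[of x]] by (simp add: ennreal_indicator)
  qed
  also have "\<dots> = ennreal (LINT x|\<mu>. L * line_kernel \<i> x)"
    by (rule nn_integral_eq_integral[OF integrable_mult_right[OF int]]) (use L in \<open>simp add: k\<close>)
  also have "\<dots> < \<infinity>" by simp
  finally show ?thesis .
qed

lemma poisson_finite_sigma_finite:
  assumes "poisson_finite \<mu>"
  shows "sigma_finite_measure \<mu>"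
proof
  have s: "sets \<mu> = sets borel" using assms by (simp add: poisson_finite_def)
  have "\<Union> (range (\<lambda>n. {- real n..real n})) = UNIV"
  proof (intro set_eqI iffI UNIV_I)
    fix x :: real
    obtain n :: nat where "\<bar>x\<bar> \<le> real n" using real_arch_simple by blast
    then have "x \<in> {- real n..real n}" by auto
    then show "x \<in> \<Union> (range (\<lambda>n. {- real n..real n}))" by blast
  qed
  then show "\<exists>A. countable A \<and> A \<subseteq> sets \<mu> \<and> \<Union> A = space \<mu> \<and> (\<forall>a\<in>A. emeasure \<mu> a \<noteq> \<infinity>)"
    using poisson_finite_emeasure[OF assms] sets_eq_imp_space_eq[OF s]
    by (intro exI[of _ "range (\<lambda>n. {- real n..real n})"]) (auto simp: s less_top[symmetric])
qed

lemma poisson_averaged_indicator: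
  assumes \<mu>: "poisson_finite \<mu>" and ab: "a \<le> b"
  shows "(\<lambda>n. \<integral>\<^sup>+t. (\<integral>\<^sup>+x. ennreal (line_kernel (of_real t + \<i> * of_real (1 / real (Suc n))) x) \<partial>\<mu>) * indicator {a..b} t \<partial>lborel)
      \<longlonglongrightarrow> ennreal (LINT x|\<mu>. pi * averaged_indicator a b x)"
    and "integrable \<mu> (\<lambda>x. pi * averaged_indicator a b x)"
proof -
  have [measurable_cong]: "sets \<mu> = sets borel" and int: "integrable \<mu> (line_kernel \<i>)"
    using \<mu> by (auto simp: poisson_finite_def)
  interpret \<mu>: sigma_finite_measure \<mu> by (rule poisson_finite_sigma_finite[OF \<mu>])
  interpret P: pair_sigma_finite \<mu> lborel ..
  have mk [measurable]: "(\<lambda>p. line_kernel (of_real (snd p) + \<i> * of_real c) (fst p)) \<in> borel_measurable (borel \<Otimes>\<^sub>M borel)" for c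
    unfolding line_kernel_eq by measurable
  obtain K where K: "K \<ge> 0" "\<And>n x. interval_kernel a b n x \<le> K * line_kernel \<i> x"
    using interval_kernel_bound[OF ab] by blast
  have Km: "integrable \<mu> (\<lambda>x. K * line_kernel \<i> x)" using int by simp
  have wm [measurable]: "(\<lambda>x. pi * averaged_indicator a b x) \<in> borel_measurable \<mu>"
    unfolding averaged_indicator_def by measurable
  have im [measurable]: "interval_kernel a b n \<in> borel_measurable \<mu>" for n
    unfolding interval_kernel_def by measurable
  have dom: "AE x in \<mu>. norm (interval_kernel a b n x) \<le> K * line_kernel \<i> x" for n
    using K(2) interval_kernel_nonneg[OF ab] by (intro AE_I2) simp
  have lim: "AE x in \<mu>. (\<lambda>n. interval_kernel a b n x) \<longlonglongrightarrow> pi * averaged_indicator a b x"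
    by (intro AE_I2 interval_kernel_tendsto)
  show "integrable \<mu> (\<lambda>x. pi * averaged_indicator a b x)"
    using integrable_dominated_convergence[OF wm im Km lim dom] .
  have "(\<integral>\<^sup>+t. (\<integral>\<^sup>+x. ennreal (line_kernel (of_real t + \<i> * of_real (1 / real (Suc n))) x) \<partial>\<mu>) * indicator {a..b} t \<partial>lborel)
     = ennreal (LINT x|\<mu>. interval_kernel a b n x)" for n
  proof -
    let ?k = "\<lambda>t x. line_kernel (of_real t + \<i> * of_real (1 / real (Suc n))) x"
    have "(\<integral>\<^sup>+t. (\<integral>\<^sup>+x. ennreal (?k t x) \<partial>\<mu>) * indicator {a..b} t \<partial>lborel)
       = (\<integral>\<^sup>+t. (\<integral>\<^sup>+x. ennreal (?k t x) * indicator {a..b} t \<partial>\<mu>) \<partial>lborel)"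
      by (intro nn_integral_cong nn_integral_multc[symmetric]) measurable
    also have "\<dots> = (\<integral>\<^sup>+x. (\<integral>\<^sup>+t. ennreal (?k t x) * indicator {a..b} t \<partial>lborel) \<partial>\<mu>)"
      by (rule P.Fubini') (unfold case_prod_beta line_kernel_eq, measurable)
    also have "\<dots> = (\<integral>\<^sup>+x. ennreal (interval_kernel a b n x) \<partial>\<mu>)"
      by (simp only: interval_kernel_has_integral[OF ab])
    also have "\<dots> = ennreal (LINT x|\<mu>. interval_kernel a b n x)"
      by (intro nn_integral_eq_integral integrable_dominated_convergence2[OF wm im Km lim dom])
         (use interval_kernel_nonneg[OF ab] in auto)
    finally show ?thesis .
  qed
  then show "(\<lambda>n. \<integral>\<^sup>+t. (\<integral>\<^sup>+x. ennreal (line_kernel (of_real t + \<i> * of_real (1 / real (Suc n))) x) \<partial>\<mu>) * indicator {a..b} t \<partial>lborel)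
      \<longlonglongrightarrow> ennreal (LINT x|\<mu>. pi * averaged_indicator a b x)"
    using integral_dominated_convergence[OF wm im Km lim dom] by simp
qed

text \<open>
  Moving both end points to the right turns the averaged indicator into the one of a half-open interval.
\<close>

lemma averaged_indicator_tendsto_Ioc:
  assumes \<mu>: "poisson_finite \<mu>" and ab: "a \<le> b"
  shows "(\<lambda>n. LINT x|\<mu>. pi * averaged_indicator (a + 1 / real (Suc n)) (b + 1 / real (Suc n)) x) \<longlonglongrightarrow> pi * measure \<mu> {a<..b}"
proof -
  have [measurable_cong]: "sets \<mu> = sets borel" using \<mu> by (auto simp: poisson_finite_def)
  have "emeasure \<mu> {a<..b} \<le> emeasure \<mu> {a..b}" by (rule emeasure_mono) auto
  then have fin: "emeasure \<mu> {a<..b} < \<infinity>" using poisson_finite_emeasure[OF \<mu>, of a b] by (rule le_less_trans)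
  have "(\<lambda>n. LINT x|\<mu>. pi * averaged_indicator (a + 1 / real (Suc n)) (b + 1 / real (Suc n)) x) \<longlonglongrightarrow>
     (LINT x|\<mu>. pi * indicator {a<..b} x)"
  proof (rule integral_dominated_convergence)
    show "integrable \<mu> (\<lambda>x. pi * indicator {a..b + 1} x)"
      using poisson_finite_emeasure[OF \<mu>, of a "b + 1"] by (intro integrable_mult_right) auto
    show "(\<lambda>x. pi * averaged_indicator (a + 1 / real (Suc n)) (b + 1 / real (Suc n)) x) \<in> borel_measurable \<mu>" for n
      unfolding averaged_indicator_def by measurable
    have sgn_right: "(\<lambda>n. sgn (c + 1 / real (Suc n) - x)) \<longlonglongrightarrow> (if x \<le> c then 1 else - 1)" for c x :: real
    proof (rule tendsto_eventually)
      show "\<forall>\<^sub>F n in sequentially. sgn (c + 1 / real (Suc n) - x) = (if x \<le> c then 1 else - 1)"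
      proof (cases "x \<le> c")
        case True
        have "c + 1 / real (Suc n) - x > 0" for n
        proof -
          have "1 / real (Suc n) > 0" by simp
          with True show ?thesis by linarith
        qed
        then show ?thesis using True by simp
      next
        case False
        then have "\<forall>\<^sub>F n in sequentially. inverse (real (Suc n)) < x - c"
          using order_tendstoD(2)[OF LIMSEQ_inverse_real_of_nat, of "x - c"] by simp
        then show ?thesis by (rule eventually_mono) (use False in \<open>simp add: inverse_eq_divide sgn_if\<close>)
      qed
    qed
    show "AE x in \<mu>. (\<lambda>n. pi * averaged_indicator (a + 1 / real (Suc n)) (b + 1 / real (Suc n)) x) \<longlonglongrightarrow> pi * indicator {a<..b} x"
    proof (intro AE_I2)
      fix x
      have "(\<lambda>n. pi * averaged_indicator (a + 1 / real (Suc n)) (b + 1 / real (Suc n)) x) \<longlonglongrightarrow>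
         pi * (((if x \<le> b then 1 else - 1) - (if x \<le> a then 1 else - 1)) / 2)"
        unfolding averaged_indicator_def by (intro tendsto_intros sgn_right) simp
      also have "pi * (((if x \<le> b then 1 else - 1) - (if x \<le> a then 1 else - 1)) / 2) = pi * indicator {a<..b} x"
        using ab by (auto simp: indicator_def)
      finally show "(\<lambda>n. pi * averaged_indicator (a + 1 / real (Suc n)) (b + 1 / real (Suc n)) x) \<longlonglongrightarrow> pi * indicator {a<..b} x" .
    qed
    show "AE x in \<mu>. norm (pi * averaged_indicator (a + 1 / real (Suc n)) (b + 1 / real (Suc n)) x) \<le> pi * indicator {a..b + 1} x" for n
    proof (intro AE_I2)
      fix x
      have s: "1 / real (Suc n) \<le> 1" "1 / real (Suc n) > 0" by auto
      have "\<bar>averaged_indicator (a + h) (b + h) x\<bar> \<le> indicator {a..b + 1} x" if "0 < h" "h \<le> 1" for h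
        unfolding averaged_indicator_def indicator_def using ab that by (auto simp: sgn_if)
      from this[OF s(2,1)]
      have "\<bar>averaged_indicator (a + 1 / real (Suc n)) (b + 1 / real (Suc n)) x\<bar> \<le> indicator {a..b + 1} x" .
      then show "norm (pi * averaged_indicator (a + 1 / real (Suc n)) (b + 1 / real (Suc n)) x) \<le> pi * indicator {a..b + 1} x"
        by (simp add: abs_mult)
    qed
  qed measurable
  then show ?thesis using fin by simp
qed

text \<open>
  Integrating the Poisson integrals over an interval at decreasing heights determines the integrals of the
  averaged indicators, hence the measure of all half-open intervals.
\<close>

lemma poisson_measure_unique:
  assumes \<mu>: "poisson_finite \<mu>" and \<nu>: "poisson_finite \<nu>"
    and eq: "\<And>z. Im z > 0 \<Longrightarrow> (LINT x|\<mu>. line_kernel z x) = (LINT x|\<nu>. line_kernel z x)"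
  shows "\<mu> = \<nu>"
proof -
  have s: "sets \<mu> = sets borel" "sets \<nu> = sets borel" using \<mu> \<nu> by (auto simp: poisson_finite_def)
  have nn: "(\<integral>\<^sup>+x. ennreal (line_kernel z x) \<partial>\<mu>) = (\<integral>\<^sup>+x. ennreal (line_kernel z x) \<partial>\<nu>)" if z: "Im z > 0" for z
    using \<mu> \<nu> z eq[OF z] less_imp_le[OF line_kernel_pos[OF z]] by (subst (1 2) nn_integral_eq_integral) (auto simp: poisson_finite_def)
  have w: "(LINT x|\<mu>. pi * averaged_indicator a b x) = (LINT x|\<nu>. pi * averaged_indicator a b x)" if ab: "a \<le> b" for a b
  proof -
    have same: "(\<lambda>n. \<integral>\<^sup>+t. (\<integral>\<^sup>+x. ennreal (line_kernel (of_real t + \<i> * of_real (1 / real (Suc n))) x) \<partial>\<mu>) * indicator {a..b} t \<partial>lborel) =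
       (\<lambda>n. \<integral>\<^sup>+t. (\<integral>\<^sup>+x. ennreal (line_kernel (of_real t + \<i> * of_real (1 / real (Suc n))) x) \<partial>\<nu>) * indicator {a..b} t \<partial>lborel)"
      by (intro ext nn_integral_cong arg_cong2[of _ _ _ _ "(*)"] nn refl) simp
    have "ennreal (LINT x|\<mu>. pi * averaged_indicator a b x) = ennreal (LINT x|\<nu>. pi * averaged_indicator a b x)"
      by (rule LIMSEQ_unique[OF poisson_averaged_indicator(1)[OF \<mu> ab, unfolded same] poisson_averaged_indicator(1)[OF \<nu> ab]])
    moreover have "(LINT x|\<rho>. pi * averaged_indicator a b x) \<ge> 0" for \<rho>
      by (rule integral_nonneg_AE) (use ab in \<open>auto simp: averaged_indicator_def sgn_if\<close>)
    ultimately show ?thesis by simp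
  qed
  have m: "measure \<mu> {a<..b} = measure \<nu> {a<..b}" if ab: "a \<le> b" for a b
  proof -
    have "(LINT x|\<mu>. pi * averaged_indicator (a + 1 / real (Suc n)) (b + 1 / real (Suc n)) x) =
       (LINT x|\<nu>. pi * averaged_indicator (a + 1 / real (Suc n)) (b + 1 / real (Suc n)) x)" for n
      by (rule w) (use ab in simp)
    then have "pi * measure \<mu> {a<..b} = pi * measure \<nu> {a<..b}"
      using averaged_indicator_tendsto_Ioc[OF \<mu> ab] averaged_indicator_tendsto_Ioc[OF \<nu> ab]
      by (simp only: LIMSEQ_unique)
    then show ?thesis by simp
  qed
  have fin: "emeasure \<rho> {a<..b} < \<infinity>" if \<rho>: "poisson_finite \<rho>" for \<rho> a b
  proof -
    have "sets \<rho> = sets borel" using \<rho> by (simp add: poisson_finite_def)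
    then have "emeasure \<rho> {a<..b} \<le> emeasure \<rho> {a..b}" by (intro emeasure_mono) auto
    then show ?thesis using poisson_finite_emeasure[OF \<rho>, of a b] by (rule le_less_trans)
  qed
  have em: "emeasure \<mu> {a<..b} = emeasure \<nu> {a<..b}" for a b
  proof (cases "a \<le> b")
    case True
    then show ?thesis using m[OF True] fin[OF \<mu>, of a b] fin[OF \<nu>, of a b]
      by (simp add: emeasure_eq_ennreal_measure less_top[symmetric])
  next
    case False
    then have "{a<..b} = {}" by simp
    then show ?thesis by simp
  qed
  show ?thesis
  proof (rule measure_eqI_generator_eq[where E = "range (\<lambda>(a, b). {a<..b::real})" and \<Omega> = UNIV and A = "\<lambda>n. {- real n<..real n}"])
    show "Int_stable (range (\<lambda>(a, b). {a<..b::real}))"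
      by (auto simp: Int_stable_def)
    show "sets \<mu> = sigma_sets UNIV (range (\<lambda>(a, b). {a<..b}))" "sets \<nu> = sigma_sets UNIV (range (\<lambda>(a, b). {a<..b}))"
      unfolding s borel_sigma_sets_Ioc by auto
    show "\<And>X. X \<in> range (\<lambda>(a, b). {a<..b}) \<Longrightarrow> emeasure \<mu> X = emeasure \<nu> X" using em by auto
    show "(\<Union>n. {- real n<..real n}) = UNIV"
    proof (intro set_eqI iffI UNIV_I)
      fix x :: real
      obtain n :: nat where "\<bar>x\<bar> < real n" using reals_Archimedean2 by blast
      then have "x \<in> {- real n<..real n}" by auto
      then show "x \<in> (\<Union>n. {- real n<..real n})" by blast
    qed
    show "emeasure \<mu> {- real n<..real n} \<noteq> \<infinity>" for n using fin[OF \<mu>] by (simp add: less_top[symmetric])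
  qed auto
qed

section \<open>The fundamental solution of the Persson equation\<close>

lemmas matrix2_simps = vec_eq_iff forall_2 sum_2 matrix_matrix_mult_def vector_2 mat_def transpose_def

lemmas scaleR_complex = scaleR_conv_of_real[where 'a = complex]

text \<open>
  This is \<open>Q({k}) J\<^sup>*\<close> for the mass \<open>c\<close>; its square is \<open>\<bar>c\<bar>\<^sup>2\<close> times the identity.
\<close>

definition sym_matrix :: "complex \<Rightarrow> complex^2^2" where
  "sym_matrix c = vector [vector [- of_real (Re c), of_real (Im c)], vector [of_real (Im c), of_real (Re c)]]"

text \<open>
  The exponential of \<open>sym_matrix c\<close>, by which a solution is multiplied at the atom. For \<open>c = 0\<close> the second
  term vanishes together with \<open>sym_matrix c\<close>.
\<close>

definition jump :: "complex \<Rightarrow> complex^2^2" where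
  "jump c = cosh (cmod c) *\<^sub>R mat 1 + (sinh (cmod c) / cmod c) *\<^sub>R sym_matrix c"

text \<open>
  With \<open>w = z x\<close> this is the fundamental matrix of \<open>J N' = z N\<close>.
\<close>

definition rotation :: "complex \<Rightarrow> complex^2^2" where
  "rotation w = vector [vector [cos w, sin w], vector [- sin w, cos w]]"

lemma Qmat_J: "Qmat c ** transpose J = sym_matrix c" "sym_matrix c ** J = Qmat c"
  by (simp_all add: matrix2_simps Qmat_def J_def sym_matrix_def)

lemma J_square: "J ** (J ** A) = - A"
  by (simp add: matrix2_simps J_def)

lemma exp_tail: "(\<lambda>n. x ^ (n + 2) / fact (n + 2)) sums (exp x - 1 - x)" for x :: real
proof -
  have "(\<lambda>n. x ^ n / fact n) sums exp x" using exp_converges[of x] by (simp add: field_simps)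
  from sums_split_initial_segment[OF this, of 2] show ?thesis by (simp add: numeral_2_eq_2 diff_diff_eq)
qed

text \<open>
  The powers of the matrix alternate between multiples of the identity and of the matrix, so the series
  splits into two hyperbolic ones; \<open>a\<close> and \<open>b\<close> below are the coefficients of its powers.
\<close>

lemma gfun_sym_matrix:
  assumes c: "c \<noteq> 0"
  shows "gfun (sym_matrix c) = (sinh (cmod c) / cmod c) *\<^sub>R mat 1 + ((cosh (cmod c) - 1) / (cmod c)\<^sup>2) *\<^sub>R sym_matrix c"
proof -
  define \<rho> where "\<rho> = cmod c"
  have \<rho>: "\<rho> \<noteq> 0" using c by (simp add: \<rho>_def)
  have \<rho>2: "\<rho>\<^sup>2 = (Re c)\<^sup>2 + (Im c)\<^sup>2" by (simp add: \<rho>_def cmod_power2)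
  define a where "a n = (\<rho> ^ n + (- \<rho>) ^ n) / 2" for n
  define b where "b n = (\<rho> ^ n - (- \<rho>) ^ n) / (2 * \<rho>)" for n
  have a_Suc: "a (Suc n) = \<rho>\<^sup>2 * b n" and b_Suc: "b (Suc n) = a n" for n
    using \<rho> by (simp_all add: a_def b_def field_simps power2_eq_square)
  have pow: "mat_pow (sym_matrix c) n = a n *\<^sub>R mat 1 + b n *\<^sub>R sym_matrix c" for n
  proof (induction n)
    case 0 show ?case by (simp add: a_def b_def)
  next
    case (Suc n)
    have "sym_matrix c ** (x *\<^sub>R mat 1 + y *\<^sub>R sym_matrix c) = (\<rho>\<^sup>2 * y) *\<^sub>R mat 1 + x *\<^sub>R sym_matrix c" for x y
      unfolding \<rho>2 by (simp add: matrix2_simps sym_matrix_def scaleR_complex power2_eq_square algebra_simps)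
    then show ?case by (simp add: Suc a_Suc b_Suc)
  qed
  have A: "(\<lambda>n. a (n + 1) / fact (n + 2)) sums (sinh \<rho> / \<rho> - 1)"
  proof -
    have "(\<lambda>n. (1 / (2 * \<rho>)) * (\<rho> ^ (n + 2) / fact (n + 2) - (- \<rho>) ^ (n + 2) / fact (n + 2))) sums
       ((1 / (2 * \<rho>)) * ((exp \<rho> - 1 - \<rho>) - (exp (- \<rho>) - 1 - (- \<rho>))))"
      by (intro sums_mult sums_diff exp_tail)
    moreover have "(1 / (2 * \<rho>)) * (\<rho> ^ (n + 2) / fact (n + 2) - (- \<rho>) ^ (n + 2) / fact (n + 2)) = a (n + 1) / fact (n + 2)" for n
    proof -
      have "(1 / (2 * \<rho>)) * (\<rho> ^ (n + 2) - (- \<rho>) ^ (n + 2)) = a (n + 1)" using \<rho> by (simp add: a_def field_simps power2_eq_square)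
      then show ?thesis by (simp add: diff_divide_distrib[symmetric])
    qed
    moreover have "(1 / (2 * \<rho>)) * ((exp \<rho> - 1 - \<rho>) - (exp (- \<rho>) - 1 - (- \<rho>))) = sinh \<rho> / \<rho> - 1"
      using \<rho> by (simp add: sinh_field_def field_simps)
    ultimately show ?thesis by (simp only:)
  qed
  have B: "(\<lambda>n. b (n + 1) / fact (n + 2)) sums ((cosh \<rho> - 1) / \<rho>\<^sup>2)"
  proof -
    have "(\<lambda>n. (1 / (2 * \<rho>\<^sup>2)) * (\<rho> ^ (n + 2) / fact (n + 2) + (- \<rho>) ^ (n + 2) / fact (n + 2))) sums
       ((1 / (2 * \<rho>\<^sup>2)) * ((exp \<rho> - 1 - \<rho>) + (exp (- \<rho>) - 1 - (- \<rho>))))"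
      by (intro sums_mult sums_add exp_tail)
    moreover have "(1 / (2 * \<rho>\<^sup>2)) * (\<rho> ^ (n + 2) / fact (n + 2) + (- \<rho>) ^ (n + 2) / fact (n + 2)) = b (n + 1) / fact (n + 2)" for n
    proof -
      have "(1 / (2 * \<rho>\<^sup>2)) * (\<rho> ^ (n + 2) + (- \<rho>) ^ (n + 2)) = b (n + 1)" using \<rho> by (simp add: b_def field_simps power2_eq_square)
      then show ?thesis by (simp add: add_divide_distrib[symmetric])
    qed
    moreover have "(1 / (2 * \<rho>\<^sup>2)) * ((exp \<rho> - 1 - \<rho>) + (exp (- \<rho>) - 1 - (- \<rho>))) = (cosh \<rho> - 1) / \<rho>\<^sup>2"
      using \<rho> by (simp add: cosh_field_def field_simps)
    ultimately show ?thesis by (simp only:)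
  qed
  have "(\<lambda>n. (a (n + 1) / fact (n + 2)) *\<^sub>R mat 1 + (b (n + 1) / fact (n + 2)) *\<^sub>R sym_matrix c) sums
     ((sinh \<rho> / \<rho> - 1) *\<^sub>R mat 1 + ((cosh \<rho> - 1) / \<rho>\<^sup>2) *\<^sub>R sym_matrix c)"
    by (intro sums_add sums_scaleR_left A B)
  then have "(\<lambda>n. (1 / fact (n + 2)) *\<^sub>R mat_pow (sym_matrix c) (n + 1)) sums
     ((sinh \<rho> / \<rho> - 1) *\<^sub>R mat 1 + ((cosh \<rho> - 1) / \<rho>\<^sup>2) *\<^sub>R sym_matrix c)"
    unfolding pow by (simp add: scaleR_add_right)
  then show ?thesis unfolding gfun_def by (simp add: sums_iff \<rho>_def[symmetric] scaleR_diff_left)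
qed

lemma sym_matrix_0: "sym_matrix 0 = 0"
  by (simp add: matrix2_simps sym_matrix_def)

lemma gfun_0: "gfun 0 = mat 1"
proof -
  have "mat_pow 0 (Suc n) = 0" for n by (simp add: matrix2_simps)
  then show ?thesis by (simp add: gfun_def)
qed

text \<open>
  The function \<open>g\<close> is \<open>(e\<^sup>T - 1) / T\<close>, so that \<open>g(T) T\<close> is the exponential minus the identity; this is why
  the Persson equation has multiplicative jumps.
\<close>

lemma gfun_Qmat: "gfun (sym_matrix c) ** Qmat c = (jump c - mat 1) ** J"
proof (cases "c = 0")
  case True
  then show ?thesis by (simp add: jump_def Qmat_def sym_matrix_0 matrix2_simps)
next
  case False
  have *: "(x *\<^sub>R mat 1 + y *\<^sub>R sym_matrix c) ** Qmat c = (x *\<^sub>R sym_matrix c + (y * (cmod c)\<^sup>2) *\<^sub>R mat 1) ** J" for x y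
    unfolding cmod_power2 by (simp add: matrix2_simps sym_matrix_def Qmat_def J_def scaleR_complex power2_eq_square algebra_simps)
  show ?thesis unfolding gfun_sym_matrix[OF False] * using False
    by (intro arg_cong2[of _ _ _ _ "(**)"] refl) (simp add: jump_def scaleR_diff_left)
qed

text \<open>
  The jump is symmetric of determinant one, hence symplectic.
\<close>

lemma jump_J_jump: "jump c ** (J ** (jump c ** A)) = J ** A"
proof -
  have "(sinh (cmod c) / cmod c)\<^sup>2 * ((Re c)\<^sup>2 + (Im c)\<^sup>2) = (sinh (cmod c))\<^sup>2"
    by (cases "c = 0") (simp_all add: power_divide flip: cmod_power2)
  then have "(cosh (cmod c))\<^sup>2 - (sinh (cmod c) / cmod c)\<^sup>2 * ((Re c)\<^sup>2 + (Im c)\<^sup>2) = 1"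
    using hyperbolic_pythagoras[of "cmod c"] by simp
  moreover have "(x *\<^sub>R mat 1 + y *\<^sub>R sym_matrix c) ** (J ** ((x *\<^sub>R mat 1 + y *\<^sub>R sym_matrix c) ** A)) =
      (x\<^sup>2 - y\<^sup>2 * ((Re c)\<^sup>2 + (Im c)\<^sup>2)) *\<^sub>R (J ** A)" for x y
    by (simp add: matrix2_simps sym_matrix_def J_def scaleR_complex power2_eq_square algebra_simps)
  ultimately show ?thesis unfolding jump_def by (simp only: scaleR_one)
qed

lemma persson_factor_atom: "persson_factor q (real k) ** Qmat (q k) = (jump (q k) - mat 1) ** J"
  by (simp add: persson_factor_def mass_at_def Qmat_J gfun_Qmat)

lemma persson_factor_off_atoms:
  assumes "x \<notin> \<nat>"
  shows "persson_factor q x = mat 1"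
proof -
  have "Qmat 0 ** transpose J = 0" by (simp add: Qmat_J sym_matrix_0)
  then show ?thesis using assms by (simp add: persson_factor_def mass_at_def gfun_0)
qed

lemma matrix2_diff_distrib:
  fixes A B C :: "complex^2^2"
  shows "(A - B) ** C = A ** C - B ** C" "C ** (A - B) = C ** A - C ** B"
  by (simp_all add: matrix2_simps algebra_simps)

lemma bounded_linear_matrix_mult: "bounded_linear (\<lambda>B :: complex^2^2. A ** B)"
proof -
  have "linear (\<lambda>B :: complex^2^2. A ** B)"
    by (rule linearI) (simp_all add: matrix2_simps algebra_simps scaleR_complex)
  then show ?thesis by (simp add: linear_conv_bounded_linear)
qed

text \<open>
  A right-continuous function is the limit of its values at the next point on the right with denominator
  \<open>n + 1\<close>.
\<close>

lemma right_continuous_measurable: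
  fixes N :: "real \<Rightarrow> 'a::{metric_space}"
  assumes rc: "\<And>x. continuous (at_right x) N"
  shows "N \<in> borel_measurable borel"
proof (rule borel_measurable_LIMSEQ_metric)
  fix n
  have "(\<lambda>k :: int. N ((of_int k + 1) / real (Suc n))) \<in> measurable (count_space UNIV) borel" by simp
  moreover have "(\<lambda>x. \<lfloor>real (Suc n) * x\<rfloor>) \<in> measurable borel (count_space UNIV)" by measurable
  ultimately show "(\<lambda>x. N ((of_int \<lfloor>real (Suc n) * x\<rfloor> + 1) / real (Suc n))) \<in> borel_measurable borel"
    by (rule measurable_compose[rotated])
next
  fix x :: real
  let ?u = "\<lambda>n. (of_int \<lfloor>real (Suc n) * x\<rfloor> + 1) / real (Suc n)"
  have gt: "?u n > x" and le: "?u n \<le> x + inverse (real (Suc n))" for n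
  proof -
    have "real (Suc n) * x < of_int \<lfloor>real (Suc n) * x\<rfloor> + 1" "of_int \<lfloor>real (Suc n) * x\<rfloor> \<le> real (Suc n) * x" by linarith+
    moreover have "real (Suc n) * (x + inverse (real (Suc n))) = real (Suc n) * x + 1"
      by (simp add: distrib_left del: of_nat_Suc)
    ultimately show "?u n > x" "?u n \<le> x + inverse (real (Suc n))"
      by (simp_all add: pos_less_divide_eq pos_divide_le_eq mult.commute[of _ "real (Suc n)"] del: of_nat_Suc)
  qed
  have "(\<lambda>n. x + inverse (real (Suc n))) \<longlonglongrightarrow> x + 0" by (intro tendsto_intros LIMSEQ_inverse_real_of_nat)
  then have "?u \<longlonglongrightarrow> x"
    by (intro tendsto_sandwich[of "\<lambda>_. x" ?u sequentially "\<lambda>n. x + inverse (real (Suc n))"])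
       (use gt le in \<open>auto intro: less_imp_le always_eventually\<close>)
  then have "filterlim ?u (at_right x) sequentially"
  proof -
    have "\<forall>\<^sub>F n in sequentially. ?u n \<in> {x<..} \<and> ?u n \<noteq> x"
      by (intro always_eventually allI) (use gt in \<open>metis greaterThan_iff less_irrefl\<close>)
    with \<open>?u \<longlonglongrightarrow> x\<close> show ?thesis unfolding filterlim_at by blast
  qed
  moreover have "(N \<longlongrightarrow> N x) (at_right x)" using rc[of x] by (simp add: continuous_within)
  ultimately show "(\<lambda>n. N (?u n)) \<longlonglongrightarrow> N x" by (rule filterlim_compose[rotated])
qed

lemma persson_integral:
  "(LINT t:{..x}|lborel. persson_factor q t ** (indicator {0..} t *\<^sub>R (mat z ** N t))) =
   (LINT t:{0..x}|lborel. mat z ** N t)"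
  unfolding set_lebesgue_integral_def
proof (rule integral_discrete_difference[of "\<nat>"])
  show "countable (\<nat> :: real set)" by (simp add: Nats_def)
  fix t assume "t \<notin> (\<nat> :: real set)"
  then show "indicator {..x} t *\<^sub>R (persson_factor q t ** (indicator {0..} t *\<^sub>R (mat z ** N t))) =
     indicator {0..x} t *\<^sub>R (mat z ** N t)"
    by (auto simp: persson_factor_off_atoms indicator_def)
qed auto

lemma atoms_below: "0 \<le> x \<Longrightarrow> {k. real k \<le> x} = {..nat \<lfloor>x\<rfloor>}" "x < 0 \<Longrightarrow> {k. real k \<le> x} = {}"
  by (auto simp: le_nat_iff le_floor_iff)

text \<open>The Persson equation with its integrals evaluated.\<close>

lemma persson_solution_iff:
  "persson_solution q z N \<longleftrightarrow> (\<forall>x. continuous (at_right x) N) \<and> locally_bounded_variation N \<and>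
     (\<forall>x<0. N x = mat 1) \<and>
     (\<forall>x\<ge>0. J ** N x + (\<Sum>k\<le>nat \<lfloor>x\<rfloor>. (jump (q k) - mat 1) ** J ** N (real k)) - (LINT t:{0..x}|lborel. mat z ** N t) = J)"
proof -
  have neg: "J ** N x + ((\<Sum>k | real k \<le> x. persson_factor q (real k) ** Qmat (q k) ** N (real k))
             - (LINT t:{..x}|lborel. persson_factor q t ** (indicator {0..} t *\<^sub>R (mat z ** N t)))) = J
      \<longleftrightarrow> N x = mat 1" if "x < 0" for x
  proof -
    have "J ** N x = J \<longleftrightarrow> N x = mat 1"
    proof
      assume "J ** N x = J"
      then have "J ** (J ** N x) = J ** (J ** mat 1)" by simp
      then show "N x = mat 1" by (simp only: J_square neg_equal_iff_equal)
    qed simp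
    moreover have "(LINT t:{0..x}|lborel. mat z ** N t) = 0"
      using that by (simp add: set_lebesgue_integral_def)
    ultimately show ?thesis using that by (simp add: persson_integral atoms_below)
  qed
  have pos: "J ** N x + ((\<Sum>k | real k \<le> x. persson_factor q (real k) ** Qmat (q k) ** N (real k))
             - (LINT t:{..x}|lborel. persson_factor q t ** (indicator {0..} t *\<^sub>R (mat z ** N t)))) = J
      \<longleftrightarrow> J ** N x + (\<Sum>k\<le>nat \<lfloor>x\<rfloor>. (jump (q k) - mat 1) ** J ** N (real k)) - (LINT t:{0..x}|lborel. mat z ** N t) = J" if "x \<ge> 0" for x
    using that by (simp add: persson_integral atoms_below persson_factor_atom algebra_simps)
  have split: "(\<forall>x. P x) \<longleftrightarrow> (\<forall>x<0. Q x) \<and> (\<forall>x\<ge>0. R x)"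
    if "\<And>x. x < 0 \<Longrightarrow> P x \<longleftrightarrow> Q x" "\<And>x. x \<ge> 0 \<Longrightarrow> P x \<longleftrightarrow> R x" for P Q R :: "real \<Rightarrow> bool"
    using that by (metis linorder_not_less)
  show ?thesis unfolding persson_solution_def by (simp only: split[OF neg pos])
qed

text \<open>
  The value of the solution at the atom \<open>n\<close>; by right-continuity it includes the jump there.
\<close>

primrec transfer :: "(nat \<Rightarrow> complex) \<Rightarrow> complex \<Rightarrow> nat \<Rightarrow> complex^2^2" where
  "transfer q z 0 = jump (q 0)"
| "transfer q z (Suc n) = jump (q (Suc n)) ** (rotation z ** transfer q z n)"

definition fundamental :: "(nat \<Rightarrow> complex) \<Rightarrow> complex \<Rightarrow> real \<Rightarrow> complex^2^2" where
  "fundamental q z x = (if x < 0 then mat 1 else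
     rotation (z * of_real (x - real (nat \<lfloor>x\<rfloor>))) ** transfer q z (nat \<lfloor>x\<rfloor>))"

lemma rotation_0: "rotation 0 = mat 1"
  by (simp add: matrix2_simps rotation_def)

lemma fundamental_piece: "real n \<le> x \<Longrightarrow> x < real n + 1 \<Longrightarrow> fundamental q z x = rotation (z * of_real (x - real n)) ** transfer q z n"
proof -
  assume x: "real n \<le> x" "x < real n + 1"
  then have "\<lfloor>x\<rfloor> = int n" by (simp add: floor_eq_iff)
  then show ?thesis using x by (simp add: fundamental_def)
qed

lemma fundamental_nat: "fundamental q z (real n) = transfer q z n"
  using fundamental_piece[of n "real n" q z] by (simp add: rotation_0)

lemma rotation_derivative:
  fixes A :: "complex^2^2"
  shows "((\<lambda>t. J ** (rotation (z * of_real (t - c)) ** A)) has_vector_derivative mat z ** (rotation (z * of_real (t - c)) ** A)) (at t within S)"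
proof -
  have c: "((\<lambda>t. cos (z * of_real (t - c))) has_vector_derivative - z * sin (z * of_real (t - c))) (at t within S)"
    and s: "((\<lambda>t. sin (z * of_real (t - c))) has_vector_derivative z * cos (z * of_real (t - c))) (at t within S)"
  proof -
    have "((\<lambda>w. cos (z * (w - of_real c))) has_field_derivative - z * sin (z * of_real (t - c))) (at (of_real t))"
      by (auto intro!: derivative_eq_intros)
    from has_vector_derivative_real_field[OF this, of S]
    show "((\<lambda>t. cos (z * of_real (t - c))) has_vector_derivative - z * sin (z * of_real (t - c))) (at t within S)" by simp
    have "((\<lambda>w. sin (z * (w - of_real c))) has_field_derivative z * cos (z * of_real (t - c))) (at (of_real t))"
      by (auto intro!: derivative_eq_intros)
    from has_vector_derivative_real_field[OF this, of S]
    show "((\<lambda>t. sin (z * of_real (t - c))) has_vector_derivative z * cos (z * of_real (t - c))) (at t within S)" by simp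
  qed
  define B where "B = J ** A"
  have bl: "bounded_linear (\<lambda>w. mat w ** B)" for B :: "complex^2^2"
  proof -
    have "linear (\<lambda>w. mat w ** B)" by (rule linearI) (simp_all add: matrix2_simps algebra_simps scaleR_complex)
    then show ?thesis by (simp add: linear_conv_bounded_linear)
  qed
  have eq: "J ** (rotation w ** A) = mat (cos w) ** (J ** A) + mat (sin w) ** A" for w
    by (simp add: matrix2_simps rotation_def J_def algebra_simps)
  have "((\<lambda>t. mat (cos (z * of_real (t - c))) ** (J ** A) + mat (sin (z * of_real (t - c))) ** A) has_vector_derivative
     (mat (- z * sin (z * of_real (t - c))) ** (J ** A) + mat (z * cos (z * of_real (t - c))) ** A)) (at t within S)"
    by (intro has_vector_derivative_add bounded_linear.has_vector_derivative[OF bl c] bounded_linear.has_vector_derivative[OF bl s])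
  moreover have "mat (- z * sin w) ** (J ** A) + mat (z * cos w) ** A = mat z ** (rotation w ** A)" for w
    by (simp add: matrix2_simps rotation_def J_def algebra_simps)
  ultimately show ?thesis unfolding eq by simp
qed

lemma continuous_rotation:
  fixes A :: "complex^2^2"
  shows "continuous_on S (\<lambda>t. rotation (z * of_real (t - c)) ** A)"
proof -
  have "continuous_on S (\<lambda>t. J ** (rotation (z * of_real (t - c)) ** A))"
    by (rule continuous_on_vector_derivative[OF rotation_derivative])
  from continuous_on_minus[OF bounded_linear.continuous_on[OF bounded_linear_matrix_mult this, of J]]
  show ?thesis by (simp add: J_square)
qed

lemma fundamental_right_continuous: "continuous (at_right x) (fundamental q z)"
proof (cases "x < 0")
  case True
  have "\<forall>\<^sub>F t in at_right x. fundamental q z t = mat 1"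
    using eventually_at_right_real[OF True] by eventually_elim (simp add: fundamental_def)
  then have "(fundamental q z \<longlongrightarrow> mat 1) (at_right x)" by (rule tendsto_eventually)
  then show ?thesis using True by (simp add: continuous_within fundamental_def)
next
  case False
  define n where "n = nat \<lfloor>x\<rfloor>"
  have n: "real n \<le> x" "x < real n + 1" using False unfolding n_def by linarith+
  have "((\<lambda>t. rotation (z * of_real (t - real n)) ** transfer q z n) \<longlongrightarrow> rotation (z * of_real (x - real n)) ** transfer q z n) (at_right x)"
    using continuous_rotation[of UNIV z "real n" "transfer q z n"]
    by (simp add: continuous_on_def filterlim_at_split)
  moreover have "\<forall>\<^sub>F t in at_right x. rotation (z * of_real (t - real n)) ** transfer q z n = fundamental q z t"
    using eventually_at_right_real[OF n(2)]
    by eventually_elim (rule fundamental_piece[symmetric], use n in auto)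
  ultimately have "(fundamental q z \<longlongrightarrow> rotation (z * of_real (x - real n)) ** transfer q z n) (at_right x)"
    by (rule Lim_transform_eventually)
  then show ?thesis using fundamental_piece[OF n] by (simp add: continuous_within)
qed

lemma right_continuous_integrable:
  fixes N :: "real \<Rightarrow> 'a::euclidean_space"
  assumes N: "N \<in> borel_measurable borel" and B: "\<And>t. t \<in> {a..b} \<Longrightarrow> norm (N t) \<le> B"
  shows "set_integrable lborel {a..b} N"
  unfolding set_integrable_def
proof (rule integrableI_bounded_set_indicator[where B = B])
  show "emeasure lborel {a..b} < \<infinity>" by (simp add: emeasure_lborel_Icc_eq)
qed (use N B in auto)

lemma fundamental_bounded: "\<exists>B. \<forall>x\<le>b. norm (fundamental q z x) \<le> B"
proof -
  have "\<exists>B. \<forall>x<real n. norm (fundamental q z x) \<le> B" for n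
  proof (induction n)
    case 0
    then show ?case by (intro exI[of _ "norm (mat 1 :: complex^2^2)"]) (simp add: fundamental_def)
  next
    case (Suc n)
    then obtain B where B: "\<And>x. x < real n \<Longrightarrow> norm (fundamental q z x) \<le> B" by blast
    have "compact ((\<lambda>t. rotation (z * of_real (t - real n)) ** transfer q z n) ` {real n..real n + 1})"
      by (intro compact_continuous_image continuous_rotation) auto
    then have "bounded ((\<lambda>t. rotation (z * of_real (t - real n)) ** transfer q z n) ` {real n..real n + 1})"
      by (rule compact_imp_bounded)
    then obtain C where C: "\<forall>y\<in>(\<lambda>t. rotation (z * of_real (t - real n)) ** transfer q z n) ` {real n..real n + 1}. norm y \<le> C"
      unfolding bounded_iff ..
    have "norm (fundamental q z x) \<le> max B C" if "x < real (Suc n)" for x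
    proof (cases "x < real n")
      case True then show ?thesis using B[of x] by simp
    next
      case False
      then have x: "real n \<le> x" "x < real n + 1" using that by auto
      have "fundamental q z x \<in> (\<lambda>t. rotation (z * of_real (t - real n)) ** transfer q z n) ` {real n..real n + 1}"
        unfolding fundamental_piece[OF x] by (rule imageI) (use x in auto)
      then have "norm (fundamental q z x) \<le> C" by (rule C[rule_format])
      then show ?thesis by simp
    qed
    then show ?case by blast
  qed
  moreover obtain n :: nat where "b < real n" using reals_Archimedean2 by blast
  ultimately show ?thesis by (meson le_less_trans)
qed

lemma fundamental_measurable: "fundamental q z \<in> borel_measurable borel"
  by (rule right_continuous_measurable[OF fundamental_right_continuous])

lemma matrix_mult_measurable:
  fixes N :: "real \<Rightarrow> complex^2^2"
  assumes "N \<in> borel_measurable borel"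
  shows "(\<lambda>t. A ** N t) \<in> borel_measurable borel"
  using measurable_compose[OF assms borel_measurable_continuous_onI[OF linear_continuous_on[OF bounded_linear_matrix_mult[of A]]]] .

lemma fundamental_integral_piece:
  assumes x: "real n \<le> x" "x \<le> real n + 1"
  shows "((\<lambda>t. mat z ** fundamental q z t) has_integral
     (J ** (rotation (z * of_real (x - real n)) ** transfer q z n) - J ** transfer q z n)) {real n..x}"
proof -
  have "((\<lambda>t. mat z ** (rotation (z * of_real (t - real n)) ** transfer q z n)) has_integral
     (J ** (rotation (z * of_real (x - real n)) ** transfer q z n) - J ** (rotation (z * of_real (real n - real n)) ** transfer q z n))) {real n..x}"
    by (rule fundamental_theorem_of_calculus[OF x(1) rotation_derivative])
  then have "((\<lambda>t. mat z ** (rotation (z * of_real (t - real n)) ** transfer q z n)) has_integral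
     (J ** (rotation (z * of_real (x - real n)) ** transfer q z n) - J ** transfer q z n)) {real n..x}"
    by (simp add: rotation_0)
  then show ?thesis
  proof (rule has_integral_spike_finite[rotated 2])
    show "mat z ** fundamental q z t = mat z ** (rotation (z * of_real (t - real n)) ** transfer q z n)"
      if "t \<in> {real n..x} - {real n + 1}" for t
      using that x fundamental_piece[of n t q z] by simp
  qed simp
qed

text \<open>Telescoping over the atoms turns the evaluated Persson equation into an identity for the transfer matrices.\<close>

lemma fundamental_equation:
  assumes x: "real n \<le> x" "x < real n + 1"
  shows "J ** fundamental q z x + (\<Sum>k\<le>n. (jump (q k) - mat 1) ** J ** fundamental q z (real k))
     - integral {0..x} (\<lambda>t. mat z ** fundamental q z t) = J
     \<and> (\<lambda>t. mat z ** fundamental q z t) integrable_on {0..x}"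
proof -
  let ?F = "\<lambda>t. mat z ** fundamental q z t"
  have sub: "(jump c - mat 1) ** J ** A = jump c ** (J ** A) - J ** A" for c and A :: "complex^2^2"
    by (simp add: matrix2_diff_distrib matrix_mul_assoc[symmetric])
  have whole: "(?F has_integral (J ** transfer q z n + (\<Sum>k\<le>n. (jump (q k) - mat 1) ** J ** transfer q z k) - J)) {0..real n}" for n
  proof (induction n)
    case 0
    have "jump (q 0) ** (J ** transfer q z 0) = J" using jump_J_jump[of "q 0" "mat 1"] by simp
    then show ?case by (simp add: sub has_integral_refl)
  next
    case (Suc n)
    have "(?F has_integral (J ** (rotation (z * of_real (real (Suc n) - real n)) ** transfer q z n) - J ** transfer q z n)) {real n..real (Suc n)}"
      by (rule fundamental_integral_piece) auto
    from has_integral_combine[OF _ _ Suc this]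
    have "(?F has_integral ((J ** transfer q z n + (\<Sum>k\<le>n. (jump (q k) - mat 1) ** J ** transfer q z k) - J) +
       (J ** (rotation z ** transfer q z n) - J ** transfer q z n))) {0..real (Suc n)}" by simp
    moreover have "jump (q (Suc n)) ** (J ** transfer q z (Suc n)) = J ** (rotation z ** transfer q z n)"
      unfolding transfer.simps by (rule jump_J_jump)
    ultimately show ?case by (simp add: sub algebra_simps)
  qed
  have "(?F has_integral ((J ** transfer q z n + (\<Sum>k\<le>n. (jump (q k) - mat 1) ** J ** transfer q z k) - J) +
      (J ** (rotation (z * of_real (x - real n)) ** transfer q z n) - J ** transfer q z n))) {0..x}"
    by (rule has_integral_combine[OF _ x(1) whole fundamental_integral_piece]) (use x in auto)
  then have "(?F has_integral (J ** fundamental q z x + (\<Sum>k\<le>n. (jump (q k) - mat 1) ** J ** fundamental q z (real k)) - J)) {0..x}"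
    by (simp add: fundamental_piece[OF x] fundamental_nat algebra_simps)
  then show ?thesis by (auto simp: integral_unique intro: has_integral_integrable)
qed

lemma fundamental_set_integrable: "set_integrable lborel {0..x} (\<lambda>t. mat z ** fundamental q z t)"
proof -
  obtain B where B: "\<And>t. t \<le> x \<Longrightarrow> norm (fundamental q z t) \<le> B" using fundamental_bounded by blast
  obtain K where K: "K > 0" "\<And>A. norm (mat z ** A :: complex^2^2) \<le> norm A * K"
    using bounded_linear.pos_bounded[OF bounded_linear_matrix_mult[of "mat z"]] by blast
  show ?thesis
    by (rule right_continuous_integrable[where B = "B * K", OF matrix_mult_measurable[OF fundamental_measurable]])
       (use K B in \<open>auto intro!: order_trans[OF K(2)] mult_right_mono\<close>)
qed

lemma fundamental_locally_bounded_variation: "locally_bounded_variation (fundamental q z)"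
  unfolding locally_bounded_variation_def
proof (intro allI)
  fix a b :: real
  define m where "m = nat \<lfloor>b\<rfloor>"
  obtain B where B: "\<And>t. t \<le> b \<Longrightarrow> norm (fundamental q z t) \<le> B" using fundamental_bounded by blast
  obtain K where K: "K > 0" "\<And>A. norm (mat z ** A :: complex^2^2) \<le> norm A * K"
    using bounded_linear.pos_bounded[OF bounded_linear_matrix_mult[of "mat z"]] by blast
  obtain K' where K': "K' > 0" "\<And>A. norm (J ** A :: complex^2^2) \<le> norm A * K'"
    using bounded_linear.pos_bounded[OF bounded_linear_matrix_mult[of J]] by blast
  define W where "W k = (jump (q k) - mat 1) ** J ** fundamental q z (real k)" for k
  define F where "F t = mat z ** fundamental q z t" for t
  have Fe: "F = (\<lambda>t. mat z ** fundamental q z t)" by (rule ext) (simp add: F_def)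
  define B' where "B' = \<bar>B\<bar> * K"
  have FB: "norm (F t) \<le> B'" if "t \<le> b" for t
  proof -
    have "norm (F t) \<le> norm (fundamental q z t) * K" unfolding F_def by (rule K(2))
    also have "\<dots> \<le> \<bar>B\<bar> * K" using B[OF that] K(1) by (intro mult_right_mono) auto
    finally show ?thesis by (simp add: B'_def)
  qed
  have B'0: "B' \<ge> 0" using K(1) by (simp add: B'_def)
  \<comment> \<open>a nondecreasing function that controls all increments\<close>
  define G where "G x = norm (mat 1 - transfer q z 0) * indicator {0..} x + K' * ((\<Sum>k | real k \<le> x. norm (W k)) + B' * max 0 x)" for x
  have fin: "finite {k. real k \<le> x}" for x
    by (cases "x < 0") (simp_all add: atoms_below)
  have incr: "norm (fundamental q z t - fundamental q z s) \<le> G t - G s" if st: "s \<le> t" "t \<le> b" for s t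
  proof -
    have pos: "norm (fundamental q z t - fundamental q z s) \<le> K' * (((\<Sum>k | real k \<le> t. norm (W k)) + B' * t) - ((\<Sum>k | real k \<le> s. norm (W k)) + B' * s))"
      if st: "0 \<le> s" "s \<le> t" "t \<le> b" for s t
    proof -
      have e: "J ** fundamental q z x = J - (\<Sum>k | real k \<le> x. W k) + integral {0..x} F \<and> F integrable_on {0..x}" if "x \<ge> 0" for x
      proof -
        have "real (nat \<lfloor>x\<rfloor>) \<le> x" "x < real (nat \<lfloor>x\<rfloor>) + 1" using that by linarith+
        from fundamental_equation[OF this, of q z] show ?thesis using that
          by (auto simp: atoms_below W_def Fe algebra_simps)
      qed
      have I: "integral {0..t} F = integral {0..s} F + integral {s..t} F"
        using st e[of t] by (intro Henstock_Kurzweil_Integration.integral_combine[symmetric]) auto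
      have sub: "{k. real k \<le> s} \<subseteq> {k. real k \<le> t}" using st by auto
      have S: "(\<Sum>k | real k \<le> t. W k) = (\<Sum>k | real k \<le> s. W k) + (\<Sum>k\<in>{k. real k \<le> t} - {k. real k \<le> s}. W k)"
        and S': "(\<Sum>k | real k \<le> t. norm (W k)) = (\<Sum>k | real k \<le> s. norm (W k)) + (\<Sum>k\<in>{k. real k \<le> t} - {k. real k \<le> s}. norm (W k))"
        using sum.subset_diff[OF sub fin, of W] sum.subset_diff[OF sub fin, of "\<lambda>k. norm (W k)"] by (simp_all add: add.commute)
      have "J ** (fundamental q z t - fundamental q z s) = integral {s..t} F - (\<Sum>k\<in>{k. real k \<le> t} - {k. real k \<le> s}. W k)"
        using e[of s] e[of t] st I S by (simp add: matrix2_diff_distrib)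
      also have "norm \<dots> \<le> B' * (t - s) + (\<Sum>k\<in>{k. real k \<le> t} - {k. real k \<le> s}. norm (W k))"
      proof (rule order_trans[OF norm_triangle_ineq4 add_mono[OF _ norm_sum]])
        have "F integrable_on {s..t}" using e[of t] st by (auto intro: integrable_on_subinterval)
        then show "norm (integral {s..t} F) \<le> B' * (t - s)"
          using has_integral_bound[of B' F "integral {s..t} F" s t] FB B'0 st by (auto simp: has_integral_integral)
      qed
      finally have n: "norm (J ** (fundamental q z t - fundamental q z s)) \<le>
          ((\<Sum>k | real k \<le> t. norm (W k)) + B' * t) - ((\<Sum>k | real k \<le> s. norm (W k)) + B' * s)"
        unfolding S' by (simp add: algebra_simps)
      have "fundamental q z t - fundamental q z s = - (J ** (J ** (fundamental q z t - fundamental q z s)))" by (simp add: J_square)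
      then have "norm (fundamental q z t - fundamental q z s) = norm (J ** (J ** (fundamental q z t - fundamental q z s)))"
        by (metis norm_minus_cancel)
      also have "\<dots> \<le> norm (J ** (fundamental q z t - fundamental q z s)) * K'" by (rule K'(2))
      also have "\<dots> \<le> (((\<Sum>k | real k \<le> t. norm (W k)) + B' * t) - ((\<Sum>k | real k \<le> s. norm (W k)) + B' * s)) * K'"
        using n K'(1) by (intro mult_right_mono) auto
      finally show ?thesis by (simp add: mult.commute)
    qed
    consider "t < 0" | "s < 0" "0 \<le> t" | "0 \<le> s" using st by linarith
    then show ?thesis
    proof cases
      case 1 then show ?thesis using st by (simp add: fundamental_def G_def atoms_below)
    next
      case 2
      have "norm (fundamental q z t - fundamental q z s) \<le> norm (fundamental q z t - fundamental q z 0) + norm (fundamental q z 0 - fundamental q z s)"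
        using norm_triangle_ineq[of "fundamental q z t - fundamental q z 0" "fundamental q z 0 - fundamental q z s"] by simp
      also have "norm (fundamental q z 0 - fundamental q z s) = norm (mat 1 - transfer q z 0)"
        using fundamental_nat[of q z 0] 2(1) by (simp add: fundamental_def norm_minus_commute)
      also have "norm (fundamental q z t - fundamental q z 0) \<le> K' * ((\<Sum>k | real k \<le> t. norm (W k)) + B' * t)"
      proof -
        have "norm (fundamental q z t - fundamental q z 0) \<le> K' * (((\<Sum>k | real k \<le> t. norm (W k)) + B' * t) - ((\<Sum>k | real k \<le> 0. norm (W k)) + B' * 0))"
          by (rule pos) (use st 2 in auto)
        also have "\<dots> \<le> K' * ((\<Sum>k | real k \<le> t. norm (W k)) + B' * t)"
          using K'(1) sum_nonneg[of "{k. real k \<le> 0}" "\<lambda>k. norm (W k)"] by (intro mult_left_mono) auto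
        finally show ?thesis .
      qed
      finally show ?thesis using 2 by (simp add: G_def atoms_below(2))
    next
      case 3
      then show ?thesis using pos[OF 3 st] st by (simp add: G_def algebra_simps)
    qed
  qed
  show "\<exists>C. \<forall>n t. (\<forall>i<n. t i \<le> t (Suc i)) \<and> a \<le> t 0 \<and> t n \<le> b \<longrightarrow> (\<Sum>i<n. norm (fundamental q z (t (Suc i)) - fundamental q z (t i))) \<le> C"
  proof (intro exI[of _ "norm (mat 1 - transfer q z 0) + K' * ((\<Sum>k | real k \<le> b. norm (W k)) + B' * max 0 b)"] allI impI)
    fix n and t :: "nat \<Rightarrow> real"
    assume t: "(\<forall>i<n. t i \<le> t (Suc i)) \<and> a \<le> t 0 \<and> t n \<le> b"
    have tb: "t i \<le> t n" if "i \<le> n" for i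
      using that by (induction rule: inc_induct) (use t in \<open>auto intro: order_trans\<close>)
    have "(\<Sum>i<n. norm (fundamental q z (t (Suc i)) - fundamental q z (t i))) \<le> (\<Sum>i<n. G (t (Suc i)) - G (t i))"
    proof (rule sum_mono)
      fix i assume "i \<in> {..<n}"
      then have "t i \<le> t (Suc i)" "t (Suc i) \<le> b" using t tb[of "Suc i"] by auto
      then show "norm (fundamental q z (t (Suc i)) - fundamental q z (t i)) \<le> G (t (Suc i)) - G (t i)" by (rule incr)
    qed
    also have "\<dots> = G (t n) - G (t 0)" by (rule sum_lessThan_telescope)
    also have "G (t 0) \<ge> 0" using K'(1) B'0 by (auto simp: G_def intro!: add_nonneg_nonneg mult_nonneg_nonneg sum_nonneg)
    then have "G (t n) - G (t 0) \<le> G (t n)" by simp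
    also have "G (t n) \<le> norm (mat 1 - transfer q z 0) + K' * ((\<Sum>k | real k \<le> b. norm (W k)) + B' * max 0 b)"
      unfolding G_def
    proof (intro add_mono mult_left_mono)
      show "(\<Sum>k | real k \<le> t n. norm (W k)) \<le> (\<Sum>k | real k \<le> b. norm (W k))"
        by (rule sum_mono2) (use fin t in auto)
    qed (use t K'(1) B'0 in \<open>auto simp: indicator_def\<close>)
    finally show "(\<Sum>i<n. norm (fundamental q z (t (Suc i)) - fundamental q z (t i))) \<le>
       norm (mat 1 - transfer q z 0) + K' * ((\<Sum>k | real k \<le> b. norm (W k)) + B' * max 0 b)" .
  qed
qed

lemma fundamental_persson: "persson_solution q z (fundamental q z)"
  unfolding persson_solution_iff
proof (intro conjI allI impI)
  fix x :: real
  show "fundamental q z x = mat 1" if "x < 0" using that by (simp add: fundamental_def)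
  assume x: "0 \<le> x"
  then have n: "real (nat \<lfloor>x\<rfloor>) \<le> x" "x < real (nat \<lfloor>x\<rfloor>) + 1" by linarith+
  show "J ** fundamental q z x + (\<Sum>k\<le>nat \<lfloor>x\<rfloor>. (jump (q k) - mat 1) ** J ** fundamental q z (real k)) - (LINT t:{0..x}|lborel. mat z ** fundamental q z t) = J"
    using fundamental_equation[OF n, of q z] set_borel_integral_eq_integral(2)[OF fundamental_set_integrable[of x z q]] by simp
qed (rule fundamental_right_continuous fundamental_locally_bounded_variation)+

section \<open>Uniqueness of the solution and the Weyl function\<close>

lemma persson_locally_bounded:
  assumes "persson_solution q z N"
  shows "\<exists>B. \<forall>x\<le>b. norm (N x) \<le> B"
proof -
  have bv: "locally_bounded_variation N" and neg: "\<And>x. x < 0 \<Longrightarrow> N x = mat 1"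
    using assms unfolding persson_solution_iff by auto
  have "\<exists>C. \<forall>n. \<forall>t :: nat \<Rightarrow> real. (\<forall>i<n. t i \<le> t (Suc i)) \<and> - 1 \<le> t 0 \<and> t n \<le> b \<longrightarrow>
      (\<Sum>i<n. norm (N (t (Suc i)) - N (t i))) \<le> C"
    by (rule spec[OF spec[OF bv[unfolded locally_bounded_variation_def]]])
  then obtain C where C: "\<forall>n. \<forall>t :: nat \<Rightarrow> real. (\<forall>i<n. t i \<le> t (Suc i)) \<and> - 1 \<le> t 0 \<and> t n \<le> b \<longrightarrow>
      (\<Sum>i<n. norm (N (t (Suc i)) - N (t i))) \<le> C" ..
  have "norm (N x) \<le> norm (mat 1 :: complex^2^2) + \<bar>C\<bar>" if "x \<le> b" for x
  proof (cases "x < 0")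
    case True then show ?thesis by (simp add: neg)
  next
    case False
    have "(\<Sum>i<1. norm (N ((\<lambda>i. if i = 0 then - 1 else x) (Suc i)) - N ((\<lambda>i. if i = (0::nat) then - 1 else x) i))) \<le> C"
      by (rule C[rule_format]) (use False that in auto)
    then have "norm (N x - mat 1) \<le> C" by (simp add: neg)
    moreover have "norm (N x) \<le> norm (mat 1 :: complex^2^2) + norm (N x - mat 1)"
      using norm_triangle_ineq[of "mat 1 :: complex^2^2" "N x - mat 1"] by simp
    ultimately show ?thesis by linarith
  qed
  then show ?thesis by blast
qed

lemma persson_set_integrable:
  assumes "persson_solution q z N"
  shows "set_integrable lborel {0..x} (\<lambda>t. mat z ** N t)"
proof -
  obtain B where B: "\<And>t. t \<le> x \<Longrightarrow> norm (N t) \<le> B" using persson_locally_bounded[OF assms] by blast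
  have m: "N \<in> borel_measurable borel"
    using assms unfolding persson_solution_def by (intro right_continuous_measurable) auto
  obtain K where K: "K > 0" "\<And>A. norm (mat z ** A :: complex^2^2) \<le> norm A * K"
    using bounded_linear.pos_bounded[OF bounded_linear_matrix_mult[of "mat z"]] by blast
  show ?thesis
    by (rule right_continuous_integrable[where B = "B * K", OF matrix_mult_measurable[OF m]])
       (use K B in \<open>auto intro!: order_trans[OF K(2)] mult_right_mono\<close>)
qed

text \<open>
  Between two atoms the difference of two solutions satisfies this Volterra equation; iterating it gives the
  terms of an exponential series as bounds.
\<close>

lemma volterra_zero:
  fixes D :: "real \<Rightarrow> complex^2^2"
  assumes bnd: "\<And>x. x \<in> {a..<a + 1} \<Longrightarrow> norm (D x) \<le> B"
    and int: "\<And>x. x \<in> {a..<a + 1} \<Longrightarrow> (\<lambda>t. mat z ** D t) integrable_on {a..x}"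
    and eq: "\<And>x. x \<in> {a..<a + 1} \<Longrightarrow> J ** D x = integral {a..x} (\<lambda>t. mat z ** D t)"
    and x: "x \<in> {a..<a + 1}"
  shows "D x = 0"
proof -
  obtain K where K: "K > 0" "\<And>A. norm (mat z ** A :: complex^2^2) \<le> norm A * K"
    using bounded_linear.pos_bounded[OF bounded_linear_matrix_mult[of "mat z"]] by blast
  obtain K' where K': "K' > 0" "\<And>A. norm (J ** A :: complex^2^2) \<le> norm A * K'"
    using bounded_linear.pos_bounded[OF bounded_linear_matrix_mult[of J]] by blast
  define c where "c = K * K'"
  have step: "norm (D x) \<le> B * (c ^ m * (x - a) ^ m / fact m)" if "x \<in> {a..<a + 1}" for x m
    using that
  proof (induction m arbitrary: x)
    case 0 then show ?case using bnd by simp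
  next
    case (Suc m)
    define A where "A = B * c ^ m / fact m * K"
    have hi: "((\<lambda>t. A * (t - a) ^ m) has_integral A * (x - a) ^ Suc m / real (Suc m) - A * (a - a) ^ Suc m / real (Suc m)) {a..x}"
    proof (rule fundamental_theorem_of_calculus)
      fix t assume "t \<in> {a..x}"
      have "((\<lambda>t. A * (t - a) ^ Suc m / real (Suc m)) has_real_derivative A * (real (Suc m) * (t - a) ^ m) / real (Suc m)) (at t within {a..x})"
      proof -
        have "((\<lambda>t. (t - a) ^ Suc m) has_real_derivative (1 + of_nat m) * (1 * (t - a) ^ m)) (at t within {a..x})"
          by (rule DERIV_power_Suc) (auto intro!: derivative_eq_intros)
        from DERIV_cdivide[OF DERIV_cmult[OF this, of A], of "real (Suc m)"] show ?thesis by simp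
      qed
      moreover have "A * (real (Suc m) * (t - a) ^ m) / real (Suc m) = A * (t - a) ^ m" by (simp del: of_nat_Suc)
      ultimately show "((\<lambda>t. A * (t - a) ^ Suc m / real (Suc m)) has_vector_derivative A * (t - a) ^ m) (at t within {a..x})"
        by (simp only: has_real_derivative_iff_has_vector_derivative)
    qed (use Suc.prems in auto)
    have "norm (integral {a..x} (\<lambda>t. mat z ** D t)) \<le> integral {a..x} (\<lambda>t. A * (t - a) ^ m)"
    proof (rule Henstock_Kurzweil_Integration.integral_norm_bound_integral[OF int[OF Suc.prems]])
      show "(\<lambda>t. A * (t - a) ^ m) integrable_on {a..x}" using hi by (rule has_integral_integrable)
      fix t assume t: "t \<in> {a..x}"
      have "norm (mat z ** D t) \<le> norm (D t) * K" by (rule K(2))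
      also have "\<dots> \<le> (B * (c ^ m * (t - a) ^ m / fact m)) * K"
        by (rule mult_right_mono[OF Suc.IH]) (use t Suc.prems K(1) in auto)
      finally show "norm (mat z ** D t) \<le> A * (t - a) ^ m" by (simp add: A_def mult_ac)
    qed
    also have "\<dots> = A * (x - a) ^ Suc m / real (Suc m)" using integral_unique[OF hi] by simp
    finally have n: "norm (J ** D x) \<le> A * (x - a) ^ Suc m / real (Suc m)" unfolding eq[OF Suc.prems] .
    have "D x = - (J ** (J ** D x))" by (simp add: J_square)
    then have "norm (D x) = norm (J ** (J ** D x))" by (metis norm_minus_cancel)
    also have "\<dots> \<le> norm (J ** D x) * K'" by (rule K'(2))
    also have "\<dots> \<le> (A * (x - a) ^ Suc m / real (Suc m)) * K'" using n K'(1) by (intro mult_right_mono) auto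
    also have "\<dots> = B * (c ^ Suc m * (x - a) ^ Suc m / fact (Suc m))"
      by (simp add: A_def c_def field_simps del: of_nat_Suc)
    finally show ?case .
  qed
  have "(\<lambda>m. inverse (fact m) * (c * (x - a)) ^ m) \<longlonglongrightarrow> 0"
    by (rule summable_LIMSEQ_zero[OF summable_exp])
  then have "(\<lambda>m. B * (inverse (fact m) * (c * (x - a)) ^ m)) \<longlonglongrightarrow> B * 0" by (rule tendsto_mult_left)
  then have "(\<lambda>m. B * (c ^ m * (x - a) ^ m / fact m)) \<longlonglongrightarrow> 0"
    by (simp add: power_mult_distrib divide_inverse mult_ac)
  then have "norm (D x) \<le> 0"
    by (rule LIMSEQ_le_const) (use step[OF x] in auto)
  then show ?thesis by simp
qed

text \<open>
  Induction over the unit intervals. If two solutions agree before \<open>n\<close>, only the atom \<open>n\<close> contributes to the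
  equation for their difference; it leaves the value at \<open>n\<close> equal to zero, and the Volterra equation extends
  this to the next interval.
\<close>

lemma persson_unique:
  assumes "persson_solution q z N"
  shows "N = fundamental q z"
proof -
  define M where "M = fundamental q z"
  have M: "persson_solution q z M" unfolding M_def by (rule fundamental_persson)
  define D where "D x = N x - M x" for x
  have FD: "mat z ** D t = mat z ** N t - mat z ** M t" for t by (simp add: D_def matrix2_diff_distrib)
  have intD: "(\<lambda>t. mat z ** D t) integrable_on {0..x}" for x
    unfolding FD using persson_set_integrable[OF assms, of x] persson_set_integrable[OF M, of x]
    by (intro Henstock_Kurzweil_Integration.integrable_diff set_borel_integral_eq_integral(1))
  have eq: "J ** D x + (\<Sum>k\<le>nat \<lfloor>x\<rfloor>. (jump (q k) - mat 1) ** J ** D (real k)) = integral {0..x} (\<lambda>t. mat z ** D t)" if x: "x \<ge> 0" for x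
  proof -
    have e: "J ** S x + (\<Sum>k\<le>nat \<lfloor>x\<rfloor>. (jump (q k) - mat 1) ** J ** S (real k)) - integral {0..x} (\<lambda>t. mat z ** S t) = J"
      and i: "(\<lambda>t. mat z ** S t) integrable_on {0..x}"
      if S: "persson_solution q z S" for S
      using S x set_borel_integral_eq_integral[OF persson_set_integrable[OF S, of x]] unfolding persson_solution_iff by auto
    have "integral {0..x} (\<lambda>t. mat z ** D t) = integral {0..x} (\<lambda>t. mat z ** N t) - integral {0..x} (\<lambda>t. mat z ** M t)"
      unfolding FD by (rule Henstock_Kurzweil_Integration.integral_diff[OF i[OF assms] i[OF M]])
    moreover have "J ** D x = J ** N x - J ** M x" by (simp only: D_def matrix2_diff_distrib(2))
    moreover have "(\<Sum>k\<le>nat \<lfloor>x\<rfloor>. (jump (q k) - mat 1) ** J ** D (real k)) =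
        (\<Sum>k\<le>nat \<lfloor>x\<rfloor>. (jump (q k) - mat 1) ** J ** N (real k)) - (\<Sum>k\<le>nat \<lfloor>x\<rfloor>. (jump (q k) - mat 1) ** J ** M (real k))"
      by (simp only: D_def matrix2_diff_distrib(2) sum_subtractf)
    moreover have "jD + sD = iD" if "iD = iN - iM" "jD = jN - jM" "sD = sN - sM" "jN + sN - iN = J" "jM + sM - iM = J"
      for jD sD iD jN sN iN jM sM iM :: "complex^2^2"
    proof -
      have "jD + sD - iD = (jN + sN - iN) - (jM + sM - iM)" unfolding that(1-3) by simp
      then show ?thesis using that(4,5) by simp
    qed
    ultimately show ?thesis using e[OF assms] e[OF M] by blast
  qed
  obtain BN where BN: "\<And>b x. x \<le> b \<Longrightarrow> norm (N x) \<le> BN b" using persson_locally_bounded[OF assms] by metis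
  obtain BM where BM: "\<And>b x. x \<le> b \<Longrightarrow> norm (M x) \<le> BM b" using persson_locally_bounded[OF M] by metis
  have zero: "\<forall>x<real n. D x = 0" for n
  proof (induction n)
    case 0 then show ?case using assms M by (auto simp: D_def persson_solution_iff)
  next
    case (Suc n)
    have sum: "(\<Sum>k\<le>n. (jump (q k) - mat 1) ** J ** D (real k)) = jump (q n) ** (J ** D (real n)) - J ** D (real n)"
    proof -
      have "(\<Sum>k\<le>n. (jump (q k) - mat 1) ** J ** D (real k)) = (\<Sum>k\<in>{n}. (jump (q k) - mat 1) ** J ** D (real k))"
      proof (rule sum.mono_neutral_right)
        show "\<forall>k\<in>{..n} - {n}. (jump (q k) - mat 1) ** J ** D (real k) = 0"
        proof
          fix k assume "k \<in> {..n} - {n}"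
          then have "D (real k) = 0" using Suc by auto
          then show "(jump (q k) - mat 1) ** J ** D (real k) = 0" by (simp add: matrix2_simps)
        qed
      qed auto
      then show ?thesis by (simp add: matrix2_diff_distrib matrix_mul_assoc[symmetric])
    qed
    have int0: "((\<lambda>t. mat z ** D t) has_integral 0) {0..real n}"
    proof (rule has_integral_spike_finite[of "{real n}"])
      show "mat z ** D t = 0" if "t \<in> {0..real n} - {real n}" for t
        using that Suc by (simp add: matrix2_simps)
    qed auto
    have intn: "integral {0..x} (\<lambda>t. mat z ** D t) = integral {real n..x} (\<lambda>t. mat z ** D t) \<and> (\<lambda>t. mat z ** D t) integrable_on {real n..x}" if x: "real n \<le> x" for x
    proof -
      have "(\<lambda>t. mat z ** D t) integrable_on {real n..x}"
        by (rule integrable_on_subinterval[OF intD[of x]]) auto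
      moreover have "integral {0..real n} (\<lambda>t. mat z ** D t) + integral {real n..x} (\<lambda>t. mat z ** D t) = integral {0..x} (\<lambda>t. mat z ** D t)"
        by (rule Henstock_Kurzweil_Integration.integral_combine) (use x intD in auto)
      ultimately show ?thesis using integral_unique[OF int0] by simp
    qed
    have "jump (q n) ** (J ** D (real n)) = 0"
      using eq[of "real n"] sum integral_unique[OF int0] by simp
    then have "J ** (jump (q n) ** (J ** (jump (q n) ** (J ** D (real n))))) = 0" by (simp add: matrix2_simps)
    then have "J ** D (real n) = 0" by (simp only: jump_J_jump J_square[of "J ** D (real n)"] neg_equal_0_iff_equal)
    then have Dn: "J ** D (real n) = 0" .
    have "D x = 0" if x: "x \<in> {real n..<real n + 1}" for x
    proof (rule volterra_zero[where D = D and z = z and a = "real n" and B = "BN (real n + 1) + BM (real n + 1)", OF _ _ _ x])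
      fix y assume y: "y \<in> {real n..<real n + 1}"
      show "norm (D y) \<le> BN (real n + 1) + BM (real n + 1)"
        unfolding D_def by (rule order_trans[OF norm_triangle_ineq4 add_mono[OF BN BM]]) (use y in auto)
      show "(\<lambda>t. mat z ** D t) integrable_on {real n..y}" using intn[of y] y by simp
      have "nat \<lfloor>y\<rfloor> = n" using y by (simp add: nat_eq_iff floor_eq_iff)
      then have "J ** D y + (\<Sum>k\<le>n. (jump (q k) - mat 1) ** J ** D (real k)) = integral {0..y} (\<lambda>t. mat z ** D t)"
        using eq[of y] y by simp
      moreover have "(\<Sum>k\<le>n. (jump (q k) - mat 1) ** J ** D (real k)) = 0"
        unfolding sum Dn by (simp add: matrix2_simps)
      ultimately show "J ** D y = integral {real n..y} (\<lambda>t. mat z ** D t)" using intn[of y] y by simp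
    qed
    note in_piece = this
    show ?case
    proof (intro allI impI)
      fix x assume "x < real (Suc n)"
      then consider "x < real n" | "x \<in> {real n..<real n + 1}" by fastforce
      then show "D x = 0" using Suc in_piece by cases auto
    qed
  qed
  have "N x = M x" for x
  proof -
    obtain n :: nat where "x < real n" using reals_Archimedean2 by blast
    with zero[of n] show ?thesis by (simp add: D_def)
  qed
  then show ?thesis by (auto simp: M_def)
qed

lemma dirac_solution_eq: "dirac_solution q z = fundamental q z"
  unfolding dirac_solution_def using fundamental_persson persson_unique by (rule the_equality)

text \<open>
  The quotient of the entries of the jump matrix in the coordinates below; for \<open>c = 0\<close> the division
  by zero gives zero, the correct value.
\<close>

definition schur_parameter :: "complex \<Rightarrow> complex" where
  "schur_parameter c = of_real (tanh (cmod c) / cmod c) * cnj c"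

lemma norm_schur_parameter: "cmod (schur_parameter c) = tanh (cmod c)"
proof (cases "c = 0")
  case False
  then show ?thesis unfolding schur_parameter_def norm_mult norm_of_real by simp
qed (simp add: schur_parameter_def)

lemma schur_parameters_q: "schur_parameters (\<lambda>k. schur_parameter (q k))"
  by unfold_locales (simp add: norm_schur_parameter tanh_real_lt_1)

text \<open>
  In the coordinates \<open>p\<^sub>2 \<plusminus> \<i> p\<^sub>1\<close> of a column the rotation is diagonal and the jump matrix is one step
  of the Szego recursion.
\<close>

lemma jump_action:
  fixes A :: "complex^2^2" and c :: complex
  shows "(jump c ** A) $ 2 $ j + \<i> * (jump c ** A) $ 1 $ j =
     of_real (cosh (cmod c)) * ((A $ 2 $ j + \<i> * A $ 1 $ j) + cnj (schur_parameter c) * (A $ 2 $ j - \<i> * A $ 1 $ j))"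
    and "(jump c ** A) $ 2 $ j - \<i> * (jump c ** A) $ 1 $ j =
     of_real (cosh (cmod c)) * ((A $ 2 $ j - \<i> * A $ 1 $ j) + schur_parameter c * (A $ 2 $ j + \<i> * A $ 1 $ j))"
proof -
  have g: "of_real (cosh (cmod c)) * schur_parameter c = of_real (sinh (cmod c) / cmod c) * cnj c"
  proof -
    have "cosh (cmod c) * (tanh (cmod c) / cmod c) = sinh (cmod c) / cmod c"
      by (simp add: tanh_def)
    then show ?thesis unfolding schur_parameter_def by (simp only: mult.assoc[symmetric] of_real_mult[symmetric])
  qed
  have g': "of_real (cosh (cmod c)) * cnj (schur_parameter c) = of_real (sinh (cmod c) / cmod c) * c"
    using arg_cong[OF g, of cnj] by simp
  have c: "c = of_real (Re c) + \<i> * of_real (Im c)" "cnj c = of_real (Re c) - \<i> * of_real (Im c)"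
    by (simp_all add: complex_eq_iff)
  have gc: "of_real (cosh (cmod c)) * schur_parameter c = of_real (sinh (cmod c) / cmod c) * (of_real (Re c) - \<i> * of_real (Im c))"
    by (rule trans[OF g]) (rule arg_cong[OF c(2)])
  have gc': "of_real (cosh (cmod c)) * cnj (schur_parameter c) = of_real (sinh (cmod c) / cmod c) * (of_real (Re c) + \<i> * of_real (Im c))"
    by (rule trans[OF g']) (rule arg_cong[OF c(1)])
  have alg: "h * (p\<^sub>2 + \<i> * p\<^sub>1) + s * (a + \<i> * b) * (p\<^sub>2 - \<i> * p\<^sub>1) =
      (s * b * p\<^sub>1 + (h + s * a) * p\<^sub>2) + \<i> * ((h - s * a) * p\<^sub>1 + s * b * p\<^sub>2)"
    "h * (p\<^sub>2 - \<i> * p\<^sub>1) + s * (a - \<i> * b) * (p\<^sub>2 + \<i> * p\<^sub>1) =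
      (s * b * p\<^sub>1 + (h + s * a) * p\<^sub>2) - \<i> * ((h - s * a) * p\<^sub>1 + s * b * p\<^sub>2)" for h s a b p\<^sub>1 p\<^sub>2 :: complex
    by (simp_all add: algebra_simps)
  have e: "(jump c ** A) $ 1 $ j = (of_real (cosh (cmod c)) - of_real (sinh (cmod c) / cmod c) * of_real (Re c)) * A $ 1 $ j + of_real (sinh (cmod c) / cmod c) * of_real (Im c) * A $ 2 $ j"
    "(jump c ** A) $ 2 $ j = of_real (sinh (cmod c) / cmod c) * of_real (Im c) * A $ 1 $ j + (of_real (cosh (cmod c)) + of_real (sinh (cmod c) / cmod c) * of_real (Re c)) * A $ 2 $ j"
    unfolding jump_def by (simp_all add: matrix_matrix_mult_def sum_2 mat_def sym_matrix_def vector_2 scaleR_complex algebra_simps)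
  have gen: "h * (U + g * V) = h * U + (h * g) * V" for h U g V :: complex
    by (simp add: algebra_simps)
  show "(jump c ** A) $ 2 $ j + \<i> * (jump c ** A) $ 1 $ j =
     of_real (cosh (cmod c)) * ((A $ 2 $ j + \<i> * A $ 1 $ j) + cnj (schur_parameter c) * (A $ 2 $ j - \<i> * A $ 1 $ j))"
    unfolding e by (rule sym, rule trans[OF gen], unfold gc', rule alg(1))
  show "(jump c ** A) $ 2 $ j - \<i> * (jump c ** A) $ 1 $ j =
     of_real (cosh (cmod c)) * ((A $ 2 $ j - \<i> * A $ 1 $ j) + schur_parameter c * (A $ 2 $ j + \<i> * A $ 1 $ j))"
    unfolding e by (rule sym, rule trans[OF gen], unfold gc, rule alg(2))
qed

lemma rotation_action:
  fixes A :: "complex^2^2"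
  shows "(rotation w ** A) $ 2 $ j + \<i> * (rotation w ** A) $ 1 $ j = exp (\<i> * w) * (A $ 2 $ j + \<i> * A $ 1 $ j)"
    and "(rotation w ** A) $ 2 $ j - \<i> * (rotation w ** A) $ 1 $ j = exp (- (\<i> * w)) * (A $ 2 $ j - \<i> * A $ 1 $ j)"
proof -
  have e: "exp (\<i> * w) = cos w + \<i> * sin w" "exp (- (\<i> * w)) = cos w - \<i> * sin w"
    using exp_Euler[of w] exp_Euler[of "- w"] by simp_all
  show "(rotation w ** A) $ 2 $ j + \<i> * (rotation w ** A) $ 1 $ j = exp (\<i> * w) * (A $ 2 $ j + \<i> * A $ 1 $ j)"
    "(rotation w ** A) $ 2 $ j - \<i> * (rotation w ** A) $ 1 $ j = exp (- (\<i> * w)) * (A $ 2 $ j - \<i> * A $ 1 $ j)"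
    unfolding e by (simp_all add: matrix_matrix_mult_def sum_2 rotation_def vector_2 algebra_simps)
qed

definition transfer_scale :: "(nat \<Rightarrow> complex) \<Rightarrow> complex \<Rightarrow> nat \<Rightarrow> complex" where
  "transfer_scale q z n = (\<Prod>k\<le>n. complex_of_real (cosh (cmod (q k)))) * exp (- (\<i> * z)) ^ n"

lemma transfer_scale_nonzero: "transfer_scale q z n \<noteq> 0"
proof -
  have "complex_of_real (cosh x) \<noteq> 0" for x
    unfolding of_real_eq_0_iff using cosh_real_pos[of x] by linarith
  then show ?thesis by (simp add: transfer_scale_def)
qed

text \<open>
  In these coordinates a column of the transfer matrix follows the Szego recursion for \<open>\<zeta> = e\<^bsup>2iz\<^esup>\<close>, after the
  common factors \<open>cosh\<close> and \<open>e\<^bsup>-iz\<^esup>\<close> are split off. Both columns are instances, with different initial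
  values.
\<close>

lemma transfer_szego_column:
  assumes X0: "poly (X 0) \<zeta> = x + cnj (\<gamma> 0) * y" and Y0: "poly (Y 0) \<zeta> = y + \<gamma> 0 * x"
    and XS: "\<And>n. poly (X (Suc n)) \<zeta> = \<zeta> * poly (X n) \<zeta> + cnj (\<gamma> (Suc n)) * poly (Y n) \<zeta>"
    and YS: "\<And>n. poly (Y (Suc n)) \<zeta> = poly (Y n) \<zeta> + \<gamma> (Suc n) * (\<zeta> * poly (X n) \<zeta>)"
    and \<gamma>: "\<And>k. \<gamma> k = schur_parameter (q k)" and \<zeta>: "\<zeta> = exp (2 * \<i> * z)"
    and x: "c * x = (mat 1 :: complex^2^2) $ 2 $ j + \<i> * (mat 1 :: complex^2^2) $ 1 $ j"
    and y: "c * y = (mat 1 :: complex^2^2) $ 2 $ j - \<i> * (mat 1 :: complex^2^2) $ 1 $ j"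
  shows "transfer q z n $ 2 $ j + \<i> * transfer q z n $ 1 $ j = c * transfer_scale q z n * poly (X n) \<zeta> \<and>
     transfer q z n $ 2 $ j - \<i> * transfer q z n $ 1 $ j = c * transfer_scale q z n * poly (Y n) \<zeta>"
proof (induction n)
  case 0
  have T0: "transfer q z 0 = jump (q 0) ** mat 1" by (simp only: transfer.simps matrix_mul_rid)
  have s0: "transfer_scale q z 0 = of_real (cosh (cmod (q 0)))" by (simp add: transfer_scale_def)
  show ?case unfolding T0 jump_action x[symmetric] y[symmetric] s0 X0 Y0 \<gamma> by (simp add: algebra_simps)
next
  case (Suc n)
  have ez: "exp (\<i> * z) = exp (- (\<i> * z)) * \<zeta>" unfolding \<zeta> by (simp flip: exp_add)
  have sS: "transfer_scale q z (Suc n) = of_real (cosh (cmod (q (Suc n)))) * exp (- (\<i> * z)) * transfer_scale q z n"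
    by (simp add: transfer_scale_def)
  note H = conjunct1[OF Suc] conjunct2[OF Suc]
  show ?case
    unfolding transfer.simps(2) jump_action rotation_action H ez sS XS YS \<gamma> by (simp add: algebra_simps)
qed

lemma transfer_szego:
  fixes q :: "nat \<Rightarrow> complex"
  defines "\<gamma> \<equiv> \<lambda>k. schur_parameter (q k)"
  shows "transfer q z n $ 2 $ 1 + \<i> * transfer q z n $ 1 $ 1 = - \<i> * transfer_scale q z n * poly (phi \<gamma> n) (exp (2 * \<i> * z))"
    and "transfer q z n $ 2 $ 1 - \<i> * transfer q z n $ 1 $ 1 = - \<i> * transfer_scale q z n * poly (phi_star \<gamma> n) (exp (2 * \<i> * z))"
    and "transfer q z n $ 2 $ 2 + \<i> * transfer q z n $ 1 $ 2 = 1 * transfer_scale q z n * poly (psi \<gamma> n) (exp (2 * \<i> * z))"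
    and "transfer q z n $ 2 $ 2 - \<i> * transfer q z n $ 1 $ 2 = 1 * transfer_scale q z n * poly (psi_star \<gamma> n) (exp (2 * \<i> * z))"
  using transfer_szego_column[of "phi \<gamma>" "exp (2 * \<i> * z)" "- 1" \<gamma> 1 "phi_star \<gamma>" q z "- \<i>" 1 n]
    transfer_szego_column[of "psi \<gamma>" "exp (2 * \<i> * z)" 1 \<gamma> 1 "psi_star \<gamma>" q z 1 2 n]
  by (simp_all only: phi_0 phi_Suc psi_0 psi_Suc) (simp_all add: \<gamma>_def mat_def mult.left_commute)

lemma norm_exp_upper: "Im z > 0 \<Longrightarrow> cmod (exp (2 * \<i> * z)) < 1"
  by simp

text \<open>
  The quotient in the definition of the Weyl function is a point of a Weyl disc, with \<open>u\<close> the free motion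
  since the last atom.
\<close>

lemma weyl_function_eq:
  assumes z: "Im z > 0"
  shows "weyl_function q z = \<i> * carath (\<lambda>k. schur_parameter (q k)) (exp (2 * \<i> * z))"
proof -
  define \<gamma> where "\<gamma> = (\<lambda>k. schur_parameter (q k))"
  interpret schur_parameters \<gamma> unfolding \<gamma>_def by (rule schur_parameters_q)
  let ?z = "exp (2 * \<i> * z)"
  define n where "n x = nat \<lfloor>x\<rfloor>" for x :: real
  \<comment> \<open>the value for negative x only serves to make the bound hold everywhere\<close>
  define u where "u x = (if x \<ge> 0 then exp (2 * \<i> * z * of_real (x - real (n x))) else 0)" for x
  have u1: "cmod (u x) \<le> 1" for x
  proof (cases "x \<ge> 0")
    case True
    then have "real (n x) \<le> x" by (simp add: n_def)
    then show ?thesis using z by (simp add: u_def)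
  qed (simp add: u_def)
  have n: "filterlim n at_top at_top" unfolding n_def
    by (rule filterlim_compose[OF filterlim_nat_sequentially filterlim_floor_sequentially])
  have lim: "((\<lambda>x. \<i> * ((poly (psi_star \<gamma> (n x)) ?z + u x * poly (psi \<gamma> (n x)) ?z) /
      (poly (phi_star \<gamma> (n x)) ?z + u x * poly (phi \<gamma> (n x)) ?z))) \<longlongrightarrow> \<i> * carath \<gamma> ?z) at_top"
    by (intro tendsto_mult_left weyl_disc_tendsto u1 n norm_exp_upper z)
  have row: "fundamental q z x $ 2 $ 2 / fundamental q z x $ 2 $ 1 = \<i> * ((poly (psi_star \<gamma> (n x)) ?z + u x * poly (psi \<gamma> (n x)) ?z) /
      (poly (phi_star \<gamma> (n x)) ?z + u x * poly (phi \<gamma> (n x)) ?z))" if x: "x \<ge> 0" for x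
  proof -
    define w where "w = z * of_real (x - real (n x))"
    let ?T = "transfer q z (n x)"
    define \<kappa> where "\<kappa> = transfer_scale q z (n x)"
    have \<kappa>0: "\<kappa> \<noteq> 0" using transfer_scale_nonzero by (simp add: \<kappa>_def)
    have f: "fundamental q z x = rotation w ** ?T" using x by (simp add: fundamental_def n_def w_def)
    have eu: "exp (\<i> * w) = exp (- (\<i> * w)) * u x"
      using x by (simp add: u_def w_def flip: exp_add)
    have half: "B $ 2 $ j = ((B $ 2 $ j + \<i> * B $ 1 $ j) + (B $ 2 $ j - \<i> * B $ 1 $ j)) / 2" for B :: "complex^2^2" and j by simp
    note T = transfer_szego[of q z "n x", folded \<gamma>_def \<kappa>_def]
    have 1: "fundamental q z x $ 2 $ 1 = - \<i> * (\<kappa> * exp (- (\<i> * w)) / 2) * (poly (phi_star \<gamma> (n x)) ?z + u x * poly (phi \<gamma> (n x)) ?z)"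
      unfolding f by (subst half, unfold rotation_action T eu) (simp add: field_simps)
    have 2: "fundamental q z x $ 2 $ 2 = (\<kappa> * exp (- (\<i> * w)) / 2) * (poly (psi_star \<gamma> (n x)) ?z + u x * poly (psi \<gamma> (n x)) ?z)"
      unfolding f by (subst half, unfold rotation_action T eu) (simp add: field_simps)
    have "(c * p) / (- \<i> * c * r) = \<i> * (p / r)" if "c \<noteq> 0" for c p r :: complex
      using that by (simp add: divide_simps)
    from this[of "\<kappa> * exp (- (\<i> * w)) / 2"] show ?thesis unfolding 1 2 using \<kappa>0 by simp
  qed
  have "((\<lambda>x. fundamental q z x $ 2 $ 2 / fundamental q z x $ 2 $ 1) \<longlongrightarrow> \<i> * carath \<gamma> ?z) at_top"
    by (rule Lim_transform_eventually[OF lim]) (use eventually_ge_at_top[of 0] in \<open>eventually_elim, simp add: row\<close>)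
  then show ?thesis unfolding weyl_function_def dirac_solution_eq \<gamma>_def by (intro tendsto_Lim) auto
qed

lemma schur_function_eq:
  assumes z: "Im z > 0"
  shows "schur_function q z = schur_fun (\<lambda>k. schur_parameter (q k)) (exp (2 * \<i> * z))"
proof -
  interpret schur_parameters "\<lambda>k. schur_parameter (q k)" by (rule schur_parameters_q)
  define C where "C = carath (\<lambda>k. schur_parameter (q k)) (exp (2 * \<i> * z))"
  have C: "C + 1 \<noteq> 0" unfolding C_def by (rule carath_plus_1_nonzero(1)[OF norm_exp_upper[OF z]])
  have "(THE f. f \<noteq> 1 \<and> \<i> * C = \<i> * ((1 + f) / (1 - f))) = (C - 1) / (C + 1)"
  proof (rule the_equality)
    have "1 - (C - 1) / (C + 1) = 2 / (C + 1)" "1 + (C - 1) / (C + 1) = 2 * C / (C + 1)"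
      using C by (simp_all add: field_simps)
    then show "(C - 1) / (C + 1) \<noteq> 1 \<and> \<i> * C = \<i> * ((1 + (C - 1) / (C + 1)) / (1 - (C - 1) / (C + 1)))"
      using C by (simp add: divide_simps)
    fix f assume f: "f \<noteq> 1 \<and> \<i> * C = \<i> * ((1 + f) / (1 - f))"
    then have "C = (1 + f) / (1 - f)" by (metis mult_left_cancel complex_i_not_zero)
    moreover have "1 - f \<noteq> 0" using f by simp
    ultimately have "C * (1 - f) = 1 + f" by simp
    then have "f * (C + 1) = C - 1" by (simp add: algebra_simps)
    then show "f = (C - 1) / (C + 1)" using C by (simp add: eq_divide_eq)
  qed
  then show ?thesis unfolding schur_function_def weyl_function_eq[OF z] schur_fun_def C_def .
qed

lemma cayley_real_part:
  fixes C :: complex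
  assumes "C + 1 \<noteq> 0"
  shows "(1 - (cmod ((C - 1) / (C + 1)))\<^sup>2) / (cmod (1 - (C - 1) / (C + 1)))\<^sup>2 = Re C"
proof -
  have 1: "1 - (C - 1) / (C + 1) = 2 / (C + 1)" using assms by (simp add: field_simps)
  have n: "(cmod (C + 1))\<^sup>2 \<noteq> 0" using assms by simp
  have d: "(cmod (C + 1))\<^sup>2 - (cmod (C - 1))\<^sup>2 = 4 * Re C"
    unfolding cmod_power2 by (simp add: power2_eq_square algebra_simps)
  have "1 - (cmod ((C - 1) / (C + 1)))\<^sup>2 = ((cmod (C + 1))\<^sup>2 - (cmod (C - 1))\<^sup>2) / (cmod (C + 1))\<^sup>2"
  proof -
    have "1 - a / b = (b - a) / b" if "b \<noteq> 0" for a b :: real using that by (simp add: field_simps)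
    from this[OF n] show ?thesis by (simp only: norm_divide power_divide)
  qed
  then show ?thesis unfolding 1 d using n by (simp add: norm_divide power_divide)
qed

lemma schur_function_density:
  assumes z: "Im z > 0"
  shows "(1 - (cmod (schur_function q z))\<^sup>2) / (cmod (1 - schur_function q z))\<^sup>2 =
     Re (carath (\<lambda>k. schur_parameter (q k)) (exp (2 * \<i> * z)))"
  unfolding schur_function_eq[OF z] schur_fun_def
  by (rule cayley_real_part[OF schur_parameters.carath_plus_1_nonzero(1)[OF schur_parameters_q norm_exp_upper[OF z]]])

lemma periodize_poisson:
  assumes M: "finite_measure M" "sets M = sets borel" and z: "Im z > 0"
  shows "integrable (periodize M) (line_kernel z)"
    and "(LINT x|periodize M. line_kernel z x) = (LINT x|M. Re (herglotz_kernel (exp (2 * \<i> * z)) x))"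
proof -
  interpret finite_measure M by fact
  have [measurable_cong]: "sets M = sets borel" by fact
  let ?H = "\<lambda>x. Re (herglotz_kernel (exp (2 * \<i> * z)) x)"
  note n1 = norm_exp_upper[OF z]
  have pos: "?H x > 0" for x by (rule Re_herglotz_kernel_pos[OF n1])
  have "norm (?H x) \<le> 2 / (1 - cmod (exp (2 * \<i> * z)))" for x
    using norm_herglotz_kernel_le[OF n1, of x] abs_Re_le_cmod[of "herglotz_kernel (exp (2 * \<i> * z)) x"]
    unfolding real_norm_def by (rule order_trans[rotated])
  then have H: "integrable M ?H"
    by (intro integrable_const_bound[where B = "2 / (1 - cmod (exp (2 * \<i> * z)))"]) auto
  have nn: "(\<integral>\<^sup>+x. ennreal (line_kernel z x) \<partial>periodize M) = ennreal (LINT x|M. ?H x)"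
  proof -
    have "(\<integral>\<^sup>+x. ennreal (line_kernel z x) \<partial>periodize M) = (\<integral>\<^sup>+x. ennreal (?H x) \<partial>M)"
      by (subst nn_integral_periodize[OF M(2)]) (simp, simp only: line_kernel_periodization[OF z])
    also have "\<dots> = ennreal (LINT x|M. ?H x)"
      by (rule nn_integral_eq_integral[OF H]) (use pos in \<open>auto intro: less_imp_le\<close>)
    finally show ?thesis .
  qed
  have lk: "line_kernel z x \<ge> 0" for x using line_kernel_pos[OF z, of x] by simp
  show int: "integrable (periodize M) (line_kernel z)"
    by (rule integrableI_nonneg) (use lk nn in auto)
  have "(LINT x|M. ?H x) \<ge> 0" using pos by (intro integral_nonneg_AE AE_I2 less_imp_le)
  then show "(LINT x|periodize M. line_kernel z x) = (LINT x|M. ?H x)"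
    using nn_integral_eq_integral[OF int] lk nn integral_nonneg_AE[of "line_kernel z" "periodize M"] by simp
qed

text \<open>
  The disc representation of the real part of the Weyl function becomes the half-plane representation by
  periodisation, and the latter determines the measure.
\<close>

lemma main_spectral_measure_eq:
  assumes M: "finite_measure M" "sets M = sets borel"
    and eq: "\<And>\<zeta>. cmod \<zeta> < 1 \<Longrightarrow> Re (carath (\<lambda>k. schur_parameter (q k)) \<zeta>) = 1 / pi * (LINT x|M. Re (herglotz_kernel \<zeta> x))"
  shows "main_spectral_measure q = periodize M"
  unfolding main_spectral_measure_def
proof (rule the_equality)
  have pf: "poisson_finite (periodize M)" unfolding poisson_finite_def using periodize_poisson(1)[OF M] by simp
  have val: "Re (carath (\<lambda>k. schur_parameter (q k)) (exp (2 * \<i> * z))) = 1 / pi * (LINT x|periodize M. line_kernel z x)"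
    if z: "Im z > 0" for z
    unfolding periodize_poisson(2)[OF M z] by (rule eq[OF norm_exp_upper[OF z]])
  show "sets (periodize M) = sets borel \<and> (\<forall>z. Im z > 0 \<longrightarrow>
        integrable (periodize M) (\<lambda>x. Im z / (cmod (of_real x - z))\<^sup>2) \<and>
        (1 - (cmod (schur_function q z))\<^sup>2) / (cmod (1 - schur_function q z))\<^sup>2
          = 1 / pi * (LINT x|periodize M. Im z / (cmod (of_real x - z))\<^sup>2))"
    using pf val by (simp add: schur_function_density poisson_finite_def line_kernel_def[abs_def] del: times_divide_eq_left)
  fix \<mu> assume \<mu>: "sets \<mu> = sets borel \<and> (\<forall>z. Im z > 0 \<longrightarrow>
        integrable \<mu> (\<lambda>x. Im z / (cmod (of_real x - z))\<^sup>2) \<and>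
        (1 - (cmod (schur_function q z))\<^sup>2) / (cmod (1 - schur_function q z))\<^sup>2
          = 1 / pi * (LINT x|\<mu>. Im z / (cmod (of_real x - z))\<^sup>2))"
  show "\<mu> = periodize M"
  proof (rule poisson_measure_unique[OF _ pf])
    show "poisson_finite \<mu>" using \<mu> by (simp add: poisson_finite_def line_kernel_def[abs_def])
    fix z assume z: "Im z > 0"
    have "1 / pi * (LINT x|\<mu>. line_kernel z x) = 1 / pi * (LINT x|periodize M. line_kernel z x)"
      using \<mu> z val[OF z] schur_function_density[OF z, of q] unfolding line_kernel_def by simp
    then show "(LINT x|\<mu>. line_kernel z x) = (LINT x|periodize M. line_kernel z x)" by simp
  qed
qed

section \<open>Herglotz measures and densities on the circle\<close>

context schur_parameters
begin

lemma herglotz_kernel_0: "herglotz_kernel 0 x = 1"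
  by (simp add: herglotz_kernel_def)

lemma weight_mean: "(LINT x|circle_measure. bernstein_szego_weight \<gamma> n x) = Re ((1 + \<gamma> 0) / (1 - \<gamma> 0))"
  using carath_approx_herglotz[of 0 n] by (simp add: carath_approx_at_0 herglotz_kernel_0 complex_eq_iff)

lemma mean_pos: "Re ((1 + \<gamma> 0) / (1 - \<gamma> 0)) > 0"
  unfolding weight_mean[of 0, symmetric]
proof -
  have "0 \<le> (LINT x|circle_measure. bernstein_szego_weight \<gamma> 0 x)"
    by (intro integral_nonneg_AE AE_I2 less_imp_le[OF weight_pos])
  moreover have "(LINT x|circle_measure. bernstein_szego_weight \<gamma> 0 x) \<noteq> 0"
  proof
    assume "(LINT x|circle_measure. bernstein_szego_weight \<gamma> 0 x) = 0"
    then have "AE x in circle_measure. bernstein_szego_weight \<gamma> 0 x = 0"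
      using integral_nonneg_eq_0_iff_AE[OF weight_integrable[of 0]] weight_pos[of 0] by (simp add: less_imp_le)
    then have "AE x in circle_measure. False" by eventually_elim (use weight_pos[of 0] in \<open>metis less_irrefl\<close>)
    then show False by simp
  qed
  ultimately show "0 < (LINT x|circle_measure. bernstein_szego_weight \<gamma> 0 x)" by simp
qed

text \<open>
  The Herglotz measure of an arbitrary sequence of parameters: the Bernstein--Szego measures are
  carried by one compact interval and have equal mass, so Helly's theorem gives a weak limit.
\<close>

lemma herglotz_measure_exists:
  obtains M where "finite_measure M" "sets M = sets borel"
    "\<And>\<zeta>. cmod \<zeta> < 1 \<Longrightarrow> carath \<gamma> \<zeta> = \<i> * of_real (Im ((1 + \<gamma> 0) / (1 - \<gamma> 0))) + (LINT x|M. herglotz_kernel \<zeta> x)"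
proof -
  define s where "s = Re ((1 + \<gamma> 0) / (1 - \<gamma> 0))"
  have s: "s > 0" unfolding s_def by (rule mean_pos)
  define w where "w n x = bernstein_szego_weight \<gamma> n x / s" for n x
  define \<mu> where "\<mu> n = density circle_measure (\<lambda>x. ennreal (w n x))" for n
  have wm [measurable]: "w n \<in> borel_measurable borel" for n unfolding w_def by measurable
  have wpos: "w n x \<ge> 0" for n x using weight_pos[of n x] s by (simp add: w_def)
  have wint: "integrable circle_measure (w n)" for n unfolding w_def using weight_integrable[of n] by simp
  have w1: "(LINT x|circle_measure. w n x) = 1" for n
    using weight_mean[of n] s by (simp add: w_def s_def[symmetric])
  have rd: "real_distribution (\<mu> n)" for n
  proof -
    have "emeasure (\<mu> n) (space (\<mu> n)) = (\<integral>\<^sup>+x. ennreal (w n x) \<partial>circle_measure)"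
      unfolding \<mu>_def by (simp add: emeasure_density)
    also have "\<dots> = ennreal 1" using wint wpos w1 by (subst nn_integral_eq_integral) auto
    finally have "prob_space (\<mu> n)" by (intro prob_spaceI) simp
    then show ?thesis by (simp add: real_distribution_def real_distribution_axioms_def \<mu>_def)
  qed
  have full: "emeasure circle_measure (- {- pi / 2..pi / 2}) = 0"
    unfolding circle_measure_def by (subst emeasure_uniform_measure) auto
  have "tight \<mu>"
    unfolding tight_def
  proof (intro conjI allI impI rd)
    fix e :: real assume e: "0 < e"
    have m1: "measure (\<mu> n) {- 2<..2} = 1" for n
    proof -
      interpret real_distribution "\<mu> n" by (rule rd)
      have "AE x in circle_measure. x \<in> {- pi / 2..pi / 2}"
        using full by (intro AE_I'[of "- {- pi / 2..pi / 2}"]) (auto simp: null_sets_def)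
      then have "AE x in circle_measure. x \<in> {- 2<..2}"
        by eventually_elim (use pi_less_4 pi_gt3 in auto)
      then have "AE x in \<mu> n. x \<in> {- 2<..2}" unfolding \<mu>_def by (subst AE_density) auto
      then show ?thesis by (subst prob_eq_1) (auto simp: \<mu>_def)
    qed
    show "\<exists>a b. a < b \<and> (\<forall>n. 1 - e < measure (\<mu> n) {a<..b})"
      by (intro exI[of _ "- 2"] exI[of _ 2]) (use m1 e in auto)
  qed
  then obtain r M where r: "strict_mono (r :: nat \<Rightarrow> nat)" and M: "real_distribution M" "weak_conv_m (\<mu> \<circ> id \<circ> r) M"
    using tight_imp_convergent_subsubsequence[of \<mu> id] by (auto simp: strict_mono_def)
  interpret M: real_distribution M by fact
  have limit: "carath \<gamma> \<zeta> = \<i> * of_real (Im ((1 + \<gamma> 0) / (1 - \<gamma> 0))) + of_real s * (LINT x|M. herglotz_kernel \<zeta> x)"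
    if z: "cmod \<zeta> < 1" for \<zeta>
  proof -
    have conv: "(\<lambda>n. LINT x|\<mu> (r n). herglotz_kernel \<zeta> x) \<longlonglongrightarrow> (LINT x|M. herglotz_kernel \<zeta> x)"
    proof (rule weak_conv_imp_integral_bdd_continuous_conv[where \<mu> = "\<lambda>n. \<mu> (r n)" and B = "2 / (1 - cmod \<zeta>)"])
      show "weak_conv_m (\<lambda>n. \<mu> (r n)) M" using M(2) by (simp add: comp_def)
      show "\<And>x. isCont (herglotz_kernel \<zeta>) x"
        using continuous_herglotz_kernel[OF z, of UNIV] by (simp add: continuous_on_eq_continuous_at)
      show "\<And>x. norm (herglotz_kernel \<zeta> x) \<le> 2 / (1 - cmod \<zeta>)" by (rule norm_herglotz_kernel_le[OF z])
    qed (use rd M in auto)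
    have "(LINT x|\<mu> n. herglotz_kernel \<zeta> x) = (carath_approx \<gamma> n \<zeta> - \<i> * of_real (Im ((1 + \<gamma> 0) / (1 - \<gamma> 0)))) / of_real s" for n
    proof -
      have "(LINT x|\<mu> n. herglotz_kernel \<zeta> x) = (LINT x|circle_measure. w n x *\<^sub>R herglotz_kernel \<zeta> x)"
        unfolding \<mu>_def by (rule integral_density) (use wpos in auto)
      also have "\<dots> = (LINT x|circle_measure. (herglotz_kernel \<zeta> x * of_real (bernstein_szego_weight \<gamma> n x)) / of_real s)"
        by (intro Bochner_Integration.integral_cong refl) (simp add: w_def scaleR_conv_of_real mult.commute)
      finally show ?thesis unfolding carath_approx_herglotz[OF z, of n] by simp
    qed
    then have "(\<lambda>n. (carath_approx \<gamma> (r n) \<zeta> - \<i> * of_real (Im ((1 + \<gamma> 0) / (1 - \<gamma> 0)))) / of_real s) \<longlonglongrightarrow> (LINT x|M. herglotz_kernel \<zeta> x)"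
      using conv by simp
    moreover have "(\<lambda>n. (carath_approx \<gamma> (r n) \<zeta> - \<i> * of_real (Im ((1 + \<gamma> 0) / (1 - \<gamma> 0)))) / of_real s) \<longlonglongrightarrow>
       (carath \<gamma> \<zeta> - \<i> * of_real (Im ((1 + \<gamma> 0) / (1 - \<gamma> 0)))) / of_real s"
      using s LIMSEQ_subseq_LIMSEQ[OF carath_approx_tendsto[OF z] r]
      by (intro tendsto_intros) (auto simp: comp_def)
    ultimately have "(LINT x|M. herglotz_kernel \<zeta> x) = (carath \<gamma> \<zeta> - \<i> * of_real (Im ((1 + \<gamma> 0) / (1 - \<gamma> 0)))) / of_real s"
      by (rule LIMSEQ_unique)
    then show ?thesis using s by simp
  qed
  define N where "N = density M (\<lambda>_. ennreal s)"
  have "finite_measure N"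
  proof (rule finite_measureI)
    have "emeasure N (space N) = ennreal s * emeasure M (space M)"
      unfolding N_def by (subst emeasure_density) (auto simp: nn_integral_cmult)
    then show "emeasure N (space N) \<noteq> \<infinity>" using M.emeasure_space_1 by (simp add: ennreal_mult_eq_top_iff)
  qed
  moreover have "sets N = sets borel" by (simp add: N_def)
  moreover have "(LINT x|N. herglotz_kernel \<zeta> x) = of_real s * (LINT x|M. herglotz_kernel \<zeta> x)" for \<zeta>
  proof -
    have "(LINT x|N. herglotz_kernel \<zeta> x) = (LINT x|M. s *\<^sub>R herglotz_kernel \<zeta> x)"
      unfolding N_def by (rule integral_density) (use s in auto)
    then show ?thesis by (simp add: scaleR_conv_of_real)
  qed
  ultimately show ?thesis using limit that[of N] by simp
qed

end

lemma finite_measure_integrable_herglotz: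
  assumes "finite_measure M" "sets M = sets borel" "cmod \<zeta> < 1"
  shows "integrable M (herglotz_kernel \<zeta>)"
proof -
  interpret finite_measure M by fact
  have [measurable_cong]: "sets M = sets borel" by fact
  show ?thesis by (rule integrable_const_bound[where B = "2 / (1 - cmod \<zeta>)"]) (use norm_herglotz_kernel_le[OF assms(3)] in auto)
qed

text \<open>The density is restricted to a half-open period, whose translates tile the line.\<close>

definition lift_density :: "(real \<Rightarrow> real) \<Rightarrow> real measure" where
  "lift_density w = density lborel (\<lambda>x. indicator {- pi / 2..<pi / 2} x * ennreal (w x))"

lemma sets_lift_density [simp, measurable_cong]: "sets (lift_density w) = sets borel"
  by (simp add: lift_density_def)

lemma lift_density_circle:
  assumes [measurable]: "w \<in> borel_measurable borel" and pos: "\<And>x. w x \<ge> 0"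
  shows "lift_density w = density circle_measure (\<lambda>x. ennreal (pi * w x))"
proof (rule measure_eqI)
  fix A assume "A \<in> sets (lift_density w)"
  then have [measurable]: "A \<in> sets borel" by simp
  have c: "circle_measure = density lborel (\<lambda>x. indicator {- pi / 2..pi / 2} x / ennreal pi)"
    unfolding circle_measure_def uniform_measure_def by (intro density_cong) auto
  have "emeasure (density circle_measure (\<lambda>x. ennreal (pi * w x))) A = (\<integral>\<^sup>+x. ennreal (pi * w x) * indicator A x \<partial>circle_measure)"
    by (subst emeasure_density) auto
  also have "\<dots> = (\<integral>\<^sup>+x. (indicator {- pi / 2..pi / 2} x / ennreal pi) * (ennreal (pi * w x) * indicator A x) \<partial>lborel)"
    unfolding c by (subst nn_integral_density) auto
  also have "\<dots> = (\<integral>\<^sup>+x. (indicator {- pi / 2..<pi / 2} x * ennreal (w x)) * indicator A x \<partial>lborel)"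
  proof (rule nn_integral_cong_AE)
    have "AE x in lborel. x \<noteq> pi / 2" by (rule AE_lborel_singleton)
    then show "AE x in lborel. (indicator {- pi / 2..pi / 2} x / ennreal pi) * (ennreal (pi * w x) * indicator A x) =
       (indicator {- pi / 2..<pi / 2} x * ennreal (w x)) * indicator A x"
    proof eventually_elim
      case (elim x)
      have "(1 / ennreal pi) * ennreal (pi * w x) = ennreal (w x)"
        using pos[of x] by (simp add: divide_ennreal[of 1, simplified] flip: ennreal_mult')
      then show ?case using elim by (auto simp: indicator_def)
    qed
  qed
  also have "\<dots> = emeasure (lift_density w) A"
    unfolding lift_density_def by (subst emeasure_density) auto
  finally show "emeasure (lift_density w) A = emeasure (density circle_measure (\<lambda>x. ennreal (pi * w x))) A" by simp
qed simp

lemma lift_density_integral: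
  fixes f :: "real \<Rightarrow> 'a::{banach, second_countable_topology}"
  assumes [measurable]: "w \<in> borel_measurable borel" "f \<in> borel_measurable borel" and pos: "\<And>x. w x \<ge> 0"
  shows "(LINT x|lift_density w. f x) = pi *\<^sub>R (LINT x|circle_measure. w x *\<^sub>R f x)"
proof -
  have "(LINT x|lift_density w. f x) = (LINT x|circle_measure. (pi * w x) *\<^sub>R f x)"
    unfolding lift_density_circle[OF assms(1) pos] by (rule integral_density) (use pos in auto)
  also have "\<dots> = (LINT x|circle_measure. pi *\<^sub>R (w x *\<^sub>R f x))" by simp
  finally show ?thesis by (simp only: integral_scaleR_right)
qed

lemma lift_density_finite:
  assumes "integrable circle_measure w" and pos: "\<And>x. w x \<ge> 0"
  shows "finite_measure (lift_density w)"
proof (rule finite_measureI)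
  have [measurable]: "w \<in> borel_measurable borel" using borel_measurable_integrable[OF assms(1)] by simp
  have "emeasure (lift_density w) (space (lift_density w)) = (\<integral>\<^sup>+x. ennreal (pi * w x) \<partial>circle_measure)"
    unfolding lift_density_circle[OF \<open>w \<in> borel_measurable borel\<close> pos] by (simp add: emeasure_density)
  also have "\<dots> = ennreal (LINT x|circle_measure. pi * w x)"
    by (rule nn_integral_eq_integral) (use assms in auto)
  finally show "emeasure (lift_density w) (space (lift_density w)) \<noteq> \<infinity>" by simp
qed

lemma lift_density_periodize:
  assumes [measurable]: "w \<in> borel_measurable borel" and per: "\<And>x. w (x + pi) = w x"
  shows "density lborel (\<lambda>x. ennreal (w x)) = periodize (lift_density w)"
  unfolding lift_density_def by (rule density_periodize) (use per in auto)

text \<open>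
  Periodisation turns the Poisson integrals on the disc into those on the half-plane, which determine the
  measure.
\<close>

lemma disc_poisson_unique:
  assumes M: "finite_measure M1" "sets M1 = sets borel" "finite_measure M2" "sets M2 = sets borel"
    and eq: "\<And>\<zeta>. cmod \<zeta> < 1 \<Longrightarrow> (LINT x|M1. Re (herglotz_kernel \<zeta> x)) = (LINT x|M2. Re (herglotz_kernel \<zeta> x))"
  shows "periodize M1 = periodize M2"
proof (rule poisson_measure_unique)
  show "poisson_finite (periodize M1)" "poisson_finite (periodize M2)"
    unfolding poisson_finite_def using periodize_poisson(1)[OF M(1,2)] periodize_poisson(1)[OF M(3,4)] by auto
  fix z assume z: "Im z > 0"
  show "(LINT x|periodize M1. line_kernel z x) = (LINT x|periodize M2. line_kernel z x)"
    unfolding periodize_poisson(2)[OF M(1,2) z] periodize_poisson(2)[OF M(3,4) z]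
    by (rule eq[OF norm_exp_upper[OF z]])
qed

text \<open>
  A function with vanishing coefficients is orthogonal to all Herglotz kernels. So its positive and negative
  parts have the same Poisson integrals and therefore the same periodised measures.
\<close>

lemma fourier_unique:
  assumes f: "integrable circle_measure f"
    and zero: "\<And>k. (LINT x|circle_measure. f x *\<^sub>R cnj (circ x) ^ k) = 0"
  shows "AE x in circle_measure. f x = (0 :: real)"
proof -
  have [measurable]: "f \<in> borel_measurable borel" using borel_measurable_integrable[OF f] by simp
  have H0: "(LINT x|circle_measure. of_real (f x) * herglotz_kernel \<zeta> x) = 0" if z: "cmod \<zeta> < 1" for \<zeta>
  proof -
    obtain R where R: "R > 1" "(\<lambda>w. 1 / (1 - cnj \<zeta> * w)) holomorphic_on ball 0 R"
      "\<And>k. taylor_coeff (\<lambda>w. 1 / (1 - cnj \<zeta> * w)) k = cnj \<zeta> ^ k"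
      using geometric_holomorphic[of "cnj \<zeta>"] z by auto
    have fc: "integrable circle_measure (\<lambda>x. complex_of_real (f x))" using f by simp
    have coeff: "(LINT x|circle_measure. circ x ^ k * complex_of_real (f x)) = 0" for k
    proof -
      have "(LINT x|circle_measure. circ x ^ k * complex_of_real (f x)) = cnj (LINT x|circle_measure. f x *\<^sub>R cnj (circ x) ^ k)"
        by (subst Bochner_Integration.integral_cnj[symmetric]) (simp add: scaleR_conv_of_real mult.commute)
      then show ?thesis by (simp add: zero)
    qed
    have "(\<lambda>k. cnj \<zeta> ^ k * (LINT x|circle_measure. circ x ^ k * complex_of_real (f x))) sums
       (LINT x|circle_measure. 1 / (1 - cnj \<zeta> * circ x) * complex_of_real (f x))"
      using circle_integral_taylor[OF R(2,1) fc] unfolding R(3) .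
    then have I0: "(LINT x|circle_measure. 1 / (1 - cnj \<zeta> * circ x) * complex_of_real (f x)) = 0"
      unfolding coeff using sums_unique2[OF _ sums_zero] by fastforce
    have gi: "integrable circle_measure (\<lambda>x. 1 / (1 - cnj \<zeta> * circ x) * complex_of_real (f x))"
    proof -
      obtain B where B: "B > 0" "\<And>x. norm (1 / (1 - cnj \<zeta> * circ x)) \<le> B"
        using bounded_circ_holomorphic[OF R(2,1)] by blast
      show ?thesis
      proof (rule Bochner_Integration.integrable_bound[where f = "\<lambda>x. B * f x"])
        show "AE x in circle_measure. norm (1 / (1 - cnj \<zeta> * circ x) * complex_of_real (f x)) \<le> norm (B * f x)"
          unfolding norm_mult using B by (intro AE_I2 mult_mono) (auto simp: less_imp_le)
      qed (use f in auto)
    qed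
    have "(LINT x|circle_measure. of_real (f x) * herglotz_kernel \<zeta> x) =
       (LINT x|circle_measure. 2 * cnj (1 / (1 - cnj \<zeta> * circ x) * complex_of_real (f x)) - complex_of_real (f x))"
      by (intro Bochner_Integration.integral_cong refl) (simp add: herglotz_kernel_eq[OF z] algebra_simps)
    also have "\<dots> = 2 * cnj (LINT x|circle_measure. 1 / (1 - cnj \<zeta> * circ x) * complex_of_real (f x)) - (LINT x|circle_measure. complex_of_real (f x))"
      by (subst Bochner_Integration.integral_diff[OF integrable_mult_right[OF integrable_cnj[OF gi]] fc])
         (simp only: integral_mult_right_zero Bochner_Integration.integral_cnj)
    also have "\<dots> = 0" unfolding I0 using coeff[of 0] by simp
    finally show ?thesis .
  qed
  define p where "p x = max 0 (f x)" for x
  define m where "m x = max 0 (- f x)" for x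
  have pm: "f x = p x - m x" "p x \<ge> 0" "m x \<ge> 0" for x by (auto simp: p_def m_def)
  have [measurable]: "p \<in> borel_measurable borel" "m \<in> borel_measurable borel" unfolding p_def m_def by measurable
  have pi': "integrable circle_measure p" "integrable circle_measure m"
    unfolding p_def m_def by (rule Bochner_Integration.integrable_bound[OF f]; auto)+
  have Hint: "integrable circle_measure (\<lambda>x. v x * Re (herglotz_kernel \<zeta> x))"
    if z: "cmod \<zeta> < 1" and v: "integrable circle_measure v" for v \<zeta>
  proof -
    have [measurable]: "v \<in> borel_measurable borel" using borel_measurable_integrable[OF v] by simp
    have b: "\<bar>Re (herglotz_kernel \<zeta> x)\<bar> \<le> 2 / (1 - cmod \<zeta>)" for x
      using norm_herglotz_kernel_le[OF z, of x] abs_Re_le_cmod[of "herglotz_kernel \<zeta> x"] by linarith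
    show ?thesis
    proof (rule Bochner_Integration.integrable_bound[where f = "\<lambda>x. 2 / (1 - cmod \<zeta>) * v x"])
      show "AE x in circle_measure. norm (v x * Re (herglotz_kernel \<zeta> x)) \<le> norm (2 / (1 - cmod \<zeta>) * v x)"
        using mult_left_mono[OF b, of "\<bar>v x\<bar>" for x] z by (intro AE_I2) (simp add: abs_mult mult.commute)
    qed (use v in auto)
  qed
  have "periodize (lift_density p) = periodize (lift_density m)"
  proof (rule disc_poisson_unique)
    fix \<zeta> :: complex assume z: "cmod \<zeta> < 1"
    have "0 = Re (LINT x|circle_measure. of_real (f x) * herglotz_kernel \<zeta> x)" using H0[OF z] by simp
    also have "\<dots> = (LINT x|circle_measure. Re (of_real (f x) * herglotz_kernel \<zeta> x))"
    proof (rule integral_Re[symmetric])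
      have b: "norm (complex_of_real (f x) * herglotz_kernel \<zeta> x) \<le> norm (2 / (1 - cmod \<zeta>) * f x)" for x
        using norm_herglotz_kernel_le[OF z, of x] z mult_left_mono[of "norm (herglotz_kernel \<zeta> x)" "2 / (1 - cmod \<zeta>)" "\<bar>f x\<bar>"]
        by (simp add: norm_mult abs_mult mult.commute)
      show "integrable circle_measure (\<lambda>x. complex_of_real (f x) * herglotz_kernel \<zeta> x)"
        by (rule Bochner_Integration.integrable_bound[where f = "\<lambda>x. 2 / (1 - cmod \<zeta>) * f x"]) (use f b in auto)
    qed
    also have "\<dots> = (LINT x|circle_measure. p x * Re (herglotz_kernel \<zeta> x) - m x * Re (herglotz_kernel \<zeta> x))"
      by (intro Bochner_Integration.integral_cong refl) (simp add: pm(1) algebra_simps)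
    also have "\<dots> = (LINT x|circle_measure. p x * Re (herglotz_kernel \<zeta> x)) - (LINT x|circle_measure. m x * Re (herglotz_kernel \<zeta> x))"
      by (rule Bochner_Integration.integral_diff[OF Hint[OF z pi'(1)] Hint[OF z pi'(2)]])
    finally have "(LINT x|circle_measure. p x * Re (herglotz_kernel \<zeta> x)) = (LINT x|circle_measure. m x * Re (herglotz_kernel \<zeta> x))" by simp
    then show "(LINT x|lift_density p. Re (herglotz_kernel \<zeta> x)) = (LINT x|lift_density m. Re (herglotz_kernel \<zeta> x))"
      by (simp add: lift_density_integral pm)
  qed (use lift_density_finite pi' pm in auto)
  have eqm: "emeasure (lift_density p) A = emeasure (lift_density m) A" if [measurable]: "A \<in> sets borel" for A
  proof -
    have per: "emeasure (lift_density v) A = emeasure (periodize (lift_density v)) (A \<inter> {- pi / 2..<pi / 2})"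
      if [measurable]: "v \<in> borel_measurable borel" for v
    proof -
      interpret Z: sigma_finite_measure "count_space (UNIV :: int set)" by (rule sigma_finite_measure_count_space)
      have [measurable]: "(\<lambda>x. \<integral>\<^sup>+k. indicator (A \<inter> {- pi / 2..<pi / 2}) (x + pi * of_int k) \<partial>count_space (UNIV :: int set)) \<in> borel_measurable borel"
        by measurable
      have "emeasure (periodize (lift_density v)) (A \<inter> {- pi / 2..<pi / 2}) = (\<integral>\<^sup>+x. indicator (A \<inter> {- pi / 2..<pi / 2}) x \<partial>periodize (lift_density v))"
        by simp
      also have "\<dots> = (\<integral>\<^sup>+x. (\<integral>\<^sup>+k. indicator (A \<inter> {- pi / 2..<pi / 2}) (x + pi * of_int k) \<partial>count_space UNIV) \<partial>lift_density v)"
        by (rule nn_integral_periodize) auto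
      also have "\<dots> = (\<integral>\<^sup>+x. (indicator {- pi / 2..<pi / 2} x * ennreal (v x)) * (\<integral>\<^sup>+k. indicator (A \<inter> {- pi / 2..<pi / 2}) (x + pi * of_int k) \<partial>count_space (UNIV :: int set)) \<partial>lborel)"
        unfolding lift_density_def by (subst nn_integral_density) auto
      also have "\<dots> = (\<integral>\<^sup>+x. (indicator {- pi / 2..<pi / 2} x * ennreal (v x)) * indicator A x \<partial>lborel)"
      proof (rule nn_integral_cong)
        fix x
        show "(indicator {- pi / 2..<pi / 2} x * ennreal (v x)) * (\<integral>\<^sup>+k. indicator (A \<inter> {- pi / 2..<pi / 2}) (x + pi * of_int k) \<partial>count_space (UNIV :: int set)) =
           (indicator {- pi / 2..<pi / 2} x * ennreal (v x)) * indicator A x"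
        proof (cases "x \<in> {- pi / 2..<pi / 2}")
          case True
          have "indicator (A \<inter> {- pi / 2..<pi / 2}) (x + pi * of_int k) = (indicator A x * indicator {0} k :: ennreal)" for k :: int
          proof (cases "k = 0")
            case False
            then consider "1 \<le> real_of_int k" | "real_of_int k \<le> - 1" by linarith
            then have "x + pi * of_int k \<notin> {- pi / 2..<pi / 2}"
            proof cases
              case 1
              have "pi \<le> pi * real_of_int k" using mult_left_mono[OF 1, of pi] by simp
              moreover have "- (pi / 2) \<le> x" using True by simp
              ultimately have "pi / 2 \<le> x + pi * real_of_int k" by linarith
              then show ?thesis by (metis atLeastLessThan_iff not_less)
            next
              case 2
              have "pi * real_of_int k \<le> - pi" using mult_left_mono[OF 2, of pi] by simp
              moreover have "x < pi / 2" using True by simp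
              ultimately have "x + pi * real_of_int k < - pi / 2" by linarith
              then show ?thesis by (metis atLeastLessThan_iff not_less)
            qed
            then show ?thesis using False by simp
          qed (use True in \<open>auto simp: indicator_def\<close>)
          then have "(\<integral>\<^sup>+k. indicator (A \<inter> {- pi / 2..<pi / 2}) (x + pi * of_int k) \<partial>count_space (UNIV :: int set)) = indicator A x"
            by (simp add: nn_integral_cmult)
          then show ?thesis by simp
        qed simp
      qed
      also have "\<dots> = emeasure (lift_density v) A" unfolding lift_density_def by (subst emeasure_density) auto
      finally show ?thesis by simp
    qed
    show ?thesis using per[of p] per[of m] \<open>periodize (lift_density p) = periodize (lift_density m)\<close> by simp
  qed
  have dm: "density circle_measure (\<lambda>x. ennreal (pi * p x)) = density circle_measure (\<lambda>x. ennreal (pi * m x))"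
    unfolding lift_density_circle[symmetric, OF \<open>p \<in> borel_measurable borel\<close> pm(2)]
      lift_density_circle[symmetric, OF \<open>m \<in> borel_measurable borel\<close> pm(3)]
    by (rule measure_eqI) (use eqm in auto)
  have "AE x in circle_measure. ennreal (pi * p x) = ennreal (pi * m x)"
    by (rule circle.density_unique[OF _ _ dm]) measurable
  then show ?thesis by eventually_elim (use pm in simp)
qed

section \<open>Fourier coefficients of the logarithm of a density\<close>

lemma AE_circle: "AE x in lborel. P x \<Longrightarrow> AE x in circle_measure. P x"
  unfolding circle_measure_def uniform_measure_def by (subst AE_density) auto

lemma L1_pairing:
  fixes h :: "real \<Rightarrow> complex"
  assumes e: "\<And>i. integrable circle_measure (e i)" "integrable circle_measure v"
    and h [measurable]: "h \<in> borel_measurable borel" and B: "\<And>x. cmod (h x) \<le> B"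
    and lim: "(\<lambda>i. LINT x|circle_measure. \<bar>e i x - v x\<bar>) \<longlonglongrightarrow> 0"
  shows "(\<lambda>i. LINT x|circle_measure. h x * of_real (e i x)) \<longlonglongrightarrow> (LINT x|circle_measure. h x * of_real (v x))"
    and "integrable circle_measure (\<lambda>x. h x * of_real (v x))"
proof -
  have int: "integrable circle_measure (\<lambda>x. h x * of_real (f x))" if f: "integrable circle_measure f" for f
  proof (rule Bochner_Integration.integrable_bound[where f = "\<lambda>x. B * f x"])
    have [measurable]: "f \<in> borel_measurable borel" using borel_measurable_integrable[OF f] by simp
    show "(\<lambda>x. h x * complex_of_real (f x)) \<in> borel_measurable circle_measure" by measurable
    have "cmod (h x * of_real (f x)) \<le> norm (B * f x)" for x
      using mult_right_mono[OF B[of x], of "\<bar>f x\<bar>"] order_trans[OF norm_ge_zero B[of x]]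
      by (simp add: norm_mult abs_mult)
    then show "AE x in circle_measure. norm (h x * of_real (f x)) \<le> norm (B * f x)" by simp
  qed (use f in auto)
  show "integrable circle_measure (\<lambda>x. h x * of_real (v x))" by (rule int[OF e(2)])
  have bound: "cmod ((LINT x|circle_measure. h x * of_real (e i x)) - (LINT x|circle_measure. h x * of_real (v x)))
      \<le> B * (LINT x|circle_measure. \<bar>e i x - v x\<bar>)" for i
  proof -
    have d: "integrable circle_measure (\<lambda>x. e i x - v x)" using e by simp
    have "(LINT x|circle_measure. h x * of_real (e i x)) - (LINT x|circle_measure. h x * of_real (v x)) =
       (LINT x|circle_measure. h x * of_real (e i x) - h x * of_real (v x))"
      by (rule Bochner_Integration.integral_diff[symmetric, OF int[OF e(1)] int[OF e(2)]])
    also have "\<dots> = (LINT x|circle_measure. h x * of_real (e i x - v x))"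
      by (simp add: algebra_simps)
    finally have "cmod ((LINT x|circle_measure. h x * of_real (e i x)) - (LINT x|circle_measure. h x * of_real (v x)))
       \<le> (LINT x|circle_measure. cmod (h x * of_real (e i x - v x)))"
      using integral_norm_bound[of circle_measure "\<lambda>x. h x * of_real (e i x - v x)"] by simp
    also have "\<dots> \<le> (LINT x|circle_measure. B * \<bar>e i x - v x\<bar>)"
    proof (rule integral_mono)
      show "integrable circle_measure (\<lambda>x. cmod (h x * of_real (e i x - v x)))" by (rule integrable_norm[OF int[OF d]])
      show "integrable circle_measure (\<lambda>x. B * \<bar>e i x - v x\<bar>)" using d by simp
      show "cmod (h x * of_real (e i x - v x)) \<le> B * \<bar>e i x - v x\<bar>" for x
        using mult_right_mono[OF B[of x], of "\<bar>e i x - v x\<bar>"] by (simp add: norm_mult flip: of_real_diff)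
    qed
    finally show ?thesis by simp
  qed
  have "(\<lambda>i. B * (LINT x|circle_measure. \<bar>e i x - v x\<bar>)) \<longlonglongrightarrow> B * 0" by (intro tendsto_intros lim)
  then have "(\<lambda>i. (LINT x|circle_measure. h x * of_real (e i x)) - (LINT x|circle_measure. h x * of_real (v x))) \<longlonglongrightarrow> 0"
    by (intro Lim_null_comparison[OF always_eventually[OF allI[OF bound]]]) simp
  then show "(\<lambda>i. LINT x|circle_measure. h x * of_real (e i x)) \<longlonglongrightarrow> (LINT x|circle_measure. h x * of_real (v x))"
    by (simp only: LIM_zero_iff)
qed

text \<open>
  The conjugate half of \<open>2 Re g\<close> contributes to the coefficient of index zero only.
\<close>

lemma real_part_coefficient:
  assumes g: "g holomorphic_on ball 0 R" "1 < R"
  shows "(LINT x|circle_measure. cnj (circ x) ^ k * of_real (Re (g (circ x)))) =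
    (if k = 0 then of_real (Re (g 0)) else taylor_coeff g k / 2)"
proof -
  have zg: "(\<lambda>z. z ^ k * g z) holomorphic_on ball 0 R" by (intro holomorphic_intros g)
  have i1: "integrable circle_measure (\<lambda>x. g (circ x) * cnj (circ x ^ k))"
  proof -
    obtain B where B: "\<And>x. cmod (g (circ x)) \<le> B" using bounded_circ_holomorphic[OF g] by blast
    show ?thesis using measurable_circ_holomorphic[OF g] B
      by (intro circle_integrable_bounded[where B = B]) (auto simp: norm_mult norm_power)
  qed
  have i2: "integrable circle_measure (\<lambda>x. cnj (circ x ^ k * g (circ x)))"
    by (rule integrable_cnj[OF integrable_circ_holomorphic[OF zg g(2)]])
  have "(LINT x|circle_measure. cnj (circ x) ^ k * of_real (Re (g (circ x)))) =
     (LINT x|circle_measure. (1 / 2) * (g (circ x) * cnj (circ x ^ k) + cnj (circ x ^ k * g (circ x))))"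
  proof (intro Bochner_Integration.integral_cong refl)
    fix x
    have half: "complex_of_real (Re c) = (1 / 2) * (c + cnj c)" for c by (simp add: complex_add_cnj)
    show "cnj (circ x) ^ k * of_real (Re (g (circ x))) = (1 / 2) * (g (circ x) * cnj (circ x ^ k) + cnj (circ x ^ k * g (circ x)))"
      unfolding half by (simp only: complex_cnj_mult complex_cnj_power distrib_left mult_ac)
  qed
  also have "\<dots> = (1 / 2) * ((LINT x|circle_measure. g (circ x) * cnj (circ x ^ k)) + (LINT x|circle_measure. cnj (circ x ^ k * g (circ x))))"
    unfolding integral_mult_right_zero Bochner_Integration.integral_add[OF i1 i2] ..
  also have "\<dots> = (1 / 2) * (taylor_coeff g k + cnj (0 ^ k * g 0))"
    unfolding circle_mean_character[OF g] Bochner_Integration.integral_cnj circle_mean[OF zg g(2)] ..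
  also have "\<dots> = (if k = 0 then of_real (Re (g 0)) else taylor_coeff g k / 2)"
    by (simp add: complex_add_cnj)
  finally show ?thesis .
qed

lemma log_fourier_coeff_circle:
  assumes [measurable]: "w \<in> borel_measurable borel"
  shows "log_fourier_coeff w (int k) = (LINT x|circle_measure. cnj (circ x) ^ k * of_real (ln (w x)))"
    and "log_fourier_coeff w (- int k) = cnj (log_fourier_coeff w (int k))"
proof -
  have e: "exp (- 2 * \<i> * of_int (int k) * of_real x) = cnj (circ x) ^ k" for x
  proof -
    have "cnj (circ x) ^ k = cnj (cis (2 * real k * x))" by (simp add: circ_power[symmetric])
    also have "\<dots> = exp (- 2 * \<i> * of_int (int k) * of_real x)" by (simp add: cis_conv_exp exp_cnj mult_ac)
    finally show ?thesis ..
  qed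
  have e': "exp (- 2 * \<i> * of_int (- int k) * of_real x) = circ x ^ k" for x
    unfolding circ_power by (simp add: cis_conv_exp mult_ac)
  show 1: "log_fourier_coeff w (int k) = (LINT x|circle_measure. cnj (circ x) ^ k * of_real (ln (w x)))"
    unfolding log_fourier_coeff_def e by (subst circle_integral(1)) (simp_all add: scaleR_conv_of_real)
  have "log_fourier_coeff w (- int k) = (LINT x|circle_measure. circ x ^ k * of_real (ln (w x)))"
    unfolding log_fourier_coeff_def e' by (subst circle_integral(1)) (simp_all add: scaleR_conv_of_real)
  also have "\<dots> = cnj (LINT x|circle_measure. cnj (circ x) ^ k * of_real (ln (w x)))"
    by (subst Bochner_Integration.integral_cnj[symmetric]) simp
  finally show "log_fourier_coeff w (- int k) = cnj (log_fourier_coeff w (int k))" unfolding 1 .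
qed

lemma log_fourier_summable_iff:
  assumes "w \<in> borel_measurable borel"
  shows "(\<lambda>k::int. \<bar>real_of_int k\<bar> * (cmod (log_fourier_coeff w k))\<^sup>2) summable_on UNIV \<longleftrightarrow>
    (\<exists>D. \<forall>n. (\<Sum>k\<le>n. real k * (cmod (log_fourier_coeff w (int k)))\<^sup>2) \<le> D)"
    (is "?f summable_on UNIV \<longleftrightarrow> ?B")
proof
  assume s: "?f summable_on UNIV"
  have "(\<Sum>k\<le>n. real k * (cmod (log_fourier_coeff w (int k)))\<^sup>2) \<le> infsum ?f UNIV" for n
  proof -
    have "(\<Sum>k\<le>n. real k * (cmod (log_fourier_coeff w (int k)))\<^sup>2) = sum ?f (int ` {..n})"
      by (subst sum.reindex) auto
    also have "\<dots> \<le> infsum ?f UNIV" by (rule finite_sum_le_infsum[OF s]) auto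
    finally show ?thesis .
  qed
  then show ?B by blast
next
  assume ?B
  then obtain D where D: "\<And>n. (\<Sum>k\<le>n. real k * (cmod (log_fourier_coeff w (int k)))\<^sup>2) \<le> D" by blast
  have "sum ?f F \<le> 2 * D" if F: "finite F" for F
  proof -
    define n where "n = (\<Sum>k\<in>F. nat \<bar>k\<bar>)"
    have sub: "F \<subseteq> int ` {..n} \<union> (\<lambda>k. - int k) ` {..n}"
    proof
      fix k assume k: "k \<in> F"
      have n: "nat \<bar>k\<bar> \<le> n" unfolding n_def by (rule member_le_sum[OF k]) (use F in auto)
      show "k \<in> int ` {..n} \<union> (\<lambda>k. - int k) ` {..n}"
      proof (cases "k \<ge> 0")
        case True
        then have "k = int (nat \<bar>k\<bar>)" by simp
        then show ?thesis using n by blast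
      next
        case False
        then have "k = - int (nat \<bar>k\<bar>)" by simp
        then show ?thesis using n by blast
      qed
    qed
    have "sum ?f F \<le> sum ?f (int ` {..n} \<union> (\<lambda>k. - int k) ` {..n})"
      by (rule sum_mono2[OF _ sub]) auto
    also have "\<dots> \<le> sum ?f (int ` {..n}) + sum ?f ((\<lambda>k. - int k) ` {..n})"
    proof -
      have "sum ?f (int ` {..n} \<inter> (\<lambda>k. - int k) ` {..n}) \<ge> 0" by (intro sum_nonneg) simp
      then show ?thesis using sum.union_inter[of "int ` {..n}" "(\<lambda>k. - int k) ` {..n}" ?f] by simp
    qed
    also have "sum ?f (int ` {..n}) = (\<Sum>k\<le>n. real k * (cmod (log_fourier_coeff w (int k)))\<^sup>2)"
      by (subst sum.reindex) auto
    also have "sum ?f ((\<lambda>k. - int k) ` {..n}) = (\<Sum>k\<le>n. real k * (cmod (log_fourier_coeff w (int k)))\<^sup>2)"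
      by (subst sum.reindex) (auto simp: inj_on_def log_fourier_coeff_circle(2)[OF assms])
    finally show ?thesis using D[of n] by simp
  qed
  then show "?f summable_on UNIV"
    by (intro nonneg_bdd_above_summable_on) (auto simp: bdd_above_def)
qed

section \<open>Summable parameters give a Sobolev density\<close>

context schur_parameters
begin

text \<open>
  A constant, a multiple of \<open>2\<pi>\<i>\<close>, corrects the value at the origin so that it is the same for all \<open>n\<close>.
\<close>

lemma normalized_logarithm:
  "\<exists>R g. R > 1 \<and> g holomorphic_on ball 0 R \<and> g 0 = Ln (1 - \<gamma> 0) \<and>
     (\<forall>z. cmod z < R \<longrightarrow> exp (g z) = poly (phi_star \<gamma> n) z) \<and>
     (\<lambda>k. real k * (cmod (taylor_coeff g k))\<^sup>2) sums - (\<Sum>k=1..n. real k * ln (1 - (cmod (\<gamma> k))\<^sup>2))"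
proof -
  obtain R g where R: "R > 1" and g: "g holomorphic_on ball 0 R"
    and eg: "\<And>z. cmod z < R \<Longrightarrow> exp (g z) = poly (phi_star \<gamma> n) z"
    using dirichlet_identity_ex[of n] by blast
  define h where "h z = g z + (Ln (1 - \<gamma> 0) - g 0)" for z
  have h: "h holomorphic_on ball 0 R" unfolding h_def by (intro holomorphic_intros g)
  have "exp (g 0) = 1 - \<gamma> 0" using eg[of 0] R by (simp add: phi_star_at_0)
  then have "exp (Ln (1 - \<gamma> 0) - g 0) = 1" using \<gamma>_neq_1(2)[of 0] by (simp add: exp_diff)
  then have eh: "exp (h z) = 1 * poly (phi_star \<gamma> n) z" if "cmod z < R" for z
    unfolding h_def exp_add using eg[OF that] by simp
  have "(\<lambda>k. real k * (cmod (taylor_coeff h k))\<^sup>2) sums - (\<Sum>k=1..n. real k * ln (1 - (cmod (\<gamma> k))\<^sup>2))"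
    by (rule dirichlet_identity[OF h _ _ eh]) (use R in auto)
  moreover have "h 0 = Ln (1 - \<gamma> 0)" by (simp add: h_def)
  ultimately show ?thesis using R h eh by auto
qed

lemma weighted_log_bounded:
  assumes s: "summable (\<lambda>k. real k * (cmod (\<gamma> k))\<^sup>2)"
  obtains D where "\<And>n. - (\<Sum>k=1..n. real k * ln (1 - (cmod (\<gamma> k))\<^sup>2)) \<le> D"
proof -
  have ln0: "ln (1 - (cmod (\<gamma> k))\<^sup>2) \<le> 0" for k using \<gamma>_sq[of k] by simp
  have small: "\<forall>\<^sub>F k in sequentially. (cmod (\<gamma> k))\<^sup>2 \<le> 1 / 2"
  proof -
    have "\<forall>\<^sub>F k in sequentially. real k * (cmod (\<gamma> k))\<^sup>2 < 1 / 2"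
      using order_tendstoD(2)[OF summable_LIMSEQ_zero[OF s], of "1 / 2"] by simp
    then show ?thesis using eventually_ge_at_top[of 1]
    proof eventually_elim
      case (elim k)
      have "1 * (cmod (\<gamma> k))\<^sup>2 \<le> real k * (cmod (\<gamma> k))\<^sup>2" using elim by (intro mult_right_mono) auto
      then show ?case using elim by simp
    qed
  qed
  have "summable (\<lambda>k. - (real k * ln (1 - (cmod (\<gamma> k))\<^sup>2)))"
  proof (rule summable_comparison_test_ev)
    show "summable (\<lambda>k. 2 * (real k * (cmod (\<gamma> k))\<^sup>2))" using s by (rule summable_mult)
    show "\<forall>\<^sub>F k in sequentially. norm (- (real k * ln (1 - (cmod (\<gamma> k))\<^sup>2))) \<le> 2 * (real k * (cmod (\<gamma> k))\<^sup>2)"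
      using small
    proof eventually_elim
      case (elim k)
      define t where "t = (cmod (\<gamma> k))\<^sup>2"
      have t: "0 \<le> t" "t \<le> 1 / 2" using elim by (auto simp: t_def)
      have "- t - 2 * t\<^sup>2 \<le> ln (1 - t)" by (rule ln_one_minus_pos_lower_bound) (use t in auto)
      moreover have "2 * t\<^sup>2 \<le> t" using mult_left_mono[OF t(2) t(1)] by (simp add: power2_eq_square)
      ultimately have "- ln (1 - t) \<le> 2 * t" by linarith
      then have "real k * (- ln (1 - t)) \<le> real k * (2 * t)" by (intro mult_left_mono) auto
      moreover have "norm (- (real k * ln (1 - t))) = real k * (- ln (1 - t))"
        using ln0[of k] by (simp add: t_def abs_mult)
      ultimately show ?case unfolding t_def by simp
    qed
  qed
  then have "(\<Sum>k=1..n. - (real k * ln (1 - (cmod (\<gamma> k))\<^sup>2))) \<le> (\<Sum>k. - (real k * ln (1 - (cmod (\<gamma> k))\<^sup>2)))" for n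
    using ln0 by (intro sum_le_suminf) (auto simp: mult_nonneg_nonpos)
  then show ?thesis by (intro that) (simp add: sum_negf)
qed

text \<open>
  As \<open>k \<ge> 1\<close> in the weighted sum, it also bounds the logarithm of the decreasing products from below.
\<close>

lemma defect_convergent:
  assumes D: "\<And>n. - (\<Sum>k=1..n. real k * ln (1 - (cmod (\<gamma> k))\<^sup>2)) \<le> D"
  obtains K where "K > 0" "defect \<gamma> \<longlonglongrightarrow> K"
proof -
  define \<kappa> where "\<kappa> = defect \<gamma> 0 * exp (- D)"
  have "\<kappa> \<le> defect \<gamma> n" for n
  proof -
    have "defect \<gamma> n = defect \<gamma> 0 * exp (\<Sum>k=1..n. ln (1 - (cmod (\<gamma> k))\<^sup>2))"
    proof (induction n)
      case (Suc n)
      then show ?case using \<gamma>_sq(2)[of "Suc n"] by (simp add: defect_Suc exp_add)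
    qed simp
    moreover have "- D \<le> (\<Sum>k=1..n. ln (1 - (cmod (\<gamma> k))\<^sup>2))"
    proof -
      have "(\<Sum>k=1..n. real k * ln (1 - (cmod (\<gamma> k))\<^sup>2)) \<le> (\<Sum>k=1..n. ln (1 - (cmod (\<gamma> k))\<^sup>2))"
      proof (rule sum_mono)
        fix k assume "k \<in> {1..n}"
        then have "real k * ln (1 - (cmod (\<gamma> k))\<^sup>2) \<le> 1 * ln (1 - (cmod (\<gamma> k))\<^sup>2)"
          using \<gamma>_sq[of k] by (intro mult_right_mono_neg) auto
        then show "real k * ln (1 - (cmod (\<gamma> k))\<^sup>2) \<le> ln (1 - (cmod (\<gamma> k))\<^sup>2)" by simp
      qed
      then show ?thesis using D[of n] by linarith
    qed
    ultimately show ?thesis unfolding \<kappa>_def using defect_pos[of 0] by simp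
  qed
  moreover have "decseq (defect \<gamma>)"
  proof (rule decseq_SucI)
    show "defect \<gamma> (Suc n) \<le> defect \<gamma> n" for n
      unfolding defect_Suc using defect_pos[of n] \<gamma>_sq[of "Suc n"] by (intro mult_left_le) auto
  qed
  ultimately obtain K where K: "defect \<gamma> \<longlonglongrightarrow> K"
    using decseq_convergent[of "defect \<gamma>" \<kappa>] by metis
  have "\<kappa> \<le> K" using \<open>\<And>n. \<kappa> \<le> defect \<gamma> n\<close> by (intro LIMSEQ_le_const[OF K]) auto
  moreover have "\<kappa> > 0" unfolding \<kappa>_def using defect_pos[of 0] by simp
  ultimately show ?thesis using K by (intro that) auto
qed

text \<open>
  The logarithms of the polynomials are bounded in the Dirichlet norm. A subsequence of their real
  parts and of the weights converges in the mean, and the limit inherits the Dirichlet bound.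
\<close>

lemma summable_parameters_sobolev_density:
  assumes s: "summable (\<lambda>k. real k * (cmod (\<gamma> k))\<^sup>2)"
  obtains w where "log_sobolev_density w" "integrable circle_measure w"
    "\<And>\<zeta>. cmod \<zeta> < 1 \<Longrightarrow> Re (carath \<gamma> \<zeta>) = (LINT x|circle_measure. w x * Re (herglotz_kernel \<zeta> x))"
proof -
  obtain D where D: "\<And>n. - (\<Sum>k=1..n. real k * ln (1 - (cmod (\<gamma> k))\<^sup>2)) \<le> D"
    using weighted_log_bounded[OF s] by blast
  obtain K where K: "K > 0" "defect \<gamma> \<longlonglongrightarrow> K" using defect_convergent[OF D] by blast
  define P where "P n R g \<longleftrightarrow> R > 1 \<and> g holomorphic_on ball 0 R \<and> g 0 = Ln (1 - \<gamma> 0) \<and>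
     (\<forall>z. cmod z < R \<longrightarrow> exp (g z) = poly (phi_star \<gamma> n) z) \<and>
     (\<lambda>k. real k * (cmod (taylor_coeff g k))\<^sup>2) sums - (\<Sum>k=1..n. real k * ln (1 - (cmod (\<gamma> k))\<^sup>2))" for n R g
  have "\<exists>R g. P n R g" for n unfolding P_def by (rule normalized_logarithm)
  then obtain R g where "\<And>n. P n (R n) (g n)" by metis
  then have Rg: "\<And>n. R n > 1" "\<And>n. g n holomorphic_on ball 0 (R n)" "\<And>n. g n 0 = Ln (1 - \<gamma> 0)"
    "\<And>n z. cmod z < R n \<Longrightarrow> exp (g n z) = poly (phi_star \<gamma> n) z"
    "\<And>n. (\<lambda>k. real k * (cmod (taylor_coeff (g n) k))\<^sup>2) sums - (\<Sum>k=1..n. real k * ln (1 - (cmod (\<gamma> k))\<^sup>2))"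
    unfolding P_def by blast+
  have gD: "(\<Sum>k\<le>m. real k * (cmod (taylor_coeff (g n) k))\<^sup>2) \<le> D" for n m
  proof -
    have "(\<Sum>k\<le>m. real k * (cmod (taylor_coeff (g n) k))\<^sup>2) \<le> (\<Sum>k. real k * (cmod (taylor_coeff (g n) k))\<^sup>2)"
      by (rule sum_le_suminf[OF sums_summable[OF Rg(5)]]) auto
    then show ?thesis using sums_unique[OF Rg(5)[of n]] D[of n] by linarith
  qed
  obtain r u where r: "strict_mono (r :: nat \<Rightarrow> nat)" and u [measurable]: "u \<in> borel_measurable borel"
    and per: "\<And>x. u (x + pi) = u x" and iu: "integrable circle_measure u"
    and Lu: "(\<lambda>i. LINT x|circle_measure. \<bar>Re (g (r i) (circ x)) - u x\<bar>) \<longlonglongrightarrow> 0"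
    and ie: "integrable circle_measure (\<lambda>x. exp (- 2 * u x))"
    and Le: "(\<lambda>i. LINT x|circle_measure. \<bar>exp (- 2 * Re (g (r i) (circ x))) - exp (- 2 * u x)\<bar>) \<longlonglongrightarrow> 0"
    by (rule dirichlet_bounded_subsequence[of g R, OF Rg(2,1,3) gD]) (rule that)
  define w where "w x = K * exp (- 2 * u x)" for x
  have w [measurable]: "w \<in> borel_measurable borel" unfolding w_def by measurable
  have wpos: "w x > 0" for x using K by (simp add: w_def)
  have lnw: "ln (w x) = ln K - 2 * u x" for x using K by (simp add: w_def ln_mult)
  have iw: "integrable circle_measure w" unfolding w_def using ie by simp
  have weight: "bernstein_szego_weight \<gamma> n x = defect \<gamma> n * exp (- 2 * Re (g n (circ x)))" for n x
  proof -
    have "cmod (poly (phi_star \<gamma> n) (circ x)) = exp (Re (g n (circ x)))"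
      using Rg(4)[of "circ x" n] Rg(1)[of n] norm_exp_eq_Re[of "g n (circ x)"] by simp
    then show ?thesis unfolding bernstein_szego_weight_def by (simp add: exp_minus field_simps flip: exp_double)
  qed
  have ig: "integrable circle_measure (\<lambda>x. Re (g n (circ x)))" for n
    using integrable_circ_holomorphic[OF Rg(2,1)] by simp
  have ieg: "integrable circle_measure (\<lambda>x. exp (- 2 * Re (g n (circ x))))" for n
  proof -
    have "(\<lambda>x. bernstein_szego_weight \<gamma> n x / defect \<gamma> n) = (\<lambda>x. exp (- 2 * Re (g n (circ x))))"
      unfolding weight using defect_pos[of n] by simp
    then show ?thesis using integrable_divide[OF weight_integrable[of n], of "defect \<gamma> n"] by simp
  qed
  have herglotz: "Re (carath \<gamma> \<zeta>) = (LINT x|circle_measure. w x * Re (herglotz_kernel \<zeta> x))" if z: "cmod \<zeta> < 1" for \<zeta>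
  proof -
    note pair = L1_pairing[OF ieg ie measurable_herglotz_kernel norm_herglotz_kernel_le[OF z] Le]
    have "(\<lambda>i. \<i> * of_real (Im ((1 + \<gamma> 0) / (1 - \<gamma> 0))) + of_real (defect \<gamma> (r i)) *
       (LINT x|circle_measure. herglotz_kernel \<zeta> x * of_real (exp (- 2 * Re (g (r i) (circ x))))))
       \<longlonglongrightarrow> \<i> * of_real (Im ((1 + \<gamma> 0) / (1 - \<gamma> 0))) + of_real K * (LINT x|circle_measure. herglotz_kernel \<zeta> x * of_real (exp (- 2 * u x)))"
      using LIMSEQ_subseq_LIMSEQ[OF K(2) r] by (intro tendsto_intros pair(1)) (simp add: comp_def)
    moreover have "carath_approx \<gamma> n \<zeta> = \<i> * of_real (Im ((1 + \<gamma> 0) / (1 - \<gamma> 0))) + of_real (defect \<gamma> n) *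
       (LINT x|circle_measure. herglotz_kernel \<zeta> x * of_real (exp (- 2 * Re (g n (circ x)))))" for n
      unfolding carath_approx_herglotz[OF z] weight
      by (simp only: of_real_mult mult.left_commute[of _ "of_real (defect \<gamma> n)"] integral_mult_right_zero)
    ultimately have "(\<lambda>i. carath_approx \<gamma> (r i) \<zeta>) \<longlonglongrightarrow>
      \<i> * of_real (Im ((1 + \<gamma> 0) / (1 - \<gamma> 0))) + of_real K * (LINT x|circle_measure. herglotz_kernel \<zeta> x * of_real (exp (- 2 * u x)))"
      by simp
    moreover have "(\<lambda>i. carath_approx \<gamma> (r i) \<zeta>) \<longlonglongrightarrow> carath \<gamma> \<zeta>"
      using LIMSEQ_subseq_LIMSEQ[OF carath_approx_tendsto[OF z] r] by (simp add: comp_def)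
    ultimately have C: "carath \<gamma> \<zeta> = \<i> * of_real (Im ((1 + \<gamma> 0) / (1 - \<gamma> 0))) +
       of_real K * (LINT x|circle_measure. herglotz_kernel \<zeta> x * of_real (exp (- 2 * u x)))"
      by (rule LIMSEQ_unique[rotated])
    have "Re (LINT x|circle_measure. herglotz_kernel \<zeta> x * of_real (exp (- 2 * u x))) =
       (LINT x|circle_measure. Re (herglotz_kernel \<zeta> x * of_real (exp (- 2 * u x))))"
      by (rule integral_Re[symmetric, OF pair(2)])
    then have "Re (carath \<gamma> \<zeta>) = K * (LINT x|circle_measure. Re (herglotz_kernel \<zeta> x * of_real (exp (- 2 * u x))))"
      unfolding C by simp
    also have "\<dots> = (LINT x|circle_measure. K * Re (herglotz_kernel \<zeta> x * of_real (exp (- 2 * u x))))"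
      by (rule integral_mult_right_zero[symmetric])
    also have "\<dots> = (LINT x|circle_measure. w x * Re (herglotz_kernel \<zeta> x))"
      by (intro Bochner_Integration.integral_cong refl) (simp add: w_def)
    finally show ?thesis .
  qed
  have coeff: "(\<lambda>i. taylor_coeff (g (r i)) k) \<longlonglongrightarrow> - log_fourier_coeff w (int k)" if k: "k \<ge> 1" for k
  proof -
    have nk: "cmod (cnj (circ x) ^ k) \<le> 1" for x by (simp add: norm_power)
    have mk: "(\<lambda>x. cnj (circ x) ^ k) \<in> borel_measurable borel" by measurable
    note pair = L1_pairing[OF ig iu mk nk Lu]
    have "(\<lambda>i. taylor_coeff (g (r i)) k / 2) \<longlonglongrightarrow> (LINT x|circle_measure. cnj (circ x) ^ k * of_real (u x))"
      using pair(1) k unfolding real_part_coefficient[OF Rg(2,1)] by simp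
    then have "(\<lambda>i. 2 * (taylor_coeff (g (r i)) k / 2)) \<longlonglongrightarrow> 2 * (LINT x|circle_measure. cnj (circ x) ^ k * of_real (u x))"
      by (intro tendsto_intros)
    moreover have "log_fourier_coeff w (int k) = - (2 * (LINT x|circle_measure. cnj (circ x) ^ k * of_real (u x)))"
    proof -
      have c: "integrable circle_measure (\<lambda>x. cnj (circ x) ^ k * of_real (ln K))"
        using nk by (intro circle_integrable_bounded[where B = "\<bar>ln K\<bar>"]) (auto simp: norm_mult norm_power)
      have z: "(LINT x|circle_measure. cnj (circ x) ^ k * complex_of_real (ln K)) = 0"
        using circ_character_integral[of 0 k] k by simp
      have "log_fourier_coeff w (int k) = (LINT x|circle_measure. cnj (circ x) ^ k * of_real (ln K) - 2 * (cnj (circ x) ^ k * of_real (u x)))"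
        unfolding log_fourier_coeff_circle[OF w] lnw by (simp add: algebra_simps)
      also have "\<dots> = 0 - 2 * (LINT x|circle_measure. cnj (circ x) ^ k * of_real (u x))"
        by (subst Bochner_Integration.integral_diff[OF c integrable_mult_right[OF pair(2)]])
          (simp only: z integral_mult_right_zero)
      finally show ?thesis by simp
    qed
    ultimately show ?thesis by simp
  qed
  have "(\<Sum>k\<le>m. real k * (cmod (log_fourier_coeff w (int k)))\<^sup>2) \<le> D" for m
  proof (rule LIMSEQ_le_const2)
    show "(\<lambda>i. \<Sum>k\<le>m. real k * (cmod (taylor_coeff (g (r i)) k))\<^sup>2) \<longlonglongrightarrow> (\<Sum>k\<le>m. real k * (cmod (log_fourier_coeff w (int k)))\<^sup>2)"
    proof (rule tendsto_sum)
      fix k assume "k \<in> {..m}"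
      show "(\<lambda>i. real k * (cmod (taylor_coeff (g (r i)) k))\<^sup>2) \<longlonglongrightarrow> real k * (cmod (log_fourier_coeff w (int k)))\<^sup>2"
      proof (cases "k = 0")
        case False
        then have "(\<lambda>i. real k * (cmod (taylor_coeff (g (r i)) k))\<^sup>2) \<longlonglongrightarrow> real k * (cmod (- log_fourier_coeff w (int k)))\<^sup>2"
          by (intro tendsto_intros coeff) simp
        then show ?thesis by simp
      qed simp
    qed
    show "\<exists>N. \<forall>n\<ge>N. (\<Sum>k\<le>m. real k * (cmod (taylor_coeff (g (r n)) k))\<^sup>2) \<le> D" using gD by blast
  qed
  then have "(\<lambda>k::int. \<bar>real_of_int k\<bar> * (cmod (log_fourier_coeff w k))\<^sup>2) summable_on UNIV"
    unfolding log_fourier_summable_iff[OF w] by blast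
  moreover have "set_integrable lborel {- pi / 2..pi / 2} (\<lambda>x. ln (w x))"
    by (subst circle_integral(2)[symmetric]) (auto simp: lnw iu)
  moreover have "w (x + pi) = w x" for x by (simp add: w_def per)
  ultimately have "log_sobolev_density w"
    unfolding log_sobolev_density_def using w wpos by (auto simp: less_imp_le)
  then show ?thesis using that iw herglotz by blast
qed

end

section \<open>Spectral parts of an absolutely continuous measure\<close>

lemma emeasure_zero_outside:
  assumes "sets \<nu> = sets borel" "A \<in> sets borel" "emeasure \<nu> A = 0" "emeasure \<nu> (- A) = 0"
  shows "\<nu> = null_measure borel"
proof (rule measure_eqI)
  show "sets \<nu> = sets (null_measure borel)" using assms(1) by simp
  fix B assume B: "B \<in> sets \<nu>"
  have "emeasure \<nu> B \<le> emeasure \<nu> (A \<union> - A)" by (rule emeasure_mono) (use assms(1,2) in auto)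
  also have "\<dots> \<le> emeasure \<nu> A + emeasure \<nu> (- A)" by (rule emeasure_subadditive) (use assms(1,2) in auto)
  finally show "emeasure \<nu> B = emeasure (null_measure borel) B" using assms(3,4) by simp
qed

text \<open>
  A countable set and a Lebesgue null set are both null for an absolutely continuous measure, so the other
  two parts vanish on their carriers.
\<close>

lemma density_parts:
  assumes \<mu>: "\<mu> = density lborel (\<lambda>x. ennreal (w x))" and [measurable]: "w \<in> borel_measurable borel"
  shows "lebesgue_parts \<mu> \<mu> (null_measure borel) (null_measure borel)"
    and "lebesgue_parts \<mu> ac pp sc \<Longrightarrow> pp = null_measure borel \<and> sc = null_measure borel"
proof -
  have ac: "absolutely_continuous lborel \<mu>"
    unfolding \<mu> by (rule absolutely_continuousI_density) measurable
  show "lebesgue_parts \<mu> \<mu> (null_measure borel) (null_measure borel)"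
    unfolding lebesgue_parts_def using ac by (auto simp: \<mu> intro!: exI[of _ "{}"] bexI[of _ "{}"])
  assume L: "lebesgue_parts \<mu> ac pp sc"
  have null: "emeasure \<mu> A = 0" if "A \<in> null_sets lborel" for A
    using ac that unfolding absolutely_continuous_def by auto
  have sets: "sets pp = sets borel" "sets sc = sets borel"
    and add: "\<And>A. A \<in> sets borel \<Longrightarrow> emeasure \<mu> A = emeasure ac A + emeasure pp A + emeasure sc A"
    using L unfolding lebesgue_parts_def by auto
  obtain C S where C: "countable C" "emeasure pp (- C) = 0" and S: "S \<in> null_sets lborel" "emeasure sc (- S) = 0"
    using L unfolding lebesgue_parts_def by auto
  have Cb: "C \<in> sets borel" by (rule sets.countable[OF _ C(1)]) auto
  then have "C \<in> null_sets lborel" using emeasure_lborel_countable[OF C(1)] by (auto simp: null_sets_def)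
  then have "emeasure pp C = 0" using add[OF Cb] null by simp
  then have pp: "pp = null_measure borel" by (rule emeasure_zero_outside[OF sets(1) Cb _ C(2)])
  have Sb: "S \<in> sets borel" using S(1) by (auto simp: null_sets_def)
  have "emeasure sc S = 0" using add[OF Sb] null[OF S(1)] by simp
  then show "pp = null_measure borel \<and> sc = null_measure borel"
    using pp emeasure_zero_outside[OF sets(2) Sb _ S(2)] by simp
qed

lemma density_no_singular_spectrum:
  assumes \<mu>: "main_spectral_measure q = density lborel (\<lambda>x. ennreal (w x))" and w: "w \<in> borel_measurable borel"
  shows "sigma_p q = {}" "sigma_sc q = {}"
proof -
  note parts = density_parts[OF \<mu> w]
  have "pp_part (main_spectral_measure q) = null_measure borel"
    unfolding pp_part_def using parts by (intro the_equality) blast+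
  moreover have "sc_part (main_spectral_measure q) = null_measure borel"
    unfolding sc_part_def using parts by (intro the_equality) blast+
  moreover have "closed_support (null_measure borel) = {}"
    unfolding closed_support_def by (auto intro!: exI[of _ 1])
  ultimately show "sigma_p q = {}" "sigma_sc q = {}" unfolding sigma_p_def sigma_sc_def by simp_all
qed

section \<open>A Sobolev density has summable parameters\<close>

lemma taylor_coeff_poly: "taylor_coeff (poly p) k = coeff p k"
proof -
  have "(\<lambda>n. coeff p n * u ^ n) sums poly p u" for u
    unfolding poly_altdef by (rule sums_finite) (auto intro: coeff_eq_0)
  then have "poly p has_fps_expansion Abs_fps (coeff p)"
    by (intro has_fps_expansionI) simp
  from taylor_coeff_eq[OF this] show ?thesis by simp
qed

lemma cayley_disc:
  fixes s :: complex
  assumes "Re s > 0"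
  shows "cmod ((s - 1) / (s + 1)) < 1"
    and "(1 + (s - 1) / (s + 1)) / (1 - (s - 1) / (s + 1)) = s"
proof -
  have s: "s + 1 \<noteq> 0" using assms by (auto simp: complex_eq_iff)
  have "(cmod (s - 1))\<^sup>2 < (cmod (s + 1))\<^sup>2"
    unfolding cmod_power2 using assms by (simp add: power2_eq_square algebra_simps)
  then have "cmod (s - 1) < cmod (s + 1)" by (rule power_less_imp_less_base) simp
  then show "cmod ((s - 1) / (s + 1)) < 1" using s by (simp add: norm_divide)
  have "1 + (s - 1) / (s + 1) = s * (2 / (s + 1))" "1 - (s - 1) / (s + 1) = 2 / (s + 1)"
    using s by (simp_all add: field_simps)
  then show "(1 + (s - 1) / (s + 1)) / (1 - (s - 1) / (s + 1)) = s" using s by simp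
qed

text \<open>
  The polynomial \<open>T = e\<^bsup>G(0)\<^esup>(1 + (G - G(0))/m)\<^sup>m\<close> has for large \<open>m\<close> an explicit logarithm, close to
  \<open>G\<close> and equal to it at the origin.
\<close>

lemma polynomial_exponential:
  fixes G :: "complex poly"
  assumes e: "e > 0"
  obtains T g where "g holomorphic_on ball 0 3" "g 0 = poly G 0" "\<And>z. cmod z < 3 \<Longrightarrow> exp (g z) = poly T z"
    "\<And>z. cmod z < 3 \<Longrightarrow> cmod (g z - poly G z) \<le> e"
proof -
  define H where "H = G - [:poly G 0:]"
  have H: "poly H z = poly G z - poly G 0" for z by (simp add: H_def)
  have "compact (poly H ` cball 0 3)"
    by (intro compact_continuous_image continuous_intros compact_cball)
  then obtain M where M: "M > 0" "\<And>z. z \<in> cball 0 3 \<Longrightarrow> cmod (poly H z) \<le> M"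
    using compact_imp_bounded bounded_pos[of "poly H ` cball 0 3"] by auto
  obtain m :: nat where m: "real m > max (2 * M) (2 * M\<^sup>2 / e)" using reals_Archimedean2 by blast
  have m0: "real m > 0" and m1: "M / real m < 1 / 2" and m2: "2 * M\<^sup>2 / real m \<le> e"
    using m M(1) e by (auto simp: field_simps)
  define h where "h z = poly H z / of_nat m" for z
  have h: "cmod (h z) \<le> M / real m" if "cmod z < 3" for z
    using M(2)[of z] that m0 by (simp add: h_def norm_divide divide_right_mono)
  have pos: "Re (1 + h z) > 0" if "cmod z < 3" for z
    using h[OF that] m1 abs_Re_le_cmod[of "h z"]
    unfolding plus_complex.sel one_complex.sel by linarith
  define g where "g z = poly G 0 + of_nat m * Ln (1 + h z)" for z
  define T where "T = smult (exp (poly G 0)) ((1 + smult (1 / of_nat m) H) ^ m)"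
  show ?thesis
  proof (rule that[of g T])
    show "g holomorphic_on ball 0 3"
      unfolding g_def
    proof (intro holomorphic_intros)
      show "h holomorphic_on ball 0 3" unfolding h_def by (intro holomorphic_intros) (use m0 in auto)
      show "1 + h z \<notin> \<real>\<^sub>\<le>\<^sub>0" if "z \<in> ball 0 3" for z
        using pos[of z] that by (auto simp: complex_nonpos_Reals_iff)
    qed
    show "g 0 = poly G 0" by (simp add: g_def h_def H)
    fix z :: complex assume z: "cmod z < 3"
    have "1 + h z \<noteq> 0" using pos[OF z] by (metis less_irrefl zero_complex.sel(1))
    then show "exp (g z) = poly T z"
      unfolding g_def T_def exp_add exp_of_nat_mult by (simp add: h_def)
    have h1: "cmod (h z) < 1 / 2" using h[OF z] m1 by linarith
    have "cmod (Ln (1 + h z) - h z) \<le> (cmod (h z))\<^sup>2 / (1 - cmod (h z))"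
      by (rule Ln_approx_linear) (use h1 in linarith)
    also have "\<dots> \<le> (cmod (h z))\<^sup>2 / (1 / 2)"
      by (rule divide_left_mono) (use h1 in auto)
    also have "\<dots> \<le> (M / real m)\<^sup>2 / (1 / 2)"
      by (intro divide_right_mono power_mono h z) auto
    finally have "real m * cmod (Ln (1 + h z) - h z) \<le> real m * ((M / real m)\<^sup>2 / (1 / 2))"
      by (intro mult_left_mono) auto
    also have "\<dots> = 2 * M\<^sup>2 / real m" using m0 by (simp add: power2_eq_square)
    also have "\<dots> \<le> e" by (rule m2)
    also have "real m * cmod (Ln (1 + h z) - h z) = cmod (g z - poly G z)"
    proof -
      have "g z - poly G z = of_nat m * (Ln (1 + h z) - h z)"
        using m0 H[of z] by (simp add: g_def h_def algebra_simps)
      then show ?thesis by (simp add: norm_mult)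
    qed
    finally show "cmod (g z - poly G z) \<le> e" .
  qed
qed

lemma exp_real_part_integrable:
  assumes g: "g holomorphic_on ball 0 R" "1 < R"
  shows "integrable circle_measure (\<lambda>x. exp (- 2 * Re (g (circ x))))"
    and "(LINT x|circle_measure. exp (- 2 * Re (g (circ x)))) > 0"
proof -
  obtain B where B: "\<And>x. cmod (g (circ x)) \<le> B" using bounded_circ_holomorphic[OF g] by blast
  have b: "- Re (g (circ x)) \<le> B \<and> Re (g (circ x)) \<le> B" for x
    using B[of x] abs_Re_le_cmod[of "g (circ x)"] by linarith
  have [measurable]: "(\<lambda>x. g (circ x)) \<in> borel_measurable borel" by (rule measurable_circ_holomorphic[OF g])
  show i: "integrable circle_measure (\<lambda>x. exp (- 2 * Re (g (circ x))))"
    using b by (intro circle_integrable_bounded[where B = "exp (2 * B)"]) auto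
  have "(LINT x|circle_measure. exp (- 2 * B)) \<le> (LINT x|circle_measure. exp (- 2 * Re (g (circ x))))"
    by (rule integral_mono[OF _ i]) (use b in auto)
  then have "exp (- 2 * B) \<le> (LINT x|circle_measure. exp (- 2 * Re (g (circ x))))"
    using circle.prob_space by simp
  then show "(LINT x|circle_measure. exp (- 2 * Re (g (circ x)))) > 0" using exp_gt_zero[of "- 2 * B"] by linarith
qed

text \<open>
  A zero-free polynomial is, up to a factor, one of the polynomials of a finite sequence of
  parameters, whose Bernstein--Szego weight is the reciprocal of its squared modulus. The parameter
  of index zero prescribes the value of the Caratheodory function at the origin.
\<close>

lemma parameters_of_exponential:
  assumes g: "g holomorphic_on ball 0 R" "1 < R" and T: "\<And>z. cmod z < R \<Longrightarrow> exp (g z) = poly T z"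
  obtains \<Gamma> n where "schur_parameters \<Gamma>" "\<And>k. k > n \<Longrightarrow> \<Gamma> k = 0"
    "\<And>\<zeta>. cmod \<zeta> < 1 \<Longrightarrow> carath \<Gamma> \<zeta> = \<i> * of_real b +
       (LINT x|circle_measure. herglotz_kernel \<zeta> x * of_real (exp (- 2 * Re (g (circ x)))))"
    "(\<lambda>k. real k * (cmod (taylor_coeff g k))\<^sup>2) sums - (\<Sum>k=1..n. real k * ln (1 - (cmod (\<Gamma> k))\<^sup>2))"
proof -
  define \<tau> where "\<tau> = (LINT x|circle_measure. exp (- 2 * Re (g (circ x))))"
  have \<tau>: "\<tau> > 0" unfolding \<tau>_def by (rule exp_real_part_integrable(2)[OF g])
  define s where "s = of_real \<tau> + \<i> * of_real b"
  have s: "Re s = \<tau>" "Im s = b" by (simp_all add: s_def)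
  define \<gamma>\<^sub>0 where "\<gamma>\<^sub>0 = (s - 1) / (s + 1)"
  have \<gamma>0: "cmod \<gamma>\<^sub>0 < 1" "(1 + \<gamma>\<^sub>0) / (1 - \<gamma>\<^sub>0) = s" unfolding \<gamma>\<^sub>0_def using cayley_disc[of s] \<tau> s by simp_all
  have T0: "poly T z \<noteq> 0" if "cmod z \<le> 1" for z using T[of z] that g(2) exp_not_eq_zero[of "g z"] by simp
  have ne: "1 - \<gamma>\<^sub>0 \<noteq> 0" using \<gamma>0(1) by auto
  define c where "c = (1 - \<gamma>\<^sub>0) / poly T 0"
  have c: "c \<noteq> 0" using ne T0[of 0] by (simp add: c_def)
  obtain \<Gamma> where \<Gamma>: "schur_parameters \<Gamma>" "\<Gamma> 0 = \<gamma>\<^sub>0" "phi_star \<Gamma> (degree T) = smult c T" "\<And>k. k > degree T \<Longrightarrow> \<Gamma> k = 0"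
    using inverse_szego[of "smult c T" "degree T" \<gamma>\<^sub>0] c T0 \<gamma>0(1) by (auto simp: c_def)
  interpret \<Gamma>: schur_parameters \<Gamma> by fact
  define n where "n = degree T"
  have weight: "bernstein_szego_weight \<Gamma> n x = exp (- 2 * Re (g (circ x)))" for x
  proof -
    define K where "K = defect \<Gamma> n / (cmod c)\<^sup>2"
    have K: "bernstein_szego_weight \<Gamma> n x = K * exp (- 2 * Re (g (circ x)))" for x
    proof -
      have "cmod (poly T (circ x)) = exp (Re (g (circ x)))"
        using T[of "circ x"] g(2) norm_exp_eq_Re[of "g (circ x)"] by simp
      then have "(cmod (poly (phi_star \<Gamma> n) (circ x)))\<^sup>2 = (cmod c)\<^sup>2 * exp (2 * Re (g (circ x)))"
        unfolding n_def \<Gamma>(3) by (simp add: norm_mult power_mult_distrib flip: exp_double)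
      then show ?thesis unfolding bernstein_szego_weight_def K_def by (simp add: exp_minus divide_simps)
    qed
    have "\<tau> = Re ((1 + \<Gamma> 0) / (1 - \<Gamma> 0))" unfolding \<Gamma>(2) \<gamma>0(2) by (simp add: s)
    also have "\<dots> = K * \<tau>" unfolding \<Gamma>.weight_mean[of n, symmetric] K \<tau>_def by simp
    finally have "K = 1" using \<tau> by simp
    then show ?thesis using K by simp
  qed
  show ?thesis
  proof (rule that[of \<Gamma> n])
    show "schur_parameters \<Gamma>" by fact
    show "\<Gamma> k = 0" if "k > n" for k using \<Gamma>(4) that by (simp add: n_def)
    fix \<zeta> :: complex assume z: "cmod \<zeta> < 1"
    have "carath \<Gamma> \<zeta> = carath_approx \<Gamma> n \<zeta>" by (rule carath_stationary) (use \<Gamma>(4) in \<open>simp add: n_def\<close>)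
    then show "carath \<Gamma> \<zeta> = \<i> * of_real b + (LINT x|circle_measure. herglotz_kernel \<zeta> x * of_real (exp (- 2 * Re (g (circ x)))))"
      unfolding \<Gamma>.carath_approx_herglotz[OF z, of n] weight \<Gamma>(2) \<gamma>0(2) s(2) .
  next
    show "(\<lambda>k. real k * (cmod (taylor_coeff g k))\<^sup>2) sums - (\<Sum>k=1..n. real k * ln (1 - (cmod (\<Gamma> k))\<^sup>2))"
    proof (rule \<Gamma>.dirichlet_identity[OF g(1), of "inverse c"])
      show "exp (g z) = inverse c * poly (phi_star \<Gamma> n) z" if "cmod z < R" for z
        unfolding n_def \<Gamma>(3) using T[OF that] c by simp
    qed (use g(2) c in auto)
  qed
qed

text \<open>
  The inequality \<open>t \<le> - ln (1 - t)\<close>, term by term; both sums only see the indices from \<open>1\<close> to \<open>n\<close>.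
\<close>

lemma weighted_parameters_le:
  assumes "schur_parameters \<Gamma>" "\<And>k. k > n \<Longrightarrow> \<Gamma> k = 0"
  shows "(\<Sum>k\<le>m. real k * (cmod (\<Gamma> k))\<^sup>2) \<le> - (\<Sum>k=1..n. real k * ln (1 - (cmod (\<Gamma> k))\<^sup>2))"
proof -
  interpret schur_parameters \<Gamma> by fact
  define F where "F k = - (real k * ln (1 - (cmod (\<Gamma> k))\<^sup>2))" for k
  have F: "real k * (cmod (\<Gamma> k))\<^sup>2 \<le> F k" for k
  proof -
    have "ln (1 - (cmod (\<Gamma> k))\<^sup>2) \<le> - (cmod (\<Gamma> k))\<^sup>2"
      using ln_le_minus_one[OF \<gamma>_sq(2)[of k]] by simp
    then show ?thesis unfolding F_def using mult_left_mono[of _ "- (cmod (\<Gamma> k))\<^sup>2" "real k"] by fastforce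
  qed
  have F0: "F k \<ge> 0" for k using order_trans[OF _ F[of k]] by simp
  have "(\<Sum>k\<le>m. real k * (cmod (\<Gamma> k))\<^sup>2) \<le> (\<Sum>k\<le>m. F k)" by (intro sum_mono F)
  also have "\<dots> = (\<Sum>k\<in>{..m} \<inter> {1..n}. F k)"
  proof (rule sum.mono_neutral_right)
    show "\<forall>k\<in>{..m} - {..m} \<inter> {1..n}. F k = 0"
    proof
      fix k assume "k \<in> {..m} - {..m} \<inter> {1..n}"
      then have "k = 0 \<or> k > n" by auto
      then show "F k = 0" using assms(2)[of k] by (auto simp: F_def)
    qed
  qed auto
  also have "\<dots> \<le> (\<Sum>k=1..n. F k)" using F0 by (intro sum_mono2) auto
  finally show ?thesis by (simp add: F_def sum_negf)
qed

context schur_parameters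
begin

text \<open>
  The partial sums of the Fourier series of \<open>- ln w\<close> are twice the real parts of polynomials with bounded
  Dirichlet norms; up to small errors these have zero-free polynomials as exponentials. The weights of the
  corresponding finite sequences of parameters tend to \<open>w\<close> in the mean: the compactness theorem provides a
  limit, and its logarithm has the Fourier coefficients of \<open>ln w\<close>. Then the Caratheodory functions converge,
  hence the parameters, and the bound of the weighted sums, which is the Dirichlet bound, survives.
\<close>

lemma sobolev_density_summable_parameters:
  assumes w: "log_sobolev_density w" and iw: "integrable circle_measure w"
    and C: "\<And>\<zeta>. cmod \<zeta> < 1 \<Longrightarrow> carath \<gamma> \<zeta> = \<i> * of_real (Im ((1 + \<gamma> 0) / (1 - \<gamma> 0))) +
       (LINT x|circle_measure. herglotz_kernel \<zeta> x * of_real (w x))"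
  shows "summable (\<lambda>k. real k * (cmod (\<gamma> k))\<^sup>2)"
proof -
  have wm [measurable]: "w \<in> borel_measurable borel" and wpos: "AE x in circle_measure. w x > 0"
    and lnint: "integrable circle_measure (\<lambda>x. ln (w x))"
    using w AE_circle[of "\<lambda>x. w x > 0"] unfolding log_sobolev_density_def by (auto simp: circle_integral(2))
  define L where "L k = log_fourier_coeff w (int k)" for k
  obtain D where D: "\<And>n. (\<Sum>k\<le>n. real k * (cmod (L k))\<^sup>2) \<le> D"
    using w unfolding log_sobolev_density_def L_def log_fourier_summable_iff[OF wm] by blast
  have L0: "L 0 = of_real (Re (L 0))" unfolding L_def log_fourier_coeff_circle(1)[OF wm] by simp
  \<comment> \<open>twice the real part of the polynomial with coefficients a is the partial sum for - ln w\<close>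
  define a where "a k = (if k = 0 then - L 0 / 2 else - L k)" for k
  define G where "G N = (\<Sum>k\<le>N. monom (a k) k)" for N :: nat
  have G: "coeff (G N) k = (if k \<le> N then a k else 0)" for N k
    unfolding G_def by (simp add: coeff_sum sum.delta coeff_monom)
  define P where "P N T g \<longleftrightarrow> g holomorphic_on ball 0 3 \<and> g 0 = poly (G N) 0 \<and> (\<forall>z. cmod z < 3 \<longrightarrow> exp (g z) = poly T z) \<and>
    (\<forall>z. cmod z < 3 \<longrightarrow> cmod (g z - poly (G N) z) \<le> inverse (real (Suc N)))" for N T g
  have "\<exists>T g. P N T g" for N
    using polynomial_exponential[of "inverse (real (Suc N))" "G N"] unfolding P_def by (metis inverse_positive_iff_positive of_nat_0_less_iff zero_less_Suc)
  then obtain T g where "\<And>N. P N (T N) (g N)" by metis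
  then have hol: "\<And>N. g N holomorphic_on ball 0 3" and g0: "\<And>N. g N 0 = poly (G N) 0"
    and eg: "\<And>N z. cmod z < 3 \<Longrightarrow> exp (g N z) = poly (T N) z"
    and close: "\<And>N z. cmod z < 3 \<Longrightarrow> cmod (g N z - poly (G N) z) \<le> inverse (real (Suc N))"
    unfolding P_def by blast+
  define \<delta> where "\<delta> N k = taylor_coeff (\<lambda>z. g N z - poly (G N) z) k" for N k
  have coeff: "taylor_coeff (g N) k = coeff (G N) k + \<delta> N k" for N k
    unfolding \<delta>_def by (subst taylor_coeff_diff[OF hol]) (auto simp: taylor_coeff_poly intro!: holomorphic_intros)
  have \<delta>: "cmod (\<delta> N k) \<le> inverse (real (Suc N)) / 2 ^ k" for N k
  proof -
    have h: "(\<lambda>z. g N z - poly (G N) z) holomorphic_on ball 0 3" by (intro holomorphic_intros hol)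
    have "cmod ((deriv ^^ k) (\<lambda>z. g N z - poly (G N) z) 0) \<le> fact k * inverse (real (Suc N)) / 2 ^ k"
    proof (rule Cauchy_inequality)
      show "(\<lambda>z. g N z - poly (G N) z) holomorphic_on ball 0 2" by (rule holomorphic_on_subset[OF h]) auto
      show "continuous_on (cball 0 2) (\<lambda>z. g N z - poly (G N) z)"
        by (rule holomorphic_on_imp_continuous_on[OF holomorphic_on_subset[OF h]]) auto
      show "cmod (g N x - poly (G N) x) \<le> inverse (real (Suc N))" if "cmod (0 - x) = 2" for x
        by (rule close) (use that in simp)
    qed simp
    then show ?thesis unfolding \<delta>_def taylor_coeff_def
      by (simp only: norm_divide norm_fact) (simp add: field_simps)
  qed
  have \<delta>': "real k * (cmod (\<delta> N k))\<^sup>2 \<le> (1 / 2) ^ k" for N k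
  proof -
    have "inverse (real (Suc N)) \<le> 1" by (simp add: inverse_le_1_iff)
    then have "cmod (\<delta> N k) \<le> 1 / 2 ^ k" using order_trans[OF \<delta>[of N k] divide_right_mono[of _ 1]] by simp
    then have "(cmod (\<delta> N k))\<^sup>2 \<le> (1 / 2 ^ k)\<^sup>2" by (rule power_mono) simp
    moreover have "real k \<le> 2 ^ k" using of_nat_less_two_power[of k, where 'a = real] by simp
    ultimately have "real k * (cmod (\<delta> N k))\<^sup>2 \<le> 2 ^ k * (1 / 2 ^ k)\<^sup>2" by (intro mult_mono) auto
    also have "\<dots> = (1 / 2) ^ k" by (simp add: power2_eq_square power_one_over)
    finally show ?thesis .
  qed
  define D' where "D' = 2 * D + 4"
  have bound: "(\<Sum>k\<le>n. real k * (cmod (taylor_coeff (g N) k))\<^sup>2) \<le> D'" for N n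
  proof -
    have summand: "real k * (cmod (taylor_coeff (g N) k))\<^sup>2 \<le> 2 * (real k * (cmod (L k))\<^sup>2) + 2 * (1 / 2) ^ k" for k
    proof -
      have sq: "(cmod (x + y))\<^sup>2 \<le> 2 * (cmod x)\<^sup>2 + 2 * (cmod y)\<^sup>2" for x y
      proof -
        have "(cmod (x + y))\<^sup>2 \<le> (cmod x + cmod y)\<^sup>2" by (intro power_mono norm_triangle_ineq) simp
        also have "\<dots> \<le> 2 * (cmod x)\<^sup>2 + 2 * (cmod y)\<^sup>2"
          using sum_squares_bound[of "cmod x" "cmod y"] by (simp add: power2_sum)
        finally show ?thesis .
      qed
      have c: "real k * (cmod (coeff (G N) k))\<^sup>2 \<le> real k * (cmod (L k))\<^sup>2"
        by (cases "k = 0") (auto simp: G a_def)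
      have "real k * (cmod (taylor_coeff (g N) k))\<^sup>2 \<le> real k * (2 * (cmod (coeff (G N) k))\<^sup>2 + 2 * (cmod (\<delta> N k))\<^sup>2)"
        unfolding coeff by (intro mult_left_mono sq) simp
      also have "\<dots> = 2 * (real k * (cmod (coeff (G N) k))\<^sup>2) + 2 * (real k * (cmod (\<delta> N k))\<^sup>2)" by (simp add: algebra_simps)
      also have "\<dots> \<le> 2 * (real k * (cmod (L k))\<^sup>2) + 2 * (1 / 2) ^ k"
        using c \<delta>'[of k N] by linarith
      finally show ?thesis .
    qed
    have geo: "(\<Sum>k\<le>n. (1 / 2 :: real) ^ k) \<le> 2"
    proof -
      have "(\<Sum>k\<le>n. (1 / 2 :: real) ^ k) \<le> (\<Sum>k. (1 / 2) ^ k)"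
        by (rule sum_le_suminf) (auto intro: summable_geometric)
      then show ?thesis using suminf_geometric[of "1 / 2 :: real"] by simp
    qed
    have "(\<Sum>k\<le>n. real k * (cmod (taylor_coeff (g N) k))\<^sup>2) \<le> (\<Sum>k\<le>n. 2 * (real k * (cmod (L k))\<^sup>2) + 2 * (1 / 2) ^ k)"
      by (intro sum_mono summand)
    also have "\<dots> = 2 * (\<Sum>k\<le>n. real k * (cmod (L k))\<^sup>2) + 2 * (\<Sum>k\<le>n. (1 / 2) ^ k)"
      by (simp only: sum.distrib sum_distrib_left)
    finally show ?thesis using D[of n] geo unfolding D'_def by linarith
  qed
  have g0': "g N 0 = a 0" for N unfolding g0 poly_0_coeff_0 G by simp
  obtain r u where r: "strict_mono (r :: nat \<Rightarrow> nat)" and u [measurable]: "u \<in> borel_measurable borel"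
    and "\<And>x. u (x + pi) = u x" and iu: "integrable circle_measure u"
    and Lu: "(\<lambda>i. LINT x|circle_measure. \<bar>Re (g (r i) (circ x)) - u x\<bar>) \<longlonglongrightarrow> 0"
    and "integrable circle_measure (\<lambda>x. exp (- 2 * u x))"
    and Le: "(\<lambda>i. LINT x|circle_measure. \<bar>exp (- 2 * Re (g (r i) (circ x))) - exp (- 2 * u x)\<bar>) \<longlonglongrightarrow> 0"
    by (rule dirichlet_bounded_subsequence[of g "\<lambda>_. 3", OF hol _ g0' bound]) (simp, rule that)
  have ig: "integrable circle_measure (\<lambda>x. Re (g n (circ x)))" for n
    using integrable_circ_holomorphic[OF hol] by simp
  have \<delta>lim: "(\<lambda>N. \<delta> N k) \<longlonglongrightarrow> 0" for k
  proof (rule Lim_null_comparison[OF always_eventually LIMSEQ_inverse_real_of_nat], rule allI)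
    fix N
    have "inverse (real (Suc N)) / 2 ^ k \<le> inverse (real (Suc N)) / 1"
      by (intro divide_left_mono) auto
    then show "cmod (\<delta> N k) \<le> inverse (real (Suc N))" using \<delta>[of N k] by simp
  qed
  have clim: "(\<lambda>N. taylor_coeff (g N) k) \<longlonglongrightarrow> a k" for k
  proof -
    have "(\<lambda>N. a k + \<delta> N k) \<longlonglongrightarrow> a k + 0" by (intro tendsto_intros \<delta>lim)
    moreover have "\<forall>\<^sub>F N in sequentially. a k + \<delta> N k = taylor_coeff (g N) k"
      using eventually_ge_at_top[of k] by eventually_elim (simp add: coeff G)
    ultimately show ?thesis using Lim_transform_eventually by fastforce
  qed
  have nk: "cmod (cnj (circ x) ^ k) \<le> 1" for x k by (simp add: norm_power)
  have mk: "(\<lambda>x. cnj (circ x) ^ k) \<in> borel_measurable borel" for k by measurable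
  have rp: "(LINT x|circle_measure. cnj (circ x) ^ k * of_real (Re (g N (circ x)))) =
      (if k = 0 then of_real (Re (g N 0)) else taylor_coeff (g N) k / 2)" for N k
    by (rule real_part_coefficient[OF hol]) simp
  have ucoeff: "(LINT x|circle_measure. cnj (circ x) ^ k * of_real (u x)) = - L k / 2" for k
  proof (rule LIMSEQ_unique[OF L1_pairing(1)[OF ig iu mk nk Lu]])
    show "(\<lambda>i. LINT x|circle_measure. cnj (circ x) ^ k * of_real (Re (g (r i) (circ x)))) \<longlonglongrightarrow> - L k / 2"
    proof (cases "k = 0")
      case True
      have "of_real (Re (a 0)) = - L 0 / 2" unfolding a_def using L0 by (simp add: complex_eq_iff)
      then show ?thesis unfolding rp True g0' by simp
    next
      case False
      have "(\<lambda>i. taylor_coeff (g (r i)) k / 2) \<longlonglongrightarrow> a k / 2"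
        using LIMSEQ_subseq_LIMSEQ[OF clim r] by (intro tendsto_intros) (auto simp: comp_def)
      then show ?thesis using False by (simp add: rp a_def)
    qed
  qed
  have logw: "AE x in circle_measure. ln (w x) + 2 * u x = 0"
  proof (rule fourier_unique)
    show "integrable circle_measure (\<lambda>x. ln (w x) + 2 * u x)" using lnint iu by simp
    fix k
    have i1: "integrable circle_measure (\<lambda>x. cnj (circ x) ^ k * of_real (ln (w x)))"
      by (rule L1_pairing(2)[OF lnint lnint mk nk]) simp
    have i2: "integrable circle_measure (\<lambda>x. cnj (circ x) ^ k * of_real (u x))"
      by (rule L1_pairing(2)[OF iu iu mk nk]) simp
    have "(LINT x|circle_measure. (ln (w x) + 2 * u x) *\<^sub>R cnj (circ x) ^ k) =
       (LINT x|circle_measure. cnj (circ x) ^ k * of_real (ln (w x)) + 2 * (cnj (circ x) ^ k * of_real (u x)))"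
      by (simp add: scaleR_conv_of_real algebra_simps)
    also have "\<dots> = L k + 2 * (- L k / 2)"
      unfolding Bochner_Integration.integral_add[OF i1 integrable_mult_right[OF i2]] integral_mult_right_zero ucoeff L_def
        log_fourier_coeff_circle(1)[OF wm] ..
    finally show "(LINT x|circle_measure. (ln (w x) + 2 * u x) *\<^sub>R cnj (circ x) ^ k) = 0" by simp
  qed
  have ew: "AE x in circle_measure. exp (- 2 * u x) = w x"
    using logw wpos
  proof eventually_elim
    case (elim x)
    then have "- 2 * u x = ln (w x)" by simp
    then show ?case using elim(2) by (simp only: exp_ln)
  qed
  have Lw: "(\<lambda>i. LINT x|circle_measure. \<bar>exp (- 2 * Re (g (r i) (circ x))) - w x\<bar>) \<longlonglongrightarrow> 0"
  proof -
    have [measurable]: "(\<lambda>x. g i (circ x)) \<in> borel_measurable borel" for i by (rule measurable_circ_holomorphic[OF hol]) simp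
    have "(LINT x|circle_measure. \<bar>exp (- 2 * Re (g (r i) (circ x))) - w x\<bar>) =
       (LINT x|circle_measure. \<bar>exp (- 2 * Re (g (r i) (circ x))) - exp (- 2 * u x)\<bar>)" for i
      by (rule integral_cong_AE; (measurable)?) (use ew in \<open>eventually_elim, simp\<close>)
    then show ?thesis using Le by simp
  qed
  define b where "b = Im ((1 + \<gamma> 0) / (1 - \<gamma> 0))"
  define S where "S i \<Gamma> n \<longleftrightarrow> schur_parameters \<Gamma> \<and> (\<forall>k>n. \<Gamma> k = 0) \<and>
    (\<forall>\<zeta>. cmod \<zeta> < 1 \<longrightarrow> carath \<Gamma> \<zeta> = \<i> * of_real b + (LINT x|circle_measure. herglotz_kernel \<zeta> x * of_real (exp (- 2 * Re (g (r i) (circ x)))))) \<and>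
    (\<lambda>k. real k * (cmod (taylor_coeff (g (r i)) k))\<^sup>2) sums - (\<Sum>k=1..n. real k * ln (1 - (cmod (\<Gamma> k))\<^sup>2))" for i \<Gamma> n
  have "\<exists>\<Gamma> n. S i \<Gamma> n" for i
  proof (rule parameters_of_exponential[where b = b and g = "g (r i)" and R = 3 and T = "T (r i)"])
    fix \<Gamma> n assume "schur_parameters \<Gamma>" "\<And>k. k > n \<Longrightarrow> \<Gamma> k = 0"
      "\<And>\<zeta>. cmod \<zeta> < 1 \<Longrightarrow> carath \<Gamma> \<zeta> = \<i> * of_real b + (LINT x|circle_measure. herglotz_kernel \<zeta> x * of_real (exp (- 2 * Re (g (r i) (circ x)))))"
      "(\<lambda>k. real k * (cmod (taylor_coeff (g (r i)) k))\<^sup>2) sums - (\<Sum>k=1..n. real k * ln (1 - (cmod (\<Gamma> k))\<^sup>2))"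
    then have "S i \<Gamma> n" unfolding S_def by (intro conjI allI impI)
    then show ?thesis by blast
  qed (use hol eg in auto)
  then obtain \<Gamma> n where "\<And>i. S i (\<Gamma> i) (n i)" by metis
  then have \<Gamma>: "\<And>i. schur_parameters (\<Gamma> i)" "\<And>i k. k > n i \<Longrightarrow> \<Gamma> i k = 0"
    "\<And>i \<zeta>. cmod \<zeta> < 1 \<Longrightarrow> carath (\<Gamma> i) \<zeta> = \<i> * of_real b + (LINT x|circle_measure. herglotz_kernel \<zeta> x * of_real (exp (- 2 * Re (g (r i) (circ x)))))"
    "\<And>i. (\<lambda>k. real k * (cmod (taylor_coeff (g (r i)) k))\<^sup>2) sums - (\<Sum>k=1..n i. real k * ln (1 - (cmod (\<Gamma> i k))\<^sup>2))"
    unfolding S_def by blast+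
  have limit: "(\<lambda>i. \<Gamma> i k) \<longlonglongrightarrow> \<gamma> k" for k
  proof (rule schur_parameters_continuous[OF \<Gamma>(1)])
    show "schur_parameters \<gamma>" by (rule schur_parameters_axioms)
    fix z :: complex assume z: "cmod z < 1"
    have "(\<lambda>i. carath (\<Gamma> i) z) \<longlonglongrightarrow> carath \<gamma> z"
      unfolding \<Gamma>(3)[OF z] C[OF z] b_def
      by (intro tendsto_intros L1_pairing(1)[OF _ iw _ norm_herglotz_kernel_le[OF z] Lw] exp_real_part_integrable(1)[OF hol]) auto
    then show "(\<lambda>i. schur_fun (\<Gamma> i) z) \<longlonglongrightarrow> schur_fun \<gamma> z"
      unfolding schur_fun_def by (intro tendsto_intros carath_plus_1_nonzero z)
  qed
  have "(\<Sum>k\<le>m. real k * (cmod (\<gamma> k))\<^sup>2) \<le> D'" for m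
  proof (rule LIMSEQ_le_const2)
    show "(\<lambda>i. \<Sum>k\<le>m. real k * (cmod (\<Gamma> i k))\<^sup>2) \<longlonglongrightarrow> (\<Sum>k\<le>m. real k * (cmod (\<gamma> k))\<^sup>2)"
      by (intro tendsto_intros limit)
    have "(\<Sum>k\<le>m. real k * (cmod (\<Gamma> i k))\<^sup>2) \<le> D'" for i
    proof -
      have "(\<lambda>m. \<Sum>k\<le>m. real k * (cmod (taylor_coeff (g (r i)) k))\<^sup>2) \<longlonglongrightarrow> - (\<Sum>k=1..n i. real k * ln (1 - (cmod (\<Gamma> i k))\<^sup>2))"
        using \<Gamma>(4)[of i] unfolding sums_def_le .
      then have "- (\<Sum>k=1..n i. real k * ln (1 - (cmod (\<Gamma> i k))\<^sup>2)) \<le> D'"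
        by (rule LIMSEQ_le_const2) (use bound in blast)
      moreover have "(\<Sum>k\<le>m. real k * (cmod (\<Gamma> i k))\<^sup>2) \<le> - (\<Sum>k=1..n i. real k * ln (1 - (cmod (\<Gamma> i k))\<^sup>2))"
        by (rule weighted_parameters_le[OF \<Gamma>(1)]) (rule \<Gamma>(2))
      ultimately show ?thesis by linarith
    qed
    then show "\<exists>N. \<forall>i\<ge>N. (\<Sum>k\<le>m. real k * (cmod (\<Gamma> i k))\<^sup>2) \<le> D'" by blast
  qed
  then show ?thesis by (intro bounded_imp_summable[where B = D']) auto
qed

end

section \<open>From parameters to masses\<close>

lemma tanh_le_twice: "tanh x \<le> 2 * (x :: real)" if "x \<ge> 0"
proof -
  have "tanh x \<le> (1 - exp (- 2 * x)) / 1"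
    unfolding tanh_real_altdef by (intro divide_left_mono) (use that in \<open>auto intro: add_pos_pos\<close>)
  also have "\<dots> \<le> 2 * x" using exp_ge_add_one_self[of "- 2 * x"] by simp
  finally show ?thesis .
qed

lemma le_twice_tanh:
  assumes x: "x \<ge> 0" and t: "tanh x \<le> 1 / 2"
  shows "x \<le> 2 * tanh (x :: real)"
proof -
  define E where "E = exp (- 2 * x)"
  have E: "E > 0" unfolding E_def by simp
  have "E * (1 + 2 * x) \<le> E * exp (2 * x)" by (intro mult_left_mono exp_ge_add_one_self) (use E in simp)
  also have "\<dots> = 1" by (simp add: E_def flip: exp_add)
  finally have "x * (1 + E) \<le> (1 - E) * (1 + x)" by (simp add: algebra_simps)
  then have "x / (1 + x) \<le> (1 - E) / (1 + E)" using x E by (simp add: divide_simps mult_ac)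
  then have le: "x / (1 + x) \<le> tanh x" unfolding tanh_real_altdef E_def .
  then have "x / (1 + x) \<le> 1 / 2" using t by linarith
  then have "x \<le> 1" using x by (simp add: divide_simps)
  then have "x / 2 \<le> x / (1 + x)" using x by (intro divide_left_mono) auto
  then show ?thesis using le by linarith
qed

text \<open>
  The modulus of the parameter is \<open>tanh \<bar>q k\<bar>\<close>. It tends to zero under either condition, and \<open>tanh x\<close> is
  comparable with \<open>x\<close> near zero.
\<close>

lemma summable_schur_parameter_iff:
  "summable (\<lambda>k. real k * (cmod (schur_parameter (q k)))\<^sup>2) \<longleftrightarrow> summable (\<lambda>k. real k * (cmod (q k))\<^sup>2)"
proof
  assume s: "summable (\<lambda>k. real k * (cmod (q k))\<^sup>2)"
  show "summable (\<lambda>k. real k * (cmod (schur_parameter (q k)))\<^sup>2)"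
  proof (rule summable_comparison_test'[OF summable_mult[OF s, of 4]])
    fix k
    have "(tanh (cmod (q k)))\<^sup>2 \<le> (2 * cmod (q k))\<^sup>2" by (intro power_mono tanh_le_twice) auto
    then have "real k * (tanh (cmod (q k)))\<^sup>2 \<le> real k * (2 * cmod (q k))\<^sup>2" by (intro mult_left_mono) auto
    then show "norm (real k * (cmod (schur_parameter (q k)))\<^sup>2) \<le> 4 * (real k * (cmod (q k))\<^sup>2)"
      by (simp add: norm_schur_parameter power_mult_distrib)
  qed
next
  assume s: "summable (\<lambda>k. real k * (cmod (schur_parameter (q k)))\<^sup>2)"
  have small: "\<forall>\<^sub>F k in sequentially. tanh (cmod (q k)) \<le> 1 / 2"
  proof -
    have "\<forall>\<^sub>F k in sequentially. real k * (cmod (schur_parameter (q k)))\<^sup>2 < 1 / 4"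
      using order_tendstoD(2)[OF summable_LIMSEQ_zero[OF s], of "1 / 4"] by simp
    then show ?thesis using eventually_ge_at_top[of 1]
    proof eventually_elim
      case (elim k)
      have "1 * (tanh (cmod (q k)))\<^sup>2 \<le> real k * (tanh (cmod (q k)))\<^sup>2" using elim by (intro mult_right_mono) auto
      then have "(tanh (cmod (q k)))\<^sup>2 \<le> (1 / 2)\<^sup>2" using elim by (simp add: norm_schur_parameter power2_eq_square)
      then show ?case by (rule power2_le_imp_le) simp
    qed
  qed
  show "summable (\<lambda>k. real k * (cmod (q k))\<^sup>2)"
  proof (rule summable_comparison_test_ev[OF _ summable_mult[OF s, of 4]])
    show "\<forall>\<^sub>F k in sequentially. norm (real k * (cmod (q k))\<^sup>2) \<le> 4 * (real k * (cmod (schur_parameter (q k)))\<^sup>2)"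
      using small
    proof eventually_elim
      case (elim k)
      have "(cmod (q k))\<^sup>2 \<le> (2 * tanh (cmod (q k)))\<^sup>2" by (intro power_mono le_twice_tanh elim) auto
      then have "real k * (cmod (q k))\<^sup>2 \<le> real k * (2 * tanh (cmod (q k)))\<^sup>2" by (intro mult_left_mono) auto
      then show ?case by (simp add: norm_schur_parameter power_mult_distrib)
    qed
  qed
qed

section \<open>The strong Szego theorem for the Dirac operator\<close>

lemma spectral_density_of_circle:
  assumes w: "w \<in> borel_measurable borel" "\<And>x. w x \<ge> 0" "\<And>x. w (x + pi) = w x" "integrable circle_measure w"
    and C: "\<And>\<zeta>. cmod \<zeta> < 1 \<Longrightarrow> Re (carath (\<lambda>k. schur_parameter (q k)) \<zeta>) = (LINT x|circle_measure. w x * Re (herglotz_kernel \<zeta> x))"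
  shows "main_spectral_measure q = density lborel (\<lambda>x. ennreal (w x))"
  unfolding lift_density_periodize[OF w(1,3)]
proof (rule main_spectral_measure_eq)
  show "finite_measure (lift_density w)" by (rule lift_density_finite[OF w(4,2)])
  fix \<zeta> :: complex assume "cmod \<zeta> < 1"
  then show "Re (carath (\<lambda>k. schur_parameter (q k)) \<zeta>) = 1 / pi * (LINT x|lift_density w. Re (herglotz_kernel \<zeta> x))"
    using C by (subst lift_density_integral[OF w(1) _ w(2)]) auto
qed simp

text \<open>
  The Herglotz measure of the parameters and the density \<open>w\<close> have the same periodisation, hence the same
  image on the circle, and the Herglotz kernel is a function on the circle.
\<close>

lemma circle_of_spectral_density:
  fixes q :: "nat \<Rightarrow> complex"
  defines "\<gamma> \<equiv> \<lambda>k. schur_parameter (q k)"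
  assumes w: "w \<in> borel_measurable borel" "\<And>x. w x \<ge> 0" "\<And>x. w (x + pi) = w x"
    and \<mu>: "main_spectral_measure q = density lborel (\<lambda>x. ennreal (w x))"
  shows "integrable circle_measure w"
    and "cmod \<zeta> < 1 \<Longrightarrow> carath \<gamma> \<zeta> = \<i> * of_real (Im ((1 + \<gamma> 0) / (1 - \<gamma> 0))) +
       (LINT x|circle_measure. herglotz_kernel \<zeta> x * of_real (w x))"
proof -
  interpret schur_parameters \<gamma> unfolding \<gamma>_def by (rule schur_parameters_q)
  note [measurable] = w(1)
  obtain M where M: "finite_measure M" "sets M = sets borel"
    and CM: "\<And>\<zeta>. cmod \<zeta> < 1 \<Longrightarrow> carath \<gamma> \<zeta> = \<i> * of_real (Im ((1 + \<gamma> 0) / (1 - \<gamma> 0))) + (LINT x|M. herglotz_kernel \<zeta> x)"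
    using herglotz_measure_exists by blast
  note [measurable_cong, simp] = M(2)
  define N where "N = density M (\<lambda>_. ennreal pi)"
  have N: "sets N = sets borel" by (simp add: N_def)
  have NM: "(LINT x|N. f x) = pi *\<^sub>R (LINT x|M. f x)" if "f \<in> borel_measurable borel" for f :: "real \<Rightarrow> 'a::{banach, second_countable_topology}"
  proof -
    have "(LINT x|N. f x) = (LINT x|M. pi *\<^sub>R f x)"
      unfolding N_def by (rule integral_density) (use that in auto)
    then show ?thesis by (simp only: integral_scaleR_right)
  qed
  have finN: "emeasure N UNIV < \<infinity>"
  proof -
    have "space M = UNIV" using sets_eq_imp_space_eq[OF M(2)] by simp
    then have "emeasure M UNIV < \<infinity>" using finite_measure.emeasure_finite[OF M(1), of UNIV] by (simp add: less_top)
    moreover have "emeasure N UNIV = ennreal pi * emeasure M UNIV"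
      unfolding N_def by (subst emeasure_density) (simp_all add: \<open>space M = UNIV\<close>)
    ultimately show ?thesis by (simp add: ennreal_mult_less_top)
  qed
  have finite: "finite_measure N"
    by (rule finite_measureI) (use finN sets_eq_imp_space_eq[OF N] in auto)
  have "main_spectral_measure q = periodize N"
  proof (rule main_spectral_measure_eq[OF finite N])
    fix \<zeta> :: complex assume z: "cmod \<zeta> < 1"
    have "Re (carath \<gamma> \<zeta>) = (LINT x|M. Re (herglotz_kernel \<zeta> x))"
      unfolding CM[OF z] using integral_Re[OF finite_measure_integrable_herglotz[OF M z]] by simp
    also have "\<dots> = 1 / pi * (LINT x|N. Re (herglotz_kernel \<zeta> x))" by (subst NM) auto
    finally show "Re (carath (\<lambda>k. schur_parameter (q k)) \<zeta>) = 1 / pi * (LINT x|N. Re (herglotz_kernel \<zeta> x))"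
      unfolding \<gamma>_def .
  qed
  then have "periodize N = periodize (lift_density w)"
    unfolding \<mu> lift_density_periodize[OF w(1,3)] by simp
  then have dist: "distr N borel circ = distr (lift_density w) borel circ"
    by (intro periodize_eq_imp_distr_circ_eq N) auto
  have "emeasure (lift_density w) UNIV = emeasure (distr (lift_density w) borel circ) UNIV"
    by (subst emeasure_distr) (auto simp: lift_density_def)
  also have "\<dots> = emeasure N UNIV"
    unfolding dist[symmetric] by (subst emeasure_distr) (use N sets_eq_imp_space_eq[OF N] in \<open>auto simp: measurable_cong_sets[OF N refl]\<close>)
  finally have "(\<integral>\<^sup>+x. ennreal (pi * w x) \<partial>circle_measure) < \<infinity>"
    using finN unfolding lift_density_circle[OF w(1,2)] by (simp add: emeasure_density)
  then have "integrable circle_measure (\<lambda>x. pi * w x)"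
    by (intro integrableI_nonneg) (use w(2) in auto)
  then show "integrable circle_measure w" using integrable_mult_left_iff by simp
  assume z: "cmod \<zeta> < 1"
  define h where "h y = (y + \<zeta>) / (y - \<zeta>)" for y
  have h: "herglotz_kernel \<zeta> x = h (circ x)" for x by (simp add: herglotz_kernel_def h_def)
  have [measurable]: "h \<in> borel_measurable borel" unfolding h_def by measurable
  have "pi *\<^sub>R (LINT x|M. herglotz_kernel \<zeta> x) = (LINT x|N. h (circ x))"
    using NM[OF measurable_herglotz_kernel[of \<zeta>]] unfolding h by (rule sym)
  also have "\<dots> = (LINT y|distr N borel circ. h y)"
    by (rule integral_distr[symmetric]) (auto simp: measurable_cong_sets[OF N refl])
  also have "\<dots> = (LINT x|lift_density w. h (circ x))"
    unfolding dist by (rule integral_distr) auto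
  also have "\<dots> = pi *\<^sub>R (LINT x|circle_measure. w x *\<^sub>R herglotz_kernel \<zeta> x)"
    unfolding h[symmetric] by (rule lift_density_integral[OF w(1) _ w(2)]) measurable
  finally have "(LINT x|M. herglotz_kernel \<zeta> x) = (LINT x|circle_measure. herglotz_kernel \<zeta> x * of_real (w x))"
    by (simp add: scaleR_conv_of_real mult.commute)
  then show "carath \<gamma> \<zeta> = \<i> * of_real (Im ((1 + \<gamma> 0) / (1 - \<gamma> 0))) + (LINT x|circle_measure. herglotz_kernel \<zeta> x * of_real (w x))"
    using CM[OF z] by simp
qed

theorem corollary1p7:
  fixes q :: "nat \<Rightarrow> complex"
  shows "(summable (\<lambda>k. real k * (cmod (q k))\<^sup>2) \<longrightarrow>
            sigma_p q = {} \<and> sigma_sc q = {} \<and>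
            (\<exists>w. log_sobolev_density w \<and>
                 main_spectral_measure q = density lborel (\<lambda>x. ennreal (w x))))
       \<and> (\<forall>w. log_sobolev_density w \<and>
                 main_spectral_measure q = density lborel (\<lambda>x. ennreal (w x)) \<longrightarrow>
            summable (\<lambda>k. real k * (cmod (q k))\<^sup>2))"
proof (intro conjI impI allI)
  interpret schur_parameters "\<lambda>k. schur_parameter (q k)" by (rule schur_parameters_q)
  {
    assume "summable (\<lambda>k. real k * (cmod (q k))\<^sup>2)"
    then have "summable (\<lambda>k. real k * (cmod (schur_parameter (q k)))\<^sup>2)"
      unfolding summable_schur_parameter_iff .
    then obtain w where w: "log_sobolev_density w" "integrable circle_measure w"
      and C: "\<And>\<zeta>. cmod \<zeta> < 1 \<Longrightarrow> Re (carath (\<lambda>k. schur_parameter (q k)) \<zeta>) = (LINT x|circle_measure. w x * Re (herglotz_kernel \<zeta> x))"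
      by (rule summable_parameters_sobolev_density) (rule that)
    have props: "w \<in> borel_measurable borel" "\<And>x. w x \<ge> 0" "\<And>x. w (x + pi) = w x"
      using w(1) unfolding log_sobolev_density_def by auto
    have \<mu>: "main_spectral_measure q = density lborel (\<lambda>x. ennreal (w x))"
      by (rule spectral_density_of_circle[OF props w(2) C])
    show "sigma_p q = {}" "sigma_sc q = {}" by (rule density_no_singular_spectrum[OF \<mu> props(1)])+
    show "\<exists>w. log_sobolev_density w \<and> main_spectral_measure q = density lborel (\<lambda>x. ennreal (w x))"
      using w(1) \<mu> by blast
  }
  fix w assume w: "log_sobolev_density w \<and> main_spectral_measure q = density lborel (\<lambda>x. ennreal (w x))"
  then have props: "w \<in> borel_measurable borel" "\<And>x. w x \<ge> 0" "\<And>x. w (x + pi) = w x"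
    unfolding log_sobolev_density_def by auto
  note circle = circle_of_spectral_density[OF props conjunct2[OF w]]
  have "summable (\<lambda>k. real k * (cmod (schur_parameter (q k)))\<^sup>2)"
    by (rule sobolev_density_summable_parameters[OF conjunct1[OF w] circle])
  then show "summable (\<lambda>k. real k * (cmod (q k))\<^sup>2)" unfolding summable_schur_parameter_iff .
qed

end
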